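(* Let $k\in\mathbb C$, $k\ne-3$, $k\notin\mathbb Z_{\ge0}$, and assume that $N$ is an irreducible $\mathcal W_k$-module which is highest weight or relaxed. Then for each $r,s\in\mathbb Z$ and $\lambda\in\mathbb C$, $$N\otimes\mathcal P_s\otimes\Pi(0).e^{\frac r2d_2+\lambda c_2}$$ is a logarithmic $L_k(\mathfrak{sl}_3)$-module of $L_{sug}(0)$-nilpotent rank two.
   Context: $V^k(\mathfrak{sl}_3)$ is the universal affine vertex algebra of level $k$, $L_k(\mathfrak{sl}_3)$ its simple quotient, $L_{sug}$ its Sugawara Virasoro field. Notation: $e_1=e_{1,2}$, $e_2=e_{2,3}$, $e_3=e_{1,3}$, $h_1=e_{1,1}-e_{2,2}$, $h_2=e_{2,2}-e_{3,3}$, $f_1=e_{2,1}$, $f_2=e_{3,2}$, $f_3=e_{3,1}=[f_2,f_1]$. The universal Bershadsky-Polyakov algebra $\mathcal W^k$ ($k\neq-3$) is freely and strongly generated by $J,G^\pm,L^{\rm BP}$: $L^{\rm BP}$ is Virasoro of central charge $-\frac{(2k+3)(3k+1)}{k+3}$; $J$, $G^\pm$ primary of weights $1$, $\frac32$; $J(z)J(w)\sim\frac{2k+3}{3(z-w)^2}$; $J(z)G^\pm(w)\sim\frac{\pm G^\pm(w)}{z-w}$; $G^\pm G^\pm\sim0$; $G^+(z)G^-(w)\sim\frac{(k+1)(2k+3)}{(z-w)^3}+\frac{3(k+1)J(w)}{(z-w)^2}+\frac1{z-w}\big(3{:}J^2{:}+\frac{3(k+1)}2\partial J-(k+3)L^{\rm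 BP}\big)(w)$. $\mathcal W_k$ is its simple quotient, graded by the zero mode of $\widetilde L=L^{\rm BP}+\frac12\partial J$ (so $J,G^+,G^-$ have weights $1,1,2$). A relaxed module is a weight module generated by a weight vector (eigenvector of $J(0)$ and $\widetilde L(0)$) annihilated by all positive modes $J(n),G^\pm(n),\widetilde L(n)$, $n>0$; it is highest weight if this vector is moreover annihilated by $G^-(0)$. On such irreducible modules $J(0)$ and $L^{\rm BP}(0)$ act semisimply. $\mathcal S=\mathcal S(1)$ is the $\beta\gamma$ vertex algebra, $\beta(z)\gamma(w)\sim\frac1{z-w}$, with Virasoro field $L^{\mathcal S}={:}(\partial\gamma)\beta{:}$. $\mathcal P_s$, $s\in\mathbb Z$, are the known logarithmic projective $\mathcal S$-modules (Allen-Wood; Adamović-Creutzig-Kac-Ridout et al.): $\mathcal P_s$ is the projective cover, in the category of finite length weight $\mathcal S$-modules (with semisimple action of the zero mode of ${:}\gamma\beta{:}$, real weights) generated by spectral flows of $\mathcal S$ and of the relaxed modules, of the spectral flow twist $\sigma^s(\mathcal S)$ of the vacuum module. It is known that $L^{\mathcal S}(0)$ has nilpotent rank two on $\mathcal P_s$. $\Pi(0)$ is generated by Heisenberg fields $c_2,d_2$ with $c_2(z)d_2(w)\sim\frac2{(z-w)^2}$, $c_2c_2\sim0\sim d_2d_2$, and $e^{\pm c_2}$; $\Pi(0).e^{\frac r2d_2+\lambda c_2}$ is its module generated by the indicated exponential. $L_k(\mathfrak{sl}_3)$ acts through the embedding $L_k(\mathfrak{sl}_3)\hookrightarrow\mathcal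 W_k\otimes\mathcal S\otimes\Pi(0)$ (valid for $k\notin\mathbb Z_{\ge0}$), induced by (with $c=c_2,d=d_2$) $e_1\mapsto-\gamma e^{c}$, $e_2\mapsto\beta$, $e_3\mapsto e^c$, $h_1\mapsto-2J+{:}\gamma\beta{:}-\frac{2k+9}6c+\frac12d$, $h_2\mapsto J-2{:}\gamma\beta{:}+\frac{4k+9}6c+\frac12d$, $f_1\mapsto G^+-{:}(2J+\frac{8k+9}6c-\frac12d)\beta e^{-c}{:}+(k+1)(\partial\beta)e^{-c}$, $f_2\mapsto G^-e^{-c}+(J+\frac{4k+9}6c+\frac12d)\gamma+k\,\partial\gamma-{:}\gamma^2\beta{:}$ ($f_3$ determined by $f_3=[f_2,f_1]$), under which $L_{sug}\mapsto L^{\rm BP}+\frac12\partial J+{:}(\partial\gamma)\beta{:}+\frac12{:}cd{:}+\frac k3\partial c-\frac12\partial d$. A module is logarithmic if the Virasoro zero mode $L(0)$ does not act semisimply; it has $L(0)$-nilpotent rank $r$ if the nilpotent part $N_0$ of $L(0)$ satisfies $N_0^r=0$, $N_0^{r-1}\ne0$. *)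

theory Defs
  imports "HOL-Analysis.Analysis" "HOL-Library.Function_Algebras" "HOL-Library.Groups_Big_Fun"
begin

section \<open>Complex vector spaces and the algebraic tensor product\<close>

class complex_vector = ab_group_add +
  fixes scaleC :: "complex \<Rightarrow> 'a \<Rightarrow> 'a"  (infixr "*\<^sub>C" 75)
  assumes scaleC_add_right: "a *\<^sub>C (x + y) = a *\<^sub>C x + a *\<^sub>C y"
    and scaleC_add_left: "(a + b) *\<^sub>C x = a *\<^sub>C x + b *\<^sub>C x"
    and scaleC_scaleC: "a *\<^sub>C (b *\<^sub>C x) = (a * b) *\<^sub>C x"
    and scaleC_one: "1 *\<^sub>C x = x"

global_interpretation cv: vector_space "scaleC :: complex \<Rightarrow> 'a \<Rightarrow> 'a::complex_vector"
  by unfold_locales (simp_all add: scaleC_add_right scaleC_add_left scaleC_scaleC scaleC_one)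

abbreviation clinear :: "('a::complex_vector \<Rightarrow> 'b::complex_vector) \<Rightarrow> bool" where
  "clinear \<equiv> Vector_Spaces.linear scaleC scaleC"

instantiation complex :: complex_vector
begin
definition scaleC_complex :: "complex \<Rightarrow> complex \<Rightarrow> complex" where "scaleC_complex c x = c * x"
instance by standard (simp_all add: scaleC_complex_def algebra_simps)
end

instantiation "fun" :: (type, complex_vector) complex_vector
begin
definition scaleC_fun :: "complex \<Rightarrow> ('a \<Rightarrow> 'b) \<Rightarrow> 'a \<Rightarrow> 'b" where
  "scaleC_fun c f = (\<lambda>x. c *\<^sub>C f x)"
instance
  by standard (auto simp: scaleC_fun_def fun_eq_iff scaleC_add_right scaleC_add_left
      scaleC_scaleC scaleC_one)
end

instantiation vec :: (complex_vector, finite) complex_vector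
begin
definition scaleC_vec :: "complex \<Rightarrow> ('a, 'b) vec \<Rightarrow> ('a, 'b) vec" where
  "scaleC_vec c x = (\<chi> i. c *\<^sub>C (x $ i))"
instance
  by standard (auto simp: scaleC_vec_def vec_eq_iff scaleC_add_right scaleC_add_left
      scaleC_scaleC scaleC_one)
end

definition cbilinear ::
    "('a::complex_vector \<Rightarrow> 'b::complex_vector \<Rightarrow> 'c::complex_vector) \<Rightarrow> bool" where
  "cbilinear f \<longleftrightarrow> (\<forall>x. clinear (f x)) \<and> (\<forall>y. clinear (\<lambda>x. f x y))"

definition eval_bilinear ::
    "'a::complex_vector \<Rightarrow> 'b::complex_vector \<Rightarrow> ('a \<Rightarrow> 'b \<Rightarrow> complex) \<Rightarrow> complex" where
  "eval_bilinear a b = (\<lambda>\<phi>. if cbilinear \<phi> then \<phi> a b else 0)"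

text \<open>The algebraic tensor product, realised as the span of the evaluations
  \<open>\<phi> \<mapsto> \<phi> a b\<close> at pairs inside the dual of the space of bilinear forms.\<close>

typedef (overloaded) ('a, 'b) tensor =
    "cv.span {eval_bilinear a b | (a::'a::complex_vector) (b::'b::complex_vector). True}"
  using cv.span_zero by blast

setup_lifting type_definition_tensor

instantiation tensor :: (complex_vector, complex_vector) complex_vector
begin
lift_definition zero_tensor :: "('a, 'b) tensor" is 0 by (rule cv.span_zero)
lift_definition plus_tensor :: "('a, 'b) tensor \<Rightarrow> ('a, 'b) tensor \<Rightarrow> ('a, 'b) tensor" is "(+)"
  by (rule cv.span_add)
lift_definition minus_tensor :: "('a, 'b) tensor \<Rightarrow> ('a, 'b) tensor \<Rightarrow> ('a, 'b) tensor" is "(-)"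
  by (rule cv.span_diff)
lift_definition uminus_tensor :: "('a, 'b) tensor \<Rightarrow> ('a, 'b) tensor" is uminus
  by (rule cv.span_neg)
lift_definition scaleC_tensor :: "complex \<Rightarrow> ('a, 'b) tensor \<Rightarrow> ('a, 'b) tensor" is scaleC
  by (rule cv.span_scale)
instance
  by standard
    (transfer, simp add: scaleC_add_right scaleC_add_left scaleC_scaleC scaleC_one add_ac)+
end

lift_definition pure_tensor ::
    "'a::complex_vector \<Rightarrow> 'b::complex_vector \<Rightarrow> ('a, 'b) tensor"  (infixr "\<otimes>" 76)
  is eval_bilinear
  by (rule cv.span_base) blast

text \<open>The linear map out of the tensor product induced by a bilinear map.\<close>

definition tensor_lift ::
    "('a::complex_vector \<Rightarrow> 'b::complex_vector \<Rightarrow> 'c::complex_vector) \<Rightarrow> ('a, 'b) tensor \<Rightarrow> 'c" where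
  "tensor_lift \<phi> = (THE g. clinear g \<and> (\<forall>a b. g (a \<otimes> b) = \<phi> a b))"


lemma clinear_iff:
  "clinear f \<longleftrightarrow> (\<forall>x y. f (x + y) = f x + f y) \<and> (\<forall>t x. f (t *\<^sub>C x) = t *\<^sub>C f x)"
  by (simp add: Vector_Spaces.linear_iff cv.vector_space_axioms)

lemma eval_bilinear_scale: "eval_bilinear (t *\<^sub>C a) b = t *\<^sub>C eval_bilinear a b"
  by (auto simp: eval_bilinear_def scaleC_fun_def cbilinear_def clinear_iff fun_eq_iff scaleC_complex_def)

lemma scaleC_pure_tensor: "(t *\<^sub>C a) \<otimes> b = t *\<^sub>C (a \<otimes> b)"
  by transfer (rule eval_bilinear_scale)

lemma Rep_tensor_sum_list:
  "Rep_tensor (\<Sum>(a, b)\<leftarrow>ps. a \<otimes> b) = (\<Sum>(a, b)\<leftarrow>ps. eval_bilinear a b)"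
  by (induction ps) (auto simp: zero_tensor.rep_eq plus_tensor.rep_eq pure_tensor.rep_eq)

lemma tensor_eq_sum:
  fixes x :: "('a::complex_vector, 'b::complex_vector) tensor"
  obtains ps where "x = (\<Sum>(a, b)\<leftarrow>ps. a \<otimes> b)"
proof -
  have "Rep_tensor x \<in> cv.span {eval_bilinear a b | (a::'a) (b::'b). True}"
    using Rep_tensor by blast
  then have "\<exists>ps. Rep_tensor x = (\<Sum>(a::'a, b::'b)\<leftarrow>ps. eval_bilinear a b)"
  proof (induction rule: cv.span_induct_alt)
    case base
    show ?case by (rule exI[of _ "[]"]) simp
  next
    case (step t y z)
    then obtain a b ps where "y = eval_bilinear (a::'a) (b::'b)"
      "z = (\<Sum>(a, b)\<leftarrow>ps. eval_bilinear a b)" by blast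
    then show ?case
      by (intro exI[of _ "(t *\<^sub>C a, b) # ps"]) (simp add: eval_bilinear_scale)
  qed
  then show ?thesis using that by (metis Rep_tensor_sum_list Rep_tensor_inject)
qed

lemma exists_functional:
  fixes x :: "'a::complex_vector"
  assumes "x \<noteq> 0"
  obtains l :: "'a \<Rightarrow> complex" where "clinear l" "l x \<noteq> 0"
proof -
  interpret vector_space_pair "scaleC :: complex \<Rightarrow> 'a \<Rightarrow> 'a" "scaleC :: complex \<Rightarrow> complex \<Rightarrow> complex" ..
  have "cv.independent {x}" using assms by (simp add: cv.dependent_single)
  from linear_independent_extend[OF this, of "\<lambda>_. 1"] show ?thesis using that by force
qed

lemma tensor_sum_cong:
  fixes \<phi> :: "'a::complex_vector \<Rightarrow> 'b::complex_vector \<Rightarrow> 'c::complex_vector"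
  assumes "cbilinear \<phi>" and eq: "(\<Sum>(a, b)\<leftarrow>ps. a \<otimes> b) = (\<Sum>(a, b)\<leftarrow>qs. a \<otimes> b)"
  shows "(\<Sum>(a, b)\<leftarrow>ps. \<phi> a b) = (\<Sum>(a, b)\<leftarrow>qs. \<phi> a b)"
proof (rule ccontr)
  assume "\<not> ?thesis"
  then obtain l :: "'c \<Rightarrow> complex" where l: "clinear l"
      "l ((\<Sum>(a, b)\<leftarrow>ps. \<phi> a b) - (\<Sum>(a, b)\<leftarrow>qs. \<phi> a b)) \<noteq> 0"
    using exists_functional by (metis right_minus_eq)
  have bl: "cbilinear (\<lambda>a b. l (\<phi> a b))"
    using assms(1) l(1) by (auto simp: cbilinear_def clinear_iff)
  have l0: "l 0 = 0" using l(1) unfolding clinear_iff by (metis add_cancel_right_left)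
  have *: "(\<Sum>(a, b)\<leftarrow>rs. eval_bilinear a b) (\<lambda>a b. l (\<phi> a b)) = l (\<Sum>(a, b)\<leftarrow>rs. \<phi> a b)" for rs
    using l(1) by (induction rs) (auto simp: l0 clinear_iff eval_bilinear_def bl)
  have "l (\<Sum>(a, b)\<leftarrow>ps. \<phi> a b) = l (\<Sum>(a, b)\<leftarrow>qs. \<phi> a b)"
    using eq by (metis * Rep_tensor_sum_list)
  moreover have "l (u - v) = l u - l v" for u v
    using l(1) unfolding clinear_iff by (metis add_diff_cancel_right' diff_add_cancel)
  ultimately show False using l(2) by simp
qed

lemma tensor_lift_unique_exists:
  fixes \<phi> :: "'a::complex_vector \<Rightarrow> 'b::complex_vector \<Rightarrow> 'c::complex_vector"
  assumes \<phi>: "cbilinear \<phi>"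
  shows "\<exists>!g. clinear g \<and> (\<forall>a b. g (a \<otimes> b) = \<phi> a b)"
proof -
  define rep where "rep x = (SOME ps. x = (\<Sum>(a::'a, b::'b)\<leftarrow>ps. a \<otimes> b))" for x
  have rep: "x = (\<Sum>(a, b)\<leftarrow>rep x. a \<otimes> b)" for x
    unfolding rep_def by (rule someI_ex) (metis tensor_eq_sum)
  define g where "g x = (\<Sum>(a, b)\<leftarrow>rep x. \<phi> a b)" for x
  have g: "g (\<Sum>(a, b)\<leftarrow>ps. a \<otimes> b) = (\<Sum>(a, b)\<leftarrow>ps. \<phi> a b)" for ps
    unfolding g_def by (rule tensor_sum_cong[OF \<phi>]) (rule rep[symmetric])
  have sc: "t *\<^sub>C (\<Sum>(a, b)\<leftarrow>ps. a \<otimes> b) = (\<Sum>(a, b)\<leftarrow>map (\<lambda>(a, b). (t *\<^sub>C a, b)) ps. a \<otimes> b)" for t and ps :: "('a \<times> 'b) list"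
    by (induction ps) (auto simp: scaleC_pure_tensor scaleC_add_right)
  have sc': "t *\<^sub>C (\<Sum>(a, b)\<leftarrow>ps. \<phi> a b) = (\<Sum>(a, b)\<leftarrow>map (\<lambda>(a, b). (t *\<^sub>C a, b)) ps. \<phi> a b)" for t ps
    using \<phi> by (induction ps) (auto simp: scaleC_add_right cbilinear_def clinear_iff)
  have add: "g (x + y) = g x + g y" for x y
    using g[of "rep x @ rep y"] rep[of x] rep[of y] unfolding g_def[of x] g_def[of y] by simp
  have scale: "g (t *\<^sub>C x) = t *\<^sub>C g x" for t x
    using rep[of x] g sc sc' by metis
  have pure: "g (a \<otimes> b) = \<phi> a b" for a b using g[of "[(a, b)]"] by simp
  have gl: "clinear g" using add scale by (simp add: clinear_iff)
  show ?thesis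
  proof (rule ex1I[of _ g])
    fix h assume h: "clinear h \<and> (\<forall>a b. h (a \<otimes> b) = \<phi> a b)"
    have h0: "h 0 = 0" using h unfolding clinear_iff by (metis add_cancel_right_left)
    have "h (\<Sum>(a, b)\<leftarrow>ps. a \<otimes> b) = (\<Sum>(a, b)\<leftarrow>ps. \<phi> a b)" for ps
      using h by (induction ps) (auto simp: h0 clinear_iff)
    then show "h = g" using rep g by (metis ext)
  qed (use gl pure in auto)
qed

lemma
  fixes \<phi> :: "'a::complex_vector \<Rightarrow> 'b::complex_vector \<Rightarrow> 'c::complex_vector"
  assumes "cbilinear \<phi>"
  shows clinear_tensor_lift: "clinear (tensor_lift \<phi>)"
    and tensor_lift_pure: "tensor_lift \<phi> (a \<otimes> b) = \<phi> a b"
  using theI'[OF tensor_lift_unique_exists[OF assms]] unfolding tensor_lift_def by auto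


section \<open>Vertex algebras and their modules\<close>

text \<open>\<open>nprod V a n b\<close> is \<open>a\<^sub>(\<^sub>n\<^sub>)b\<close>, where \<open>a(z) = \<Sum>\<^sub>n a\<^sub>(\<^sub>n\<^sub>) z\<^bsup>-n-1\<^esup>\<close>. All vertex algebras
  below are purely even. A module structure is given in the same way by its modes.\<close>

record 'v vertex_alg =
  vacuum :: 'v
  nprod :: "'v \<Rightarrow> int \<Rightarrow> 'v \<Rightarrow> 'v"

text \<open>Modules live on a subspace \<open>M\<close> of a type. The last clause is the Borcherds identity; all sums in it
  are finite by truncation.\<close>

definition va_module ::
    "'v::complex_vector vertex_alg \<Rightarrow> 'm::complex_vector set \<Rightarrow> ('v \<Rightarrow> int \<Rightarrow> 'm \<Rightarrow> 'm) \<Rightarrow> bool" where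
  "va_module V M Y \<longleftrightarrow>
     cv.subspace M \<and>
     (\<forall>a n. \<forall>u\<in>M. Y a n u \<in> M) \<and>
     (\<forall>n. \<forall>u\<in>M. clinear (\<lambda>a. Y a n u)) \<and>
     (\<forall>a n. \<forall>u\<in>M. \<forall>v\<in>M. Y a n (u + v) = Y a n u + Y a n v) \<and>
     (\<forall>a n t. \<forall>u\<in>M. Y a n (t *\<^sub>C u) = t *\<^sub>C Y a n u) \<and>
     (\<forall>a. \<forall>u\<in>M. \<exists>K. \<forall>n\<ge>K. Y a n u = 0) \<and>
     (\<forall>n. \<forall>u\<in>M. Y (vacuum V) n u = (if n = -1 then u else 0)) \<and>
     (\<forall>a b p q r. \<forall>u\<in>M.
        Sum_any (\<lambda>j::nat. (of_int p gchoose j) *\<^sub>C Y (nprod V a (r + int j) b) (p + q - int j) u) =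
        Sum_any (\<lambda>j::nat. ((-1) ^ j * (of_int r gchoose j)) *\<^sub>C
          (Y a (p + r - int j) (Y b (q + int j) u)
            - ((-1) powi r) *\<^sub>C Y b (q + r - int j) (Y a (p + int j) u))))"

definition vertex_algebra :: "'v::complex_vector vertex_alg \<Rightarrow> bool" where
  "vertex_algebra V \<longleftrightarrow> va_module V UNIV (nprod V) \<and>
     (\<forall>a. nprod V a (-1) (vacuum V) = a) \<and>
     (\<forall>a. \<forall>n\<ge>0. nprod V a n (vacuum V) = 0)"

definition va_deriv :: "'v vertex_alg \<Rightarrow> 'v \<Rightarrow> 'v" where
  "va_deriv V a = nprod V a (-2) (vacuum V)"

abbreviation normal_prod :: "'v vertex_alg \<Rightarrow> 'v \<Rightarrow> 'v \<Rightarrow> 'v" where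
  "normal_prod V a b \<equiv> nprod V a (-1) b"

definition va_hom ::
    "'v::complex_vector vertex_alg \<Rightarrow> 'w::complex_vector vertex_alg \<Rightarrow> ('v \<Rightarrow> 'w) \<Rightarrow> bool" where
  "va_hom V W f \<longleftrightarrow> clinear f \<and> f (vacuum V) = vacuum W \<and>
     (\<forall>a n b. f (nprod V a n b) = nprod W (f a) n (f b))"

definition va_ideal :: "'v::complex_vector vertex_alg \<Rightarrow> 'v set \<Rightarrow> bool" where
  "va_ideal V I \<longleftrightarrow> cv.subspace I \<and> (\<forall>a n. \<forall>x\<in>I. nprod V a n x \<in> I \<and> nprod V x n a \<in> I)"

definition va_simple :: "'v::complex_vector vertex_alg \<Rightarrow> bool" where
  "va_simple V \<longleftrightarrow> vertex_algebra V \<and> vacuum V \<noteq> 0 \<and> (\<forall>I. va_ideal V I \<longrightarrow> I = {0} \<or> I = UNIV)"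

definition simple_quotient ::
    "'v::complex_vector vertex_alg \<Rightarrow> 'w::complex_vector vertex_alg \<Rightarrow> ('v \<Rightarrow> 'w) \<Rightarrow> bool" where
  "simple_quotient V Q \<pi> \<longleftrightarrow> va_simple Q \<and> va_hom V Q \<pi> \<and> surj \<pi>"

text \<open>\<open>ope V a b [c\<^sub>0, c\<^sub>1, \<dots>]\<close> means \<open>a(z)b(w) \<sim> \<Sum>\<^sub>i c\<^sub>i(w) / (z - w)\<^bsup>i+1\<^esup>\<close>.\<close>

definition ope :: "'v::zero vertex_alg \<Rightarrow> 'v \<Rightarrow> 'v \<Rightarrow> 'v list \<Rightarrow> bool" where
  "ope V a b cs \<longleftrightarrow> (\<forall>n. nprod V a (int n) b = (if n < length cs then cs ! n else 0))"

text \<open>Ordered monomials in the modes \<open>(gens ! i)\<^sub>(\<^sub>-\<^sub>n\<^sub>)\<close>, \<open>n \<ge> 1\<close>, applied to a vector.\<close>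

definition pbw_index :: "'v list \<Rightarrow> (nat \<times> nat) list set" where
  "pbw_index gens = {ps. (\<forall>(i, n)\<in>set ps. i < length gens \<and> n \<ge> 1) \<and>
     sorted_wrt (\<lambda>(i, m) (j, n). i < j \<or> (i = j \<and> m \<ge> n)) ps}"

definition pbw_monomial :: "'v vertex_alg \<Rightarrow> 'v list \<Rightarrow> (nat \<times> nat) list \<Rightarrow> 'v \<Rightarrow> 'v" where
  "pbw_monomial V gens ps v = foldr (\<lambda>(i, n) x. nprod V (gens ! i) (- int n) x) ps v"

definition basis_family :: "'i set \<Rightarrow> ('i \<Rightarrow> 'v::complex_vector) \<Rightarrow> bool" where
  "basis_family I f \<longleftrightarrow> inj_on f I \<and> cv.independent (f ` I) \<and> cv.span (f ` I) = UNIV"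

definition freely_strongly_generated :: "'v::complex_vector vertex_alg \<Rightarrow> 'v list \<Rightarrow> bool" where
  "freely_strongly_generated V gens \<longleftrightarrow>
     basis_family (pbw_index gens) (\<lambda>ps. pbw_monomial V gens ps (vacuum V))"

definition va_submodule ::
    "'v vertex_alg \<Rightarrow> 'm::complex_vector set \<Rightarrow> ('v \<Rightarrow> int \<Rightarrow> 'm \<Rightarrow> 'm) \<Rightarrow> 'm set \<Rightarrow> bool" where
  "va_submodule V M Y K \<longleftrightarrow> cv.subspace K \<and> K \<subseteq> M \<and> (\<forall>a n. \<forall>u\<in>K. Y a n u \<in> K)"

definition va_irreducible ::
    "'v::complex_vector vertex_alg \<Rightarrow> 'm::complex_vector set \<Rightarrow> ('v \<Rightarrow> int \<Rightarrow> 'm \<Rightarrow> 'm) \<Rightarrow> bool" where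
  "va_irreducible V M Y \<longleftrightarrow> va_module V M Y \<and> M \<noteq> {0} \<and>
     (\<forall>K. va_submodule V M Y K \<longrightarrow> K = {0} \<or> K = M)"

definition generated_by ::
    "'v vertex_alg \<Rightarrow> 'm::complex_vector set \<Rightarrow> ('v \<Rightarrow> int \<Rightarrow> 'm \<Rightarrow> 'm) \<Rightarrow> 'm \<Rightarrow> bool" where
  "generated_by V M Y v \<longleftrightarrow> v \<in> M \<and> (\<forall>K. va_submodule V M Y K \<and> v \<in> K \<longrightarrow> K = M)"

definition module_hom ::
    "'v vertex_alg \<Rightarrow> 'm::complex_vector set \<Rightarrow> ('v \<Rightarrow> int \<Rightarrow> 'm \<Rightarrow> 'm) \<Rightarrow>
     'n::complex_vector set \<Rightarrow> ('v \<Rightarrow> int \<Rightarrow> 'n \<Rightarrow> 'n) \<Rightarrow> ('m \<Rightarrow> 'n) \<Rightarrow> bool" where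
  "module_hom V M Y M' Y' f \<longleftrightarrow>
     (\<forall>u\<in>M. f u \<in> M') \<and>
     (\<forall>u\<in>M. \<forall>v\<in>M. f (u + v) = f u + f v) \<and>
     (\<forall>t. \<forall>u\<in>M. f (t *\<^sub>C u) = t *\<^sub>C f u) \<and>
     (\<forall>a n. \<forall>u\<in>M. f (Y a n u) = Y' a n (f u))"

text \<open>\<open>Y(a \<otimes> b, z) = Y\<^sub>1(a, z) \<otimes> Y\<^sub>2(b, z)\<close>, in modes.\<close>

definition tensor_act ::
    "('a::complex_vector \<Rightarrow> int \<Rightarrow> 'm::complex_vector \<Rightarrow> 'm) \<Rightarrow>
     ('b::complex_vector \<Rightarrow> int \<Rightarrow> 'n::complex_vector \<Rightarrow> 'n) \<Rightarrow>
     ('a, 'b) tensor \<Rightarrow> int \<Rightarrow> ('m, 'n) tensor \<Rightarrow> ('m, 'n) tensor" where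
  "tensor_act Y1 Y2 x n y =
     tensor_lift (\<lambda>a b. tensor_lift (\<lambda>u v.
       Sum_any (\<lambda>i::int. Y1 a i u \<otimes> Y2 b (n - 1 - i) v)) y) x"

definition tensor_va ::
    "'a::complex_vector vertex_alg \<Rightarrow> 'b::complex_vector vertex_alg \<Rightarrow> ('a, 'b) tensor vertex_alg"
    (infixr "\<otimes>\<^sub>V" 76) where
  "V \<otimes>\<^sub>V W = \<lparr>vacuum = vacuum V \<otimes> vacuum W, nprod = tensor_act (nprod V) (nprod W)\<rparr>"


section \<open>Nilpotent rank\<close>

definition diagonalizable :: "('m::complex_vector \<Rightarrow> 'm) \<Rightarrow> bool" where
  "diagonalizable T \<longleftrightarrow> cv.span {v. \<exists>\<mu>. T v = \<mu> *\<^sub>C v} = UNIV"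

text \<open>\<open>T\<^sub>n\<close> is the nilpotent part in the (additive Jordan) decomposition of a locally finite \<open>T\<close>.\<close>

definition nilpotent_part :: "('m::complex_vector \<Rightarrow> 'm) \<Rightarrow> ('m \<Rightarrow> 'm) \<Rightarrow> bool" where
  "nilpotent_part T Tn \<longleftrightarrow> clinear Tn \<and> (\<forall>v. \<exists>j. (Tn ^^ j) v = 0) \<and>
     (\<exists>Ts. clinear Ts \<and> diagonalizable Ts \<and> Ts \<circ> Tn = Tn \<circ> Ts \<and> (\<forall>v. T v = Ts v + Tn v))"

definition nilpotent_rank :: "('m::complex_vector \<Rightarrow> 'm) \<Rightarrow> nat \<Rightarrow> bool" where
  "nilpotent_rank T r \<longleftrightarrow> r > 0 \<and>
     (\<exists>Tn. nilpotent_part T Tn \<and> (\<forall>v. (Tn ^^ r) v = 0) \<and> (\<exists>v. (Tn ^^ (r - 1)) v \<noteq> 0))"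


section \<open>Affine \<open>sl\<^sub>3\<close>\<close>

definition mat_unit :: "3 \<Rightarrow> 3 \<Rightarrow> complex^3^3" where
  "mat_unit i j = (\<chi> a b. if a = i \<and> b = j then 1 else 0)"

definition sl3 :: "(complex^3^3) set" where
  "sl3 = {X. trace X = 0}"

abbreviation "sl3_e1 \<equiv> mat_unit 1 2"
abbreviation "sl3_e2 \<equiv> mat_unit 2 3"
abbreviation "sl3_e3 \<equiv> mat_unit 1 3"
abbreviation "sl3_h1 \<equiv> mat_unit 1 1 - mat_unit 2 2"
abbreviation "sl3_h2 \<equiv> mat_unit 2 2 - mat_unit 3 3"
abbreviation "sl3_f1 \<equiv> mat_unit 2 1"
abbreviation "sl3_f2 \<equiv> mat_unit 3 2"
abbreviation "sl3_f3 \<equiv> mat_unit 3 1"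

text \<open>\<open>\<iota> x = x\<^sub>(\<^sub>-\<^sub>1\<^sub>)\<one>\<close> for \<open>x\<close> in \<open>sl\<^sub>3\<close>; the values of \<open>\<iota>\<close> outside \<open>sl\<^sub>3\<close> are irrelevant. Freeness expresses
  the PBW theorem for the induced module defining \<open>V\<^sup>k(sl\<^sub>3)\<close>, and the invariant form is the trace form.\<close>

definition universal_affine_sl3 ::
    "complex \<Rightarrow> 'v::complex_vector vertex_alg \<Rightarrow> (complex^3^3 \<Rightarrow> 'v) \<Rightarrow> bool" where
  "universal_affine_sl3 k V \<iota> \<longleftrightarrow> vertex_algebra V \<and>
     (\<forall>X\<in>sl3. \<forall>Z\<in>sl3. \<iota> (X + Z) = \<iota> X + \<iota> Z) \<and>
     (\<forall>t. \<forall>X\<in>sl3. \<iota> (t *\<^sub>C X) = t *\<^sub>C \<iota> X) \<and>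
     (\<forall>X\<in>sl3. \<forall>Z\<in>sl3.
        ope V (\<iota> X) (\<iota> Z) [\<iota> (X ** Z - Z ** X), (k * trace (X ** Z)) *\<^sub>C vacuum V]) \<and>
     freely_strongly_generated V (map \<iota>
       [sl3_e1, sl3_e2, sl3_e3, sl3_h1, sl3_h2, sl3_f1, sl3_f2, sl3_f3])"

text \<open>The Cartan part uses the inverse of the Gram matrix of \<open>h\<^sub>1, h\<^sub>2\<close>, namely
  \<open>1/3\<close> times the matrix with rows \<open>(2, 1)\<close> and \<open>(1, 2)\<close>.\<close>

definition sugawara_sl3 ::
    "complex \<Rightarrow> 'v::complex_vector vertex_alg \<Rightarrow> (complex^3^3 \<Rightarrow> 'v) \<Rightarrow> 'v" where
  "sugawara_sl3 k V \<iota> = (let q = (\<lambda>X Z. normal_prod V (\<iota> X) (\<iota> Z)) in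
     (1 / (2 * (k + 3))) *\<^sub>C
      (q sl3_e1 sl3_f1 + q sl3_f1 sl3_e1 + q sl3_e2 sl3_f2 + q sl3_f2 sl3_e2
       + q sl3_e3 sl3_f3 + q sl3_f3 sl3_e3
       + (2/3) *\<^sub>C q sl3_h1 sl3_h1 + (1/3) *\<^sub>C q sl3_h1 sl3_h2
       + (1/3) *\<^sub>C q sl3_h2 sl3_h1 + (2/3) *\<^sub>C q sl3_h2 sl3_h2))"


section \<open>The Bershadsky-Polyakov algebra\<close>

definition virasoro_vector :: "'v::complex_vector vertex_alg \<Rightarrow> complex \<Rightarrow> 'v \<Rightarrow> bool" where
  "virasoro_vector V c L \<longleftrightarrow> ope V L L [va_deriv V L, 2 *\<^sub>C L, 0, (c / 2) *\<^sub>C vacuum V]"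

definition primary_vector ::
    "'v::complex_vector vertex_alg \<Rightarrow> 'v \<Rightarrow> complex \<Rightarrow> 'v \<Rightarrow> bool" where
  "primary_vector V L h a \<longleftrightarrow> ope V L a [va_deriv V a, h *\<^sub>C a]"

definition universal_bp ::
    "complex \<Rightarrow> 'v::complex_vector vertex_alg \<Rightarrow> 'v \<Rightarrow> 'v \<Rightarrow> 'v \<Rightarrow> 'v \<Rightarrow> bool" where
  "universal_bp k V J Gp Gm L \<longleftrightarrow> vertex_algebra V \<and>
     freely_strongly_generated V [J, Gp, Gm, L] \<and>
     virasoro_vector V (- ((2*k + 3) * (3*k + 1) / (k + 3))) L \<and>
     primary_vector V L 1 J \<and> primary_vector V L (3/2) Gp \<and> primary_vector V L (3/2) Gm \<and>
     ope V J J [0, ((2*k + 3) / 3) *\<^sub>C vacuum V] \<and>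
     ope V J Gp [Gp] \<and> ope V J Gm [- Gm] \<and>
     ope V Gp Gp [] \<and> ope V Gm Gm [] \<and>
     ope V Gp Gm
       [3 *\<^sub>C normal_prod V J J + (3 * (k + 1) / 2) *\<^sub>C va_deriv V J - (k + 3) *\<^sub>C L,
        (3 * (k + 1)) *\<^sub>C J,
        ((k + 1) * (2*k + 3)) *\<^sub>C vacuum V]"

definition bp_Ltilde :: "'v::complex_vector vertex_alg \<Rightarrow> 'v \<Rightarrow> 'v \<Rightarrow> 'v" where
  "bp_Ltilde V J L = L + (1/2) *\<^sub>C va_deriv V J"

definition bp_weight_vector ::
    "'v::complex_vector vertex_alg \<Rightarrow> 'v \<Rightarrow> 'v \<Rightarrow> ('v \<Rightarrow> int \<Rightarrow> 'm::complex_vector \<Rightarrow> 'm) \<Rightarrow> 'm \<Rightarrow> bool" where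
  "bp_weight_vector V J L Y v \<longleftrightarrow>
     (\<exists>j h. Y J 0 v = j *\<^sub>C v \<and> Y (bp_Ltilde V J L) 1 v = h *\<^sub>C v)"

text \<open>With respect to the grading by \<open>bp_Ltilde\<close> the fields \<open>J, G\<^sup>+, G\<^sup>-\<close> have weights 1, 1, 2, whence the index
  shift in \<open>G\<^sup>-(n) = G\<^sup>-\<^sub>(\<^sub>n\<^sub>+\<^sub>1\<^sub>)\<close>.\<close>

definition bp_relaxed_vector ::
    "'v::complex_vector vertex_alg \<Rightarrow> 'v \<Rightarrow> 'v \<Rightarrow> 'v \<Rightarrow> 'v \<Rightarrow>
     ('v \<Rightarrow> int \<Rightarrow> 'm::complex_vector \<Rightarrow> 'm) \<Rightarrow> 'm \<Rightarrow> bool" where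
  "bp_relaxed_vector V J Gp Gm L Y v \<longleftrightarrow> v \<noteq> 0 \<and> bp_weight_vector V J L Y v \<and>
     (\<forall>n>0. Y J n v = 0 \<and> Y Gp n v = 0 \<and> Y Gm (n + 1) v = 0 \<and> Y (bp_Ltilde V J L) (n + 1) v = 0)"

definition bp_weight_module ::
    "'v::complex_vector vertex_alg \<Rightarrow> 'v \<Rightarrow> 'v \<Rightarrow> 'm::complex_vector set \<Rightarrow>
     ('v \<Rightarrow> int \<Rightarrow> 'm \<Rightarrow> 'm) \<Rightarrow> bool" where
  "bp_weight_module V J L M Y \<longleftrightarrow> va_module V M Y \<and>
     M = cv.span {v\<in>M. bp_weight_vector V J L Y v}"

definition bp_relaxed_module ::
    "'v::complex_vector vertex_alg \<Rightarrow> 'v \<Rightarrow> 'v \<Rightarrow> 'v \<Rightarrow> 'v \<Rightarrow> 'm::complex_vector set \<Rightarrow>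
     ('v \<Rightarrow> int \<Rightarrow> 'm \<Rightarrow> 'm) \<Rightarrow> bool" where
  "bp_relaxed_module V J Gp Gm L M Y \<longleftrightarrow> bp_weight_module V J L M Y \<and>
     (\<exists>v. bp_relaxed_vector V J Gp Gm L Y v \<and> generated_by V M Y v)"

definition bp_highest_weight_module ::
    "'v::complex_vector vertex_alg \<Rightarrow> 'v \<Rightarrow> 'v \<Rightarrow> 'v \<Rightarrow> 'v \<Rightarrow> 'm::complex_vector set \<Rightarrow>
     ('v \<Rightarrow> int \<Rightarrow> 'm \<Rightarrow> 'm) \<Rightarrow> bool" where
  "bp_highest_weight_module V J Gp Gm L M Y \<longleftrightarrow> bp_weight_module V J L M Y \<and>
     (\<exists>v. bp_relaxed_vector V J Gp Gm L Y v \<and> Y Gm 1 v = 0 \<and> generated_by V M Y v)"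


section \<open>The \<open>\<beta>\<gamma>\<close> vertex algebra and its logarithmic projective modules\<close>

definition betagamma :: "'v::complex_vector vertex_alg \<Rightarrow> 'v \<Rightarrow> 'v \<Rightarrow> bool" where
  "betagamma V \<beta> \<gamma> \<longleftrightarrow> vertex_algebra V \<and> freely_strongly_generated V [\<beta>, \<gamma>] \<and>
     ope V \<beta> \<gamma> [vacuum V] \<and> ope V \<beta> \<beta> [] \<and> ope V \<gamma> \<gamma> []"

text \<open>\<open>Y'\<close> is the twist of \<open>Y\<close> by the \<open>s\<close>-th power of spectral flow,
  \<open>\<beta>(z) \<mapsto> z\<^bsup>-s\<^esup> \<beta>(z)\<close> and \<open>\<gamma>(z) \<mapsto> z\<^bsup>s\<^esup> \<gamma>(z)\<close> up to the convention for the sign of \<open>s\<close>.\<close>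

definition bg_spectral_flow ::
    "'v::complex_vector vertex_alg \<Rightarrow> 'v \<Rightarrow> 'v \<Rightarrow> int \<Rightarrow> 'm::complex_vector set \<Rightarrow>
     ('v \<Rightarrow> int \<Rightarrow> 'm \<Rightarrow> 'm) \<Rightarrow> ('v \<Rightarrow> int \<Rightarrow> 'm \<Rightarrow> 'm) \<Rightarrow> bool" where
  "bg_spectral_flow V \<beta> \<gamma> s M Y Y' \<longleftrightarrow> va_module V M Y \<and> va_module V M Y' \<and>
     (\<forall>n. \<forall>u\<in>M. Y' \<beta> n u = Y \<beta> (n + s) u \<and> Y' \<gamma> n u = Y \<gamma> (n - s) u)"

text \<open>The fields \<open>\<beta>, \<gamma>\<close> have weights 1, 0, so \<open>\<beta>(n) = \<beta>\<^sub>(\<^sub>n\<^sub>)\<close> and \<open>\<gamma>(n) = \<gamma>\<^sub>(\<^sub>n\<^sub>-\<^sub>1\<^sub>)\<close>.\<close>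

definition bg_relaxed_module ::
    "'v::complex_vector vertex_alg \<Rightarrow> 'v \<Rightarrow> 'v \<Rightarrow> 'm::complex_vector set \<Rightarrow>
     ('v \<Rightarrow> int \<Rightarrow> 'm \<Rightarrow> 'm) \<Rightarrow> bool" where
  "bg_relaxed_module V \<beta> \<gamma> M Y \<longleftrightarrow> va_module V M Y \<and>
     (\<exists>v. v \<noteq> 0 \<and> (\<exists>t. Y (normal_prod V \<gamma> \<beta>) 0 v = t *\<^sub>C v) \<and>
        (\<exists>h. Y (normal_prod V (va_deriv V \<gamma>) \<beta>) 1 v = h *\<^sub>C v) \<and>
        (\<forall>n>0. Y \<beta> n v = 0 \<and> Y \<gamma> (n - 1) v = 0) \<and> generated_by V M Y v)"

text \<open>The irreducible modules isomorphic to spectral flows of the vacuum module or of a relaxed module.\<close>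

definition bg_simple_object ::
    "'v::complex_vector vertex_alg \<Rightarrow> 'v \<Rightarrow> 'v \<Rightarrow> 'm::complex_vector set \<Rightarrow>
     ('v \<Rightarrow> int \<Rightarrow> 'm \<Rightarrow> 'm) \<Rightarrow> bool" where
  "bg_simple_object V \<beta> \<gamma> M Y \<longleftrightarrow> va_irreducible V M Y \<and>
     (\<exists>s Y0. bg_spectral_flow V \<beta> \<gamma> s M Y0 Y \<and>
        ((\<exists>f. module_hom V UNIV (nprod V) M Y0 f \<and> bij_betw f UNIV M) \<or>
         bg_relaxed_module V \<beta> \<gamma> M Y0))"

text \<open>Finite length weight modules with real weights whose composition factors are of the above kind.
  Each composition factor \<open>K (Suc i) / K i\<close> is exhibited as the image of a homomorphism with
  kernel \<open>K i\<close>. All modules occurring have countable dimension, so \<^typ>\<open>nat \<Rightarrow> complex\<close>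
  contains a copy of each of them.\<close>

definition bg_category ::
    "'v::complex_vector vertex_alg \<Rightarrow> 'v \<Rightarrow> 'v \<Rightarrow> 'm::complex_vector set \<Rightarrow>
     ('v \<Rightarrow> int \<Rightarrow> 'm \<Rightarrow> 'm) \<Rightarrow> bool" where
  "bg_category V \<beta> \<gamma> M Y \<longleftrightarrow> va_module V M Y \<and>
     M = cv.span {v\<in>M. \<exists>t::real. Y (normal_prod V \<gamma> \<beta>) 0 v = complex_of_real t *\<^sub>C v} \<and>
     (\<exists>l K. K 0 = {0} \<and> K l = M \<and>
        (\<forall>i<l. va_submodule V M Y (K (Suc i)) \<and> K i \<subseteq> K (Suc i) \<and>
           (\<exists>(Q :: (nat \<Rightarrow> complex) set) YQ f. bg_simple_object V \<beta> \<gamma> Q YQ \<and>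
              module_hom V (K (Suc i)) Y Q YQ f \<and> f ` K (Suc i) = Q \<and>
              {u \<in> K (Suc i). f u = 0} = K i)))"

definition bg_projective ::
    "'v::complex_vector vertex_alg \<Rightarrow> 'v \<Rightarrow> 'v \<Rightarrow> 'm::complex_vector set \<Rightarrow>
     ('v \<Rightarrow> int \<Rightarrow> 'm \<Rightarrow> 'm) \<Rightarrow> bool" where
  "bg_projective V \<beta> \<gamma> P Y \<longleftrightarrow> bg_category V \<beta> \<gamma> P Y \<and>
     (\<forall>(A :: (nat \<Rightarrow> complex) set) YA (B :: (nat \<Rightarrow> complex) set) YB p f.
        bg_category V \<beta> \<gamma> A YA \<and> bg_category V \<beta> \<gamma> B YB \<and>
        module_hom V A YA B YB p \<and> p ` A = B \<and> module_hom V P Y B YB f \<longrightarrow>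
        (\<exists>g. module_hom V P Y A YA g \<and> (\<forall>u\<in>P. p (g u) = f u)))"

definition bg_projective_cover ::
    "'v::complex_vector vertex_alg \<Rightarrow> 'v \<Rightarrow> 'v \<Rightarrow> 'm::complex_vector set \<Rightarrow> ('v \<Rightarrow> int \<Rightarrow> 'm \<Rightarrow> 'm) \<Rightarrow>
     'n::complex_vector set \<Rightarrow> ('v \<Rightarrow> int \<Rightarrow> 'n \<Rightarrow> 'n) \<Rightarrow> bool" where
  "bg_projective_cover V \<beta> \<gamma> P Y M YM \<longleftrightarrow> bg_projective V \<beta> \<gamma> P Y \<and>
     (\<exists>\<pi>. module_hom V P Y M YM \<pi> \<and> \<pi> ` P = M \<and>
        (\<forall>K. va_submodule V P Y K \<and> \<pi> ` K = M \<longrightarrow> K = P))"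

definition bg_P ::
    "'v::complex_vector vertex_alg \<Rightarrow> 'v \<Rightarrow> 'v \<Rightarrow> int \<Rightarrow> 'm::complex_vector set \<Rightarrow>
     ('v \<Rightarrow> int \<Rightarrow> 'm \<Rightarrow> 'm) \<Rightarrow> bool" where
  "bg_P V \<beta> \<gamma> s P Y \<longleftrightarrow>
     (\<exists>Y\<sigma>. bg_spectral_flow V \<beta> \<gamma> s UNIV (nprod V) Y\<sigma> \<and>
        bg_projective_cover V \<beta> \<gamma> P Y (UNIV :: 'v set) Y\<sigma>)"


section \<open>The half lattice vertex algebra \<open>\<Pi>(0)\<close>\<close>

text \<open>\<open>E j\<close> is \<open>e\<^bsup>jc\<^esup>\<close>. The lattice \<open>\<int>c\<close> is isotropic, so these vectors form a commutative subalgebra;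
  the clause on \<^const>\<open>va_deriv\<close> fixes the translation operator on it, which the OPEs alone do not.\<close>

definition half_lattice ::
    "'v::complex_vector vertex_alg \<Rightarrow> 'v \<Rightarrow> 'v \<Rightarrow> (int \<Rightarrow> 'v) \<Rightarrow> bool" where
  "half_lattice V c d E \<longleftrightarrow> vertex_algebra V \<and>
     basis_family (UNIV \<times> pbw_index [c, d]) (\<lambda>(j, ps). pbw_monomial V [c, d] ps (E j)) \<and>
     ope V c d [0, 2 *\<^sub>C vacuum V] \<and> ope V c c [] \<and> ope V d d [] \<and>
     E 0 = vacuum V \<and>
     (\<forall>j. ope V c (E j) [] \<and> ope V d (E j) [of_int (2 * j) *\<^sub>C E j] \<and>
        va_deriv V (E j) = of_int j *\<^sub>C normal_prod V c (E j)) \<and>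
     (\<forall>i j. ope V (E i) (E j) [] \<and> normal_prod V (E i) (E j) = E (i + j))"

text \<open>The module \<open>\<Pi>(0).e\<^bsup>\<mu>\<^esup>\<close>, \<open>\<mu> = (r/2) d + \<lambda> c\<close>: it is generated by the Heisenberg highest weight vector \<open>v = e\<^bsup>\<mu>\<^esup>\<close>
  with \<open>c(0)\<close>- and \<open>d(0)\<close>-eigenvalues \<open>\<langle>c,\<mu>\<rangle> = r\<close> and \<open>\<langle>d,\<mu>\<rangle> = 2\<lambda>\<close>.\<close>

definition half_lattice_exp_module ::
    "'v::complex_vector vertex_alg \<Rightarrow> 'v \<Rightarrow> 'v \<Rightarrow> int \<Rightarrow> complex \<Rightarrow> 'm::complex_vector set \<Rightarrow>
     ('v \<Rightarrow> int \<Rightarrow> 'm \<Rightarrow> 'm) \<Rightarrow> bool" where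
  "half_lattice_exp_module V c d r lam M Y \<longleftrightarrow> va_module V M Y \<and>
     (\<exists>v. v \<noteq> 0 \<and> generated_by V M Y v \<and>
        Y c 0 v = of_int r *\<^sub>C v \<and> Y d 0 v = (2 * lam) *\<^sub>C v \<and>
        (\<forall>n>0. Y c n v = 0 \<and> Y d n v = 0))"


section \<open>The embedding of \<open>L\<^sub>k(sl\<^sub>3)\<close>\<close>

text \<open>\<open>\<iota>\<close> is the map from \<open>sl\<^sub>3\<close> to \<open>L\<^sub>k(sl\<^sub>3)\<close>, and \<open>J, Gp, Gm\<close> are the generators of the simple quotient \<open>W\<close>.
  Nested normal ordered products are taken from the right.\<close>

definition sl3_embedding ::
    "complex \<Rightarrow> 'l::complex_vector vertex_alg \<Rightarrow> (complex^3^3 \<Rightarrow> 'l) \<Rightarrow>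
     'w::complex_vector vertex_alg \<Rightarrow> 'w \<Rightarrow> 'w \<Rightarrow> 'w \<Rightarrow>
     's::complex_vector vertex_alg \<Rightarrow> 's \<Rightarrow> 's \<Rightarrow>
     'p::complex_vector vertex_alg \<Rightarrow> 'p \<Rightarrow> 'p \<Rightarrow> (int \<Rightarrow> 'p) \<Rightarrow>
     ('l \<Rightarrow> ('w, ('s, 'p) tensor) tensor) \<Rightarrow> bool" where
  "sl3_embedding k Lk \<iota> W J Gp Gm S \<beta> \<gamma> Pi0 c d E \<Phi> \<longleftrightarrow>
     va_hom Lk (W \<otimes>\<^sub>V S \<otimes>\<^sub>V Pi0) \<Phi> \<and> inj \<Phi> \<and>
     (let oneW = vacuum W; oneS = vacuum S; oneP = vacuum Pi0; em = E (-1) in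
      \<Phi> (\<iota> sl3_e1) = - (oneW \<otimes> \<gamma> \<otimes> E 1) \<and>
      \<Phi> (\<iota> sl3_e2) = oneW \<otimes> \<beta> \<otimes> oneP \<and>
      \<Phi> (\<iota> sl3_e3) = oneW \<otimes> oneS \<otimes> E 1 \<and>
      \<Phi> (\<iota> sl3_h1) = - (2 *\<^sub>C (J \<otimes> oneS \<otimes> oneP)) + oneW \<otimes> normal_prod S \<gamma> \<beta> \<otimes> oneP
        - ((2*k + 9) / 6) *\<^sub>C (oneW \<otimes> oneS \<otimes> c) + (1/2) *\<^sub>C (oneW \<otimes> oneS \<otimes> d) \<and>
      \<Phi> (\<iota> sl3_h2) = J \<otimes> oneS \<otimes> oneP - 2 *\<^sub>C (oneW \<otimes> normal_prod S \<gamma> \<beta> \<otimes> oneP)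
        + ((4*k + 9) / 6) *\<^sub>C (oneW \<otimes> oneS \<otimes> c) + (1/2) *\<^sub>C (oneW \<otimes> oneS \<otimes> d) \<and>
      \<Phi> (\<iota> sl3_f1) = Gp \<otimes> oneS \<otimes> oneP
        - (2 *\<^sub>C (J \<otimes> \<beta> \<otimes> em)
           + ((8*k + 9) / 6) *\<^sub>C (oneW \<otimes> \<beta> \<otimes> normal_prod Pi0 c em)
           - (1/2) *\<^sub>C (oneW \<otimes> \<beta> \<otimes> normal_prod Pi0 d em))
        + (k + 1) *\<^sub>C (oneW \<otimes> va_deriv S \<beta> \<otimes> em) \<and>
      \<Phi> (\<iota> sl3_f2) = Gm \<otimes> oneS \<otimes> em
        + (J \<otimes> \<gamma> \<otimes> oneP + ((4*k + 9) / 6) *\<^sub>C (oneW \<otimes> \<gamma> \<otimes> c) + (1/2) *\<^sub>C (oneW \<otimes> \<gamma> \<otimes> d))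
        + k *\<^sub>C (oneW \<otimes> va_deriv S \<gamma> \<otimes> oneP)
        - oneW \<otimes> normal_prod S \<gamma> (normal_prod S \<gamma> \<beta>) \<otimes> oneP)"

end

theory Submission
  imports Defs
begin

text \<open>Tensor products of modules are modules over the tensor product vertex algebra, so pulling back along
  \<open>\<Phi>\<close> gives a module over \<open>L\<^sub>k(sl\<^sub>3)\<close>. An operator product computation identifies \<open>\<Phi>(L\<^sub>s\<^sub>u\<^sub>g)\<close> with a sum of
  vectors in the three tensor factors. Their zero modes act separately, and those on \<open>N\<close> and on the
  \<open>\<Pi>(0)\<close>-module are diagonalizable, so everything rests on the nilpotent part of \<open>L(0)\<close> on \<open>P\<^sub>s\<close>.

  After untwisting the spectral flow, \<open>P\<^sub>s\<close> is generated by a charge 0 vector \<open>w\<close> above the vacuum. All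
  composition factors with integral charges are spectral flows of the vacuum module, and their conformal weights are
  bounded below in the charges \<open>-1, 0, 1\<close>. Hence the modes \<open>\<beta>\<^sub>n, \<gamma>\<^sub>n\<close> with \<open>n \<ge> 1\<close> kill \<open>w\<close>, which
  forces \<open>L\<^sup>2 w = 0\<close>. Conversely \<open>L w \<noteq> 0\<close>: adding nilpotent parts \<open>\<epsilon>\<close> and \<open>-\<epsilon>\<close> to the exponents of two modes
  of the Weyl algebra yields an explicit module of length four on which multiplication by \<open>\<epsilon>\<close> is a surjection onto
  the vacuum module and \<open>L\<close> acts on the generator as \<open>\<epsilon>\<close>. By projectivity \<open>P\<^sub>s\<close> maps to this module over the
  vacuum module, so \<open>L\<close> cannot kill \<open>w\<close>.\<close>

section \<open>Finitely supported sums\<close>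

text \<open>A module must satisfy the full Borcherds identity for all pairs of states, whereas the
  two modules to be built, the tensor product and the deformed Weyl module, are only understood on
  generators. The technical core is therefore a closure property: the identity passes from two
  states to their products. For the beta-gamma system the state-field map is itself obtained by
  treating the fields on M as another Weyl module and sending the vacuum to the identity field.

  Projectivity is tested only on modules carried by subsets of
  \<open>nat \<Rightarrow> complex\<close>, so the deformed module and its simple factors are
  transported there; this is why countable dimension is tracked.

  The two nilpotent parts are opposite so that they cancel in the charge, which has to stay
  semisimple. In L the same two exponents have the weights 0 and -1, so one of them survives.

  The embedding gives no formula for f_3. In the Sugawara vector :e_3 f_3: is recovered by applying
  the zero mode of f_2, a derivation, to :e_3 f_1:.\<close>

lemma finite_fibre: "finite {(i, j). G i j} \<Longrightarrow> finite {j. G i j}"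
  by (rule finite_subset[of _ "snd ` {(i, j). G i j}"]) force+

lemma Sum_any_eq_sum:
  fixes f :: "'i \<Rightarrow> 'a::comm_monoid_add"
  assumes "finite A" "\<And>i. i \<notin> A \<Longrightarrow> f i = 0"
  shows "Sum_any f = sum f A"
  by (rule Sum_any.expand_superset) (use assms in auto)

lemma Sum_any_pair:
  fixes G :: "'i \<Rightarrow> 'j \<Rightarrow> 'a::comm_monoid_add"
  assumes "finite {(i, j). G i j \<noteq> 0}"
  shows "Sum_any (\<lambda>i. Sum_any (G i)) = Sum_any (\<lambda>(i, j). G i j)"
proof (rule Sum_any.cartesian_product)
  let ?C = "{(i, j). G i j \<noteq> 0}"
  show "finite (fst ` ?C \<times> snd ` ?C)" using assms by simp
  show "{a. \<exists>b. G a b \<noteq> 0} \<times> {b. \<exists>a. G a b \<noteq> 0} \<subseteq> fst ` ?C \<times> snd ` ?C" by force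
qed

lemma Sum_any_swap:
  fixes G :: "'i \<Rightarrow> 'j \<Rightarrow> 'a::comm_monoid_add"
  assumes "finite {(i, j). G i j \<noteq> 0}"
  shows "Sum_any (\<lambda>i. Sum_any (G i)) = Sum_any (\<lambda>j. Sum_any (\<lambda>i. G i j))"
proof (rule Sum_any.swap)
  let ?C = "{(i, j). G i j \<noteq> 0}"
  show "finite (fst ` ?C \<times> snd ` ?C)" using assms by simp
  show "{a. \<exists>b. G a b \<noteq> 0} \<times> {b. \<exists>a. G a b \<noteq> 0} \<subseteq> fst ` ?C \<times> snd ` ?C" by force
qed

text \<open>Products of two binomial expansions are collected along the antidiagonals i + j = s; the
  Vandermonde identity is then applied to each inner sum.\<close>

lemma Sum_any_diag:
  fixes G :: "nat \<Rightarrow> nat \<Rightarrow> 'a::comm_monoid_add"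
  assumes "finite {(i, j). G i j \<noteq> 0}"
  shows "Sum_any (\<lambda>i. Sum_any (G i)) = Sum_any (\<lambda>s. \<Sum>i\<le>s. G i (s - i))"
proof -
  let ?C = "{(i, j). G i j \<noteq> 0}"
  obtain K where K: "?C \<subseteq> {..<K} \<times> {..<K}"
  proof -
    have "finite (fst ` ?C \<union> snd ` ?C)" using assms by simp
    then obtain K where "fst ` ?C \<union> snd ` ?C \<subseteq> {..<K}" using finite_nat_iff_bounded by meson
    then have "?C \<subseteq> {..<K} \<times> {..<K}" by force
    then show ?thesis by (rule that)
  qed
  have z: "G i j = 0" if "i \<ge> K \<or> j \<ge> K" for i j using K that by fastforce
  have "Sum_any (\<lambda>i. Sum_any (G i)) = (\<Sum>(i, j)\<in>{(i, j). i + j < 2 * K}. G i j)"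
    unfolding Sum_any_pair[OF assms]
  proof (rule Sum_any_eq_sum)
    show "finite {(i, j). i + j < 2 * K}"
      by (rule finite_subset[of _ "{..<2*K} \<times> {..<2*K}"]) auto
  next
    fix p assume "p \<notin> {(i, j). i + j < 2 * K}"
    then show "(case p of (i, j) \<Rightarrow> G i j) = 0" by (cases p) (auto intro!: z)
  qed
  also have "\<dots> = (\<Sum>s<2*K. \<Sum>i\<le>s. G i (s - i))" by (rule sum.triangle_reindex)
  also have "\<dots> = Sum_any (\<lambda>s. \<Sum>i\<le>s. G i (s - i))"
    by (rule Sum_any_eq_sum[symmetric]) (auto intro!: sum.neutral z)
  finally show ?thesis .
qed

lemma Sum_any_diff:
  fixes f g :: "'i \<Rightarrow> 'a::ab_group_add"
  assumes "finite {i. f i \<noteq> 0}" "finite {i. g i \<noteq> 0}"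
  shows "Sum_any (\<lambda>i. f i - g i) = Sum_any f - Sum_any g"
proof -
  let ?A = "{i. f i \<noteq> 0} \<union> {i. g i \<noteq> 0}"
  have "Sum_any (\<lambda>i. f i - g i) = (\<Sum>i\<in>?A. f i - g i)" "Sum_any f = sum f ?A" "Sum_any g = sum g ?A"
    by (rule Sum_any_eq_sum; use assms in auto)+
  then show ?thesis by (simp add: sum_subtractf)
qed

lemma finite_nat_bound: "(\<And>j. j \<ge> K \<Longrightarrow> \<not> P j) \<Longrightarrow> finite {j::nat. P j}"
  by (rule finite_subset[of _ "{..<K}"]) (auto simp: not_le[symmetric])

lemma finite_pair_bound:
  fixes P :: "nat \<Rightarrow> 'i \<Rightarrow> bool"
  assumes "\<And>i j. i \<ge> K \<Longrightarrow> \<not> P i j" "\<And>i. finite {j. P i j}"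
  shows "finite {(i, j). P i j}"
proof (rule finite_subset)
  show "{(i, j). P i j} \<subseteq> (SIGMA i:{..<K}. {j. P i j})" using assms(1) by (force simp: not_le[symmetric])
  show "finite (SIGMA i:{..<K}. {j. P i j})" using assms(2) by auto
qed

lemma finite_pair_swap: "finite {(i, j). P i j} \<Longrightarrow> finite {(j, i). P i j}"
proof -
  assume "finite {(i, j). P i j}"
  then have "finite ((\<lambda>(i, j). (j, i)) ` {(i, j). P i j})" by simp
  then show ?thesis by (rule rev_finite_subset) force
qed

text \<open>Modules are carried by a subspace of a type and nothing is known about the modes outside
  it, so linearity has to be relative to that subspace.\<close>

definition lin_on :: "'a::complex_vector set \<Rightarrow> ('a \<Rightarrow> 'b::complex_vector) \<Rightarrow> bool" where
  "lin_on M T \<longleftrightarrow> (\<forall>u\<in>M. \<forall>v\<in>M. T (u + v) = T u + T v) \<and> (\<forall>t. \<forall>u\<in>M. T (t *\<^sub>C u) = t *\<^sub>C T u)"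

lemma lin_onD:
  assumes "lin_on M T" "u \<in> M"
  shows "v \<in> M \<Longrightarrow> T (u + v) = T u + T v" "T (t *\<^sub>C u) = t *\<^sub>C T u"
  using assms by (auto simp: lin_on_def)

lemma lin_on_0: "lin_on M T \<Longrightarrow> cv.subspace M \<Longrightarrow> T 0 = 0"
  using lin_onD(2)[of M T 0 0] cv.subspace_0 by fastforce

lemma lin_on_diff: "lin_on M T \<Longrightarrow> cv.subspace M \<Longrightarrow> u \<in> M \<Longrightarrow> v \<in> M \<Longrightarrow> T (u - v) = T u - T v"
  using lin_onD(1)[of M T "u - v" v] by (simp add: cv.subspace_diff)

lemma lin_on_sum:
  "lin_on M T \<Longrightarrow> cv.subspace M \<Longrightarrow> (\<And>i. i \<in> I \<Longrightarrow> f i \<in> M) \<Longrightarrow> T (sum f I) = (\<Sum>i\<in>I. T (f i))"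
  by (induction I rule: infinite_finite_induct) (auto simp: lin_on_0 lin_onD cv.subspace_sum)

lemma lin_on_Sum_any:
  assumes "lin_on M T" "cv.subspace M" "\<And>i. f i \<in> M" "finite {i. f i \<noteq> 0}"
  shows "T (Sum_any f) = Sum_any (\<lambda>i. T (f i))"
proof -
  have "Sum_any (\<lambda>i. T (f i)) = (\<Sum>i\<in>{i. f i \<noteq> 0}. T (f i))"
    by (rule Sum_any_eq_sum) (use assms in \<open>auto simp: lin_on_0\<close>)
  also have "\<dots> = T (sum f {i. f i \<noteq> 0})" using assms by (simp add: lin_on_sum)
  finally show ?thesis using Sum_any_eq_sum[OF assms(4), of f] by simp
qed

lemma lin_on_UNIV: "lin_on UNIV T \<longleftrightarrow> clinear T"
  by (auto simp: lin_on_def clinear_iff)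

lemma lin_on_subset: "lin_on M T \<Longrightarrow> N \<subseteq> M \<Longrightarrow> lin_on N T"
  unfolding lin_on_def by blast

lemma lin_on_scale: "lin_on UNIV (\<lambda>v. t *\<^sub>C v)"
  by (simp add: lin_on_def scaleC_add_right scaleC_scaleC mult.commute)

lemma scaleC_Sum_any:
  fixes f :: "'i \<Rightarrow> 'a::complex_vector"
  shows "t *\<^sub>C Sum_any f = Sum_any (\<lambda>i. t *\<^sub>C f i)"
proof (cases "t = 0")
  case False
  then have eq: "{i. t *\<^sub>C f i \<noteq> 0} = {i. f i \<noteq> 0}" by auto
  show ?thesis
  proof (cases "finite {i. f i \<noteq> 0}")
    case True
    then show ?thesis by (rule lin_on_Sum_any[OF lin_on_scale cv.subspace_UNIV UNIV_I])
  qed (use eq in \<open>simp add: Sum_any.infinite\<close>)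
qed simp

lemma Sum_any_mem:
  assumes "cv.subspace M" "\<And>i. f i \<in> M"
  shows "Sum_any f \<in> M"
  using assms by (simp add: Sum_any.expand_set cv.subspace_sum)

lemma cv_span_subspace_induct:
  assumes "cv.subspace M" "X \<subseteq> M" "u \<in> cv.span X"
  shows "u \<in> M"
  using assms cv.span_minimal by blast

section \<open>The Jacobi identity for triples of mode families\<close>

abbreviation bin :: "int \<Rightarrow> nat \<Rightarrow> complex" where "bin p j \<equiv> of_int p gchoose j"

lemma bin_0 [simp]: "bin p 0 = 1" by simp
lemma bin_eq_0: "i < j \<Longrightarrow> bin (int i) j = 0"
  by (simp add: binomial_gbinomial[symmetric] binomial_eq_0)
lemma bin_Vandermonde: "(\<Sum>i\<le>s. bin p i * bin q (s - i)) = bin (p + q) s"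
  using gbinomial_Vandermonde[of "of_int p :: complex" "of_int q" s] by (simp add: atMost_atLeast0)
lemma bin_trinomial: "bin n (i + j) * bin (int (i + j)) i = bin n i * bin (n - int i) j"
  using gbinomial_trinomial_revision[of i "i + j" "of_int n :: complex"] by simp
text \<open>Both sides are the trinomial coefficient of n with lower entries i and j, which is
  symmetric in them.\<close>

lemma bin_trinomial': "bin n i * bin (n - int i) j = bin n j * bin (n - int j) i"
proof -
  have "bin (int (i + j)) i = bin (int (i + j)) j"
    using binomial_symmetric[of i "i + j"] by (simp add: binomial_gbinomial[symmetric] del: of_nat_add flip: of_nat_add)
  then show ?thesis using bin_trinomial[of n i j] bin_trinomial[of n j i] by (simp add: add.commute)
qed

text \<open>The three families are the modes of \<open>a(z\<^sub>1)b(z\<^sub>2)u\<close>, \<open>b(z\<^sub>2)a(z\<^sub>1)u\<close> and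
  \<open>(a(z\<^sub>0)b)(z\<^sub>2)u\<close>, with the index of the outer field first.\<close>

definition jacL :: "(int \<Rightarrow> int \<Rightarrow> 'm::complex_vector) \<Rightarrow> int \<Rightarrow> int \<Rightarrow> int \<Rightarrow> 'm" where
  "jacL h p q r = Sum_any (\<lambda>j. bin p j *\<^sub>C h (r + int j) (p + q - int j))"

definition jacR ::
    "(int \<Rightarrow> int \<Rightarrow> 'm::complex_vector) \<Rightarrow> (int \<Rightarrow> int \<Rightarrow> 'm) \<Rightarrow> int \<Rightarrow> int \<Rightarrow> int \<Rightarrow> 'm" where
  "jacR f g p q r = Sum_any (\<lambda>j. ((-1) ^ j * bin r j) *\<^sub>C
     (f (p + r - int j) (q + int j) - ((-1) powi r) *\<^sub>C g (q + r - int j) (p + int j)))"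

definition bdd_inner :: "(int \<Rightarrow> int \<Rightarrow> 'm::zero) \<Rightarrow> int \<Rightarrow> bool" where
  "bdd_inner f K \<longleftrightarrow> (\<forall>m. \<forall>n\<ge>K. f m n = 0)"

definition bdd_outer :: "(int \<Rightarrow> int \<Rightarrow> 'm::zero) \<Rightarrow> int \<Rightarrow> bool" where
  "bdd_outer h K \<longleftrightarrow> (\<forall>m\<ge>K. \<forall>n. h m n = 0)"

text \<open>The bounds belong to the notion: they make every sum finite, and they let sums over
  further indices be exchanged with the sum over j. The bound on f and g is uniform in the outer
  index because the inner field acts on a fixed vector.\<close>

definition jac ::
    "(int \<Rightarrow> int \<Rightarrow> 'm::complex_vector) \<Rightarrow> (int \<Rightarrow> int \<Rightarrow> 'm) \<Rightarrow> (int \<Rightarrow> int \<Rightarrow> 'm) \<Rightarrow> bool" where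
  "jac f g h \<longleftrightarrow> (\<exists>K. bdd_inner f K \<and> bdd_inner g K \<and> bdd_outer h K) \<and>
     (\<forall>p q r. jacL h p q r = jacR f g p q r)"

lemma bdd_mono:
  "bdd_inner f K \<Longrightarrow> K \<le> K' \<Longrightarrow> bdd_inner f K'" "bdd_outer f K \<Longrightarrow> K \<le> K' \<Longrightarrow> bdd_outer f K'"
  by (auto simp: bdd_inner_def bdd_outer_def)

lemma jacI:
  assumes "bdd_inner f K1" "bdd_inner g K2" "bdd_outer h K3" "\<And>p q r. jacL h p q r = jacR f g p q r"
  shows "jac f g h"
  unfolding jac_def using assms bdd_mono[of f K1 "max K1 (max K2 K3)"]
    bdd_mono[of g K2 "max K1 (max K2 K3)"] bdd_mono[of h K3 "max K1 (max K2 K3)"]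
  by (intro conjI exI[of _ "max K1 (max K2 K3)"]) auto

lemma jacD: "jac f g h \<Longrightarrow> jacL h p q r = jacR f g p q r"
  by (simp add: jac_def)

lemma bdd_innerD: "bdd_inner f K \<Longrightarrow> n \<ge> K \<Longrightarrow> f m n = 0" by (simp add: bdd_inner_def)
lemma bdd_outerD: "bdd_outer f K \<Longrightarrow> m \<ge> K \<Longrightarrow> f m n = 0" by (simp add: bdd_outer_def)

lemma jacL_support:
  assumes "bdd_outer h K" shows "finite {j. bin p j *\<^sub>C h (r + int j) (N - int j) \<noteq> 0}"
  by (rule finite_nat_bound[of "nat (K - r)"]) (use bdd_outerD[OF assms] in auto)

lemma jacR_support:
  assumes "bdd_inner f K" "bdd_inner g K"
  shows "finite {j. ((-1) ^ j * bin r j) *\<^sub>C (f (p + r - int j) (q + int j)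
    - ((-1) powi r) *\<^sub>C g (q + r - int j) (p + int j)) \<noteq> 0}"
  by (rule finite_nat_bound[of "nat (max (K - q) (K - p))"])
     (use bdd_innerD[OF assms(1)] bdd_innerD[OF assms(2)] in auto)

lemma jac_zero: "jac (\<lambda>_ _. 0) (\<lambda>_ _. 0) (\<lambda>_ _. 0)"
  by (rule jacI[of _ 0 _ 0 _ 0]) (auto simp: bdd_inner_def bdd_outer_def jacL_def jacR_def)

text \<open>A bound common to all summands confines j to a finite range. The sum over i may be
  infinite as long as each coefficient is a finite sum, and it can then be exchanged with the sum
  over j.\<close>

lemma jac_Sum_any:
  fixes F :: "'i \<Rightarrow> int \<Rightarrow> int \<Rightarrow> 'm::complex_vector"
  assumes jac: "\<And>i p q r. jacL (H i) p q r = jacR (F i) (G i) p q r"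
    and K: "\<And>i. bdd_inner (F i) K" "\<And>i. bdd_inner (G i) K" "\<And>i. bdd_outer (H i) K"
    and fin: "\<And>m n. finite {i. F i m n \<noteq> 0}" "\<And>m n. finite {i. G i m n \<noteq> 0}"
      "\<And>m n. finite {i. H i m n \<noteq> 0}"
  shows "jac (\<lambda>m n. Sum_any (\<lambda>i. F i m n)) (\<lambda>m n. Sum_any (\<lambda>i. G i m n)) (\<lambda>m n. Sum_any (\<lambda>i. H i m n))"
proof (rule jacI[of _ K _ K _ K])
  show "bdd_inner (\<lambda>m n. Sum_any (\<lambda>i. F i m n)) K" "bdd_inner (\<lambda>m n. Sum_any (\<lambda>i. G i m n)) K"
    "bdd_outer (\<lambda>m n. Sum_any (\<lambda>i. H i m n)) K"
    using K by (simp_all add: bdd_inner_def bdd_outer_def)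
  fix p q r
  have "jacL (\<lambda>m n. Sum_any (\<lambda>i. H i m n)) p q r
      = Sum_any (\<lambda>j. Sum_any (\<lambda>i. bin p j *\<^sub>C H i (r + int j) (p + q - int j)))"
    by (simp add: jacL_def scaleC_Sum_any)
  also have "\<dots> = Sum_any (\<lambda>i. jacL (H i) p q r)"
    unfolding jacL_def
    by (rule Sum_any_swap, rule finite_pair_bound[of "nat (K - r)"])
      (use K(3)[THEN bdd_outerD] fin(3) in \<open>auto intro: finite_subset[OF _ fin(3)]\<close>)
  also have "\<dots> = Sum_any (\<lambda>i. jacR (F i) (G i) p q r)" by (simp add: jac)
  also have "\<dots> = Sum_any (\<lambda>j. Sum_any (\<lambda>i. ((-1) ^ j * bin r j) *\<^sub>C
     (F i (p + r - int j) (q + int j) - ((-1) powi r) *\<^sub>C G i (q + r - int j) (p + int j))))"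
    unfolding jacR_def
  proof (rule Sum_any_swap[symmetric], rule finite_pair_bound[of "nat (max (K - q) (K - p))"])
    fix j
    show "finite {i. ((-1) ^ j * bin r j) *\<^sub>C
     (F i (p + r - int j) (q + int j) - ((-1) powi r) *\<^sub>C G i (q + r - int j) (p + int j)) \<noteq> 0}"
      by (rule finite_subset[OF _ finite_UnI[OF fin(1)[of "p + r - int j" "q + int j"]
            fin(2)[of "q + r - int j" "p + int j"]]]) auto
  qed (use K(1)[THEN bdd_innerD] K(2)[THEN bdd_innerD] in auto)
  also have "\<dots> = jacR (\<lambda>m n. Sum_any (\<lambda>i. F i m n)) (\<lambda>m n. Sum_any (\<lambda>i. G i m n)) p q r"
  proof -
    have "Sum_any (\<lambda>i. F i a b - t *\<^sub>C G i c d) = Sum_any (\<lambda>i. F i a b) - t *\<^sub>C Sum_any (\<lambda>i. G i c d)" for a b c d t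
      by (subst Sum_any_diff) (auto simp: scaleC_Sum_any fin intro: finite_subset[OF _ fin(2)])
    then show ?thesis by (simp add: jacR_def scaleC_Sum_any[symmetric])
  qed
  finally show "jacL (\<lambda>m n. Sum_any (\<lambda>i. H i m n)) p q r
    = jacR (\<lambda>m n. Sum_any (\<lambda>i. F i m n)) (\<lambda>m n. Sum_any (\<lambda>i. G i m n)) p q r" .
qed

lemma jac_add:
  assumes "jac f g h" "jac f' g' h'"
  shows "jac (\<lambda>m n. f m n + f' m n) (\<lambda>m n. g m n + g' m n) (\<lambda>m n. h m n + h' m n)"
proof -
  obtain K K' where K: "bdd_inner f K" "bdd_inner g K" "bdd_outer h K"
    "bdd_inner f' K'" "bdd_inner g' K'" "bdd_outer h' K'" using assms by (auto simp: jac_def)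
  let ?c = "\<lambda>f f' (i::bool). if i then f else f'"
  have S: "Sum_any (\<lambda>i. (if i then f else f') m n) = f m n + f' m n" for f f' :: "int \<Rightarrow> int \<Rightarrow> 'a" and m n
    by (subst Sum_any_eq_sum[of UNIV]) (auto simp: UNIV_bool add.commute)
  have "jac (\<lambda>m n. Sum_any (\<lambda>i. ?c f f' i m n)) (\<lambda>m n. Sum_any (\<lambda>i. ?c g g' i m n)) (\<lambda>m n. Sum_any (\<lambda>i. ?c h h' i m n))"
    by (rule jac_Sum_any[of _ _ _ "max K K'"])
      (use assms K in \<open>auto simp: jac_def bdd_mono split: if_splits\<close>)
  then show ?thesis by (simp add: S)
qed

lemma jac_linear:
  assumes "jac f g h" "lin_on M T" "cv.subspace M"
    and M: "\<And>m n. f m n \<in> M" "\<And>m n. g m n \<in> M" "\<And>m n. h m n \<in> M"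
  shows "jac (\<lambda>m n. T (f m n)) (\<lambda>m n. T (g m n)) (\<lambda>m n. T (h m n))"
proof -
  obtain K where K: "bdd_inner f K" "bdd_inner g K" "bdd_outer h K" using assms by (auto simp: jac_def)
  note T0 = lin_on_0[OF assms(2,3)]
  note Ts = lin_onD(2)[OF assms(2)] lin_on_diff[OF assms(2,3)]
  note Ms = cv.subspace_scale[OF assms(3)] cv.subspace_diff[OF assms(3)] M
  show ?thesis
  proof (rule jacI[of _ K _ K _ K])
    fix p q r
    have "jacL (\<lambda>m n. T (h m n)) p q r = T (jacL h p q r)"
      unfolding jacL_def
      by (subst lin_on_Sum_any[OF assms(2,3) _ jacL_support[OF K(3)]]) (auto simp: Ms Ts)
    moreover have "jacR (\<lambda>m n. T (f m n)) (\<lambda>m n. T (g m n)) p q r = T (jacR f g p q r)"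
      unfolding jacR_def
      by (subst lin_on_Sum_any[OF assms(2,3) _ jacR_support[OF K(1,2)]]) (auto simp: Ms Ts)
    ultimately show "jacL (\<lambda>m n. T (h m n)) p q r = jacR (\<lambda>m n. T (f m n)) (\<lambda>m n. T (g m n)) p q r"
      using jacD[OF assms(1)] by simp
  qed (use K T0 in \<open>auto simp: bdd_inner_def bdd_outer_def\<close>)
qed

lemma jac_scale:
  "jac f g h \<Longrightarrow> jac (\<lambda>m n. t *\<^sub>C f m n) (\<lambda>m n. t *\<^sub>C g m n) (\<lambda>m n. t *\<^sub>C h m n)"
  by (rule jac_linear[OF _ lin_on_scale]) auto

text \<open>Multiplication by \<open>z\<^sub>1\<^sup>s\<close>, by \<open>z\<^sub>2\<^sup>s\<close> and by \<open>(z\<^sub>1 - z\<^sub>2)\<^sup>s\<close>.\<close>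

lemma jacL_shift1:
  assumes K: "bdd_outer h K"
  shows "jacL (\<lambda>r t. Sum_any (\<lambda>l. bin s l *\<^sub>C h (r + int l) (t + s - int l))) p q r = jacL h (p + s) q r"
proof -
  let ?G = "\<lambda>j l. (bin p j * bin s l) *\<^sub>C h (r + int (j + l)) (p + s + q - int (j + l))"
  have fin: "finite {(j, l). ?G j l \<noteq> 0}"
  proof (rule finite_pair_bound[of "nat (K - r)"])
    show "finite {l. ?G j l \<noteq> 0}" for j
      by (rule finite_nat_bound[of "nat (K - r)"]) (use bdd_outerD[OF K] in auto)
  qed (use bdd_outerD[OF K] in auto)
  have "jacL (\<lambda>r t. Sum_any (\<lambda>l. bin s l *\<^sub>C h (r + int l) (t + s - int l))) p q r
    = Sum_any (\<lambda>j. Sum_any (?G j))"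
    by (simp add: jacL_def scaleC_Sum_any scaleC_scaleC algebra_simps)
  also have "\<dots> = Sum_any (\<lambda>k. \<Sum>j\<le>k. ?G j (k - j))" by (rule Sum_any_diag[OF fin])
  also have "\<dots> = Sum_any (\<lambda>k. bin (p + s) k *\<^sub>C h (r + int k) (p + s + q - int k))"
    by (simp add: bin_Vandermonde[symmetric] cv.scale_sum_left del: of_int_add)
  also have "\<dots> = jacL h (p + s) q r" by (simp add: jacL_def)
  finally show ?thesis .
qed

text \<open>In the third family z_1 equals z_2 + z_0, so z_1^s is expanded in nonnegative powers of
  z_0; this produces the sum with \<open>bin s l\<close>. In the other two families only the index
  of a moves.\<close>

lemma jac_shift1:
  assumes "jac f g h"
  shows "jac (\<lambda>m n. f (m + s) n) (\<lambda>n m. g n (m + s))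
    (\<lambda>r t. Sum_any (\<lambda>l. bin s l *\<^sub>C h (r + int l) (t + s - int l)))"
proof -
  obtain K where K: "bdd_inner f K" "bdd_inner g K" "bdd_outer h K" using assms by (auto simp: jac_def)
  show ?thesis
  proof (rule jacI[of _ K _ "K - s" _ K])
    show "bdd_outer (\<lambda>r t. Sum_any (\<lambda>l. bin s l *\<^sub>C h (r + int l) (t + s - int l))) K"
      using bdd_outerD[OF K(3)] by (simp add: bdd_outer_def)
    fix p q r
    have "jacL h (p + s) q r = jacR f g (p + s) q r" by (rule jacD[OF assms])
    also have "\<dots> = jacR (\<lambda>m n. f (m + s) n) (\<lambda>n m. g n (m + s)) p q r"
      by (simp add: jacR_def algebra_simps)
    finally show "jacL (\<lambda>r t. Sum_any (\<lambda>l. bin s l *\<^sub>C h (r + int l) (t + s - int l))) p q r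
      = jacR (\<lambda>m n. f (m + s) n) (\<lambda>n m. g n (m + s)) p q r"
      by (simp add: jacL_shift1[OF K(3)])
  qed (use K in \<open>auto simp: bdd_inner_def\<close>)
qed

lemma jac_shift2:
  assumes "jac f g h"
  shows "jac (\<lambda>m n. f m (n + s)) (\<lambda>n m. g (n + s) m) (\<lambda>r t. h r (t + s))"
proof -
  obtain K where K: "bdd_inner f K" "bdd_inner g K" "bdd_outer h K" using assms by (auto simp: jac_def)
  show ?thesis
  proof (rule jacI[of _ "K - s" _ K _ K])
    fix p q r
    have "jacL h p (q + s) r = jacR f g p (q + s) r" by (rule jacD[OF assms])
    then show "jacL (\<lambda>r t. h r (t + s)) p q r = jacR (\<lambda>m n. f m (n + s)) (\<lambda>n m. g (n + s) m) p q r"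
      by (simp add: jacL_def jacR_def algebra_simps)
  qed (use K in \<open>auto simp: bdd_inner_def bdd_outer_def\<close>)
qed

lemma powi_neg1: "(-1::complex) powi (a + b) = (-1) powi a * (-1) powi b"
  "(-1::complex) powi (int n) = (-1) ^ n" "(-1::complex) powi a * (-1) powi a = 1"
  "(-1::complex) powi (a - int n) = (-1) powi a * (-1) ^ n"
proof -
  show 1: "(-1::complex) powi (a + b) = (-1) powi a * (-1) powi b" for a b by (simp add: power_int_add)
  show "(-1::complex) powi (int n) = (-1) ^ n" by simp
  show "(-1::complex) powi a * (-1) powi a = 1" by (cases "even a") auto
  show "(-1::complex) powi (a - int n) = (-1) powi a * (-1) ^ n"
    using 1[of a "- int n"] by (cases "even n") auto
qed

text \<open>Modes of (z_1 - z_2)^s times a series, expanded in nonnegative powers of z_2, the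
  variable of the inner field.\<close>

definition shift12 :: "int \<Rightarrow> (int \<Rightarrow> int \<Rightarrow> 'm::complex_vector) \<Rightarrow> int \<Rightarrow> int \<Rightarrow> 'm" where
  "shift12 s f m n = Sum_any (\<lambda>l. ((-1) ^ l * bin s l) *\<^sub>C f (m + s - int l) (n + int l))"

lemma jacR_support1:
  assumes "bdd_inner F K"
  shows "finite {j. ((-1) ^ j * bin r j) *\<^sub>C F (p + r - int j) (q + int j) \<noteq> 0}"
  by (rule finite_nat_bound[of "nat (K - q)"]) (use bdd_innerD[OF assms] in auto)

text \<open>The parameter r of the identity is itself a multiplication by (z_1 - z_2)^r, expanded
  according to the order of the fields in each product. Multiplying by a further power is then the
  addition of exponents in \<open>shift12_add\<close>.\<close>

lemma jacR_split:
  assumes F: "bdd_inner F K" "bdd_inner G K"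
  shows "jacR F G p q r = shift12 r F p q - (-1) powi r *\<^sub>C shift12 r G q p"
proof -
  have "finite {j. ((-1) ^ j * bin r j) *\<^sub>C (-1) powi r *\<^sub>C G (q + r - int j) (p + int j) \<noteq> 0}"
    by (rule finite_subset[OF _ jacR_support1[OF F(2), of r q p]]) auto
  then show ?thesis
    unfolding jacR_def cv.scale_right_diff_distrib shift12_def
    by (subst Sum_any_diff[OF jacR_support1[OF F(1)]]) (simp_all add: scaleC_Sum_any scaleC_scaleC mult.commute)
qed

lemma shift12_add:
  assumes F: "bdd_inner F K"
  shows "shift12 r (shift12 s F) p q = shift12 (r + s) F p q"
proof -
  have fin: "finite {(j, l). ((-1) ^ j * bin r j * ((-1) ^ l * bin s l)) *\<^sub>C
      F (p + (r + s) - int (j + l)) (q + int (j + l)) \<noteq> 0}"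
  proof (rule finite_pair_bound[of "nat (K - q)"])
    show "finite {l. ((-1) ^ j * bin r j * ((-1) ^ l * bin s l)) *\<^sub>C
      F (p + (r + s) - int (j + l)) (q + int (j + l)) \<noteq> 0}" for j
      by (rule finite_nat_bound[of "nat (K - q)"]) (use bdd_innerD[OF F] in auto)
  qed (use bdd_innerD[OF F] in auto)
  let ?G = "\<lambda>j l. ((-1) ^ j * bin r j * ((-1) ^ l * bin s l)) *\<^sub>C
    F (p + (r + s) - int (j + l)) (q + int (j + l))"
  have "shift12 r (shift12 s F) p q = Sum_any (\<lambda>j. Sum_any (?G j))"
    by (simp add: shift12_def scaleC_Sum_any scaleC_scaleC algebra_simps)
  also have "\<dots> = Sum_any (\<lambda>k. \<Sum>j\<le>k. ?G j (k - j))" by (rule Sum_any_diag[OF fin])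
  also have "\<dots> = shift12 (r + s) F p q"
    unfolding shift12_def
  proof (rule Sum_any.cong)
    fix k
    have "(\<Sum>j\<le>k. (-1) ^ j * bin r j * ((-1) ^ (k - j) * bin s (k - j)))
      = (\<Sum>j\<le>k. (-1) ^ k * (bin r j * bin s (k - j)))"
      by (rule sum.cong) (auto simp: power_add[symmetric])
    then have "(\<Sum>j\<le>k. (-1) ^ j * bin r j * ((-1) ^ (k - j) * bin s (k - j))) = (-1) ^ k * bin (r + s) k"
      by (simp add: sum_distrib_left[symmetric] bin_Vandermonde)
    then show "(\<Sum>j\<le>k. ?G j (k - j)) = ((-1) ^ k * bin (r + s) k) *\<^sub>C F (p + (r + s) - int k) (q + int k)"
      by (simp add: cv.scale_sum_left[symmetric])
  qed
  finally show ?thesis .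
qed

lemma bdd_inner_shift12: "bdd_inner F K \<Longrightarrow> bdd_inner (shift12 s F) K"
  using bdd_innerD by (auto simp: bdd_inner_def shift12_def)

lemma bdd_inner_scale: "bdd_inner F K \<Longrightarrow> bdd_inner (\<lambda>m n. t *\<^sub>C F m n) K"
  by (auto simp: bdd_inner_def)

lemma shift12_scale: "shift12 r (\<lambda>m n. t *\<^sub>C F m n) p q = t *\<^sub>C shift12 r F p q"
  by (simp add: shift12_def scaleC_Sum_any scaleC_scaleC mult.left_commute mult.commute)

lemma jacR_shift12:
  assumes K: "bdd_inner f K" "bdd_inner g K"
  shows "jacR (shift12 s f) (\<lambda>n m. (-1) powi s *\<^sub>C shift12 s g n m) p q r = jacR f g p q (r + s)"
  by (simp add: jacR_split[OF K] jacR_split[OF bdd_inner_shift12[OF K(1)] bdd_inner_scale[OF bdd_inner_shift12[OF K(2)]]]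
      shift12_scale shift12_add[OF K(1)] shift12_add[OF K(2)] powi_neg1(1) scaleC_scaleC)

lemma jac_shift12:
  assumes "jac f g h"
  shows "jac (shift12 s f) (\<lambda>n m. (-1) powi s *\<^sub>C shift12 s g n m) (\<lambda>r t. h (r + s) t)"
proof -
  obtain K where K: "bdd_inner f K" "bdd_inner g K" "bdd_outer h K" using assms by (auto simp: jac_def)
  show ?thesis
  proof (rule jacI[of _ K _ K _ "K - s"])
    fix p q r
    have "jacL (\<lambda>r t. h (r + s) t) p q r = jacL h p q (r + s)" by (simp add: jacL_def algebra_simps)
    then show "jacL (\<lambda>r t. h (r + s) t) p q r = jacR (shift12 s f) (\<lambda>n m. (-1) powi s *\<^sub>C shift12 s g n m) p q r"
      using jacD[OF assms] jacR_shift12[OF K(1,2)] by simp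
  qed (use K in \<open>auto simp: bdd_outer_def intro: bdd_inner_shift12 bdd_inner_scale\<close>)
qed

text \<open>All three parameters of the identity are reached from \<open>r = 0\<close> and \<open>p = 0\<close> by the recurrence that
  expresses \<open>z\<^sub>1 = z\<^sub>2 + (z\<^sub>1 - z\<^sub>2)\<close>.\<close>

lemma jacL_rec:
  assumes "bdd_outer h K"
  shows "jacL h (p + 1) q r = jacL h p (q + 1) r + jacL h p q (r + 1)"
proof -
  have "Sum_any (\<lambda>l. bin 1 l *\<^sub>C h (r + int l) (t + 1 - int l)) = h r (t + 1) + h (r + 1) t" for r t
  proof -
    have z: "bin 1 l = 0" if "l \<notin> {0, 1}" for l
      using bin_eq_0[of 1 l] that by auto
    show ?thesis
      by (subst Sum_any_eq_sum[of "{0, 1}"]) (use z in auto)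
  qed
  then have "jacL h (p + 1) q r = jacL (\<lambda>r t. h r (t + 1) + h (r + 1) t) p q r"
    using jacL_shift1[OF assms, of 1 p q r] by simp
  also have "\<dots> = jacL h p (q + 1) r + jacL h p q (r + 1)"
    unfolding jacL_def scaleC_add_right
    using jacL_support[OF assms, of p r "p + (q + 1)"] jacL_support[OF assms, of p "r + 1" "p + q"]
    by (subst Sum_any.distrib) (simp_all add: algebra_simps)
  finally show ?thesis .
qed

lemma jacR_rec:
  assumes K: "bdd_inner f K" "bdd_inner g K"
  shows "jacR f g (p + 1) q r = jacR f g p (q + 1) r + jacR f g p q (r + 1)"
proof -
  have 1: "shift12 1 F m n = F (m + 1) n - F m (n + 1)" for F :: "int \<Rightarrow> int \<Rightarrow> 'a" and m n
  proof -
    have z: "bin 1 l = 0" if "l \<notin> {0, 1}" for l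
      using bin_eq_0[of 1 l] that by auto
    show ?thesis
      unfolding shift12_def by (subst Sum_any_eq_sum[of "{0, 1}"]) (use z in \<open>auto simp: algebra_simps\<close>)
  qed
  have 2: "shift12 (r + 1) F p q = shift12 r F (p + 1) q - shift12 r F p (q + 1)"
    if F: "bdd_inner F K" for F :: "int \<Rightarrow> int \<Rightarrow> 'a" and p q
  proof -
    have "shift12 (r + 1) F p q = shift12 1 (shift12 r F) p q"
      using shift12_add[OF F, of 1 r] by (simp add: add.commute)
    then show ?thesis by (simp add: 1)
  qed
  show ?thesis
    unfolding jacR_split[OF K] 2[OF K(1)] 2[OF K(2)] powi_neg1(1)
    by (simp add: cv.scale_right_diff_distrib cv.scale_minus_left algebra_simps)
qed

lemma jac_from_comm_iter:
  assumes K: "bdd_inner f K" "bdd_inner g K" "bdd_outer h K"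
    and comm: "\<And>p q. jacL h p q 0 = jacR f g p q 0"
    and iter: "\<And>q r. jacL h 0 q r = jacR f g 0 q r"
  shows "jac f g h"
proof (rule jacI[OF K])
  define D where "D p q r \<longleftrightarrow> jacL h p q r = jacR f g p q r" for p q r
  note rec = jacL_rec[OF K(3)] jacR_rec[OF K(1,2)]
  \<comment> \<open>The one recurrence is solved in turn for each of its three terms: for the one
    with r + 1 to reach r >= 0, for the one with p + 1 to reach p >= 0, and for the one with q + 1
    when p and r are both negative.\<close>
  have up_r: "D p q (int n)" for p q n
  proof (induction n arbitrary: p q)
    case (Suc n p q)
    from Suc[of "p + 1" q] Suc[of p "q + 1"] show ?case
      using rec(1)[of p q "int n"] rec(2)[of p q "int n"] by (simp add: D_def add.commute)
  qed (simp add: D_def comm)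
  have up_p: "D (int n) q r" for n q r
  proof (induction n arbitrary: q r)
    case (Suc n q r)
    from Suc[of "q + 1" r] Suc[of q "r + 1"] show ?case
      using rec(1)[of "int n" q r] rec(2)[of "int n" q r] by (simp add: D_def add.commute)
  qed (simp add: D_def iter)
  have down: "D p q r" if "nat (- p) + nat (- r) = n" for n p q r
    using that
  proof (induction n arbitrary: p q r rule: less_induct)
    case (less n)
    show ?case
    proof (cases "p \<ge> 0 \<or> r \<ge> 0")
      case True
      then show ?thesis using up_r[of p q "nat r"] up_p[of "nat p" q r] by auto
    next
      case False
      have "D (p + 1) (q - 1) r" "D p (q - 1) (r + 1)"
        by (rule less.IH[OF _ refl]; use less.prems False in linarith)+
      then show ?thesis
        using rec(1)[of p "q - 1" r] rec(2)[of p "q - 1" r] by (simp add: D_def)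
    qed
  qed
  then show "jacL h p q r = jacR f g p q r" for p q r by (simp add: D_def)
qed

section \<open>Closure of the Jacobi identity under products of states\<close>

lemma Sum_any_shift:
  fixes f :: "nat \<Rightarrow> 'a::comm_monoid_add"
  assumes "\<And>i. i < j \<Longrightarrow> f i = 0" "finite {i. f i \<noteq> 0}"
  shows "Sum_any f = Sum_any (\<lambda>l. f (j + l))"
proof -
  obtain K where K: "{i. f i \<noteq> 0} \<subseteq> {..<K}" using assms(2) finite_nat_iff_bounded by meson
  have "Sum_any f = sum f {j..<j + K}"
    by (rule Sum_any_eq_sum) (use K assms in \<open>auto simp: subset_eq not_le not_less\<close>)
  also have "\<dots> = (\<Sum>l<K. f (j + l))"
    by (rule sum.reindex_bij_witness[of _ "\<lambda>l. j + l" "\<lambda>i. i - j"]) auto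
  also have "\<dots> = Sum_any (\<lambda>l. f (j + l))"
    by (rule Sum_any_eq_sum[symmetric]) (use K in auto)
  finally show ?thesis .
qed

lemma jac_finite_sum:
  fixes N :: nat
  assumes "\<And>i. jac (F i) (G i) (H i)" and "\<And>i m n. i \<ge> N \<Longrightarrow> F i m n = 0 \<and> G i m n = 0 \<and> H i m n = 0"
  shows "jac (\<lambda>m n. Sum_any (\<lambda>i. F i m n)) (\<lambda>m n. Sum_any (\<lambda>i. G i m n)) (\<lambda>m n. Sum_any (\<lambda>i. H i m n))"
proof -
  have "jac (\<lambda>m n. \<Sum>i<k. F i m n) (\<lambda>m n. \<Sum>i<k. G i m n) (\<lambda>m n. \<Sum>i<k. H i m n)" for k
    by (induction k) (auto simp: jac_zero intro: jac_add assms(1))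
  moreover have eq: "Sum_any X = (\<Sum>i<N. X i)" if "\<And>i. i \<ge> N \<Longrightarrow> X i = 0" for X :: "nat \<Rightarrow> 'a"
    by (rule Sum_any_eq_sum) (use that in \<open>simp_all add: not_less\<close>)
  moreover have "Sum_any (\<lambda>i. F i m n) = (\<Sum>i<N. F i m n)" for m n
    by (rule eq) (simp add: assms(2))
  moreover have "Sum_any (\<lambda>i. G i m n) = (\<Sum>i<N. G i m n)" for m n
    by (rule eq) (simp add: assms(2))
  moreover have "Sum_any (\<lambda>i. H i m n) = (\<Sum>i<N. H i m n)" for m n
    by (rule eq) (simp add: assms(2))
  ultimately show ?thesis by simp
qed

text \<open>All clauses of a module except those on the vacuum and the Borcherds identity, for modes
  and products about which no identity is assumed. This allows the identity to be established one
  triple at a time.\<close>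

locale modes =
  fixes P :: "'v::complex_vector \<Rightarrow> int \<Rightarrow> 'v \<Rightarrow> 'v" and Y :: "'v \<Rightarrow> int \<Rightarrow> 'm::complex_vector \<Rightarrow> 'm"
    and M :: "'m set"
  assumes subM: "cv.subspace M"
    and Y_mem: "u \<in> M \<Longrightarrow> Y a n u \<in> M"
    and Y_lin: "lin_on M (Y a n)"
    and Y_lin1: "u \<in> M \<Longrightarrow> lin_on UNIV (\<lambda>a. Y a n u)"
    and Y_trunc: "u \<in> M \<Longrightarrow> \<exists>K. \<forall>n\<ge>K. Y a n u = 0"
    and P_lin: "lin_on UNIV (P a n)"
    and P_trunc: "\<exists>K. \<forall>n\<ge>K. P a n b = 0"
begin

definition Jac :: "'v \<Rightarrow> 'v \<Rightarrow> 'm \<Rightarrow> bool" where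
  "Jac a b u \<longleftrightarrow> jac (\<lambda>m n. Y a m (Y b n u)) (\<lambda>n m. Y b n (Y a m u)) (\<lambda>r t. Y (P a r b) t u)"

lemma Y_0 [simp]: "Y a n 0 = 0" by (rule lin_on_0[OF Y_lin subM])
lemma P_0 [simp]: "P a n 0 = 0" by (rule lin_on_0[OF P_lin cv.subspace_UNIV])
lemma Y_0_left [simp]: "u \<in> M \<Longrightarrow> Y 0 n u = 0" using lin_on_0[OF Y_lin1 cv.subspace_UNIV] .
lemmas Y_add = lin_onD(1)[OF Y_lin] and Y_scale = lin_onD(2)[OF Y_lin]
  and Y_diff = lin_on_diff[OF Y_lin subM]
  and Y_Sum_any = lin_on_Sum_any[OF Y_lin subM]
lemmas Y_add_left = lin_onD(1)[OF Y_lin1 UNIV_I UNIV_I] and Y_scale_left = lin_onD(2)[OF Y_lin1 UNIV_I]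
  and Y_diff_left = lin_on_diff[OF Y_lin1 cv.subspace_UNIV UNIV_I UNIV_I]
  and Y_Sum_any_left = lin_on_Sum_any[OF Y_lin1 cv.subspace_UNIV UNIV_I]
lemmas M_ops = cv.subspace_add[OF subM] cv.subspace_scale[OF subM] cv.subspace_diff[OF subM]
  Sum_any_mem[OF subM] cv.subspace_0[OF subM] Y_mem

lemma fin_Y: "u \<in> M \<Longrightarrow> finite {i. Y a (m + int i) u \<noteq> 0}"
proof -
  assume "u \<in> M"
  then obtain K where K: "\<And>n. n \<ge> K \<Longrightarrow> Y a n u = 0" by (metis Y_trunc)
  show ?thesis by (rule finite_nat_bound[of "nat (K - m)"]) (simp add: K)
qed

lemma fin_P: "finite {i. P a (m + int i) b \<noteq> 0}"
proof -
  obtain K where K: "\<And>n. n \<ge> K \<Longrightarrow> P a n b = 0" by (metis P_trunc)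
  show ?thesis by (rule finite_nat_bound[of "nat (K - m)"]) (simp add: K)
qed

lemma fin_PY: "u \<in> M \<Longrightarrow> finite {i. c i *\<^sub>C Y (P a (m + int i) b) (k i) u \<noteq> 0}"
  by (rule finite_subset[OF _ fin_P[of a m b]]) auto

lemma Jac_comm:
  assumes "Jac a b u"
  shows "Y a m (Y b n u) - Y b n (Y a m u) = Sum_any (\<lambda>j. bin m j *\<^sub>C Y (P a (int j) b) (m + n - int j) u)"
proof -
  have "jacL (\<lambda>r t. Y (P a r b) t u) m n 0 = jacR (\<lambda>m n. Y a m (Y b n u)) (\<lambda>n m. Y b n (Y a m u)) m n 0"
    using assms unfolding Jac_def by (rule jacD)
  moreover have "jacR (\<lambda>m n. Y a m (Y b n u)) (\<lambda>n m. Y b n (Y a m u)) m n 0 = Y a m (Y b n u) - Y b n (Y a m u)"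
    unfolding jacR_def by (subst Sum_any_eq_sum[of "{0}"]) (auto simp: gbinomial_0_left)
  ultimately show ?thesis by (simp add: jacL_def)
qed

lemma Jac_iter:
  assumes "Jac a b u"
  shows "Y (P a r b) t u = Sum_any (\<lambda>j. ((-1) ^ j * bin r j) *\<^sub>C
    (Y a (r - int j) (Y b (t + int j) u) - (-1) powi r *\<^sub>C Y b (t + r - int j) (Y a (int j) u)))"
proof -
  have "jacL (\<lambda>r t. Y (P a r b) t u) 0 t r = jacR (\<lambda>m n. Y a m (Y b n u)) (\<lambda>n m. Y b n (Y a m u)) 0 t r"
    using assms unfolding Jac_def by (rule jacD)
  moreover have "jacL (\<lambda>r t. Y (P a r b) t u) 0 t r = Y (P a r b) t u"
    unfolding jacL_def by (subst Sum_any_eq_sum[of "{0}"]) (auto simp: gbinomial_0_left)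
  ultimately show ?thesis by (simp add: jacR_def)
qed

lemma fin_iter:
  assumes "u \<in> M"
  shows "finite {j. c j *\<^sub>C (Y a (k j) (Y b (t + int j) u) - e *\<^sub>C Y b (l j) (Y a (int j) u)) \<noteq> 0}"
  by (rule finite_subset[OF _ finite_UnI[OF fin_Y[OF assms, of b t] fin_Y[OF assms, of a 0]]]) auto

text \<open>Moving the positive modes of \<open>x\<close> to the right and splitting off the commutators, the triple of
  \<open>(x\<^sub>(\<^sub>n\<^sub>)a, b)\<close> at \<open>u\<close> becomes a combination of shifted triples of \<open>(a, b)\<close> at \<open>u\<close>,
  of \<open>(a, b)\<close> at \<open>x\<^sub>(\<^sub>i\<^sub>)u\<close>, and of \<open>(a, x\<^sub>(\<^sub>j\<^sub>)b)\<close> at \<open>u\<close>.\<close>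

lemma Jac_nprod:
  assumes u: "u \<in> M"
    and x: "\<And>b u. u \<in> M \<Longrightarrow> Jac x b u" and a: "\<And>b u. u \<in> M \<Longrightarrow> Jac a b u"
    and iterP: "\<And>r. P (P x n a) r b = Sum_any (\<lambda>i. ((-1) ^ i * bin n i) *\<^sub>C
      (P x (n - int i) (P a (r + int i) b) - (-1) powi n *\<^sub>C P a (r + n - int i) (P x (int i) b)))"
  shows "Jac (P x n a) b u"
proof -
  define c where "c i = (-1) ^ i * bin n i" for i
  define e :: complex where "e = (-1) powi n"
  define FA GA HA where
    "FA i m t = c i *\<^sub>C Y x (n - int i) (Y a (m + int i) (Y b t u))" and
    "GA i t m = c i *\<^sub>C Y x (n - int i) (Y b t (Y a (m + int i) u))" and
    "HA i r t = c i *\<^sub>C Y x (n - int i) (Sum_any (\<lambda>l. bin (int i) l *\<^sub>C Y (P a (r + int l) b) (t + int i - int l) u))"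
    for i m t r
  define FB GB HB where
    "FB i m t = (- e * c i) *\<^sub>C Y a (m + (n - int i)) (Y b t (Y x (int i) u))" and
    "GB i t m = (- e * c i) *\<^sub>C Y b t (Y a (m + (n - int i)) (Y x (int i) u))" and
    "HB i r t = (- e * c i) *\<^sub>C Sum_any (\<lambda>l. bin (n - int i) l *\<^sub>C Y (P a (r + int l) b) (t + (n - int i) - int l) (Y x (int i) u))"
    for i m t r
  define FC GC HC where
    "FC j m t = (- e * c j) *\<^sub>C Sum_any (\<lambda>l. ((-1) ^ l * bin (n - int j) l) *\<^sub>C
        Y a (m + (n - int j) - int l) (Y (P x (int j) b) (t + int l) u))" and
    "GC j t m = (- e * c j) *\<^sub>C (-1) powi (n - int j) *\<^sub>C Sum_any (\<lambda>l. ((-1) ^ l * bin (n - int j) l) *\<^sub>C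
        Y (P x (int j) b) (t + (n - int j) - int l) (Y a (m + int l) u))" and
    "HC j r t = (- e * c j) *\<^sub>C Y (P a (r + (n - int j)) (P x (int j) b)) t u"
    for j m t r
  obtain Kx where Kx: "\<And>i. i \<ge> Kx \<Longrightarrow> Y x i u = 0" by (metis Y_trunc[OF u])
  obtain Ka where Ka: "\<And>i. i \<ge> Ka \<Longrightarrow> Y a i u = 0" by (metis Y_trunc[OF u])
  obtain Kb where Kb: "\<And>i. i \<ge> Kb \<Longrightarrow> Y b i u = 0" by (metis Y_trunc[OF u])
  obtain Nb where Nb: "\<And>i. i \<ge> Nb \<Longrightarrow> P x i b = 0" by (metis P_trunc)
  obtain Na where Na: "\<And>i. i \<ge> Na \<Longrightarrow> P a i b = 0" by (metis P_trunc)
  note ops = M_ops u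
  \<comment> \<open>In this combination the range of i is finite only after the outer indices are
    fixed, so the version with a uniform bound is needed. In the other two, i and j are bounded
    outright because x_i u and x_j b vanish eventually.\<close>
  have jacA: "jac (\<lambda>m t. Sum_any (\<lambda>i. FA i m t)) (\<lambda>t m. Sum_any (\<lambda>i. GA i t m)) (\<lambda>r t. Sum_any (\<lambda>i. HA i r t))"
  proof (rule jac_Sum_any[of _ _ _ "max Kb (max Ka Na)"])
    fix i :: nat
    have "jac (FA i) (GA i) (HA i)"
      unfolding FA_def GA_def HA_def
      by (rule jac_scale, rule jac_linear[OF _ Y_lin subM])
         (use jac_shift1[OF a[OF u, of b, unfolded Jac_def], of "int i"] in \<open>auto simp: ops\<close>)
    then show "jacL (HA i) p q r = jacR (FA i) (GA i) p q r" for p q r by (rule jacD)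
    show "bdd_inner (FA i) (max Kb (max Ka Na))" by (auto simp: bdd_inner_def FA_def Kb)
    show "bdd_inner (GA i) (max Kb (max Ka Na))" by (auto simp: bdd_inner_def GA_def Ka)
    show "bdd_outer (HA i) (max Kb (max Ka Na))" by (auto simp: bdd_outer_def HA_def Na u)
  next
    fix m t :: int
    show "finite {i. FA i m t \<noteq> 0}"
      by (rule finite_subset[OF _ fin_Y[of "Y b t u" a m]]) (auto simp: FA_def ops)
    show "finite {i. GA i m t \<noteq> 0}"
      by (rule finite_subset[OF _ fin_Y[of u a t]]) (auto simp: GA_def ops)
    have "finite (\<Union>l\<in>{l. P a (m + int l) b \<noteq> 0}. {i. Y (P a (m + int l) b) (t - int l + int i) u \<noteq> 0})"
      by (rule finite_UN_I[OF fin_P]) (rule fin_Y[OF u])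
    moreover have "{i. HA i m t \<noteq> 0} \<subseteq> (\<Union>l\<in>{l. P a (m + int l) b \<noteq> 0}. {i. Y (P a (m + int l) b) (t - int l + int i) u \<noteq> 0})"
    proof safe
      fix i assume "HA i m t \<noteq> 0"
      then have "Sum_any (\<lambda>l. bin (int i) l *\<^sub>C Y (P a (m + int l) b) (t + int i - int l) u) \<noteq> 0"
        by (auto simp: HA_def)
      then obtain l where "bin (int i) l *\<^sub>C Y (P a (m + int l) b) (t + int i - int l) u \<noteq> 0"
        by (rule Sum_any.not_neutral_obtains_not_neutral)
      then show "i \<in> (\<Union>l\<in>{l. P a (m + int l) b \<noteq> 0}. {i. Y (P a (m + int l) b) (t - int l + int i) u \<noteq> 0})"
        by (intro UN_I[of l]) (auto simp: algebra_simps u)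
    qed
    ultimately show "finite {i. HA i m t \<noteq> 0}" by (rule rev_finite_subset)
  qed
  have jacB: "jac (\<lambda>m t. Sum_any (\<lambda>i. FB i m t)) (\<lambda>t m. Sum_any (\<lambda>i. GB i t m)) (\<lambda>r t. Sum_any (\<lambda>i. HB i r t))"
  proof (rule jac_finite_sum[of _ _ _ "nat Kx"])
    show "jac (FB i) (GB i) (HB i)" for i
      unfolding FB_def GB_def HB_def
      by (rule jac_scale) (rule jac_shift1[OF a[unfolded Jac_def]], simp add: ops)
  qed (auto simp: FB_def GB_def HB_def Kx ops)
  have jacC: "jac (\<lambda>m t. Sum_any (\<lambda>i. FC i m t)) (\<lambda>t m. Sum_any (\<lambda>i. GC i t m)) (\<lambda>r t. Sum_any (\<lambda>i. HC i r t))"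
  proof (rule jac_finite_sum[of _ _ _ "nat Nb"])
    show "jac (FC i) (GC i) (HC i)" for i
      unfolding FC_def GC_def HC_def
      by (rule jac_scale) (rule jac_shift12[OF a[OF u, unfolded Jac_def], unfolded shift12_def])
    show "FC i m t = 0 \<and> GC i m t = 0 \<and> HC i m t = 0" if "nat Nb \<le> i" for i m t
      using that by (auto simp: FC_def GC_def HC_def Nb ops)
  qed
  have F: "Y (P x n a) m (Y b t u) = Sum_any (\<lambda>i. FA i m t) + (Sum_any (\<lambda>i. FB i m t) + Sum_any (\<lambda>i. FC i m t))" for m t
  proof -
    \<comment> \<open>\<open>D\<close> collects the commutators that appear when the nonnegative
      modes of x pass b. Summed over i at fixed j they become multiplication by (z_1 - z_2)^(n -
      j).\<close>
    define D where "D i j = (- e * c i * bin (int i) j) *\<^sub>C Y a (m + (n - int i)) (Y (P x (int j) b) (int i + t - int j) u)" for i j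
    have finD: "finite {(i, j). D i j \<noteq> 0}"
    proof (rule finite_pair_swap, rule finite_pair_bound[of "nat Nb"])
      show "finite {i. D i j \<noteq> 0}" for j
        by (rule finite_subset[OF _ fin_Y[of u "P x (int j) b" "t - int j"]]) (auto simp: D_def u algebra_simps)
    qed (auto simp: D_def Nb u)
    have finB: "finite {i. FB i m t \<noteq> 0}"
      by (rule finite_nat_bound[of "nat Kx"]) (auto simp: FB_def Kx)
    have finA: "finite {i. FA i m t \<noteq> 0}"
      by (rule finite_subset[OF _ fin_Y[of "Y b t u" a m]]) (auto simp: FA_def ops)
    have finS: "finite {i. Sum_any (D i) \<noteq> 0}"
    proof (rule finite_subset)
      show "{i. Sum_any (D i) \<noteq> 0} \<subseteq> fst ` {(i, j). D i j \<noteq> 0}"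
        by (force elim: Sum_any.not_neutral_obtains_not_neutral)
    qed (use finD in simp)
    have "Y (P x n a) m (Y b t u) = Sum_any (\<lambda>i. c i *\<^sub>C (Y x (n - int i) (Y a (m + int i) (Y b t u))
        - e *\<^sub>C Y a (m + n - int i) (Y x (int i) (Y b t u))))"
      using Jac_iter[OF x[of "Y b t u" a], of n m] by (simp add: c_def e_def ops)
    also have "\<dots> = Sum_any (\<lambda>i. FA i m t + (FB i m t + Sum_any (D i)))"
    proof (rule Sum_any.cong)
      fix i
      have "Y x (int i) (Y b t u) = Y b t (Y x (int i) u) +
          Sum_any (\<lambda>j. bin (int i) j *\<^sub>C Y (P x (int j) b) (int i + t - int j) u)"
        using Jac_comm[OF x[OF u, of b], of "int i" t] by (simp add: algebra_simps)
      then have "Y a (m + n - int i) (Y x (int i) (Y b t u)) = Y a (m + n - int i) (Y b t (Y x (int i) u)) +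
          Sum_any (\<lambda>j. bin (int i) j *\<^sub>C Y a (m + n - int i) (Y (P x (int j) b) (int i + t - int j) u))"
        using fin_PY[OF u, of "\<lambda>j. bin (int i) j" x 0 b] by (simp add: Y_add Y_Sum_any Y_scale ops)
      moreover have "(- e * c i) *\<^sub>C Sum_any (\<lambda>j. bin (int i) j *\<^sub>C Y a (m + n - int i) (Y (P x (int j) b) (int i + t - int j) u))
          = Sum_any (D i)"
        unfolding D_def by (simp only: scaleC_Sum_any scaleC_scaleC add_diff_eq)
      ultimately show "c i *\<^sub>C (Y x (n - int i) (Y a (m + int i) (Y b t u))
        - e *\<^sub>C Y a (m + n - int i) (Y x (int i) (Y b t u))) = FA i m t + (FB i m t + Sum_any (D i))"
        by (simp add: FA_def FB_def cv.scale_right_diff_distrib scaleC_add_right scaleC_scaleC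
            mult.commute diff_add_eq add_diff_eq)
    qed
    also have "\<dots> = Sum_any (\<lambda>i. FA i m t) + (Sum_any (\<lambda>i. FB i m t) + Sum_any (\<lambda>i. Sum_any (D i)))"
    proof -
      have "finite {i. FB i m t + Sum_any (D i) \<noteq> 0}"
        by (rule finite_subset[OF _ finite_UnI[OF finB finS]]) auto
      then show ?thesis by (simp add: Sum_any.distrib finA finB finS)
    qed
    also have "Sum_any (\<lambda>i. Sum_any (D i)) = Sum_any (\<lambda>j. Sum_any (\<lambda>i. D i j))"
      by (rule Sum_any_swap[OF finD])
    also have "\<dots> = Sum_any (\<lambda>j. FC j m t)"
    proof (rule Sum_any.cong)
      fix j
      have "Sum_any (\<lambda>i. D i j) = Sum_any (\<lambda>l. D (j + l) j)"
        by (rule Sum_any_shift) (use finite_fibre[OF finite_pair_swap[OF finD], of j] in \<open>simp_all add: D_def bin_eq_0[simplified]\<close>)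
      also have "\<dots> = FC j m t"
        unfolding FC_def scaleC_Sum_any
      proof (rule Sum_any.cong)
        fix l
        have "c (j + l) * bin (int (j + l)) j = c j * ((-1) ^ l * bin (n - int j) l)"
          using bin_trinomial[of n j l] by (simp add: c_def power_add mult.assoc mult.left_commute)
        then show "D (j + l) j = (- e * c j) *\<^sub>C ((-1) ^ l * bin (n - int j) l) *\<^sub>C
            Y a (m + (n - int j) - int l) (Y (P x (int j) b) (t + int l) u)"
          unfolding D_def scaleC_scaleC by (simp add: algebra_simps)
      qed
      finally show "Sum_any (\<lambda>i. D i j) = FC j m t" .
    qed
    finally show ?thesis .
  qed
  have G: "Y b t (Y (P x n a) m u) = Sum_any (\<lambda>i. GA i t m) + (Sum_any (\<lambda>i. GB i t m) + Sum_any (\<lambda>i. GC i t m))" for m t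
  proof -
    \<comment> \<open>Here b stands on the left and x_(n-i) has to be brought in front of it, so the
      commutators carry \<open>bin (n - int i) j\<close>. Their sum over i again gives the power n -
      j, now expanded for the opposite order of the fields.\<close>
    define D where "D i j = (- c i * bin (n - int i) j) *\<^sub>C Y (P x (int j) b) (n - int i + t - int j) (Y a (m + int i) u)" for i j
    have finD: "finite {(i, j). D i j \<noteq> 0}"
    proof (rule finite_pair_swap, rule finite_pair_bound[of "nat Nb"])
      show "finite {i. D i j \<noteq> 0}" for j
        by (rule finite_subset[OF _ fin_Y[of u a m]]) (auto simp: D_def u)
    qed (auto simp: D_def Nb ops)
    have finB: "finite {i. GB i t m \<noteq> 0}"
      by (rule finite_nat_bound[of "nat Kx"]) (auto simp: GB_def Kx)
    have finA: "finite {i. GA i t m \<noteq> 0}"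
      by (rule finite_subset[OF _ fin_Y[of u a m]]) (auto simp: GA_def ops)
    have finS: "finite {i. Sum_any (D i) \<noteq> 0}"
    proof (rule finite_subset)
      show "{i. Sum_any (D i) \<noteq> 0} \<subseteq> fst ` {(i, j). D i j \<noteq> 0}"
        by (force elim: Sum_any.not_neutral_obtains_not_neutral)
    qed (use finD in simp)
    have "Y b t (Y (P x n a) m u) = Y b t (Sum_any (\<lambda>i. c i *\<^sub>C (Y x (n - int i) (Y a (m + int i) u)
        - e *\<^sub>C Y a (m + n - int i) (Y x (int i) u))))"
      using Jac_iter[OF x[OF u, of a], of n m] by (simp add: c_def e_def ops)
    also have "\<dots> = Sum_any (\<lambda>i. c i *\<^sub>C (Y b t (Y x (n - int i) (Y a (m + int i) u))
        - e *\<^sub>C Y b t (Y a (m + n - int i) (Y x (int i) u))))"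
      by (subst Y_Sum_any[OF _ fin_iter[OF u]]) (auto simp: ops Y_scale Y_diff)
    also have "\<dots> = Sum_any (\<lambda>i. GA i t m + (GB i t m + Sum_any (D i)))"
    proof (rule Sum_any.cong)
      fix i
      have 1: "Y b t (Y x (n - int i) (Y a (m + int i) u)) = Y x (n - int i) (Y b t (Y a (m + int i) u)) -
          Sum_any (\<lambda>j. bin (n - int i) j *\<^sub>C Y (P x (int j) b) (n - int i + t - int j) (Y a (m + int i) u))"
        using Jac_comm[OF x[of "Y a (m + int i) u" b], of "n - int i" t] by (simp add: algebra_simps ops)
      have 2: "- (c i *\<^sub>C Sum_any (\<lambda>j. bin (n - int i) j *\<^sub>C Y (P x (int j) b) (n - int i + t - int j) (Y a (m + int i) u))) = Sum_any (D i)"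
        unfolding D_def cv.scale_minus_left[symmetric] by (simp only: scaleC_Sum_any scaleC_scaleC)
      show "c i *\<^sub>C (Y b t (Y x (n - int i) (Y a (m + int i) u))
        - e *\<^sub>C Y b t (Y a (m + n - int i) (Y x (int i) u))) = GA i t m + (GB i t m + Sum_any (D i))"
        unfolding 1 2[symmetric]
        by (simp add: GA_def GB_def cv.scale_right_diff_distrib scaleC_scaleC mult.commute add_diff_eq)
    qed
    also have "\<dots> = Sum_any (\<lambda>i. GA i t m) + (Sum_any (\<lambda>i. GB i t m) + Sum_any (\<lambda>i. Sum_any (D i)))"
    proof -
      have "finite {i. GB i t m + Sum_any (D i) \<noteq> 0}"
        by (rule finite_subset[OF _ finite_UnI[OF finB finS]]) auto
      then show ?thesis by (simp add: Sum_any.distrib finA finB finS)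
    qed
    also have "Sum_any (\<lambda>i. Sum_any (D i)) = Sum_any (\<lambda>j. Sum_any (\<lambda>i. D i j))"
      by (rule Sum_any_swap[OF finD])
    also have "\<dots> = Sum_any (\<lambda>j. GC j t m)"
    proof (rule Sum_any.cong)
      fix j
      show "Sum_any (\<lambda>i. D i j) = GC j t m"
        unfolding GC_def scaleC_Sum_any
      proof (rule Sum_any.cong)
        fix l
        have "c l * bin (n - int l) j = (-1) ^ l * bin n j * bin (n - int j) l"
          using bin_trinomial'[of n l j] by (simp add: c_def mult.assoc)
        moreover have "e * c j * (-1) powi (n - int j) = bin n j"
          unfolding powi_neg1(4) e_def c_def using powi_neg1(3)[of n]
          by (simp add: mult.left_commute mult.commute[of _ "bin n j"] power_mult_distrib[symmetric])
        ultimately have "c l * bin (n - int l) j = e * c j * (-1) powi (n - int j) * ((-1) ^ l * bin (n - int j) l)"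
          by simp
        then show "D l j = (- e * c j) *\<^sub>C (-1) powi (n - int j) *\<^sub>C ((-1) ^ l * bin (n - int j) l) *\<^sub>C
            Y (P x (int j) b) (t + (n - int j) - int l) (Y a (m + int l) u)"
          unfolding D_def scaleC_scaleC by (simp add: algebra_simps)
      qed
    qed
    finally show ?thesis .
  qed
  have H: "Y (P (P x n a) r b) t u = Sum_any (\<lambda>i. HA i r t) + (Sum_any (\<lambda>i. HB i r t) + Sum_any (\<lambda>i. HC i r t))" for r t
  proof -
    \<comment> \<open>The iterate formula is applied twice, once inside the algebra to (x_n a)_r b
      and once to x_(n-i)(a_(r+i) b) acting on u. \<open>E1\<close> has x outermost,
      \<open>E2\<close> has x acting directly on u.\<close>
    define E1 where "E1 i l = (c i * ((-1) ^ l * bin (n - int i) l)) *\<^sub>C Y x (n - int i - int l) (Y (P a (r + int i) b) (t + int l) u)" for i l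
    define E2 where "E2 i l = (- c i * ((-1) ^ l * bin (n - int i) l) * (-1) powi (n - int i)) *\<^sub>C
      Y (P a (r + int i) b) (t + (n - int i) - int l) (Y x (int l) u)" for i l
    have fin1: "finite {(i, l). E1 i l \<noteq> 0}"
    proof (rule finite_pair_bound[of "nat (Na - r)"])
      show "finite {l. E1 i l \<noteq> 0}" for i
        by (rule finite_subset[OF _ fin_Y[of u "P a (r + int i) b" t]]) (auto simp: E1_def u)
    qed (auto simp: E1_def Na u)
    have fin2: "finite {(i, l). E2 i l \<noteq> 0}"
    proof (rule finite_pair_bound[of "nat (Na - r)"])
      show "finite {l. E2 i l \<noteq> 0}" for i
        by (rule finite_nat_bound[of "nat Kx"]) (auto simp: E2_def Kx)
    qed (auto simp: E2_def Na ops)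
    have S1: "finite {i. c i *\<^sub>C Y (P x (n - int i) (P a (r + int i) b)) t u \<noteq> 0}"
      by (rule finite_nat_bound[of "nat (Na - r)"]) (simp add: Na u)
    have S2: "finite {i. HC i r t \<noteq> 0}"
      by (rule finite_nat_bound[of "nat Nb"]) (simp add: HC_def Nb u)
    have S3: "finite {i. c i *\<^sub>C (P x (n - int i) (P a (r + int i) b) - e *\<^sub>C P a (r + n - int i) (P x (int i) b)) \<noteq> 0}"
      by (rule finite_nat_bound[of "nat (max (Na - r) Nb)"]) (simp add: Na Nb)
    have finS: "finite {i. Sum_any (E i) \<noteq> 0}" if "finite {(i, l). E i l \<noteq> 0}" for E :: "nat \<Rightarrow> nat \<Rightarrow> 'm"
    proof (rule finite_subset)
      show "{i. Sum_any (E i) \<noteq> 0} \<subseteq> fst ` {(i, j). E i j \<noteq> 0}"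
        by (force elim: Sum_any.not_neutral_obtains_not_neutral)
    qed (use that in simp)
    have "Y (P (P x n a) r b) t u = Sum_any (\<lambda>i. c i *\<^sub>C Y (P x (n - int i) (P a (r + int i) b)) t u + HC i r t)"
      unfolding iterP[folded c_def e_def]
      by (subst Y_Sum_any_left[OF u S3])
         (auto simp: HC_def Y_scale_left Y_diff_left u cv.scale_right_diff_distrib scaleC_scaleC
           mult.commute algebra_simps)
    also have "\<dots> = Sum_any (\<lambda>i. c i *\<^sub>C Y (P x (n - int i) (P a (r + int i) b)) t u) + Sum_any (\<lambda>i. HC i r t)"
      by (rule Sum_any.distrib[OF S1 S2])
    also have "Sum_any (\<lambda>i. c i *\<^sub>C Y (P x (n - int i) (P a (r + int i) b)) t u)
      = Sum_any (\<lambda>i. Sum_any (E1 i) + Sum_any (E2 i))"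
    proof (rule Sum_any.cong)
      fix i
      have f1: "finite {l. E1 i l \<noteq> 0}" "finite {l. E2 i l \<noteq> 0}"
        using finite_fibre[OF fin1] finite_fibre[OF fin2] by auto
      have "c i *\<^sub>C Y (P x (n - int i) (P a (r + int i) b)) t u = Sum_any (\<lambda>l. E1 i l + E2 i l)"
        unfolding Jac_iter[OF x[OF u, of "P a (r + int i) b"], of "n - int i" t] scaleC_Sum_any
        by (rule Sum_any.cong)
          (simp add: E1_def E2_def cv.scale_right_diff_distrib scaleC_scaleC algebra_simps)
      then show "c i *\<^sub>C Y (P x (n - int i) (P a (r + int i) b)) t u = Sum_any (E1 i) + Sum_any (E2 i)"
        by (simp add: Sum_any.distrib[OF f1])
    qed
    also have "\<dots> = Sum_any (\<lambda>i. Sum_any (E1 i)) + Sum_any (\<lambda>i. Sum_any (E2 i))"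
      by (rule Sum_any.distrib[OF finS[OF fin1] finS[OF fin2]])
    also have "Sum_any (\<lambda>i. Sum_any (E1 i)) = Sum_any (\<lambda>s. HA s r t)"
      unfolding Sum_any_diag[OF fin1]
    proof (rule Sum_any.cong)
      fix s
      have "Sum_any (\<lambda>l. bin (int s) l *\<^sub>C Y (P a (r + int l) b) (t + int s - int l) u)
        = (\<Sum>l\<le>s. bin (int s) l *\<^sub>C Y (P a (r + int l) b) (t + int s - int l) u)"
        by (rule Sum_any_eq_sum) (auto simp: bin_eq_0[simplified])
      then have "HA s r t = (\<Sum>i\<le>s. c s *\<^sub>C bin (int s) i *\<^sub>C Y x (n - int s) (Y (P a (r + int i) b) (t + int s - int i) u))"
        by (simp add: HA_def lin_on_sum[OF Y_lin subM] Y_scale ops cv.scale_sum_right)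
      also have "\<dots> = (\<Sum>i\<le>s. E1 i (s - i))"
      proof (rule sum.cong[OF refl])
        fix i assume "i \<in> {..s}"
        then have [simp]: "i \<le> s" by simp
        have "c i * ((-1) ^ (s - i) * bin (n - int i) (s - i)) = c s * bin (int s) i"
          using bin_trinomial[of n i "s - i"] by (simp add: c_def mult.assoc mult.left_commute power_add[symmetric])
        then show "c s *\<^sub>C bin (int s) i *\<^sub>C Y x (n - int s) (Y (P a (r + int i) b) (t + int s - int i) u) = E1 i (s - i)"
          by (simp add: E1_def scaleC_scaleC of_nat_diff algebra_simps)
      qed
      finally show "(\<Sum>i\<le>s. E1 i (s - i)) = HA s r t" by simp
    qed
    also have "Sum_any (\<lambda>i. Sum_any (E2 i)) = Sum_any (\<lambda>l. HB l r t)"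
      unfolding Sum_any_swap[OF fin2]
    proof (rule Sum_any.cong)
      fix l
      show "Sum_any (\<lambda>i. E2 i l) = HB l r t"
        unfolding HB_def scaleC_Sum_any
      proof (rule Sum_any.cong)
        fix i
        have "(-1) ^ i * (-1) powi (n - int i) = e"
          unfolding powi_neg1(4) e_def by (simp add: mult.left_commute power_mult_distrib[symmetric])
        then have "c i * ((-1) ^ l * bin (n - int i) l) * (-1) powi (n - int i)
          = e * (-1) ^ l * (bin n i * bin (n - int i) l)"
          by (simp add: c_def mult_ac)
        also have "\<dots> = e * c l * bin (n - int l) i"
          unfolding bin_trinomial'[of n i l] by (simp add: c_def mult_ac)
        finally show "E2 i l = (- e * c l) *\<^sub>C bin (n - int l) i *\<^sub>C Y (P a (r + int i) b) (t + (n - int l) - int i) (Y x (int l) u)"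
          by (simp add: E2_def scaleC_scaleC algebra_simps)
      qed
    qed
    finally show ?thesis by (simp add: add.assoc)
  qed
  show ?thesis
    unfolding Jac_def F G H by (rule jac_add[OF jacA jac_add[OF jacB jacC]])
qed

end

context modes begin

lemma Jac_bdd:
  assumes "u \<in> M"
  obtains K where "bdd_inner (\<lambda>m n. Y a m (Y b n u)) K" "bdd_inner (\<lambda>n m. Y b n (Y a m u)) K"
    "bdd_outer (\<lambda>r t. Y (P a r b) t u) K"
proof -
  obtain K1 where K1: "\<And>n. n \<ge> K1 \<Longrightarrow> Y a n u = 0" by (metis Y_trunc[OF assms])
  obtain K2 where K2: "\<And>n. n \<ge> K2 \<Longrightarrow> Y b n u = 0" by (metis Y_trunc[OF assms])
  obtain K3 where K3: "\<And>n. n \<ge> K3 \<Longrightarrow> P a n b = 0" by (metis P_trunc)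
  show ?thesis
    by (rule that[of "max K1 (max K2 K3)"]) (auto simp: bdd_inner_def bdd_outer_def K1 K2 K3 assms)
qed

lemma Jac_subspace_u: "cv.subspace {u\<in>M. Jac a b u}"
proof (rule cv.subspaceI)
  fix u v assume "u \<in> {u\<in>M. Jac a b u}" "v \<in> {u\<in>M. Jac a b u}"
  then show "u + v \<in> {u\<in>M. Jac a b u}"
    using jac_add[of _ _ _ "\<lambda>m n. Y a m (Y b n v)"] by (auto simp: Jac_def Y_add M_ops)
next
  fix t u assume "u \<in> {u\<in>M. Jac a b u}"
  then show "t *\<^sub>C u \<in> {u\<in>M. Jac a b u}"
    using jac_scale[of _ _ _ t] by (auto simp: Jac_def Y_scale M_ops)
qed (simp add: Jac_def M_ops jac_zero)

lemma P_lin_left_subspace: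
  "(\<And>b n. lin_on UNIV (\<lambda>a. P a n b)) \<Longrightarrow> cv.subspace {a. \<forall>b. \<forall>u\<in>M. Jac a b u}"
proof (rule cv.subspaceI)
  assume P1: "\<And>b n. lin_on UNIV (\<lambda>a. P a n b)"
  show "0 \<in> {a. \<forall>b. \<forall>u\<in>M. Jac a b u}"
    using lin_on_0[OF P1 cv.subspace_UNIV] by (auto simp: Jac_def M_ops jac_zero)
  fix x y assume "x \<in> {a. \<forall>b. \<forall>u\<in>M. Jac a b u}" "y \<in> {a. \<forall>b. \<forall>u\<in>M. Jac a b u}"
  then show "x + y \<in> {a. \<forall>b. \<forall>u\<in>M. Jac a b u}"
    using jac_add[of _ _ _ "\<lambda>m n. Y y m (Y _ n _)"] lin_onD(1)[OF P1]
    by (auto simp: Jac_def Y_add Y_add_left M_ops)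
next
  assume P1: "\<And>b n. lin_on UNIV (\<lambda>a. P a n b)"
  fix t x assume "x \<in> {a. \<forall>b. \<forall>u\<in>M. Jac a b u}"
  then show "t *\<^sub>C x \<in> {a. \<forall>b. \<forall>u\<in>M. Jac a b u}"
    using lin_onD(2)[OF P1]
    by (auto simp: Jac_def Y_scale Y_scale_left M_ops intro!: jac_scale)
qed

lemma Jac_subspace_b: "cv.subspace {b. \<forall>u\<in>M. Jac a b u}"
proof (rule cv.subspaceI)
  show "0 \<in> {b. \<forall>u\<in>M. Jac a b u}" by (auto simp: Jac_def M_ops jac_zero)
  fix x y assume "x \<in> {b. \<forall>u\<in>M. Jac a b u}" "y \<in> {b. \<forall>u\<in>M. Jac a b u}"
  then show "x + y \<in> {b. \<forall>u\<in>M. Jac a b u}"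
    using jac_add[of _ _ _ "\<lambda>m n. Y a m (Y y n _)"] lin_onD(1)[OF P_lin]
    by (auto simp: Jac_def Y_add Y_add_left M_ops)
next
  fix t x assume "x \<in> {b. \<forall>u\<in>M. Jac a b u}"
  then show "t *\<^sub>C x \<in> {b. \<forall>u\<in>M. Jac a b u}"
    using lin_onD(2)[OF P_lin]
    by (auto simp: Jac_def Y_scale Y_scale_left M_ops intro!: jac_scale)
qed

lemma va_module_iff:
  assumes "P = nprod V"
  shows "va_module V M Y \<longleftrightarrow> (\<forall>n. \<forall>u\<in>M. Y (vacuum V) n u = (if n = -1 then u else 0)) \<and>
    (\<forall>a b. \<forall>u\<in>M. Jac a b u)"
proof -
  have "Jac a b u \<longleftrightarrow> (\<forall>p q r. jacL (\<lambda>r t. Y (P a r b) t u) p q r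
      = jacR (\<lambda>m n. Y a m (Y b n u)) (\<lambda>n m. Y b n (Y a m u)) p q r)" if "u \<in> M" for a b u
    using Jac_bdd[OF that, of a b] unfolding Jac_def jac_def by metis
  then show ?thesis
    unfolding va_module_def jacL_def jacR_def assms
    using subM Y_mem Y_lin Y_lin1 Y_trunc unfolding lin_on_def clinear_iff by auto
qed

end

lemma va_moduleD:
  assumes "va_module V M Y"
  shows "cv.subspace M" "u \<in> M \<Longrightarrow> Y a n u \<in> M" "lin_on M (Y a n)" "u \<in> M \<Longrightarrow> lin_on UNIV (\<lambda>a. Y a n u)"
    "u \<in> M \<Longrightarrow> \<exists>K. \<forall>n\<ge>K. Y a n u = 0" "u \<in> M \<Longrightarrow> Y (vacuum V) n u = (if n = -1 then u else 0)"
  using assms by (auto simp: va_module_def lin_on_def clinear_iff)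

lemma vertex_algebraD:
  assumes "vertex_algebra V"
  shows "va_module V UNIV (nprod V)" "nprod V a (-1) (vacuum V) = a" "n \<ge> 0 \<Longrightarrow> nprod V a n (vacuum V) = 0"
    "nprod V (vacuum V) n a = (if n = -1 then a else 0)"
  using assms va_moduleD(6)[of V UNIV "nprod V"] by (auto simp: vertex_algebra_def)

lemma modesI:
  assumes "vertex_algebra V" "va_module V M Y"
  shows "modes (nprod V) Y M"
  using va_moduleD[OF assms(2)] va_moduleD[OF vertex_algebraD(1)[OF assms(1)]] by unfold_locales auto

lemma modes_Jac:
  assumes "vertex_algebra V" "va_module V M Y" "u \<in> M"
  shows "modes.Jac (nprod V) Y a b u"
  using modes.va_module_iff[OF modesI[OF assms(1,2)] refl] assms by blast

section \<open>Tensor products of modules\<close>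

lemma pure_tensor_add_left: "(a + a') \<otimes> b = a \<otimes> b + a' \<otimes> b"
  by transfer (auto simp: eval_bilinear_def cbilinear_def clinear_iff fun_eq_iff)

lemma pure_tensor_add_right: "a \<otimes> (b + b') = a \<otimes> b + a \<otimes> b'"
  by transfer (auto simp: eval_bilinear_def cbilinear_def clinear_iff fun_eq_iff)

lemma pure_tensor_scale_right: "a \<otimes> (t *\<^sub>C b) = t *\<^sub>C (a \<otimes> b)"
  by transfer (auto simp: eval_bilinear_def cbilinear_def clinear_iff fun_eq_iff scaleC_fun_def scaleC_complex_def)

lemma lin_pure_left: "lin_on UNIV (\<lambda>a. a \<otimes> b)"
  by (simp add: lin_on_def pure_tensor_add_left scaleC_pure_tensor)

lemma lin_pure_right: "lin_on UNIV (\<lambda>b. a \<otimes> b)"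
  by (simp add: lin_on_def pure_tensor_add_right pure_tensor_scale_right)

lemma pure_tensor_0 [simp]: "0 \<otimes> b = 0" "a \<otimes> 0 = 0"
  using lin_on_0[OF lin_pure_left cv.subspace_UNIV] lin_on_0[OF lin_pure_right cv.subspace_UNIV] by auto

lemmas pure_tensor_diff_left = lin_on_diff[OF lin_pure_left cv.subspace_UNIV UNIV_I UNIV_I]
  and pure_tensor_diff_right = lin_on_diff[OF lin_pure_right cv.subspace_UNIV UNIV_I UNIV_I]

lemma tensor_subspace_UNIV:
  assumes "cv.subspace K" "\<And>a b. a \<otimes> b \<in> K"
  shows "x \<in> K"
proof -
  obtain ps where ps: "x = (\<Sum>(a, b)\<leftarrow>ps. a \<otimes> b)" by (rule tensor_eq_sum)
  have "(\<Sum>(a, b)\<leftarrow>ps. a \<otimes> b) \<in> K"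
    by (induction ps) (auto simp: cv.subspace_0[OF assms(1)] intro: cv.subspace_add[OF assms(1)] assms(2))
  then show ?thesis by (simp add: ps)
qed

lemma pure_tensor_nonzero:
  fixes a :: "'a::complex_vector" and b :: "'b::complex_vector"
  assumes "a \<noteq> 0" "b \<noteq> 0" shows "a \<otimes> b \<noteq> 0"
proof -
  obtain l :: "'a \<Rightarrow> complex" where l: "clinear l" "l a \<noteq> 0" using exists_functional[OF assms(1)] .
  obtain k :: "'b \<Rightarrow> complex" where k: "clinear k" "k b \<noteq> 0" using exists_functional[OF assms(2)] .
  have bl: "cbilinear (\<lambda>x y. l x * k y)"
    using l(1) k(1) by (auto simp: cbilinear_def clinear_iff scaleC_complex_def algebra_simps)
  have "tensor_lift (\<lambda>x y. l x * k y) (a \<otimes> b) \<noteq> 0" using tensor_lift_pure[OF bl] l k by simp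
  moreover have "tensor_lift (\<lambda>x y. l x * k y) 0 = 0"
    using lin_on_0[OF _ cv.subspace_UNIV, of "tensor_lift (\<lambda>x y. l x * k y)"] clinear_tensor_lift[OF bl]
    by (simp add: lin_on_UNIV)
  ultimately show ?thesis by auto
qed

lemma tensor_lift_add:
  assumes "cbilinear \<phi>" "cbilinear \<psi>" "\<And>a b. \<xi> a b = \<phi> a b + \<psi> a b"
  shows "tensor_lift \<xi> y = tensor_lift \<phi> y + tensor_lift \<psi> y"
proof -
  have c: "cbilinear \<xi>" using assms by (auto simp: cbilinear_def clinear_iff scaleC_add_right algebra_simps)
  have "y \<in> {y. tensor_lift \<xi> y = tensor_lift \<phi> y + tensor_lift \<psi> y}"
  proof (rule tensor_subspace_UNIV)
    show "cv.subspace {y. tensor_lift \<xi> y = tensor_lift \<phi> y + tensor_lift \<psi> y}"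
      using clinear_tensor_lift[OF assms(1)] clinear_tensor_lift[OF assms(2)] clinear_tensor_lift[OF c]
      unfolding lin_on_UNIV[symmetric]
      by (intro cv.subspaceI) (auto simp: lin_on_0[OF _ cv.subspace_UNIV] lin_onD scaleC_add_right)
  qed (use assms c in \<open>simp add: tensor_lift_pure\<close>)
  then show ?thesis by simp
qed

lemma tensor_lift_scale:
  assumes "cbilinear \<phi>" "\<And>a b. \<xi> a b = t *\<^sub>C \<phi> a b"
  shows "tensor_lift \<xi> y = t *\<^sub>C tensor_lift \<phi> y"
proof -
  have c: "cbilinear \<xi>" using assms by (auto simp: cbilinear_def clinear_iff scaleC_add_right scaleC_scaleC mult.commute)
  have "y \<in> {y. tensor_lift \<xi> y = t *\<^sub>C tensor_lift \<phi> y}"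
  proof (rule tensor_subspace_UNIV)
    show "cv.subspace {y. tensor_lift \<xi> y = t *\<^sub>C tensor_lift \<phi> y}"
      using clinear_tensor_lift[OF assms(1)] clinear_tensor_lift[OF c]
      unfolding lin_on_UNIV[symmetric]
      by (intro cv.subspaceI) (auto simp: lin_on_0[OF _ cv.subspace_UNIV] lin_onD scaleC_add_right scaleC_scaleC mult.commute)
  qed (use assms c in \<open>simp add: tensor_lift_pure\<close>)
  then show ?thesis by simp
qed

lemma Sum_any_int_reflect:
  fixes f :: "int \<Rightarrow> 'a::comm_monoid_add"
  shows "Sum_any (\<lambda>i. f (c - i)) = Sum_any f"
proof -
  have "bij (\<lambda>i. c - i)" by (rule o_bij[of "\<lambda>i. c - i"]) auto
  from Sum_any.reindex_cong[OF this refl, of f] show ?thesis by (simp add: comp_def)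
qed

locale tensor_modes =
  A: modes P1 Y1 UNIV + B: modes P2 Y2 UNIV
  for P1 :: "'a::complex_vector \<Rightarrow> int \<Rightarrow> 'a \<Rightarrow> 'a" and Y1 :: "'a \<Rightarrow> int \<Rightarrow> 'm::complex_vector \<Rightarrow> 'm"
    and P2 :: "'b::complex_vector \<Rightarrow> int \<Rightarrow> 'b \<Rightarrow> 'b" and Y2 :: "'b \<Rightarrow> int \<Rightarrow> 'n::complex_vector \<Rightarrow> 'n"
begin

abbreviation T where "T \<equiv> tensor_act Y1 Y2"

lemma fin_pure: "finite {i. Y1 a i u \<otimes> Y2 b (n - 1 - i) v \<noteq> 0}"
proof -
  obtain K1 where K1: "\<And>n. n \<ge> K1 \<Longrightarrow> Y1 a n u = 0" by (metis A.Y_trunc[OF UNIV_I])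
  obtain K2 where K2: "\<And>n. n \<ge> K2 \<Longrightarrow> Y2 b n v = 0" by (metis B.Y_trunc[OF UNIV_I])
  show ?thesis
  proof (rule finite_subset)
    show "{i. Y1 a i u \<otimes> Y2 b (n - 1 - i) v \<noteq> 0} \<subseteq> {n - 1 - K2..K1}"
    proof
      fix i assume i: "i \<in> {i. Y1 a i u \<otimes> Y2 b (n - 1 - i) v \<noteq> 0}"
      have "\<not> i \<ge> K1" using i K1 by auto
      moreover have "\<not> n - 1 - i \<ge> K2" using i K2[of "n - 1 - i"] by auto
      ultimately show "i \<in> {n - 1 - K2..K1}" by simp
    qed
  qed simp
qed

lemma bilinear_inner: "cbilinear (\<lambda>u v. Sum_any (\<lambda>i. Y1 a i u \<otimes> Y2 b (n - 1 - i) v))"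
  unfolding cbilinear_def clinear_iff
  by (auto simp: A.Y_add B.Y_add A.Y_scale B.Y_scale pure_tensor_add_left pure_tensor_add_right
    scaleC_pure_tensor pure_tensor_scale_right scaleC_Sum_any[symmetric] Sum_any.distrib fin_pure)

lemma bilinear_outer:
  "cbilinear (\<lambda>a b. tensor_lift (\<lambda>u v. Sum_any (\<lambda>i. Y1 a i u \<otimes> Y2 b (n - 1 - i) v)) y)"
  unfolding cbilinear_def clinear_iff
proof (safe, goal_cases)
  case (1 a b b')
  show ?case by (rule tensor_lift_add[OF bilinear_inner bilinear_inner])
      (simp add: B.Y_add_left pure_tensor_add_right Sum_any.distrib fin_pure)
next
  case (2 a t b)
  show ?case by (rule tensor_lift_scale[OF bilinear_inner])
      (simp add: B.Y_scale_left pure_tensor_scale_right scaleC_Sum_any)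
next
  case (3 b a a')
  show ?case by (rule tensor_lift_add[OF bilinear_inner bilinear_inner])
      (simp add: A.Y_add_left pure_tensor_add_left Sum_any.distrib fin_pure)
next
  case (4 b t a)
  show ?case by (rule tensor_lift_scale[OF bilinear_inner])
      (simp add: A.Y_scale_left scaleC_pure_tensor scaleC_Sum_any)
qed

lemma T_left: "lin_on UNIV (\<lambda>x. T x n y)"
  unfolding tensor_act_def lin_on_UNIV by (rule clinear_tensor_lift[OF bilinear_outer])

lemma T_pure_left: "T (a \<otimes> b) n y = tensor_lift (\<lambda>u v. Sum_any (\<lambda>i. Y1 a i u \<otimes> Y2 b (n - 1 - i) v)) y"
  unfolding tensor_act_def by (rule tensor_lift_pure[OF bilinear_outer])

lemma T_pure: "T (a \<otimes> b) n (u \<otimes> v) = Sum_any (\<lambda>i. Y1 a i u \<otimes> Y2 b (n - 1 - i) v)"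
  unfolding T_pure_left by (rule tensor_lift_pure[OF bilinear_inner])

lemma T_pure': "T (a \<otimes> b) n (u \<otimes> v) = Sum_any (\<lambda>i. Y1 a (n - 1 - i) u \<otimes> Y2 b i v)"
  unfolding T_pure
  by (subst Sum_any_int_reflect[of _ "n - 1", symmetric]) simp

lemma T_right: "lin_on UNIV (T x n)"
proof -
  have "x \<in> {x. lin_on UNIV (T x n)}"
  proof (rule tensor_subspace_UNIV)
    note L = lin_onD(1)[OF T_left UNIV_I UNIV_I] lin_onD(2)[OF T_left UNIV_I] lin_on_0[OF T_left cv.subspace_UNIV]
    show "cv.subspace {x. lin_on UNIV (T x n)}"
      by (rule cv.subspaceI) (auto simp: lin_on_def L scaleC_add_right scaleC_scaleC mult.commute)
    show "a \<otimes> b \<in> {x. lin_on UNIV (T x n)}" for a b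
    proof -
      have "T (a \<otimes> b) n = tensor_lift (\<lambda>u v. Sum_any (\<lambda>i. Y1 a i u \<otimes> Y2 b (n - 1 - i) v))"
        by (rule ext) (rule T_pure_left)
      then show ?thesis using clinear_tensor_lift[OF bilinear_inner] by (simp add: lin_on_UNIV)
    qed
  qed
  then show ?thesis by simp
qed

lemma T_trunc: "\<exists>K. \<forall>n\<ge>K. T x n y = 0"
proof -
  note L = lin_onD(1)[OF T_left UNIV_I UNIV_I] lin_onD(2)[OF T_left UNIV_I] lin_on_0[OF T_left cv.subspace_UNIV]
  note R = lin_onD(1)[OF T_right UNIV_I UNIV_I] lin_onD(2)[OF T_right UNIV_I] lin_on_0[OF T_right cv.subspace_UNIV]
  have "x \<in> {x. \<forall>y. \<exists>K. \<forall>n\<ge>K. T x n y = 0}"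
  proof (rule tensor_subspace_UNIV)
    show "cv.subspace {x. \<forall>y. \<exists>K. \<forall>n\<ge>K. T x n y = 0}"
    proof (rule cv.subspaceI, goal_cases)
      case (2 x x')
      show ?case
      proof safe
        fix y obtain K K' where "\<forall>n\<ge>K. T x n y = 0" "\<forall>n\<ge>K'. T x' n y = 0" using 2 by blast
        then show "\<exists>K. \<forall>n\<ge>K. T (x + x') n y = 0" by (intro exI[of _ "max K K'"]) (simp add: L)
      qed
    next
      case (3 t x) then show ?case by (simp add: L) (metis cv.scale_zero_right)
    qed (simp add: L)
    fix a b
    have "y \<in> {y. \<exists>K. \<forall>n\<ge>K. T (a \<otimes> b) n y = 0}" for y
    proof (rule tensor_subspace_UNIV)
      show "cv.subspace {y. \<exists>K. \<forall>n\<ge>K. T (a \<otimes> b) n y = 0}"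
      proof (rule cv.subspaceI, goal_cases)
        case (2 y y')
        then obtain K K' where "\<forall>n\<ge>K. T (a \<otimes> b) n y = 0" "\<forall>n\<ge>K'. T (a \<otimes> b) n y' = 0" by blast
        then have "\<forall>n\<ge>max K K'. T (a \<otimes> b) n (y + y') = 0" by (simp add: R)
        then show ?case by blast
      next
        case (3 t y) then show ?case by (simp add: R) (metis cv.scale_zero_right)
      qed (simp add: R)
      fix u v
      obtain K1 where K1: "\<And>n. n \<ge> K1 \<Longrightarrow> Y1 a n u = 0" by (metis A.Y_trunc[OF UNIV_I])
      obtain K2 where K2: "\<And>n. n \<ge> K2 \<Longrightarrow> Y2 b n v = 0" by (metis B.Y_trunc[OF UNIV_I])
      have "T (a \<otimes> b) n (u \<otimes> v) = 0" if "n \<ge> K1 + K2" for n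
      proof -
        have "Y1 a i u \<otimes> Y2 b (n - 1 - i) v = 0" for i
          using K1[of i] K2[of "n - 1 - i"] that by (cases "i \<ge> K1") auto
        then show ?thesis by (simp add: T_pure)
      qed
      then show "u \<otimes> v \<in> {y. \<exists>K. \<forall>n\<ge>K. T (a \<otimes> b) n y = 0}" by blast
    qed
    then show "a \<otimes> b \<in> {x. \<forall>y. \<exists>K. \<forall>n\<ge>K. T x n y = 0}" by blast
  qed
  then show ?thesis by blast
qed

end

locale tensor_va_modes = tensor_modes P1 Y1 P2 Y2 + PA: tensor_modes P1 P1 P2 P2
  for P1 :: "'a::complex_vector \<Rightarrow> int \<Rightarrow> 'a \<Rightarrow> 'a" and Y1 :: "'a \<Rightarrow> int \<Rightarrow> 'm::complex_vector \<Rightarrow> 'm"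
    and P2 :: "'b::complex_vector \<Rightarrow> int \<Rightarrow> 'b \<Rightarrow> 'b" and Y2 :: "'b \<Rightarrow> int \<Rightarrow> 'n::complex_vector \<Rightarrow> 'n" +
  fixes one1 :: 'a and one2 :: 'b
  assumes vac1: "Y1 one1 n u = (if n = -1 then u else 0)" and vac2: "Y2 one2 n v = (if n = -1 then v else 0)"
    and vac1P: "P1 one1 n a = (if n = -1 then a else 0)" and vac2P: "P2 one2 n b = (if n = -1 then b else 0)"
    and Jac1: "A.Jac a a' u" and Jac2: "B.Jac b b' v"
begin

sublocale TM: modes PA.T T UNIV
  by unfold_locales (auto simp: T_right T_left T_trunc PA.T_trunc PA.T_right)

lemma T_left_factor: "T (a \<otimes> one2) n (u \<otimes> v) = Y1 a n u \<otimes> v"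
  by (subst T_pure, subst Sum_any_eq_sum[of "{n}"]) (auto simp: vac2)

lemma T_right_factor: "T (one1 \<otimes> b) n (u \<otimes> v) = u \<otimes> Y2 b n v"
  by (subst T_pure', subst Sum_any_eq_sum[of "{n}"]) (auto simp: vac1)

lemma P_left_factor: "PA.T (a \<otimes> one2) n (u \<otimes> v) = P1 a n u \<otimes> v"
  by (subst PA.T_pure, subst Sum_any_eq_sum[of "{n}"]) (auto simp: vac2P)

lemma P_right_factor: "PA.T (one1 \<otimes> b) n (u \<otimes> v) = u \<otimes> P2 b n v"
  by (subst PA.T_pure', subst Sum_any_eq_sum[of "{n}"]) (auto simp: vac1P)

text \<open>On pure tensors \<open>a \<otimes> one2\<close> acts in the first factor only. The
  triple at \<open>b1 \<otimes> b2\<close> and \<open>u1 \<otimes> u2\<close> is thus the sum over s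
  of the triples of a and b1 at u1, shifted in z_2 by -1 - s and tensored with the fixed vector
  \<open>Y2 b2 s u2\<close>.\<close>

lemma Jac_left: "TM.Jac (a \<otimes> one2) y w"
proof -
  have pure: "TM.Jac (a \<otimes> one2) (b1 \<otimes> b2) (u1 \<otimes> u2)" for b1 b2 u1 u2
  proof -
    define F where "F s m n = Y1 a m (Y1 b1 (n - 1 - s) u1) \<otimes> Y2 b2 s u2" for s m n
    define G where "G s n m = Y1 b1 (n - 1 - s) (Y1 a m u1) \<otimes> Y2 b2 s u2" for s m n
    define H where "H s r t = Y1 (P1 a r b1) (t - 1 - s) u1 \<otimes> Y2 b2 s u2" for s r t
    obtain Ka where Ka: "\<And>n. n \<ge> Ka \<Longrightarrow> Y1 a n u1 = 0" by (metis A.Y_trunc[OF UNIV_I])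
    obtain K1 where K1: "\<And>n. n \<ge> K1 \<Longrightarrow> Y1 b1 n u1 = 0" by (metis A.Y_trunc[OF UNIV_I])
    obtain K2 where K2: "\<And>n. n \<ge> K2 \<Longrightarrow> Y2 b2 n u2 = 0" by (metis B.Y_trunc[OF UNIV_I])
    obtain N where N: "\<And>n. n \<ge> N \<Longrightarrow> P1 a n b1 = 0" by (metis A.P_trunc)
    let ?K = "max Ka (max N (K1 + K2))"
    have "jac (\<lambda>m n. Sum_any (\<lambda>s. F s m n)) (\<lambda>m n. Sum_any (\<lambda>s. G s m n)) (\<lambda>m n. Sum_any (\<lambda>s. H s m n))"
    proof (rule jac_Sum_any[of _ _ _ ?K])
      fix s
      have "jac (F s) (G s) (H s)"
        unfolding F_def G_def H_def
        using jac_linear[OF jac_shift2[OF Jac1[unfolded A.Jac_def], where s = "-1 - s"] lin_pure_left]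
        by (simp add: diff_diff_eq2[symmetric] algebra_simps)
      then show "jacL (H s) p q r = jacR (F s) (G s) p q r" for p q r by (rule jacD)
      have "F s m n = 0" if "n \<ge> ?K" for m n
        using K1[of "n - 1 - s"] K2[of s] that by (cases "s \<ge> K2") (auto simp: F_def)
      then show "bdd_inner (F s) ?K" by (simp add: bdd_inner_def)
      show "bdd_inner (G s) ?K" by (simp add: bdd_inner_def G_def Ka)
      show "bdd_outer (H s) ?K" by (simp add: bdd_outer_def H_def N)
    next
      have fin: "finite {s. Y1 c (n - 1 - s) u \<otimes> Y2 b2 s u2 \<noteq> 0}" for c n u
      proof -
        have "{s. Y1 c (n - 1 - s) u \<otimes> Y2 b2 s u2 \<noteq> 0} \<subseteq>
          (\<lambda>i. n - 1 - i) ` {i. Y1 c i u \<otimes> Y2 b2 (n - 1 - i) u2 \<noteq> 0}"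
          by (force intro!: image_eqI[where x = "n - 1 - _"])
        then show ?thesis using fin_pure finite_surj by blast
      qed
      fix m n
      show "finite {s. F s m n \<noteq> 0}"
        by (rule finite_subset[OF _ fin[of b1 n u1]]) (auto simp: F_def simp flip: T_left_factor)
      show "finite {s. G s m n \<noteq> 0}" "finite {s. H s m n \<noteq> 0}"
        using fin by (simp_all add: G_def H_def)
    qed
    moreover have "T (a \<otimes> one2) m (T (b1 \<otimes> b2) n (u1 \<otimes> u2)) = Sum_any (\<lambda>s. F s m n)" for m n
    proof -
      have fin: "finite {s. Y1 b1 (n - 1 - s) u1 \<otimes> Y2 b2 s u2 \<noteq> 0}"
      proof -
        have "{s. Y1 b1 (n - 1 - s) u1 \<otimes> Y2 b2 s u2 \<noteq> 0} \<subseteq>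
          (\<lambda>i. n - 1 - i) ` {i. Y1 b1 i u1 \<otimes> Y2 b2 (n - 1 - i) u2 \<noteq> 0}"
          by (force intro!: image_eqI[where x = "n - 1 - _"])
        then show ?thesis using fin_pure finite_surj by blast
      qed
      show ?thesis
        unfolding T_pure' by (subst TM.Y_Sum_any[OF UNIV_I fin]) (simp add: T_left_factor F_def)
    qed
    moreover have "T (b1 \<otimes> b2) n (T (a \<otimes> one2) m (u1 \<otimes> u2)) = Sum_any (\<lambda>s. G s n m)" for m n
      unfolding T_left_factor unfolding T_pure' G_def ..
    moreover have "T (PA.T (a \<otimes> one2) r (b1 \<otimes> b2)) t (u1 \<otimes> u2) = Sum_any (\<lambda>s. H s r t)" for r t
      unfolding P_left_factor unfolding T_pure' H_def ..
    ultimately show ?thesis by (simp add: TM.Jac_def)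
  qed
  have bb: "TM.Jac (a \<otimes> one2) (b1 \<otimes> b2) w" for b1 b2 w
    using tensor_subspace_UNIV[OF TM.Jac_subspace_u[of "a \<otimes> one2" "b1 \<otimes> b2"]] pure by simp
  have "y \<in> {y. \<forall>w\<in>UNIV. TM.Jac (a \<otimes> one2) y w}"
    by (rule tensor_subspace_UNIV[OF TM.Jac_subspace_b]) (intro CollectI ballI bb)
  then show ?thesis by simp
qed

lemma Jac_right: "TM.Jac (one1 \<otimes> a) y w"
proof -
  have pure: "TM.Jac (one1 \<otimes> a) (b1 \<otimes> b2) (u1 \<otimes> u2)" for b1 b2 u1 u2
  proof -
    define F where "F s m n = Y1 b1 s u1 \<otimes> Y2 a m (Y2 b2 (n - 1 - s) u2)" for s m n
    define G where "G s n m = Y1 b1 s u1 \<otimes> Y2 b2 (n - 1 - s) (Y2 a m u2)" for s m n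
    define H where "H s r t = Y1 b1 s u1 \<otimes> Y2 (P2 a r b2) (t - 1 - s) u2" for s r t
    obtain Ka where Ka: "\<And>n. n \<ge> Ka \<Longrightarrow> Y2 a n u2 = 0" by (metis B.Y_trunc[OF UNIV_I])
    obtain K1 where K1: "\<And>n. n \<ge> K1 \<Longrightarrow> Y1 b1 n u1 = 0" by (metis A.Y_trunc[OF UNIV_I])
    obtain K2 where K2: "\<And>n. n \<ge> K2 \<Longrightarrow> Y2 b2 n u2 = 0" by (metis B.Y_trunc[OF UNIV_I])
    obtain N where N: "\<And>n. n \<ge> N \<Longrightarrow> P2 a n b2 = 0" by (metis B.P_trunc)
    let ?K = "max Ka (max N (K1 + K2))"
    have "jac (\<lambda>m n. Sum_any (\<lambda>s. F s m n)) (\<lambda>m n. Sum_any (\<lambda>s. G s m n)) (\<lambda>m n. Sum_any (\<lambda>s. H s m n))"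
    proof (rule jac_Sum_any[of _ _ _ ?K])
      fix s
      have "jac (F s) (G s) (H s)"
        unfolding F_def G_def H_def
        using jac_linear[OF jac_shift2[OF Jac2[unfolded B.Jac_def], where s = "-1 - s"] lin_pure_right]
        by (simp add: diff_diff_eq2[symmetric] algebra_simps)
      then show "jacL (H s) p q r = jacR (F s) (G s) p q r" for p q r by (rule jacD)
      have "F s m n = 0" if "n \<ge> ?K" for m n
        using K2[of "n - 1 - s"] K1[of s] that by (cases "s \<ge> K1") (auto simp: F_def)
      then show "bdd_inner (F s) ?K" by (simp add: bdd_inner_def)
      show "bdd_inner (G s) ?K" by (simp add: bdd_inner_def G_def Ka)
      show "bdd_outer (H s) ?K" by (simp add: bdd_outer_def H_def N)
    next
      fix m n
      show "finite {s. F s m n \<noteq> 0}"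
        by (rule finite_subset[OF _ fin_pure[of b1 u1 b2 n u2]]) (auto simp: F_def simp flip: T_right_factor)
      show "finite {s. G s m n \<noteq> 0}" "finite {s. H s m n \<noteq> 0}"
        using fin_pure by (simp_all add: G_def H_def)
    qed
    moreover have "T (one1 \<otimes> a) m (T (b1 \<otimes> b2) n (u1 \<otimes> u2)) = Sum_any (\<lambda>s. F s m n)" for m n
      unfolding T_pure by (subst TM.Y_Sum_any[OF UNIV_I fin_pure]) (simp add: T_right_factor F_def)
    moreover have "T (b1 \<otimes> b2) n (T (one1 \<otimes> a) m (u1 \<otimes> u2)) = Sum_any (\<lambda>s. G s n m)" for m n
      unfolding T_right_factor unfolding T_pure G_def ..
    moreover have "T (PA.T (one1 \<otimes> a) r (b1 \<otimes> b2)) t (u1 \<otimes> u2) = Sum_any (\<lambda>s. H s r t)" for r t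
      unfolding P_right_factor unfolding T_pure H_def ..
    ultimately show ?thesis by (simp add: TM.Jac_def)
  qed
  have bb: "TM.Jac (one1 \<otimes> a) (b1 \<otimes> b2) w" for b1 b2 w
    using tensor_subspace_UNIV[OF TM.Jac_subspace_u[of "one1 \<otimes> a" "b1 \<otimes> b2"]] pure by simp
  have "y \<in> {y. \<forall>w\<in>UNIV. TM.Jac (one1 \<otimes> a) y w}"
    by (rule tensor_subspace_UNIV[OF TM.Jac_subspace_b]) (intro CollectI ballI bb)
  then show ?thesis by simp
qed

lemma vac_tensor: "T (one1 \<otimes> one2) n y = (if n = -1 then y else 0)"
proof -
  have "y \<in> {y. T (one1 \<otimes> one2) n y = (if n = -1 then y else 0)}"
  proof (rule tensor_subspace_UNIV)
    show "cv.subspace {y. T (one1 \<otimes> one2) n y = (if n = -1 then y else 0)}"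
      by (rule cv.subspaceI) (auto simp: TM.Y_add TM.Y_scale)
  qed (simp add: T_left_factor vac1)
  then show ?thesis by simp
qed

end

lemma tensor_va_modesI:
  assumes "vertex_algebra V" "va_module V UNIV YV" "vertex_algebra W" "va_module W UNIV YW"
  shows "tensor_va_modes (nprod V) YV (nprod W) YW (vacuum V) (vacuum W)"
proof -
  note m = modesI[OF assms(1,2)] modesI[OF assms(3,4)] modesI[OF assms(1) vertex_algebraD(1)[OF assms(1)]]
    modesI[OF assms(3) vertex_algebraD(1)[OF assms(3)]]
  note t = tensor_modes.intro[OF m(1,2)] tensor_modes.intro[OF m(3,4)]
  show ?thesis
    by (intro tensor_va_modes.intro[OF t] tensor_va_modes_axioms.intro
        va_moduleD(6)[OF assms(2)] va_moduleD(6)[OF assms(4)] vertex_algebraD(4)[OF assms(1)]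
        vertex_algebraD(4)[OF assms(3)] modes_Jac[OF assms(1,2)] modes_Jac[OF assms(3,4)]) auto
qed

text \<open>Every pure tensor is the (-1)-product of \<open>a \<otimes> vacuum W\<close> and
  \<open>vacuum V \<otimes> b\<close>. The identity is known for these two kinds of states, passes
  to their product by \<open>Jac_nprod\<close>, and to sums by linearity.\<close>

lemma tensor_va_module:
  assumes V: "vertex_algebra V" "va_module V UNIV YV" and W: "vertex_algebra W" "va_module W UNIV YW"
  shows "va_module (V \<otimes>\<^sub>V W) UNIV (tensor_act YV YW)"
proof -
  interpret N: tensor_va_modes "nprod V" "nprod V" "nprod W" "nprod W" "vacuum V" "vacuum W"
    by (rule tensor_va_modesI[OF V(1) vertex_algebraD(1)[OF V(1)] W(1) vertex_algebraD(1)[OF W(1)]])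
  interpret tensor_va_modes "nprod V" YV "nprod W" YW "vacuum V" "vacuum W"
    by (rule tensor_va_modesI[OF V W])
  have pure: "TM.Jac (a \<otimes> b) y w" for a b y w
  proof -
    have ab: "N.T (a \<otimes> vacuum W) (-1) (vacuum V \<otimes> b) = a \<otimes> b"
      by (simp add: P_left_factor vertex_algebraD(2)[OF V(1)])
    have "TM.Jac (N.T (a \<otimes> vacuum W) (-1) (vacuum V \<otimes> b)) y w"
    proof (rule TM.Jac_nprod[OF UNIV_I Jac_left Jac_right])
      fix r
      show "N.T (N.T (a \<otimes> vacuum W) (- 1) (vacuum V \<otimes> b)) r y =
        Sum_any (\<lambda>i. ((- 1) ^ i * bin (- 1) i) *\<^sub>C
          (N.T (a \<otimes> vacuum W) (- 1 - int i) (N.T (vacuum V \<otimes> b) (r + int i) y) -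
           (- 1) powi - 1 *\<^sub>C N.T (vacuum V \<otimes> b) (r + - 1 - int i) (N.T (a \<otimes> vacuum W) (int i) y)))"
        by (rule N.TM.Jac_iter[OF N.Jac_left])
    qed
    then show ?thesis by (simp only: ab)
  qed
  have all: "TM.Jac x y w" for x y w
  proof -
    have "x \<in> {x. \<forall>y. \<forall>w\<in>UNIV. TM.Jac x y w}"
      by (rule tensor_subspace_UNIV[OF TM.P_lin_left_subspace[OF N.T_left]]) (intro CollectI allI ballI pure)
    then show ?thesis by simp
  qed
  show ?thesis
    by (subst TM.va_module_iff) (auto simp: tensor_va_def vac_tensor all)
qed

lemma tensor_vertex_algebra:
  assumes V: "vertex_algebra V" and W: "vertex_algebra W"
  shows "vertex_algebra (V \<otimes>\<^sub>V W)"
proof -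
  interpret tensor_va_modes "nprod V" "nprod V" "nprod W" "nprod W" "vacuum V" "vacuum W"
    by (rule tensor_va_modesI[OF V vertex_algebraD(1)[OF V] W vertex_algebraD(1)[OF W]])
  have "x \<in> {x. T x (-1) (vacuum V \<otimes> vacuum W) = x \<and> (\<forall>n\<ge>0. T x n (vacuum V \<otimes> vacuum W) = 0)}" for x
  proof (rule tensor_subspace_UNIV)
    note L = lin_onD(1)[OF T_left UNIV_I UNIV_I] lin_onD(2)[OF T_left UNIV_I] lin_on_0[OF T_left cv.subspace_UNIV]
    show "cv.subspace {x. T x (-1) (vacuum V \<otimes> vacuum W) = x \<and> (\<forall>n\<ge>0. T x n (vacuum V \<otimes> vacuum W) = 0)}"
      by (rule cv.subspaceI) (auto simp: L)
    fix a b
    have z: "nprod V a i (vacuum V) \<otimes> nprod W b (n - 1 - i) (vacuum W) = 0" if "n \<ge> 0 \<or> (n = -1 \<and> i \<noteq> -1)" for n i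
      using vertex_algebraD(3)[OF V, of i a] vertex_algebraD(3)[OF W, of "n - 1 - i" b] that
      by (cases "i \<ge> 0") auto
    have "T (a \<otimes> b) (-1) (vacuum V \<otimes> vacuum W) = a \<otimes> b"
      by (subst T_pure, subst Sum_any_eq_sum[of "{-1}"])
        (use z[of "-1"] in \<open>auto simp: vertex_algebraD(2)[OF V] vertex_algebraD(2)[OF W]\<close>)
    moreover have "T (a \<otimes> b) n (vacuum V \<otimes> vacuum W) = 0" if "n \<ge> 0" for n
      using that by (simp add: T_pure z)
    ultimately show "a \<otimes> b \<in> {x. T x (-1) (vacuum V \<otimes> vacuum W) = x \<and> (\<forall>n\<ge>0. T x n (vacuum V \<otimes> vacuum W) = 0)}"
      by simp
  qed
  then show ?thesis
    unfolding vertex_algebra_def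
    using tensor_va_module[OF V vertex_algebraD(1)[OF V] W vertex_algebraD(1)[OF W]]
    by (simp add: tensor_va_def)
qed

section \<open>Modules over the Weyl algebra of modes\<close>

text \<open>The index \<open>False\<close> stands for \<open>\<beta>\<close> and \<open>True\<close> for \<open>\<gamma>\<close>.\<close>

definition om :: "bool \<Rightarrow> bool \<Rightarrow> complex" where
  "om i j = (if i = j then 0 else if i then -1 else 1)"

text \<open>Modes are numbered as in the vertex algebra, without a shift by the conformal weight;
  the canonical pairs are therefore beta_m and gamma_n with m + n = -1.\<close>

definition weyl :: "'m::complex_vector set \<Rightarrow> (bool \<Rightarrow> int \<Rightarrow> 'm \<Rightarrow> 'm) \<Rightarrow> bool" where
  "weyl M x \<longleftrightarrow> cv.subspace M \<and> (\<forall>i n. \<forall>u\<in>M. x i n u \<in> M) \<and> (\<forall>i n. lin_on M (x i n)) \<and>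
    (\<forall>i j m n. \<forall>u\<in>M. x i m (x j n u) = x j n (x i m u) + (if m + n = -1 then om i j *\<^sub>C u else 0))"

definition smooth :: "'m::complex_vector set \<Rightarrow> (bool \<Rightarrow> int \<Rightarrow> 'm \<Rightarrow> 'm) \<Rightarrow> bool" where
  "smooth M x \<longleftrightarrow> (\<forall>i. \<forall>u\<in>M. \<exists>K. \<forall>n\<ge>K. x i n u = 0)"

lemma weylD:
  assumes "weyl M x"
  shows "cv.subspace M" "u \<in> M \<Longrightarrow> x i n u \<in> M" "lin_on M (x i n)"
    "u \<in> M \<Longrightarrow> x i m (x j n u) = x j n (x i m u) + (if m + n = -1 then om i j *\<^sub>C u else 0)"
  using assms unfolding weyl_def by blast+

lemma smoothD: "smooth M x \<Longrightarrow> u \<in> M \<Longrightarrow> \<exists>K. \<forall>n\<ge>K. x i n u = 0"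
  by (auto simp: smooth_def)

locale weyl_module =
  fixes M :: "'m::complex_vector set" and x :: "bool \<Rightarrow> int \<Rightarrow> 'm \<Rightarrow> 'm"
  assumes weyl: "weyl M x"
begin

lemma subM: "cv.subspace M" using weylD(1)[OF weyl] .
lemma x_lin: "lin_on M (x i n)" using weylD(3)[OF weyl] .
lemmas x_mem = weylD(2)[OF weyl]
lemmas x_swap = weylD(4)[OF weyl]
lemmas x_add = lin_onD(1)[OF x_lin] and x_scale = lin_onD(2)[OF x_lin]
  and x_diff = lin_on_diff[OF x_lin subM] and x_Sum_any = lin_on_Sum_any[OF x_lin subM]
lemma x_0 [simp]: "x i n 0 = 0" by (rule lin_on_0[OF x_lin subM])
lemmas M_ops = cv.subspace_add[OF subM] cv.subspace_scale[OF subM] cv.subspace_diff[OF subM]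
  Sum_any_mem[OF subM] cv.subspace_0[OF subM] x_mem

end

section \<open>The universal property of the beta-gamma system\<close>

definition bgen :: "'s \<Rightarrow> 's \<Rightarrow> bool \<Rightarrow> 's" where
  "bgen b g i = (if i then g else b)"

definition bgmon :: "(bool \<Rightarrow> int \<Rightarrow> 'm \<Rightarrow> 'm) \<Rightarrow> (nat \<times> nat) list \<Rightarrow> 'm \<Rightarrow> 'm" where
  "bgmon x ps v = foldr (\<lambda>(i, n). x (i = 1) (- int n)) ps v"

lemma bgmon_simps [simp]: "bgmon x [] v = v" "bgmon x (p # ps) v = x (fst p = 1) (- int (snd p)) (bgmon x ps v)"
  by (auto simp: bgmon_def split: prod.splits)

abbreviation bg_le :: "nat \<times> nat \<Rightarrow> nat \<times> nat \<Rightarrow> bool" where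
  "bg_le p q \<equiv> fst p < fst q \<or> (fst p = fst q \<and> snd p \<ge> snd q)"

fun bg_ins :: "nat \<times> nat \<Rightarrow> (nat \<times> nat) list \<Rightarrow> (nat \<times> nat) list" where
  "bg_ins p [] = [p]"
| "bg_ins p (q # qs) = (if bg_le p q then p # q # qs else q # bg_ins p qs)"

lemma set_bg_ins [simp]: "set (bg_ins p qs) = insert p (set qs)"
  by (induction qs) auto

lemma sorted_bg_ins: "sorted_wrt bg_le qs \<Longrightarrow> sorted_wrt bg_le (bg_ins p qs)"
proof (induction qs)
  case (Cons q qs)
  then show ?case by (auto simp: not_less)
qed simp

lemma pbw_index_bg: "pbw_index [b, g] = {ps. (\<forall>p\<in>set ps. fst p < 2 \<and> snd p \<ge> 1) \<and> sorted_wrt bg_le ps}"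
proof -
  have "(\<lambda>(i, m) (j, n). i < j \<or> i = j \<and> m \<ge> n) = bg_le" by (auto simp: fun_eq_iff)
  then show ?thesis by (auto simp: pbw_index_def case_prod_beta numeral_2_eq_2)
qed

lemma bg_ins_index:
  "fst p < 2 \<Longrightarrow> snd p \<ge> 1 \<Longrightarrow> ps \<in> pbw_index [b, g] \<Longrightarrow> bg_ins p ps \<in> pbw_index [b, g]"
  using sorted_bg_ins by (auto simp: pbw_index_bg)

context weyl_module begin

lemma bgmon_mem: "v \<in> M \<Longrightarrow> bgmon x ps v \<in> M"
  by (induction ps) (auto simp: x_mem)

text \<open>Two modes of index at most -1 have indices adding up to at most -2, so they commute and
  can be sorted freely.\<close>

lemma bgmon_ins:
  assumes "v \<in> M" "\<forall>p\<in>insert p (set ps). snd p \<ge> 1"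
  shows "bgmon x (bg_ins p ps) v = bgmon x (p # ps) v"
  using assms
proof (induction ps)
  case (Cons q qs)
  then have "bgmon x (bg_ins p qs) v = bgmon x (p # qs) v" by simp
  then show ?case using Cons.prems x_swap[OF bgmon_mem, of v "fst p = 1" "- int (snd p)" "fst q = 1" "- int (snd q)" qs]
    by auto
qed simp

end

locale bg =
  fixes S :: "'s::complex_vector vertex_alg" and \<beta> \<gamma> :: 's
  assumes bg: "betagamma S \<beta> \<gamma>"
begin

abbreviation gen where "gen \<equiv> bgen \<beta> \<gamma>"
abbreviation S_act where "S_act \<equiv> \<lambda>i. nprod S (gen i)"

lemma vaS: "vertex_algebra S" using bg by (simp add: betagamma_def)

lemma weyl_of_module:
  assumes "va_module S M Y"
  shows "weyl M (\<lambda>i. Y (gen i))"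
proof -
  interpret modes "nprod S" Y M by (rule modesI[OF vaS assms])
  have c: "Y a m (Y b n u) - Y b n (Y a m u) = (if m + n = -1 then k *\<^sub>C u else 0)"
    if "u \<in> M" "\<And>j::nat. nprod S a (int j) b = (if j = 0 then k *\<^sub>C vacuum S else 0)" for a b k m n u
  proof -
    have "Y a m (Y b n u) - Y b n (Y a m u) = Sum_any (\<lambda>j. bin m j *\<^sub>C Y (nprod S a (int j) b) (m + n - int j) u)"
      by (rule Jac_comm[OF modes_Jac[OF vaS assms that(1)]])
    also have "\<dots> = Y (k *\<^sub>C vacuum S) (m + n) u"
      by (subst Sum_any_eq_sum[of "{0}"]) (use that(2)[of 0] that in auto)
    finally show ?thesis using va_moduleD(6)[OF assms that(1)] that(1) by (simp add: Y_scale_left)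
  qed
  have o: "nprod S \<beta> (int j) \<gamma> = (if j = 0 then 1 *\<^sub>C vacuum S else 0)"
    "nprod S \<beta> (int j) \<beta> = (if j = 0 then 0 *\<^sub>C vacuum S else 0)"
    "nprod S \<gamma> (int j) \<gamma> = (if j = 0 then 0 *\<^sub>C vacuum S else 0)" for j
    using bg by (auto simp: betagamma_def ope_def)
  have sw: "Y (gen i) m (Y (gen j) n u) = Y (gen j) n (Y (gen i) m u) + (if m + n = - 1 then om i j *\<^sub>C u else 0)"
    if u: "u \<in> M" for i j m n u
    using c[OF u o(1), of m n] c[OF u o(1), of n m] c[OF u o(2), of m n] c[OF u o(3), of m n]
    by (cases i; cases j) (auto simp: bgen_def om_def algebra_simps split: if_splits)
  show ?thesis unfolding weyl_def by (intro conjI allI ballI subM Y_mem Y_lin sw)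
qed

lemma smooth_of_module: "va_module S M Y \<Longrightarrow> smooth M (\<lambda>i. Y (gen i))"
  using va_moduleD(5)[of S M Y] by (auto simp: smooth_def)

sublocale S: weyl_module UNIV S_act
  by unfold_locales (rule weyl_of_module[OF vertex_algebraD(1)[OF vaS]])

lemma basis: "basis_family (pbw_index [\<beta>, \<gamma>]) (\<lambda>ps. bgmon S_act ps (vacuum S))"
proof -
  have "basis_family (pbw_index [\<beta>, \<gamma>]) (\<lambda>ps. pbw_monomial S [\<beta>, \<gamma>] ps (vacuum S))"
    using bg by (simp add: betagamma_def freely_strongly_generated_def)
  moreover have "pbw_monomial S [\<beta>, \<gamma>] ps v = bgmon S_act ps v" if "\<forall>p\<in>set ps. fst p < 2" for ps v
    using that by (induction ps) (auto simp: pbw_monomial_def bgen_def less_2_cases_iff)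
  then have eq: "pbw_monomial S [\<beta>, \<gamma>] ps (vacuum S) = bgmon S_act ps (vacuum S)" if "ps \<in> pbw_index [\<beta>, \<gamma>]" for ps
    using that by (simp add: pbw_index_bg)
  ultimately show ?thesis
    unfolding basis_family_def using inj_on_cong[of "pbw_index [\<beta>, \<gamma>]", OF eq] image_cong[OF refl eq] by simp
qed

lemma bg_induct:
  assumes "cv.subspace K" "vacuum S \<in> K" "\<And>i n a. n \<ge> 1 \<Longrightarrow> a \<in> K \<Longrightarrow> S_act i (- int n) a \<in> K"
  shows "a \<in> K"
proof -
  have "bgmon S_act ps (vacuum S) \<in> K" if "\<forall>p\<in>set ps. fst p < 2 \<and> snd p \<ge> 1" for ps
    using that by (induction ps) (auto simp: assms)
  then have "(\<lambda>ps. bgmon S_act ps (vacuum S)) ` pbw_index [\<beta>, \<gamma>] \<subseteq> K" by (auto simp: pbw_index_bg)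
  from cv.span_minimal[OF this assms(1)] show ?thesis using basis by (auto simp: basis_family_def)
qed

text \<open>The system S is the module induced from the vacuum. The map is defined on the ordered
  monomials; it intertwines creation modes because these can be sorted into place, and annihilation
  modes by moving them to the vacuum. The target may be any Weyl module, in particular a space of
  fields.\<close>

lemma universal:
  fixes X :: "bool \<Rightarrow> int \<Rightarrow> 'x::complex_vector \<Rightarrow> 'x"
  assumes X: "weyl F X" and v: "v \<in> F" "\<And>i n. n \<ge> 0 \<Longrightarrow> X i n v = 0"
  obtains \<Psi> where "clinear \<Psi>" "\<Psi> (vacuum S) = v" "\<And>a. \<Psi> a \<in> F" "\<And>i n a. \<Psi> (S_act i n a) = X i n (\<Psi> a)"
proof -
  interpret X: weyl_module F X by unfold_locales (rule X)
  interpret vector_space_pair "scaleC :: complex \<Rightarrow> 's \<Rightarrow> 's" "scaleC :: complex \<Rightarrow> 'x \<Rightarrow> 'x" ..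
  let ?I = "pbw_index [\<beta>, \<gamma>]" and ?f = "\<lambda>ps. bgmon S_act ps (vacuum S)"
  have inj: "inj_on ?f ?I" and ind: "cv.independent (?f ` ?I)" and span: "cv.span (?f ` ?I) = UNIV"
    using basis by (auto simp: basis_family_def)
  obtain \<Psi> where lin: "clinear \<Psi>" and \<Psi>: "\<forall>a\<in>?f ` ?I. \<Psi> a = bgmon X (inv_into ?I ?f a) v"
    using linear_independent_extend[OF ind, of "\<lambda>a. bgmon X (inv_into ?I ?f a) v"] by blast
  note L = lin[folded lin_on_UNIV]
  note L = lin_onD(1)[OF L UNIV_I UNIV_I] lin_onD(2)[OF L UNIV_I] lin_on_0[OF L cv.subspace_UNIV]
  have bgmon: "\<Psi> (?f ps) = bgmon X ps v" if "ps \<in> ?I" for ps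
    using \<Psi> that inv_into_f_f[OF inj that] by auto
  have mem: "\<Psi> a \<in> F" for a
  proof -
    have "?f ` ?I \<subseteq> {a. \<Psi> a \<in> F}" by (auto simp: bgmon X.bgmon_mem v)
    moreover have "cv.subspace {a. \<Psi> a \<in> F}"
      by (rule cv.subspaceI) (auto simp: L X.M_ops)
    ultimately have "cv.span (?f ` ?I) \<subseteq> {a. \<Psi> a \<in> F}" by (rule cv.span_minimal)
    then show ?thesis using span by auto
  qed
  have eqI: "\<Psi> (S_act i n a) = X i n (\<Psi> a)" if "\<And>ps. ps \<in> ?I \<Longrightarrow> \<Psi> (S_act i n (?f ps)) = X i n (\<Psi> (?f ps))" for i n a
  proof -
    have "?f ` ?I \<subseteq> {a. \<Psi> (S_act i n a) = X i n (\<Psi> a)}" using that by auto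
    moreover have "cv.subspace {a. \<Psi> (S_act i n a) = X i n (\<Psi> a)}"
      by (rule cv.subspaceI) (auto simp: L S.x_add S.x_scale X.x_add X.x_scale mem)
    ultimately have "cv.span (?f ` ?I) \<subseteq> {a. \<Psi> (S_act i n a) = X i n (\<Psi> a)}" by (rule cv.span_minimal)
    then show ?thesis using span by auto
  qed
  have creation: "\<Psi> (S_act i (- int n) a) = X i (- int n) (\<Psi> a)" if "n \<ge> 1" for i n a
  proof (rule eqI)
    fix ps assume ps: "ps \<in> ?I"
    let ?p = "(if i then 1 else 0, n) :: nat \<times> nat"
    have all: "\<forall>p\<in>insert ?p (set ps). snd p \<ge> 1" using ps that by (auto simp: pbw_index_bg)
    have "bg_ins ?p ps \<in> ?I" by (rule bg_ins_index) (use that ps in auto)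
    then have "\<Psi> (?f (bg_ins ?p ps)) = bgmon X (bg_ins ?p ps) v" by (rule bgmon)
    then show "\<Psi> (S_act i (- int n) (?f ps)) = X i (- int n) (\<Psi> (?f ps))"
      unfolding S.bgmon_ins[OF UNIV_I all] X.bgmon_ins[OF v(1) all] bgmon[OF ps] by (cases i) auto
  qed
  have vac: "\<Psi> (vacuum S) = v" using bgmon[of "[]"] by (simp add: pbw_index_bg)
  have ann: "\<Psi> (S_act i (int n) a) = X i (int n) (\<Psi> a)" for i n a
  proof -
    have "a \<in> {a. \<Psi> (S_act i (int n) a) = X i (int n) (\<Psi> a)}"
    proof (rule bg_induct)
      show "cv.subspace {a. \<Psi> (S_act i (int n) a) = X i (int n) (\<Psi> a)}"
        by (rule cv.subspaceI) (auto simp: L S.x_add S.x_scale X.x_add X.x_scale mem)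
      show "vacuum S \<in> {a. \<Psi> (S_act i (int n) a) = X i (int n) (\<Psi> a)}"
        by (simp add: vertex_algebraD(3)[OF vaS] vac v L)
      fix j k a assume k: "k \<ge> (1::nat)" and a: "a \<in> {a. \<Psi> (S_act i (int n) a) = X i (int n) (\<Psi> a)}"
      have "\<Psi> (S_act i (int n) (S_act j (- int k) a)) = X i (int n) (X j (- int k) (\<Psi> a))"
        using a S.x_swap[OF UNIV_I, of i "int n" j "- int k" a] X.x_swap[OF mem, of i "int n" j "- int k" a]
        using creation[OF k, of j "S_act i (int n) a"] by (auto simp: L)
      then show "S_act j (- int k) a \<in> {a. \<Psi> (S_act i (int n) a) = X i (int n) (\<Psi> a)}"
        by (simp add: creation[OF k])
    qed
    then show ?thesis by simp
  qed
  have "\<Psi> (S_act i n a) = X i n (\<Psi> a)" for i n a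
    using ann[of i "nat n" a] creation[of "nat (- n)" i a] by (cases "n \<ge> 0") auto
  then show ?thesis using that[of \<Psi>] lin vac mem by auto
qed

end

section \<open>Smooth Weyl modules are modules over the beta-gamma system\<close>

text \<open>Fields on M in the sense of vertex algebras. They are set to zero outside M, so that
  fields agreeing on M are equal as functions and identities between them can be written as
  equations.\<close>

definition mfields :: "'m::complex_vector set \<Rightarrow> (int \<Rightarrow> 'm \<Rightarrow> 'm) set" where
  "mfields M = {\<phi>. \<forall>t. lin_on M (\<phi> t) \<and> (\<forall>u\<in>M. \<phi> t u \<in> M) \<and> (\<forall>u. u \<notin> M \<longrightarrow> \<phi> t u = 0)} \<inter>
    {\<phi>. \<forall>u\<in>M. \<exists>K. \<forall>n\<ge>K. \<phi> n u = 0}"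

abbreviation sbin :: "int \<Rightarrow> nat \<Rightarrow> complex" where "sbin m j \<equiv> (-1) ^ j * bin m j"

lemma finite_pairD: "finite {(i, j). G i j \<noteq> 0} \<Longrightarrow> finite {p. (case p of (i, j) \<Rightarrow> G i j) \<noteq> 0}"
  by (rule rev_finite_subset) auto

locale smooth_weyl = weyl_module M x for M :: "'m::complex_vector set" and x :: "bool \<Rightarrow> int \<Rightarrow> 'm \<Rightarrow> 'm" +
  assumes smooth: "smooth M x"
begin

text \<open>\<open>lop i m \<phi>\<close> and \<open>rop i m \<phi>\<close> are the residues in \<open>z\<close> of \<open>(z - w)\<^sup>m x\<^sub>i(z)\<phi>(w)\<close> and
  \<open>(w - z)\<^sup>m \<phi>(w)x\<^sub>i(z)\<close>, expanded where the outer variable is larger.\<close>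

definition lop :: "bool \<Rightarrow> int \<Rightarrow> (int \<Rightarrow> 'm \<Rightarrow> 'm) \<Rightarrow> int \<Rightarrow> 'm \<Rightarrow> 'm" where
  "lop i m \<phi> t u = Sum_any (\<lambda>j. sbin m j *\<^sub>C x i (m - int j) (\<phi> (t + int j) u))"

definition rop :: "bool \<Rightarrow> int \<Rightarrow> (int \<Rightarrow> 'm \<Rightarrow> 'm) \<Rightarrow> int \<Rightarrow> 'm \<Rightarrow> 'm" where
  "rop i m \<phi> t u = (if u \<in> M then Sum_any (\<lambda>j. sbin m j *\<^sub>C \<phi> (t + m - int j) (x i (int j) u)) else 0)"

text \<open>The m-th product of the fields x_i(z) and \<phi>(w) in the usual calculus of
  fields.\<close>

definition fop :: "bool \<Rightarrow> int \<Rightarrow> (int \<Rightarrow> 'm \<Rightarrow> 'm) \<Rightarrow> int \<Rightarrow> 'm \<Rightarrow> 'm" where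
  "fop i m \<phi> t u = lop i m \<phi> t u - (-1) powi m *\<^sub>C rop i m \<phi> t u"

lemma fieldsD:
  assumes "\<phi> \<in> mfields M"
  shows "lin_on M (\<phi> t)" "u \<in> M \<Longrightarrow> \<phi> t u \<in> M" "u \<notin> M \<Longrightarrow> \<phi> t u = 0" "u \<in> M \<Longrightarrow> \<exists>K. \<forall>n\<ge>K. \<phi> n u = 0"
  using assms by (auto simp: mfields_def)

lemma fields_0: "\<phi> \<in> mfields M \<Longrightarrow> \<phi> t 0 = 0"
  by (rule lin_on_0[OF fieldsD(1) subM])

lemma subspace_fields: "cv.subspace (mfields M)"
proof (rule cv.subspaceI)
  show "0 \<in> mfields M" by (auto simp: mfields_def lin_on_def M_ops)
  show "\<phi> + \<psi> \<in> mfields M" if "\<phi> \<in> mfields M" "\<psi> \<in> mfields M" for \<phi> \<psi>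
  proof -
    have "\<exists>K. \<forall>n\<ge>K. \<phi> n u + \<psi> n u = 0" if u: "u \<in> M" for u
    proof -
      obtain K K' where "\<forall>n\<ge>K. \<phi> n u = 0" "\<forall>n\<ge>K'. \<psi> n u = 0"
        using fieldsD(4)[OF \<open>\<phi> \<in> mfields M\<close> u] fieldsD(4)[OF \<open>\<psi> \<in> mfields M\<close> u] by blast
      then show ?thesis by (intro exI[of _ "max K K'"]) simp
    qed
    then show ?thesis using that by (auto simp: mfields_def lin_on_def M_ops scaleC_add_right algebra_simps)
  qed
  show "t *\<^sub>C \<phi> \<in> mfields M" if "\<phi> \<in> mfields M" for t \<phi>
  proof -
    have "\<exists>K. \<forall>n\<ge>K. t *\<^sub>C \<phi> n u = 0" if u: "u \<in> M" for u
      using fieldsD(4)[OF \<open>\<phi> \<in> mfields M\<close> u] by (metis cv.scale_zero_right)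
    then show ?thesis using that
      by (auto simp: mfields_def lin_on_def M_ops scaleC_add_right scaleC_fun_def scaleC_scaleC mult.commute)
  qed
qed

lemma fin_field: "\<phi> \<in> mfields M \<Longrightarrow> u \<in> M \<Longrightarrow> finite {j. \<phi> (t + int j) u \<noteq> 0}"
proof -
  assume "\<phi> \<in> mfields M" "u \<in> M"
  then obtain K where "\<forall>n\<ge>K. \<phi> n u = 0" using fieldsD(4) by blast
  then show ?thesis by (intro finite_nat_bound[of "nat (K - t)"]) auto
qed

lemma fin_x: "u \<in> M \<Longrightarrow> finite {j. x i (t + int j) u \<noteq> 0}"
proof -
  assume "u \<in> M"
  then obtain K where "\<forall>n\<ge>K. x i n u = 0" using smoothD[OF smooth] by blast
  then show ?thesis by (intro finite_nat_bound[of "nat (K - t)"]) auto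
qed

lemma fin_lop: "\<phi> \<in> mfields M \<Longrightarrow> u \<in> M \<Longrightarrow> finite {j. c j *\<^sub>C x i (k j) (\<phi> (t + int j) u) \<noteq> 0}"
  by (rule finite_subset[OF _ fin_field[of \<phi> u t]]) auto

lemma fin_rop: "\<phi> \<in> mfields M \<Longrightarrow> u \<in> M \<Longrightarrow> finite {j. c j *\<^sub>C \<phi> (k j) (x i (int j) u) \<noteq> 0}"
  by (rule finite_subset[OF _ fin_x[of u i 0]]) (auto simp: fields_0)

lemma lop_fields: assumes \<phi>: "\<phi> \<in> mfields M" shows "lop i m \<phi> \<in> mfields M"
proof -
  have "\<exists>K. \<forall>n\<ge>K. lop i m \<phi> n u = 0" if um: "u \<in> M" for u
  proof -
    obtain K where "\<forall>n\<ge>K. \<phi> n u = 0" using fieldsD(4)[OF \<phi> um] by blast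
    then have "\<forall>n\<ge>K. lop i m \<phi> n u = 0" by (auto simp: lop_def)
    then show ?thesis by blast
  qed
  moreover have "lop i m \<phi> t (u + v) = lop i m \<phi> t u + lop i m \<phi> t v" if "u \<in> M" "v \<in> M" for t u v
    using that by (simp add: lop_def lin_onD[OF fieldsD(1)[OF \<phi>]] x_add fieldsD[OF \<phi>] scaleC_add_right
      Sum_any.distrib[OF fin_lop[OF \<phi>] fin_lop[OF \<phi>]])
  moreover have "lop i m \<phi> t (s *\<^sub>C u) = s *\<^sub>C lop i m \<phi> t u" if "u \<in> M" for t u s
    using that by (simp add: lop_def lin_onD[OF fieldsD(1)[OF \<phi>]] x_scale fieldsD[OF \<phi>] scaleC_Sum_any scaleC_scaleC mult.commute)
  moreover have "lop i m \<phi> t u \<in> M" if "u \<in> M" for t u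
    unfolding lop_def using that fieldsD(2)[OF \<phi>] by (simp add: M_ops)
  moreover have "lop i m \<phi> t u = 0" if "u \<notin> M" for t u
    using that by (simp add: lop_def fieldsD(3)[OF \<phi>])
  ultimately show ?thesis
    unfolding mfields_def lin_on_def by auto
qed

lemma rop_fields: assumes \<phi>: "\<phi> \<in> mfields M" shows "rop i m \<phi> \<in> mfields M"
proof -
  have "\<exists>K. \<forall>n\<ge>K. rop i m \<phi> n u = 0" if um: "u \<in> M" for u
  proof -
    have "\<forall>j::nat. \<exists>k. \<forall>n\<ge>k. \<phi> n (x i (int j) u) = 0"
      using fieldsD(4)[OF \<phi> x_mem[OF um]] by blast
    then have "\<exists>k. \<forall>j. \<forall>n\<ge>k j. \<phi> n (x i (int j) u) = 0" by (rule choice)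
    then obtain k where k: "\<And>j n. n \<ge> k j \<Longrightarrow> \<phi> n (x i (int j) u) = 0" by blast
    let ?J = "{j. x i (0 + int j) u \<noteq> 0}"
    have fJ: "finite ?J" by (rule fin_x[OF um])
    let ?K = "Max (insert 0 ((\<lambda>j. k j - m + int j) ` ?J))"
    have "rop i m \<phi> n u = 0" if n: "n \<ge> ?K" for n
    proof -
      have "\<phi> (n + m - int j) (x i (int j) u) = 0" for j
      proof (cases "j \<in> ?J")
        case True
        then have "k j - m + int j \<le> n" using n fJ by simp
        then show ?thesis by (intro k) simp
      qed (simp add: fields_0[OF \<phi>])
      then show ?thesis by (simp add: rop_def)
    qed
    then show ?thesis by blast
  qed
  moreover have "rop i m \<phi> t (u + v) = rop i m \<phi> t u + rop i m \<phi> t v" if "u \<in> M" "v \<in> M" for t u v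
    using that by (simp add: rop_def lin_onD[OF fieldsD(1)[OF \<phi>]] x_add M_ops fieldsD[OF \<phi>] scaleC_add_right
      Sum_any.distrib[OF fin_rop[OF \<phi>] fin_rop[OF \<phi>]])
  moreover have "rop i m \<phi> t (s *\<^sub>C u) = s *\<^sub>C rop i m \<phi> t u" if "u \<in> M" for t u s
    using that by (simp add: rop_def lin_onD[OF fieldsD(1)[OF \<phi>]] x_scale M_ops fieldsD[OF \<phi>] scaleC_Sum_any scaleC_scaleC mult.commute)
  moreover have "rop i m \<phi> t u \<in> M" if "u \<in> M" for t u
    unfolding rop_def using that fieldsD(2)[OF \<phi>] by (simp add: M_ops)
  moreover have "rop i m \<phi> t u = 0" if "u \<notin> M" for t u
    using that by (simp add: rop_def fieldsD(3)[OF \<phi>])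
  ultimately show ?thesis
    unfolding mfields_def lin_on_def by auto
qed

lemma fop_eq: "fop i m \<phi> = lop i m \<phi> - (-1) powi m *\<^sub>C rop i m \<phi>"
  by (auto simp: fop_def fun_eq_iff scaleC_fun_def)

lemma fop_fields: "\<phi> \<in> mfields M \<Longrightarrow> fop i m \<phi> \<in> mfields M"
  unfolding fop_eq
  by (intro cv.subspace_diff[OF subspace_fields] cv.subspace_scale[OF subspace_fields] lop_fields rop_fields)

lemma lop_lin: "lin_on (mfields M) (lop i m)"
proof -
  have "lop i m (\<phi> + \<psi>) t u = lop i m \<phi> t u + lop i m \<psi> t u" if "\<phi> \<in> mfields M" "\<psi> \<in> mfields M" for \<phi> \<psi> t u
  proof (cases "u \<in> M")
    case True
    then show ?thesis
      by (simp add: lop_def x_add fieldsD[OF that(1)] fieldsD[OF that(2)] scaleC_add_right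
        Sum_any.distrib[OF fin_lop[OF that(1)] fin_lop[OF that(2)]])
  qed (simp add: lop_def fieldsD(3)[OF that(1)] fieldsD(3)[OF that(2)])
  moreover have "lop i m (s *\<^sub>C \<phi>) t u = s *\<^sub>C lop i m \<phi> t u" if "\<phi> \<in> mfields M" for \<phi> t u s
  proof (cases "u \<in> M")
    case True
    then show ?thesis
      by (simp add: lop_def x_scale fieldsD[OF that(1)] scaleC_fun_def scaleC_Sum_any scaleC_scaleC mult.commute)
  qed (simp add: lop_def fieldsD(3)[OF that(1)] scaleC_fun_def)
  ultimately show ?thesis by (auto simp: lin_on_def fun_eq_iff scaleC_fun_def)
qed

lemma rop_lin: "lin_on (mfields M) (rop i m)"
proof -
  have "rop i m (\<phi> + \<psi>) t u = rop i m \<phi> t u + rop i m \<psi> t u" if "\<phi> \<in> mfields M" "\<psi> \<in> mfields M" for \<phi> \<psi> t u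
    by (simp add: rop_def scaleC_add_right Sum_any.distrib[OF fin_rop[OF that(1)] fin_rop[OF that(2)]])
  moreover have "rop i m (s *\<^sub>C \<phi>) t u = s *\<^sub>C rop i m \<phi> t u" if "\<phi> \<in> mfields M" for \<phi> t u s
    by (simp add: rop_def scaleC_fun_def scaleC_Sum_any scaleC_scaleC mult.commute)
  ultimately show ?thesis by (auto simp: lin_on_def fun_eq_iff scaleC_fun_def)
qed

lemma fop_lin: "lin_on (mfields M) (fop i m)"
  using lop_lin[of i m] rop_lin[of i m] unfolding lin_on_def fop_eq
  by (simp add: scaleC_add_right cv.scale_right_diff_distrib scaleC_scaleC mult.commute algebra_simps)

lemma lop_rop:
  assumes \<phi>: "\<phi> \<in> mfields M"
  shows "lop i m (rop k n \<phi>) = rop k n (lop i m \<phi>)"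
proof (intro ext)
  fix t u
  show "lop i m (rop k n \<phi>) t u = rop k n (lop i m \<phi>) t u"
  proof (cases "u \<in> M")
    case u: True
    let ?G = "\<lambda>j l. (sbin m j * sbin n l) *\<^sub>C x i (m - int j) (\<phi> (t + n - int l + int j) (x k (int l) u))"
    have fin: "finite {(l, j). ?G j l \<noteq> 0}"
    proof -
      obtain K where K: "\<forall>n\<ge>K. x k n u = 0" using smoothD[OF smooth u] by blast
      show ?thesis
      proof (rule finite_pair_bound[of "nat K"])
        show "finite {j. ?G j l \<noteq> 0}" for l by (rule fin_lop[OF \<phi> x_mem[OF u]])
      qed (use K in \<open>auto simp: fields_0[OF \<phi>]\<close>)
    qed
    have "lop i m (rop k n \<phi>) t u = Sum_any (\<lambda>j. Sum_any (\<lambda>l. ?G j l))"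
      unfolding lop_def rop_def using u
      by (simp add: x_Sum_any[OF _ fin_rop[OF \<phi>]] x_scale fieldsD[OF \<phi>] M_ops scaleC_Sum_any scaleC_scaleC algebra_simps)
    also have "\<dots> = Sum_any (\<lambda>l. Sum_any (\<lambda>j. ?G j l))" by (rule Sum_any_swap[symmetric, OF fin])
    also have "\<dots> = rop k n (lop i m \<phi>) t u"
      unfolding lop_def rop_def using u by (simp add: scaleC_Sum_any scaleC_scaleC algebra_simps)
    finally show ?thesis .
  qed (simp add: lop_def rop_def)
qed

lemma rop_rop:
  assumes \<phi>: "\<phi> \<in> mfields M"
  shows "rop i m (rop k n \<phi>) = rop k n (rop i m \<phi>)"
proof (intro ext)
  fix t u
  show "rop i m (rop k n \<phi>) t u = rop k n (rop i m \<phi>) t u"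
  proof (cases "u \<in> M")
    case u: True
    let ?G = "\<lambda>j l. (sbin m j * sbin n l) *\<^sub>C \<phi> (t + m + n - int j - int l) (x k (int l) (x i (int j) u))"
    have fin: "finite {(j, l). ?G j l \<noteq> 0}"
    proof -
      obtain K where K: "\<forall>n\<ge>K. x i n u = 0" using smoothD[OF smooth u] by blast
      show ?thesis
      proof (rule finite_pair_bound[of "nat K"])
        show "finite {l. ?G j l \<noteq> 0}" for j by (rule fin_rop[OF \<phi> x_mem[OF u]])
      qed (use K in \<open>auto simp: fields_0[OF \<phi>]\<close>)
    qed
    have sw: "x k (int l) (x i (int j) u) = x i (int j) (x k (int l) u)" for j l
      using x_swap[OF u, of k "int l" i "int j"] by simp
    have "rop i m (rop k n \<phi>) t u = Sum_any (\<lambda>j. Sum_any (\<lambda>l. ?G j l))"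
      unfolding rop_def using u by (simp add: x_mem scaleC_Sum_any scaleC_scaleC algebra_simps)
    also have "\<dots> = Sum_any (\<lambda>l. Sum_any (\<lambda>j. ?G j l))" by (rule Sum_any_swap[OF fin])
    also have "\<dots> = rop k n (rop i m \<phi>) t u"
      unfolding rop_def sw using u by (simp add: x_mem scaleC_Sum_any scaleC_scaleC algebra_simps)
    finally show ?thesis .
  qed (simp add: rop_def)
qed

text \<open>Only terms with j + l = m + n + 1 see the Weyl relation. By Vandermonde their
  coefficients add up to \<open>sbin (m + n) s\<close> with s = m + n + 1, and the binomial
  coefficient of s - 1 over s vanishes unless s = 0.\<close>

lemma lop_lop:
  assumes \<phi>: "\<phi> \<in> mfields M"
  shows "lop i m (lop k n \<phi>) = lop k n (lop i m \<phi>) + (if m + n = -1 then om i k *\<^sub>C \<phi> else 0)"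
proof (intro ext)
  fix t u
  show "lop i m (lop k n \<phi>) t u = (lop k n (lop i m \<phi>) + (if m + n = -1 then om i k *\<^sub>C \<phi> else 0)) t u"
  proof (cases "u \<in> M")
    case u: True
    define A where "A i m k n j l = (sbin m j * sbin n l) *\<^sub>C x i (m - int j) (x k (n - int l) (\<phi> (t + int j + int l) u))"
      for i m k n j l
    have fin: "finite {(j, l). (c j l) *\<^sub>C x i (m - int j) (x k (n - int l) (\<phi> (t + int j + int l) u)) \<noteq> 0}" for i m k n c
    proof -
      obtain K where K: "\<forall>n\<ge>K. \<phi> n u = 0" using fieldsD(4)[OF \<phi> u] by blast
      show ?thesis
      proof (rule finite_pair_bound[of "nat (K - t)"])
        show "finite {l. (c j l) *\<^sub>C x i (m - int j) (x k (n - int l) (\<phi> (t + int j + int l) u)) \<noteq> 0}" for j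
          by (rule finite_nat_bound[of "nat (K - t)"]) (use K in auto)
      qed (use K in auto)
    qed
    have LL: "lop i m (lop k n \<phi>) t u = Sum_any (\<lambda>j. Sum_any (A i m k n j))" for i m k n
      unfolding lop_def A_def using u
      by (simp add: x_Sum_any[OF _ fin_lop[OF \<phi>]] x_scale fieldsD[OF \<phi>] M_ops)
        (simp add: scaleC_Sum_any scaleC_scaleC mult_ac)
    have finA: "finite {(j, l). A i m k n j l \<noteq> 0}" for i m k n unfolding A_def by (rule fin)
    define D where "D j l = A i m k n j l - A k n i m l j" for j l
    have finA': "finite {(j, l). A k n i m l j \<noteq> 0}" by (rule finite_pair_swap[OF finA])
    have finD: "finite {(j, l). D j l \<noteq> 0}"
      by (rule finite_subset[OF _ finite_UnI[OF finA[of i m k n] finA']]) (auto simp: D_def)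
    have D: "D j l = (if m + n + 1 = int (j + l) then (sbin m j * sbin n l * om i k) *\<^sub>C \<phi> (t + int (j + l)) u else 0)" for j l
      using x_swap[OF fieldsD(2)[OF \<phi> u], of i "m - int j" k "n - int l" "t + int j + int l"]
      by (auto simp: D_def A_def scaleC_add_right scaleC_scaleC algebra_simps)
    have sbv: "(\<Sum>j\<le>s. sbin m j * sbin n (s - j)) = sbin (m + n) s" for s
    proof -
      have "(\<Sum>j\<le>s. sbin m j * sbin n (s - j)) = (\<Sum>j\<le>s. (-1) ^ s * (bin m j * bin n (s - j)))"
      proof (rule sum.cong[OF refl])
        fix j assume "j \<in> {..s}"
        then have "(-1::complex) ^ j * (-1) ^ (s - j) = (-1) ^ s" by (simp add: power_add[symmetric])
        then show "sbin m j * sbin n (s - j) = (-1) ^ s * (bin m j * bin n (s - j))" by (simp add: mult_ac)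
      qed
      then show ?thesis by (simp add: sum_distrib_left[symmetric] bin_Vandermonde)
    qed
    have "lop i m (lop k n \<phi>) t u - lop k n (lop i m \<phi>) t u = Sum_any (\<lambda>j. Sum_any (D j))"
      unfolding LL Sum_any_swap[OF finA[of k n i m]] Sum_any_pair[OF finA[of i m k n]] Sum_any_pair[OF finA']
        Sum_any_pair[OF finD]
      by (subst Sum_any_diff[symmetric, OF finite_pairD[OF finA[of i m k n]] finite_pairD[OF finA']])
        (simp add: D_def case_prod_beta)
    also have "\<dots> = Sum_any (\<lambda>s. \<Sum>j\<le>s. D j (s - j))" by (rule Sum_any_diag[OF finD])
    also have "\<dots> = Sum_any (\<lambda>s. if m + n + 1 = int s then (sbin (m + n) s * om i k) *\<^sub>C \<phi> (t + int s) u else 0)"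
    proof (rule Sum_any.cong)
      fix s
      have "(\<Sum>j\<le>s. D j (s - j)) = (if m + n + 1 = int s then (\<Sum>j\<le>s. (sbin m j * sbin n (s - j) * om i k) *\<^sub>C \<phi> (t + int s) u) else 0)"
        by (auto simp: D intro!: sum.cong)
      then show "(\<Sum>j\<le>s. D j (s - j)) = (if m + n + 1 = int s then (sbin (m + n) s * om i k) *\<^sub>C \<phi> (t + int s) u else 0)"
        by (simp add: cv.scale_sum_left[symmetric] sum_distrib_right[symmetric] sbv)
    qed
    also have "\<dots> = (if m + n = -1 then om i k *\<^sub>C \<phi> t u else 0)"
    proof (cases "m + n \<ge> -1")
      case True
      then obtain s where s: "m + n + 1 = int s" using nonneg_int_cases[of "m + n + 1"] by auto
      have "Sum_any (\<lambda>s. if m + n + 1 = int s then (sbin (m + n) s * om i k) *\<^sub>C \<phi> (t + int s) u else 0)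
          = (sbin (m + n) s * om i k) *\<^sub>C \<phi> (t + int s) u"
        by (subst Sum_any_eq_sum[of "{s}"]) (use s in auto)
      moreover have "s > 0 \<Longrightarrow> bin (m + n) s = 0"
      proof -
        assume "s > 0"
        moreover have "m + n = int (s - 1)" using s \<open>s > 0\<close> by simp
        ultimately show ?thesis using bin_eq_0[of "s - 1" s] by simp
      qed
      ultimately show ?thesis using s by (cases "s = 0") auto
    next
      case False
      then have "\<And>s. m + n + 1 \<noteq> int s" by auto
      then show ?thesis using False by simp
    qed
    finally show ?thesis by (auto simp: scaleC_fun_def algebra_simps)
  qed (simp add: lop_def fieldsD(3)[OF \<phi>] scaleC_fun_def)
qed

text \<open>Left multiplications satisfy the Weyl relations among themselves, while right
  multiplications commute with each other and with the left ones, so only the former contribute to a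
  commutator. The fields thus form a Weyl module, to which the universal property of S
  applies.\<close>

lemma weyl_fields: "weyl (mfields M) fop"
  unfolding weyl_def
proof (intro conjI allI ballI subspace_fields fop_fields fop_lin)
  fix i j m n \<phi> assume \<phi>: "\<phi> \<in> mfields M"
  note F = lop_fields[OF \<phi>] rop_fields[OF \<phi>] cv.subspace_scale[OF subspace_fields] \<phi>
  have ex: "fop i m (fop j n \<phi>) = lop i m (lop j n \<phi>) - (-1) powi n *\<^sub>C lop i m (rop j n \<phi>)
     - (-1) powi m *\<^sub>C rop i m (lop j n \<phi>) + ((-1) powi m * (-1) powi n) *\<^sub>C rop i m (rop j n \<phi>)" for i j m n
    unfolding fop_eq
    by (simp add: lin_on_diff[OF lop_lin subspace_fields] lin_on_diff[OF rop_lin subspace_fields] F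
      lin_onD(2)[OF lop_lin] lin_onD(2)[OF rop_lin] cv.scale_right_diff_distrib scaleC_scaleC algebra_simps)
  show "fop i m (fop j n \<phi>) = fop j n (fop i m \<phi>) + (if m + n = - 1 then om i j *\<^sub>C \<phi> else 0)"
    unfolding ex lop_rop[OF \<phi>] lop_lop[OF \<phi>, of i m j n] rop_rop[OF \<phi>, of i m j n]
    by (simp add: mult.commute algebra_simps)
qed

definition idf :: "int \<Rightarrow> 'm \<Rightarrow> 'm" where "idf t u = (if u \<in> M \<and> t = -1 then u else 0)"

lemma idf_fields: "idf \<in> mfields M"
proof -
  have "\<exists>K. \<forall>n\<ge>K. idf n u = 0" for u by (rule exI[of _ 0]) (simp add: idf_def)
  moreover have "lin_on M (idf t)" for t by (auto simp: lin_on_def M_ops idf_def)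
  ultimately show ?thesis by (auto simp: mfields_def) (auto simp: idf_def M_ops)
qed

lemma lop_idf: "u \<in> M \<Longrightarrow> lop i m idf t u = (if t \<le> -1 then sbin m (nat (-1 - t)) *\<^sub>C x i (m + 1 + t) u else 0)"
proof -
  assume u: "u \<in> M"
  show ?thesis
  proof (cases "t \<le> -1")
    case True
    then show ?thesis unfolding lop_def
      by (subst Sum_any_eq_sum[of "{nat (-1 - t)}"]) (auto simp: idf_def u algebra_simps)
  qed (auto simp: lop_def idf_def)
qed

lemma rop_idf: "u \<in> M \<Longrightarrow> rop i m idf t u = (if t + m \<ge> -1 then sbin m (nat (t + m + 1)) *\<^sub>C x i (t + m + 1) u else 0)"
proof -
  assume u: "u \<in> M"
  show ?thesis
  proof (cases "t + m \<ge> -1")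
    case True
    then show ?thesis unfolding rop_def
      by (subst Sum_any_eq_sum[of "{nat (t + m + 1)}"]) (auto simp: idf_def u x_mem algebra_simps)
  qed (auto simp: rop_def idf_def)
qed

text \<open>For m >= 0 the factor (z - w)^m is a polynomial, so its expansions in the two orders
  agree and cancel. The identity field is thereby a vacuum vector in the Weyl module of
  fields.\<close>

lemma fop_idf: assumes "m \<ge> 0" shows "fop i m idf = 0"
proof (intro ext)
  fix t u
  show "fop i m idf t u = 0 t u"
  proof (cases "u \<in> M")
    case u: True
    obtain k where k: "m = int k" using assms nonneg_int_cases by blast
    consider "t \<ge> 0" | "t \<le> -1" "t + m < -1" | "t \<le> -1" "t + m \<ge> -1" by linarith
    then have "fop i m idf t u = 0"
    proof cases
      case 1
      then have "bin m (nat (t + m + 1)) = 0" unfolding k by (intro bin_eq_0) linarith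
      then show ?thesis using 1 by (simp add: fop_def lop_idf[OF u] rop_idf[OF u])
    next
      case 2
      then have "bin m (nat (-1 - t)) = 0" unfolding k by (intro bin_eq_0) linarith
      then show ?thesis using 2 by (simp add: fop_def lop_idf[OF u] rop_idf[OF u])
    next
      case 3
      \<comment> \<open>The two surviving terms have complementary lower indices a + b = m and agree
        up to sign by the symmetry of binomial coefficients.\<close>
      define a b where "a = nat (-1 - t)" and "b = nat (t + m + 1)"
      have ab: "k = a + b" using 3 k by (auto simp: a_def b_def)
      have "bin (int k) a = bin (int k) b"
        using binomial_symmetric[of a k] ab by (simp add: binomial_gbinomial[symmetric] del: of_nat_add)
      moreover have "(-1) ^ a = (-1) ^ k * ((-1::complex) ^ b)" unfolding ab by (simp add: power_add power_mult_distrib[symmetric] mult.assoc)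
      ultimately have "sbin m a = (-1) powi m * sbin m b" unfolding k by (simp add: mult.assoc)
      moreover have "m + 1 + t = t + m + 1" by simp
      ultimately show ?thesis using 3
        unfolding fop_def lop_idf[OF u] rop_idf[OF u] a_def[symmetric] b_def[symmetric]
        by (auto simp: scaleC_scaleC add_ac)
    qed
    then show ?thesis by simp
  qed (simp add: fop_def lop_def rop_def idf_def)
qed

lemma fop_idf_gen: assumes u: "u \<in> M" shows "fop i (-1) idf t u = x i t u"
proof -
  have "sbin (-1) k = 1" for k
    using gbinomial_minus[of "1::complex" k] by (simp add: power_mult_distrib[symmetric] binomial_gbinomial[symmetric])
  then show ?thesis by (auto simp: fop_def lop_idf[OF u] rop_idf[OF u])
qed

end

lemma finite_sum_support:
  fixes f :: "'j \<Rightarrow> 'i \<Rightarrow> 'a::comm_monoid_add"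
  assumes "finite A" "\<And>j. finite {l. f j l \<noteq> 0}"
  shows "finite {l. (\<Sum>j\<in>A. f j l) \<noteq> 0}"
proof (rule finite_subset)
  show "{l. (\<Sum>j\<in>A. f j l) \<noteq> 0} \<subseteq> (\<Union>j\<in>A. {l. f j l \<noteq> 0})"
    by (auto elim: sum.not_neutral_contains_not_neutral)
qed (use assms in auto)

lemma Sum_any_sum:
  fixes f :: "'j \<Rightarrow> 'i \<Rightarrow> 'a::comm_monoid_add"
  assumes "finite A" "\<And>j. finite {l. f j l \<noteq> 0}"
  shows "Sum_any (\<lambda>l. \<Sum>j\<in>A. f j l) = (\<Sum>j\<in>A. Sum_any (f j))"
  using assms(1)
  by (induction A) (auto simp: Sum_any.distrib[OF assms(2) finite_sum_support[OF _ assms(2)]])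

text \<open>The coefficient identity behind \<open>[x(z), (z\<^sub>2 - w)\<^bsup>-n\<^esup>] = \<partial>\<^sub>w\<^bsup>n-1\<^esup> \<delta>(z - w) / (n-1)!\<close>.\<close>

lemma delta_coefficient:
  assumes "n \<ge> 1"
  shows "(if m - int n \<ge> -1 then sbin (- int n) (nat (m - int n + 1)) else 0)
    - (-1) powi (- int n) * (if m \<le> -1 then sbin (- int n) (nat (-1 - m)) else 0) = bin m (n - 1)"
proof -
  have neg: "sbin (- int n) k = bin (int (n + k - 1)) k" for k
  proof -
    have "bin (- int n) k = (-1) ^ k * bin (int (n + k - 1)) k"
      using gbinomial_minus[of "of_nat n :: complex" k] assms by (simp add: of_nat_diff)
    then show ?thesis by (simp add: mult.assoc[symmetric] power_mult_distrib[symmetric])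
  qed
  have sym: "bin (int a) k = bin (int a) (a - k)" if "k \<le> a" for a k
    using binomial_symmetric[OF that] by (simp add: binomial_gbinomial[symmetric])
  show ?thesis
  proof (cases "m \<ge> 0")
    case True
    then obtain a where a: "m = int a" using nonneg_int_cases by blast
    show ?thesis
    proof (cases "a \<ge> n - 1")
      case True
      then have "nat (m - int n + 1) = a - (n - 1)" "n + (a - (n - 1)) - 1 = a" using a assms by auto
      then have "sbin (- int n) (nat (m - int n + 1)) = bin m (n - 1)"
        using neg[of "a - (n - 1)"] sym[OF True] a by simp
      then show ?thesis using True a assms by simp
    next
      case False
      then show ?thesis using a assms bin_eq_0[of a "n - 1"] by simp
    qed
  next
    case False
    define a where "a = nat (-1 - m)"
    have a: "m = -1 - int a" using False by (simp add: a_def)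
    have "bin m (n - 1) = (-1) ^ (n - 1) * bin (int (a + (n - 1))) (n - 1)"
    proof -
      have "of_int m = - (of_nat (Suc a) :: complex)" using a by simp
      moreover have "of_nat (Suc a) + of_nat (n - 1) - 1 = (of_nat (a + (n - 1)) :: complex)" by simp
      ultimately show ?thesis using gbinomial_minus[of "of_nat (Suc a) :: complex" "n - 1"] by simp
    qed
    also have "bin (int (a + (n - 1))) (n - 1) = bin (int (a + (n - 1))) a"
      using sym[of "n - 1" "a + (n - 1)"] by simp
    also have "\<dots> = sbin (- int n) a" using neg[of a] assms by (simp add: add.commute)
    also have "(-1) ^ (n - 1) = - ((-1) powi (- int n) :: complex)"
      using assms powi_neg1(4)[of 0 n] by (cases n) simp_all
    finally show ?thesis using a assms by simp
  qed
qed

section \<open>Commutators of generators with products of fields\<close>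

context smooth_weyl begin

text \<open>The commutator formula between the modes of x_i and of \<phi>. The vanishing of the
  products for large j expresses locality and turns the right-hand side into a sum of fixed
  length.\<close>

definition comm_prop :: "(int \<Rightarrow> 'm \<Rightarrow> 'm) \<Rightarrow> bool" where
  "comm_prop \<phi> \<longleftrightarrow> (\<forall>i. \<exists>J. \<forall>j\<ge>J. fop i (int j) \<phi> = 0) \<and> (\<forall>i m t. \<forall>u\<in>M. x i m (\<phi> t u) - \<phi> t (x i m u)
     = Sum_any (\<lambda>j. bin m j *\<^sub>C fop i (int j) \<phi> (m + t - int j) u))"

lemma comm_prop_sum:
  assumes "comm_prop \<phi>" "\<forall>j\<ge>J. fop i (int j) \<phi> = 0" "u \<in> M"
  shows "x i m (\<phi> t u) - \<phi> t (x i m u) = (\<Sum>j<J. bin m j *\<^sub>C fop i (int j) \<phi> (m + t - int j) u)"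
proof -
  have "x i m (\<phi> t u) - \<phi> t (x i m u) = Sum_any (\<lambda>j. bin m j *\<^sub>C fop i (int j) \<phi> (m + t - int j) u)"
    using assms by (simp add: comm_prop_def)
  also have "\<dots> = (\<Sum>j<J. bin m j *\<^sub>C fop i (int j) \<phi> (m + t - int j) u)"
    by (rule Sum_any_eq_sum) (use assms(2) in auto)
  finally show ?thesis .
qed

lemma fop_swap:
  assumes "\<phi> \<in> mfields M"
  shows "fop i m (fop j n \<phi>) = fop j n (fop i m \<phi>) + (if m + n = -1 then om i j *\<^sub>C \<phi> else 0)"
  using weylD(4)[OF weyl_fields assms] .

text \<open>In each term the mode of x_i is commuted past both factors: past \<phi> by assumption,
  which gives the sum over j, and past x_k by the Weyl relation, which meets at most the one index l
  = m + n + 1.\<close>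

lemma comm_lop:
  assumes \<phi>: "\<phi> \<in> mfields M" "comm_prop \<phi>" and J: "\<forall>j\<ge>J. fop i (int j) \<phi> = 0" and u: "u \<in> M"
  shows "x i m (lop k n \<phi> t u) - lop k n \<phi> t (x i m u) =
    (\<Sum>j<J. bin m j *\<^sub>C lop k n (fop i (int j) \<phi>) (m + t - int j) u)
    + (if m + n \<ge> -1 then sbin n (nat (m + n + 1)) * om i k else 0) *\<^sub>C \<phi> (m + n + t + 1) u"
proof -
  let ?E = "\<lambda>l. (if m + n - int l = -1 then (sbin n l * om i k) *\<^sub>C \<phi> (t + int l) u else 0)"
  let ?D = "\<lambda>j l. bin m j *\<^sub>C (sbin n l *\<^sub>C x k (n - int l) (fop i (int j) \<phi> (m + t - int j + int l) u))"
  have finD: "finite {l. ?D j l \<noteq> 0}" for j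
    by (rule finite_subset[OF _ fin_field[OF fop_fields[OF \<phi>(1), of i "int j"] u, of "m + t - int j"]]) auto
  have finE: "finite {l. ?E l \<noteq> 0}"
    by (rule finite_subset[OF _ fin_field[OF \<phi>(1) u, of t]]) auto
  have finDs: "finite {l. (\<Sum>j<J. ?D j l) \<noteq> 0}"
    by (rule finite_sum_support[OF finite_lessThan finD])
  note F = fieldsD[OF \<phi>(1)] fieldsD[OF fop_fields[OF \<phi>(1)]]
  have "x i m (lop k n \<phi> t u) - lop k n \<phi> t (x i m u) = Sum_any (\<lambda>l. sbin n l *\<^sub>C x i m (x k (n - int l) (\<phi> (t + int l) u)))
    - Sum_any (\<lambda>l. sbin n l *\<^sub>C x k (n - int l) (\<phi> (t + int l) (x i m u)))"
    unfolding lop_def using u by (simp add: x_Sum_any[OF _ fin_lop[OF \<phi>(1)]] x_scale F M_ops)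
  also have "\<dots> = Sum_any (\<lambda>l. sbin n l *\<^sub>C x i m (x k (n - int l) (\<phi> (t + int l) u))
    - sbin n l *\<^sub>C x k (n - int l) (\<phi> (t + int l) (x i m u)))"
    by (rule Sum_any_diff[symmetric, OF finite_subset[OF _ fin_field[OF \<phi>(1) u, of t]] fin_lop[OF \<phi>(1) x_mem[OF u]]]) auto
  also have "\<dots> = Sum_any (\<lambda>l. (\<Sum>j<J. ?D j l) + ?E l)"
  proof (rule Sum_any.cong)
    fix l
    have "x i m (x k (n - int l) (\<phi> (t + int l) u)) - x k (n - int l) (\<phi> (t + int l) (x i m u)) =
      x k (n - int l) (x i m (\<phi> (t + int l) u) - \<phi> (t + int l) (x i m u)) +
      (if m + (n - int l) = -1 then om i k *\<^sub>C \<phi> (t + int l) u else 0)"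
      using x_swap[OF F(2)[OF u], of i m k "n - int l" "t + int l"] u by (simp add: x_diff M_ops F)
    also have "x i m (\<phi> (t + int l) u) - \<phi> (t + int l) (x i m u)
      = (\<Sum>j<J. bin m j *\<^sub>C fop i (int j) \<phi> (m + (t + int l) - int j) u)"
      by (rule comm_prop_sum[OF \<phi>(2) J u])
    also have "x k (n - int l) \<dots> = (\<Sum>j<J. bin m j *\<^sub>C x k (n - int l) (fop i (int j) \<phi> (m + t - int j + int l) u))"
      using u by (subst lin_on_sum[OF x_lin subM]) (auto simp: M_ops F x_scale algebra_simps)
    finally show "sbin n l *\<^sub>C x i m (x k (n - int l) (\<phi> (t + int l) u))
      - sbin n l *\<^sub>C x k (n - int l) (\<phi> (t + int l) (x i m u)) = (\<Sum>j<J. ?D j l) + ?E l"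
      unfolding cv.scale_right_diff_distrib[symmetric]
      by (simp add: scaleC_add_right cv.scale_sum_right scaleC_scaleC mult.commute add_diff_eq)
  qed
  also have "\<dots> = (\<Sum>j<J. Sum_any (?D j)) + Sum_any ?E"
    by (simp only: Sum_any.distrib[OF finDs finE] Sum_any_sum[OF finite_lessThan finD])
  also have "(\<Sum>j<J. Sum_any (?D j)) = (\<Sum>j<J. bin m j *\<^sub>C lop k n (fop i (int j) \<phi>) (m + t - int j) u)"
    by (simp add: lop_def scaleC_Sum_any)
  also have "Sum_any ?E = (if m + n \<ge> -1 then sbin n (nat (m + n + 1)) * om i k else 0) *\<^sub>C \<phi> (m + n + t + 1) u"
  proof (cases "m + n \<ge> -1")
    case True
    show ?thesis by (subst Sum_any_eq_sum[of "{nat (m + n + 1)}"]) (use True in \<open>auto simp: algebra_simps\<close>)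
  next
    case False
    then have "?E l = 0" for l by auto
    then show ?thesis using False by simp
  qed
  finally show ?thesis .
qed

lemma comm_rop:
  assumes \<phi>: "\<phi> \<in> mfields M" "comm_prop \<phi>" and J: "\<forall>j\<ge>J. fop i (int j) \<phi> = 0" and u: "u \<in> M"
  shows "x i m (rop k n \<phi> t u) - rop k n \<phi> t (x i m u) =
    (\<Sum>j<J. bin m j *\<^sub>C rop k n (fop i (int j) \<phi>) (m + t - int j) u)
    + (if m \<le> -1 then sbin n (nat (-1 - m)) * om i k else 0) *\<^sub>C \<phi> (m + n + t + 1) u"
proof -
  let ?E = "\<lambda>l. (if int l + m = -1 then (sbin n l * om i k) *\<^sub>C \<phi> (t + n - int l) u else 0)"
  let ?D = "\<lambda>j l. bin m j *\<^sub>C (sbin n l *\<^sub>C fop i (int j) \<phi> (m + t - int j + n - int l) (x k (int l) u))"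
  have finD: "finite {l. ?D j l \<noteq> 0}" for j
    by (rule finite_subset[OF _ fin_x[OF u, of k 0]]) (auto simp: fields_0[OF fop_fields[OF \<phi>(1)]])
  have finE: "finite {l. ?E l \<noteq> 0}"
    by (rule finite_nat_bound[of "nat (- m)"]) auto
  have finDs: "finite {l. (\<Sum>j<J. ?D j l) \<noteq> 0}"
    by (rule finite_sum_support[OF finite_lessThan finD])
  note F = fieldsD[OF \<phi>(1)] fieldsD[OF fop_fields[OF \<phi>(1)]]
  have "x i m (rop k n \<phi> t u) - rop k n \<phi> t (x i m u) = Sum_any (\<lambda>l. sbin n l *\<^sub>C x i m (\<phi> (t + n - int l) (x k (int l) u)))
    - Sum_any (\<lambda>l. sbin n l *\<^sub>C \<phi> (t + n - int l) (x k (int l) (x i m u)))"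
    unfolding rop_def using u by (simp add: x_Sum_any[OF _ fin_rop[OF \<phi>(1)]] x_scale F M_ops)
  also have "\<dots> = Sum_any (\<lambda>l. sbin n l *\<^sub>C x i m (\<phi> (t + n - int l) (x k (int l) u))
    - sbin n l *\<^sub>C \<phi> (t + n - int l) (x k (int l) (x i m u)))"
    by (rule Sum_any_diff[symmetric, OF finite_subset[OF _ fin_x[OF u, of k 0]] fin_rop[OF \<phi>(1) x_mem[OF u]]])
      (auto simp: fields_0[OF \<phi>(1)])
  also have "\<dots> = Sum_any (\<lambda>l. (\<Sum>j<J. ?D j l) + ?E l)"
  proof (rule Sum_any.cong)
    fix l
    have om: "om k i = - om i k" by (simp add: om_def)
    have "\<phi> (t + n - int l) (x k (int l) (x i m u)) = \<phi> (t + n - int l) (x i m (x k (int l) u)) -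
        (if int l + m = -1 then om i k *\<^sub>C \<phi> (t + n - int l) u else 0)"
      using u by (subst x_swap[OF u, of k "int l" i m]) (auto simp: lin_onD[OF F(1)] lin_on_diff[OF F(1) subM] M_ops om)
    moreover have "x i m (\<phi> (t + n - int l) (x k (int l) u)) - \<phi> (t + n - int l) (x i m (x k (int l) u))
      = (\<Sum>j<J. bin m j *\<^sub>C fop i (int j) \<phi> (m + (t + n - int l) - int j) (x k (int l) u))"
      by (rule comm_prop_sum[OF \<phi>(2) J x_mem[OF u]])
    ultimately have "x i m (\<phi> (t + n - int l) (x k (int l) u)) - \<phi> (t + n - int l) (x k (int l) (x i m u)) =
      (\<Sum>j<J. bin m j *\<^sub>C fop i (int j) \<phi> (m + t - int j + n - int l) (x k (int l) u)) +
      (if int l + m = -1 then om i k *\<^sub>C \<phi> (t + n - int l) u else 0)"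
      by (simp add: algebra_simps)
    then show "sbin n l *\<^sub>C x i m (\<phi> (t + n - int l) (x k (int l) u))
      - sbin n l *\<^sub>C \<phi> (t + n - int l) (x k (int l) (x i m u)) = (\<Sum>j<J. ?D j l) + ?E l"
      unfolding cv.scale_right_diff_distrib[symmetric]
      by (simp add: scaleC_add_right cv.scale_sum_right scaleC_scaleC mult.commute)
  qed
  also have "\<dots> = (\<Sum>j<J. Sum_any (?D j)) + Sum_any ?E"
    by (simp only: Sum_any.distrib[OF finDs finE] Sum_any_sum[OF finite_lessThan finD])
  also have "(\<Sum>j<J. Sum_any (?D j)) = (\<Sum>j<J. bin m j *\<^sub>C rop k n (fop i (int j) \<phi>) (m + t - int j) u)"
    using u by (simp add: rop_def scaleC_Sum_any)
  also have "Sum_any ?E = (if m \<le> -1 then sbin n (nat (-1 - m)) * om i k else 0) *\<^sub>C \<phi> (m + n + t + 1) u"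
  proof (cases "m \<le> -1")
    case True
    show ?thesis by (subst Sum_any_eq_sum[of "{nat (-1 - m)}"]) (use True in \<open>auto simp: algebra_simps\<close>)
  next
    case False
    then have "?E l = 0" for l by auto
    then show ?thesis using False by simp
  qed
  finally show ?thesis .
qed

text \<open>This is Dong's lemma with explicit coefficients. The Weyl terms of
  \<open>comm_lop\<close> and \<open>comm_rop\<close> combine by \<open>delta_coefficient\<close> to
  a single multiple of \<phi>, which is the term that \<open>fop_swap\<close> produces at j = n -
  1.\<close>

lemma comm_prop_fop:
  assumes \<phi>: "\<phi> \<in> mfields M" "comm_prop \<phi>" and n: "n \<ge> 1"
  shows "comm_prop (fop k (- int n) \<phi>)"
proof -
  have ex: "\<exists>K\<ge>n. (\<forall>j\<ge>K. fop i (int j) \<phi> = 0) \<and> (\<forall>j\<ge>K. fop i (int j) (fop k (- int n) \<phi>) = 0)" for i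
  proof -
    obtain J where J: "\<forall>j\<ge>J. fop i (int j) \<phi> = 0" using \<phi>(2) unfolding comm_prop_def by blast
    have "fop i (int j) (fop k (- int n) \<phi>) = 0" if "j \<ge> max J n" for j
      using that J by (simp add: fop_swap[OF \<phi>(1), of i "int j"] lin_on_0[OF fop_lin subspace_fields])
    then show ?thesis using J by (intro exI[of _ "max J n"]) auto
  qed
  have "x i m (fop k (- int n) \<phi> t u) - fop k (- int n) \<phi> t (x i m u)
      = Sum_any (\<lambda>j. bin m j *\<^sub>C fop i (int j) (fop k (- int n) \<phi>) (m + t - int j) u)" if u: "u \<in> M" for i m t u
  proof -
    let ?N = "- int n" and ?e = "(-1) powi (- int n) :: complex"
    let ?w = "\<phi> (m + ?N + t + 1) u"
    obtain K where K: "K \<ge> n" "\<forall>j\<ge>K. fop i (int j) \<phi> = 0" "\<forall>j\<ge>K. fop i (int j) (fop k ?N \<phi>) = 0" using ex by blast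
    define c1 where "c1 = (if m + ?N \<ge> -1 then sbin ?N (nat (m + ?N + 1)) * om i k else 0)"
    define c2 where "c2 = (if m \<le> -1 then sbin ?N (nat (-1 - m)) * om i k else 0)"
    have c: "c1 - ?e * c2 = om i k * bin m (n - 1)"
      using arg_cong[OF delta_coefficient[OF n, of m], of "\<lambda>z. om i k * z"]
      by (auto simp: c1_def c2_def algebra_simps)
    have mem: "lop k ?N \<phi> t u \<in> M" "rop k ?N \<phi> t u \<in> M"
      using fieldsD(2)[OF lop_fields[OF \<phi>(1)] u] fieldsD(2)[OF rop_fields[OF \<phi>(1)] u] by auto
    have "x i m (fop k ?N \<phi> t u) - fop k ?N \<phi> t (x i m u) =
      (x i m (lop k ?N \<phi> t u) - lop k ?N \<phi> t (x i m u)) - ?e *\<^sub>C (x i m (rop k ?N \<phi> t u) - rop k ?N \<phi> t (x i m u))"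
      unfolding fop_def using mem by (simp add: x_diff x_scale M_ops cv.scale_right_diff_distrib algebra_simps)
    also have "\<dots> = (\<Sum>j<K. bin m j *\<^sub>C fop k ?N (fop i (int j) \<phi>) (m + t - int j) u) + (c1 - ?e * c2) *\<^sub>C ?w"
      unfolding comm_lop[OF \<phi> K(2) u] comm_rop[OF \<phi> K(2) u] c1_def[symmetric] c2_def[symmetric]
      by (simp add: fop_def scaleC_add_right cv.scale_right_diff_distrib cv.scale_sum_right sum_subtractf
        scaleC_scaleC cv.scale_left_diff_distrib mult.commute algebra_simps)
    also have "\<dots> = (\<Sum>j<K. bin m j *\<^sub>C fop k ?N (fop i (int j) \<phi>) (m + t - int j) u)
      + (\<Sum>j<K. if j = n - 1 then (om i k * bin m (n - 1)) *\<^sub>C ?w else 0)"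
      using less_le_trans[OF _ K(1), of "n - 1"] n unfolding c by (simp add: sum.delta)
    also have "\<dots> = (\<Sum>j<K. bin m j *\<^sub>C fop i (int j) (fop k ?N \<phi>) (m + t - int j) u)"
      unfolding sum.distrib[symmetric]
    proof (rule sum.cong[OF refl])
      fix j
      have "fop i (int j) (fop k ?N \<phi>) = fop k ?N (fop i (int j) \<phi>) + (if j = n - 1 then om i k *\<^sub>C \<phi> else 0)"
        using fop_swap[OF \<phi>(1), of i "int j" k ?N] n by auto
      moreover have "?w = \<phi> (m + t - int j) u" if "j = n - 1"
      proof -
        have eq: "m + ?N + t + 1 = m + t - int j" using n that by simp
        show ?thesis by (simp only: eq)
      qed
      ultimately show "bin m j *\<^sub>C fop k ?N (fop i (int j) \<phi>) (m + t - int j) u +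
          (if j = n - 1 then (om i k * bin m (n - 1)) *\<^sub>C ?w else 0)
        = bin m j *\<^sub>C fop i (int j) (fop k ?N \<phi>) (m + t - int j) u"
        by (cases "j = n - 1") (simp_all add: scaleC_fun_def scaleC_add_right scaleC_scaleC mult.commute)
    qed
    also have "\<dots> = Sum_any (\<lambda>j. bin m j *\<^sub>C fop i (int j) (fop k ?N \<phi>) (m + t - int j) u)"
      by (rule Sum_any_eq_sum[symmetric]) (use K(3) in auto)
    finally show ?thesis .
  qed
  then show ?thesis unfolding comm_prop_def using ex by blast
qed

lemma comm_prop_idf: "comm_prop idf"
proof -
  have "x i m (idf t u) - idf t (x i m u) = 0" if "u \<in> M" for i m t u
    using that by (simp add: idf_def x_mem)
  then show ?thesis using fop_idf by (auto simp: comm_prop_def)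
qed

end

locale bg_weyl = bg S \<beta> \<gamma> + smooth_weyl M x
  for S :: "'s::complex_vector vertex_alg" and \<beta> \<gamma> and M :: "'m::complex_vector set" and x
begin

text \<open>The universal property, applied to the space of fields with the identity field as vacuum
  vector, yields the state-field map. For a generator the commutator formula is
  \<open>comm_prop\<close> and the iterate formula is the definition of \<open>fop\<close>; together
  they give the full identity, which spreads to all states by \<open>Jac_nprod\<close>.\<close>

theorem module_exists: "\<exists>Y. va_module S M Y \<and> (\<forall>i n. \<forall>u\<in>M. Y (gen i) n u = x i n u)"
proof -
  obtain \<Psi> where \<Psi>: "clinear \<Psi>" "\<Psi> (vacuum S) = idf" "\<And>a. \<Psi> a \<in> mfields M"
    "\<And>i n a. \<Psi> (S_act i n a) = fop i n (\<Psi> a)"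
    by (rule universal[OF weyl_fields, OF idf_fields, OF fop_idf]) (assumption, rule that)
  have L: "\<Psi> (a + b) = \<Psi> a + \<Psi> b" "\<Psi> (t *\<^sub>C a) = t *\<^sub>C \<Psi> a" for a b t
    using \<Psi>(1) by (auto simp: clinear_iff)
  have comm: "comm_prop (\<Psi> a)" for a
  proof -
    have "a \<in> {a. comm_prop (\<Psi> a)}"
    proof (rule bg_induct)
      show "cv.subspace {a. comm_prop (\<Psi> a)}"
      proof (rule cv.subspaceI)
        have "\<Psi> 0 = 0" using L(2)[of 0 0] by simp
        moreover have "fop i n 0 = 0" for i n by (rule lin_on_0[OF fop_lin subspace_fields])
        ultimately show "0 \<in> {a. comm_prop (\<Psi> a)}" by (simp add: comm_prop_def)
      next
        fix a b assume "a \<in> {a. comm_prop (\<Psi> a)}" "b \<in> {a. comm_prop (\<Psi> a)}"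
        then have ab: "comm_prop (\<Psi> a)" "comm_prop (\<Psi> b)" by auto
        have ex: "\<exists>J. (\<forall>j\<ge>J. fop i (int j) (\<Psi> a) = 0) \<and> (\<forall>j\<ge>J. fop i (int j) (\<Psi> b) = 0)" for i
        proof -
          obtain J J' where "\<forall>j\<ge>J. fop i (int j) (\<Psi> a) = 0" "\<forall>j\<ge>J'. fop i (int j) (\<Psi> b) = 0"
            using ab unfolding comm_prop_def by blast
          then show ?thesis by (intro exI[of _ "max J J'"]) auto
        qed
        have add: "fop i n (\<Psi> (a + b)) = fop i n (\<Psi> a) + fop i n (\<Psi> b)" for i n
          by (simp add: L lin_onD(1)[OF fop_lin \<Psi>(3) \<Psi>(3)])
        have "x i m (\<Psi> (a + b) t u) - \<Psi> (a + b) t (x i m u)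
          = Sum_any (\<lambda>j. bin m j *\<^sub>C fop i (int j) (\<Psi> (a + b)) (m + t - int j) u)" if u: "u \<in> M" for i m t u
        proof -
          obtain J where J: "\<forall>j\<ge>J. fop i (int j) (\<Psi> a) = 0" "\<forall>j\<ge>J. fop i (int j) (\<Psi> b) = 0" using ex by blast
          have "Sum_any (\<lambda>j. bin m j *\<^sub>C fop i (int j) (\<Psi> (a + b)) (m + t - int j) u)
            = (\<Sum>j<J. bin m j *\<^sub>C fop i (int j) (\<Psi> (a + b)) (m + t - int j) u)"
            by (rule Sum_any_eq_sum) (use J in \<open>auto simp: add\<close>)
          also have "\<dots> = (x i m (\<Psi> a t u) - \<Psi> a t (x i m u)) + (x i m (\<Psi> b t u) - \<Psi> b t (x i m u))"
            unfolding comm_prop_sum[OF ab(1) J(1) u] comm_prop_sum[OF ab(2) J(2) u]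
            by (simp add: add scaleC_add_right sum.distrib)
          finally show ?thesis
            using u by (simp add: L x_add fieldsD(2)[OF \<Psi>(3)])
        qed
        moreover have "\<exists>J. \<forall>j\<ge>J. fop i (int j) (\<Psi> (a + b)) = 0" for i
        proof -
          obtain J where "\<forall>j\<ge>J. fop i (int j) (\<Psi> a) = 0" "\<forall>j\<ge>J. fop i (int j) (\<Psi> b) = 0" using ex by blast
          then show ?thesis by (intro exI[of _ J]) (simp add: add)
        qed
        ultimately show "a + b \<in> {a. comm_prop (\<Psi> a)}" by (simp add: comm_prop_def)
      next
        fix s a assume "a \<in> {a. comm_prop (\<Psi> a)}"
        then have a: "comm_prop (\<Psi> a)" by simp
        have sc: "fop i n (\<Psi> (s *\<^sub>C a)) = s *\<^sub>C fop i n (\<Psi> a)" for i n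
          by (simp add: L lin_onD(2)[OF fop_lin \<Psi>(3)])
        have "\<exists>J. \<forall>j\<ge>J. fop i (int j) (\<Psi> (s *\<^sub>C a)) = 0" for i
          using a unfolding comm_prop_def sc by (metis cv.scale_zero_right)
        moreover have "x i m (\<Psi> (s *\<^sub>C a) t u) - \<Psi> (s *\<^sub>C a) t (x i m u)
          = Sum_any (\<lambda>j. bin m j *\<^sub>C fop i (int j) (\<Psi> (s *\<^sub>C a)) (m + t - int j) u)" if u: "u \<in> M" for i m t u
        proof -
          have "x i m (\<Psi> (s *\<^sub>C a) t u) - \<Psi> (s *\<^sub>C a) t (x i m u) = s *\<^sub>C (x i m (\<Psi> a t u) - \<Psi> a t (x i m u))"
            using u by (simp add: L scaleC_fun_def x_scale fieldsD(2)[OF \<Psi>(3)] cv.scale_right_diff_distrib)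
          also have "\<dots> = s *\<^sub>C Sum_any (\<lambda>j. bin m j *\<^sub>C fop i (int j) (\<Psi> a) (m + t - int j) u)"
            using a u by (simp add: comm_prop_def)
          finally show ?thesis by (simp add: scaleC_Sum_any sc scaleC_fun_def scaleC_scaleC mult.commute)
        qed
        ultimately show "s *\<^sub>C a \<in> {a. comm_prop (\<Psi> a)}" by (simp add: comm_prop_def)
      qed
      show "vacuum S \<in> {a. comm_prop (\<Psi> a)}" by (simp add: \<Psi> comm_prop_idf)
      show "S_act i (- int n) a \<in> {a. comm_prop (\<Psi> a)}" if "n \<ge> 1" "a \<in> {a. comm_prop (\<Psi> a)}" for i n a
        using that by (simp add: \<Psi> comm_prop_fop)
    qed
    then show ?thesis by simp
  qed
  define Y where "Y a n u = \<Psi> a n u" for a n u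
  interpret SM: modes "nprod S" "nprod S" UNIV by (rule modesI[OF vaS vertex_algebraD(1)[OF vaS]])
  interpret Y: modes "nprod S" Y M
    by unfold_locales
      (use subM fieldsD[OF \<Psi>(3)] SM.P_lin SM.P_trunc in \<open>auto simp: Y_def L scaleC_fun_def lin_on_def\<close>)
  have gen: "Y (gen i) n u = x i n u" if "u \<in> M" for i n u
  proof -
    have "S_act i (-1) (vacuum S) = gen i" by (rule vertex_algebraD(2)[OF vaS])
    then show ?thesis using \<Psi>(4)[of i "-1" "vacuum S"] fop_idf_gen[OF that] by (simp add: Y_def \<Psi>(2))
  qed
  have vac: "Y (vacuum S) n u = (if n = -1 then u else 0)" if "u \<in> M" for n u
    using that by (simp add: Y_def \<Psi>(2) idf_def)
  have jac_gen: "Y.Jac (gen i) b u" if u: "u \<in> M" for i b u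
  proof -
    obtain K where K: "bdd_inner (\<lambda>m n. Y (gen i) m (Y b n u)) K" "bdd_inner (\<lambda>n m. Y b n (Y (gen i) m u)) K"
      "bdd_outer (\<lambda>r t. Y (S_act i r b) t u) K" by (rule Y.Jac_bdd[OF u])
    show ?thesis
      unfolding Y.Jac_def
    proof (rule jac_from_comm_iter[OF K])
      fix p q
      have "jacR (\<lambda>m n. Y (gen i) m (Y b n u)) (\<lambda>n m. Y b n (Y (gen i) m u)) p q 0
        = Y (gen i) p (Y b q u) - Y b q (Y (gen i) p u)"
        unfolding jacR_def by (subst Sum_any_eq_sum[of "{0}"]) (auto simp: gbinomial_0_left)
      also have "\<dots> = Sum_any (\<lambda>j. bin p j *\<^sub>C fop i (int j) (\<Psi> b) (p + q - int j) u)"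
        using comm[of b] u by (simp add: gen Y.M_ops comm_prop_def) (simp add: Y_def)
      finally show "jacL (\<lambda>r t. Y (S_act i r b) t u) p q 0
        = jacR (\<lambda>m n. Y (gen i) m (Y b n u)) (\<lambda>n m. Y b n (Y (gen i) m u)) p q 0"
        by (simp add: jacL_def Y_def \<Psi>)
    next
      fix q r
      have "jacL (\<lambda>r t. Y (S_act i r b) t u) 0 q r = fop i r (\<Psi> b) q u"
        unfolding jacL_def by (subst Sum_any_eq_sum[of "{0}"]) (auto simp: gbinomial_0_left Y_def \<Psi>)
      also have "\<dots> = jacR (\<lambda>m n. Y (gen i) m (Y b n u)) (\<lambda>n m. Y b n (Y (gen i) m u)) 0 q r"
        using u unfolding jacR_split[OF K(1,2)]
        by (simp add: fop_def lop_def rop_def shift12_def gen Y.M_ops) (simp add: Y_def algebra_simps)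
      finally show "jacL (\<lambda>r t. Y (S_act i r b) t u) 0 q r
        = jacR (\<lambda>m n. Y (gen i) m (Y b n u)) (\<lambda>n m. Y b n (Y (gen i) m u)) 0 q r" .
    qed
  qed
  have jac_vac: "Y.Jac (vacuum S) b u" if u: "u \<in> M" for b u
  proof -
    obtain K where K: "bdd_inner (\<lambda>m n. Y (vacuum S) m (Y b n u)) K" "bdd_inner (\<lambda>n m. Y b n (Y (vacuum S) m u)) K"
      "bdd_outer (\<lambda>r t. Y (nprod S (vacuum S) r b) t u) K" by (rule Y.Jac_bdd[OF u])
    note v = vac[OF u] vac[OF Y.Y_mem[OF u]] vertex_algebraD(4)[OF vaS]
    show ?thesis
      unfolding Y.Jac_def
    proof (rule jac_from_comm_iter[OF K])
      fix p q
      have "jacR (\<lambda>m n. Y (vacuum S) m (Y b n u)) (\<lambda>n m. Y b n (Y (vacuum S) m u)) p q 0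
        = Y (vacuum S) p (Y b q u) - Y b q (Y (vacuum S) p u)"
        unfolding jacR_def by (subst Sum_any_eq_sum[of "{0}"]) (auto simp: gbinomial_0_left)
      then show "jacL (\<lambda>r t. Y (nprod S (vacuum S) r b) t u) p q 0
        = jacR (\<lambda>m n. Y (vacuum S) m (Y b n u)) (\<lambda>n m. Y b n (Y (vacuum S) m u)) p q 0"
        using u by (simp add: jacL_def v)
    next
      fix q r
      have "jacL (\<lambda>r t. Y (nprod S (vacuum S) r b) t u) 0 q r = (if r = -1 then Y b q u else 0)"
        unfolding jacL_def by (subst Sum_any_eq_sum[of "{0}"]) (use u in \<open>auto simp: gbinomial_0_left v\<close>)
      also have "\<dots> = jacR (\<lambda>m n. Y (vacuum S) m (Y b n u)) (\<lambda>n m. Y b n (Y (vacuum S) m u)) 0 q r"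
      proof (cases "r \<ge> -1")
        case True
        then obtain k where k: "r + 1 = int k" using nonneg_int_cases[of "r + 1"] by auto
        have "jacR (\<lambda>m n. Y (vacuum S) m (Y b n u)) (\<lambda>n m. Y b n (Y (vacuum S) m u)) 0 q r
          = sbin r k *\<^sub>C Y b (q + int k) u"
          unfolding jacR_def by (subst Sum_any_eq_sum[of "{k}"]) (use k in \<open>auto simp: v\<close>)
        moreover have "bin r k = 0" if "r \<noteq> -1"
        proof -
          have "r = int (k - 1)" "k - 1 < k" using that k True by auto
          then show ?thesis using bin_eq_0[of "k - 1" k] by simp
        qed
        ultimately show ?thesis using k by (cases "r = -1") auto
      next
        case False
        then have "r - int j \<noteq> -1" "int j \<noteq> -1" for j by auto
        then show ?thesis using False by (simp add: jacR_def v)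
      qed
      finally show "jacL (\<lambda>r t. Y (nprod S (vacuum S) r b) t u) 0 q r
        = jacR (\<lambda>m n. Y (vacuum S) m (Y b n u)) (\<lambda>n m. Y b n (Y (vacuum S) m u)) 0 q r" .
    qed
  qed
  have jac: "Y.Jac a b u" if u: "u \<in> M" for a b u
  proof -
    have "a \<in> {a. \<forall>b. \<forall>u\<in>M. Y.Jac a b u}"
    proof (rule bg_induct)
      show "cv.subspace {a. \<forall>b. \<forall>u\<in>M. Y.Jac a b u}"
        by (rule Y.P_lin_left_subspace) (rule SM.Y_lin1[OF UNIV_I])
      show "vacuum S \<in> {a. \<forall>b. \<forall>u\<in>M. Y.Jac a b u}" using jac_vac by simp
      fix i n a assume a: "a \<in> {a. \<forall>b. \<forall>u\<in>M. Y.Jac a b u}"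
      have "Y.Jac (S_act i (- int n) a) b u" if "u \<in> M" for b u
      proof (rule Y.Jac_nprod[OF that jac_gen])
        show "nprod S (S_act i (- int n) a) r b = Sum_any (\<lambda>ia. ((- 1) ^ ia * bin (- int n) ia) *\<^sub>C
          (S_act i (- int n - int ia) (nprod S a (r + int ia) b) -
           (- 1) powi - int n *\<^sub>C nprod S a (r + - int n - int ia) (S_act i (int ia) b)))" for r
          by (rule SM.Jac_iter[OF modes_Jac[OF vaS vertex_algebraD(1)[OF vaS] UNIV_I]])
      qed (use a in auto)
      then show "S_act i (- int n) a \<in> {a. \<forall>b. \<forall>u\<in>M. Y.Jac a b u}" by simp
    qed
    then show ?thesis using u by simp
  qed
  have "va_module S M Y" using Y.va_module_iff[OF refl] vac jac by blast
  then show ?thesis using gen by blast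
qed

end

context bg begin

lemma module_exists:
  assumes "weyl M x" "smooth M x"
  obtains Y where "va_module S M Y" "\<And>i n u. u \<in> M \<Longrightarrow> Y (gen i) n u = x i n u"
proof -
  interpret bg_weyl S \<beta> \<gamma> M x by unfold_locales (use assms in auto)
  show ?thesis using module_exists that by blast
qed

lemma iterate:
  assumes "va_module S M Y" "u \<in> M"
  shows "Y (nprod S a r b) t u = Sum_any (\<lambda>j. sbin r j *\<^sub>C
    (Y a (r - int j) (Y b (t + int j) u) - (-1) powi r *\<^sub>C Y b (t + r - int j) (Y a (int j) u)))"
proof -
  interpret modes "nprod S" Y M by (rule modesI[OF vaS assms(1)])
  show ?thesis by (rule Jac_iter[OF modes_Jac[OF vaS assms]])
qed

lemma va_submoduleI:
  assumes Y: "va_module S M Y" and K: "cv.subspace K" "K \<subseteq> M"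
    and gen: "\<And>i n u. u \<in> K \<Longrightarrow> Y (gen i) n u \<in> K"
  shows "va_submodule S M Y K"
proof -
  interpret modes "nprod S" Y M by (rule modesI[OF vaS Y])
  have "a \<in> {a. \<forall>n. \<forall>u\<in>K. Y a n u \<in> K}" for a
  proof (rule bg_induct)
    show "cv.subspace {a. \<forall>n. \<forall>u\<in>K. Y a n u \<in> K}"
      by (rule cv.subspaceI)
        (use K in \<open>auto simp: Y_add_left Y_scale_left subset_iff intro: cv.subspace_add cv.subspace_scale cv.subspace_0\<close>)
    show "vacuum S \<in> {a. \<forall>n. \<forall>u\<in>K. Y a n u \<in> K}"
      using K va_moduleD(6)[OF Y] by (auto simp: cv.subspace_0)
    show "S_act i (- int n) a \<in> {a. \<forall>n. \<forall>u\<in>K. Y a n u \<in> K}" if "a \<in> {a. \<forall>n. \<forall>u\<in>K. Y a n u \<in> K}" for i n a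
    proof safe
      fix t u assume u: "u \<in> K"
      then show "Y (S_act i (- int n) a) t u \<in> K"
        unfolding iterate[OF Y subsetD[OF K(2) u]] using that gen
        by (intro Sum_any_mem[OF K(1)] cv.subspace_scale[OF K(1)] cv.subspace_diff[OF K(1)]) auto
    qed
  qed
  then show ?thesis using K by (simp add: va_submodule_def)
qed

lemma module_homI:
  assumes Y: "va_module S M Y" and Y': "va_module S M' Y'" and f: "lin_on M f" "\<And>u. u \<in> M \<Longrightarrow> f u \<in> M'"
    and gen: "\<And>i n u. u \<in> M \<Longrightarrow> f (Y (gen i) n u) = Y' (gen i) n (f u)"
  shows "module_hom S M Y M' Y' f"
proof -
  interpret modes "nprod S" Y M by (rule modesI[OF vaS Y])
  interpret Y': modes "nprod S" Y' M' by (rule modesI[OF vaS Y'])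
  have "a \<in> {a. \<forall>n. \<forall>u\<in>M. f (Y a n u) = Y' a n (f u)}" for a
  proof (rule bg_induct)
    show "cv.subspace {a. \<forall>n. \<forall>u\<in>M. f (Y a n u) = Y' a n (f u)}"
      by (rule cv.subspaceI)
        (auto simp: Y_add_left Y_scale_left Y'.Y_add_left Y'.Y_scale_left f lin_onD[OF f(1)] M_ops lin_on_0[OF f(1) subM])
    show "vacuum S \<in> {a. \<forall>n. \<forall>u\<in>M. f (Y a n u) = Y' a n (f u)}"
      using va_moduleD(6)[OF Y] va_moduleD(6)[OF Y'] f by (auto simp: lin_on_0[OF f(1) subM])
    show "S_act i (- int n) a \<in> {a. \<forall>n. \<forall>u\<in>M. f (Y a n u) = Y' a n (f u)}"
      if a: "a \<in> {a. \<forall>n. \<forall>u\<in>M. f (Y a n u) = Y' a n (f u)}" for i n a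
    proof safe
      fix t u assume u: "u \<in> M"
      show "f (Y (S_act i (- int n) a) t u) = Y' (S_act i (- int n) a) t (f u)"
        unfolding iterate[OF Y u] iterate[OF Y' f(2)[OF u]]
        using a u by (subst lin_on_Sum_any[OF f(1) subM _ fin_iter[OF u]])
          (auto simp: M_ops lin_onD[OF f(1)] lin_on_diff[OF f(1) subM] gen)
    qed
  qed
  then show ?thesis using f by (auto simp: module_hom_def lin_on_def)
qed

end

section \<open>Eigenvectors and generalised eigenvectors\<close>

lemma lin_on_span_image:
  assumes T: "lin_on M T" "cv.subspace M" and X: "X \<subseteq> M" "\<And>u. u \<in> X \<Longrightarrow> T u \<in> K" and K: "cv.subspace K"
    and u: "u \<in> cv.span X"
  shows "T u \<in> K"
proof -
  have "X \<subseteq> {u\<in>M. T u \<in> K}" using X by auto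
  moreover have "cv.subspace {u\<in>M. T u \<in> K}"
    by (rule cv.subspaceI)
      (auto simp: lin_on_0[OF T] cv.subspace_0[OF T(2)] cv.subspace_0[OF K] lin_onD[OF T(1)]
        intro: cv.subspace_add[OF K] cv.subspace_scale[OF K] cv.subspace_add[OF T(2)] cv.subspace_scale[OF T(2)])
  ultimately show ?thesis using cv_span_subspace_induct u by blast
qed

lemma span_in_subspace: "cv.subspace M \<Longrightarrow> X \<subseteq> M \<Longrightarrow> u \<in> cv.span X \<Longrightarrow> u \<in> M"
  by (rule cv_span_subspace_induct)

text \<open>An eigenvector in a span of eigenvectors only involves those of its own eigenvalue: the other
  eigenvalues are eliminated one at a time by applying \<open>T - \<lambda>\<close>.\<close>

lemma eigen_span:
  assumes T: "lin_on M T" "cv.subspace M" and X: "X \<subseteq> M" "\<And>x. x \<in> X \<Longrightarrow> \<exists>\<mu>. T x = \<mu> *\<^sub>C x"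
    and u: "u \<in> cv.span X" "T u = c *\<^sub>C u"
  shows "u \<in> cv.span {x\<in>X. T x = c *\<^sub>C x}"
proof -
  let ?X = "\<lambda>\<Lambda>. {x\<in>X. \<exists>\<mu>\<in>\<Lambda>. T x = \<mu> *\<^sub>C x}"
  have main: "u \<in> cv.span (?X {c})" if "finite \<Lambda>" "u \<in> cv.span (?X (insert c \<Lambda>))" "T u = c *\<^sub>C u" for \<Lambda> u
    using that
  proof (induction \<Lambda> arbitrary: u)
    case (insert \<kappa> \<Lambda>)
    show ?case
    proof (cases "\<kappa> = c")
      case False
      have "?X (insert c (insert \<kappa> \<Lambda>)) = ?X {\<kappa>} \<union> ?X (insert c \<Lambda>)" by auto
      then obtain a b where ab: "u = a + b" "a \<in> cv.span (?X {\<kappa>})" "b \<in> cv.span (?X (insert c \<Lambda>))"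
        using insert.prems(1) by (auto simp: cv.span_Un)
      have M: "a \<in> M" "b \<in> M" by (rule span_in_subspace[OF T(2)], use ab X(1) in auto)+
      have "?X {\<kappa>} \<subseteq> {u\<in>M. T u = \<kappa> *\<^sub>C u}" using X(1) by auto
      moreover have "cv.subspace {u\<in>M. T u = \<kappa> *\<^sub>C u}"
        by (rule cv.subspaceI) (auto simp: lin_on_0[OF T] lin_onD[OF T(1)] scaleC_add_right scaleC_scaleC mult.commute
          cv.subspace_0[OF T(2)] cv.subspace_add[OF T(2)] cv.subspace_scale[OF T(2)])
      ultimately have a: "T a = \<kappa> *\<^sub>C a" using cv_span_subspace_induct ab(2) by blast
      have b: "T b \<in> cv.span (?X (insert c \<Lambda>))"
      proof (rule lin_on_span_image[OF T _ _ cv.subspace_span ab(3)])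
        fix y assume y: "y \<in> ?X (insert c \<Lambda>)"
        then obtain \<mu> where "T y = \<mu> *\<^sub>C y" by blast
        then show "T y \<in> cv.span (?X (insert c \<Lambda>))" using cv.span_scale[OF cv.span_base[OF y]] by simp
      qed (use X(1) in auto)
      have "(c - \<kappa>) *\<^sub>C u = T b - \<kappa> *\<^sub>C b"
        using insert.prems(2) unfolding ab(1) lin_onD(1)[OF T(1) M] a
        by (simp add: cv.scale_left_diff_distrib scaleC_add_right algebra_simps)
      also have "\<dots> \<in> cv.span (?X (insert c \<Lambda>))"
        by (rule cv.span_diff[OF b cv.span_scale[OF ab(3)]])
      finally have "inverse (c - \<kappa>) *\<^sub>C (c - \<kappa>) *\<^sub>C u \<in> cv.span (?X (insert c \<Lambda>))" by (rule cv.span_scale)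
      then have "u \<in> cv.span (?X (insert c \<Lambda>))" using False by (simp add: scaleC_scaleC scaleC_one)
      then show ?thesis using insert by blast
    qed (use insert in auto)
  qed simp
  obtain F r where F: "finite F" "F \<subseteq> X" "u = (\<Sum>a\<in>F. r a *\<^sub>C a)" using u(1) cv.span_explicit[of X] by auto
  define e where "e x = (SOME \<mu>. T x = \<mu> *\<^sub>C x)" for x
  have e: "T x = e x *\<^sub>C x" if "x \<in> X" for x unfolding e_def by (rule someI_ex) (rule X(2)[OF that])
  have "u \<in> cv.span (?X (insert c (e ` F)))"
    unfolding F(3) using F(2) e by (intro cv.span_sum cv.span_scale cv.span_base) auto
  from main[OF _ this u(2)] F(1) show ?thesis by simp
qed

text \<open>The product of the operators T - c. A vector killed by \<open>pol T cs\<close> is a sum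
  of generalised eigenvectors with eigenvalues in cs, which allows statements about weights before
  anything is known about semisimplicity.\<close>

definition pol :: "('m::complex_vector \<Rightarrow> 'm) \<Rightarrow> complex list \<Rightarrow> 'm \<Rightarrow> 'm" where
  "pol T cs u = foldr (\<lambda>c v. T v - c *\<^sub>C v) cs u"

lemma pol_simps [simp]: "pol T [] u = u" "pol T (c # cs) u = T (pol T cs u) - c *\<^sub>C pol T cs u"
  by (simp_all add: pol_def)

lemma pol_append: "pol T (cs @ ds) u = pol T cs (pol T ds u)"
  by (simp add: pol_def)

locale endo =
  fixes M :: "'m::complex_vector set" and T :: "'m \<Rightarrow> 'm"
  assumes subM: "cv.subspace M" and T_lin: "lin_on M T" and T_mem: "u \<in> M \<Longrightarrow> T u \<in> M"
begin

lemmas ops = cv.subspace_add[OF subM] cv.subspace_scale[OF subM] cv.subspace_diff[OF subM] cv.subspace_0[OF subM] T_mem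
lemmas T_add = lin_onD(1)[OF T_lin] and T_scale = lin_onD(2)[OF T_lin] and T_diff = lin_on_diff[OF T_lin subM]
lemma T_0 [simp]: "T 0 = 0" by (rule lin_on_0[OF T_lin subM])

lemma pol_mem: "u \<in> M \<Longrightarrow> pol T cs u \<in> M"
  by (induction cs) (auto simp: ops)

lemma pol_lin: "lin_on M (pol T cs)"
proof (induction cs)
  case (Cons c cs)
  then show ?case unfolding lin_on_def
    by (auto simp: pol_mem T_add T_scale scaleC_add_right cv.scale_right_diff_distrib scaleC_scaleC mult.commute algebra_simps)
qed (simp add: lin_on_def)

lemma pol_T: "u \<in> M \<Longrightarrow> pol T cs (T u) = T (pol T cs u)"
  by (induction cs) (auto simp: pol_mem T_diff T_scale ops)

lemma pol_0 [simp]: "pol T cs 0 = 0" by (rule lin_on_0[OF pol_lin subM])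

lemma pol_comm: "u \<in> M \<Longrightarrow> pol T cs (pol T ds u) = pol T ds (pol T cs u)"
proof (induction cs)
  case (Cons c cs)
  then show ?case
    by (simp add: lin_on_diff[OF pol_lin subM] pol_mem ops lin_onD(2)[OF pol_lin] pol_T)
qed simp

lemma pol_eigen: "u \<in> M \<Longrightarrow> T u = c *\<^sub>C u \<Longrightarrow> pol T cs u = (\<Prod>d\<leftarrow>cs. c - d) *\<^sub>C u"
proof (induction cs)
  case (Cons d cs)
  then show ?case
    by (simp add: T_scale scaleC_scaleC cv.scale_left_diff_distrib left_diff_distrib mult.commute)
qed (simp add: scaleC_one)

text \<open>The last nonzero vector of the chain under T - c is an eigenvector, on which
  \<open>pol T cs\<close> is the product of the nonzero numbers c - d.\<close>

lemma pol_coprime: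
  assumes "u \<in> M" "pol T (replicate k c) u = 0" "pol T cs u = 0" "c \<notin> set cs"
  shows "u = 0"
  using assms
proof (induction k arbitrary: u)
  case (Suc k)
  let ?v = "pol T (replicate k c) u"
  have v: "?v \<in> M" "T ?v = c *\<^sub>C ?v" using Suc.prems by (auto simp: pol_mem)
  have "pol T cs ?v = 0" using Suc.prems by (simp add: pol_comm[of u cs])
  then have "(\<Prod>d\<leftarrow>cs. c - d) *\<^sub>C ?v = 0" using pol_eigen[OF v] by simp
  moreover have "(\<Prod>d\<leftarrow>cs. c - d) \<noteq> 0" using Suc.prems(4) by (induction cs) auto
  ultimately have "?v = 0" by simp
  then show ?case using Suc by blast
qed simp

lemma subspace_pol: "cv.subspace {u\<in>M. \<exists>cs. set cs \<subseteq> A \<and> pol T cs u = 0}"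
proof (rule cv.subspaceI)
  show "0 \<in> {u\<in>M. \<exists>cs. set cs \<subseteq> A \<and> pol T cs u = 0}" by (auto simp: ops intro: exI[of _ "[]"])
  fix u v assume "u \<in> {u\<in>M. \<exists>cs. set cs \<subseteq> A \<and> pol T cs u = 0}" "v \<in> {u\<in>M. \<exists>cs. set cs \<subseteq> A \<and> pol T cs u = 0}"
  then obtain cs ds where c: "u \<in> M" "v \<in> M" "set cs \<subseteq> A" "set ds \<subseteq> A" "pol T cs u = 0" "pol T ds v = 0" by auto
  then have "pol T (cs @ ds) (u + v) = 0"
    by (simp add: pol_append lin_onD(1)[OF pol_lin] pol_mem ops pol_comm[of u cs ds])
  then show "u + v \<in> {u\<in>M. \<exists>cs. set cs \<subseteq> A \<and> pol T cs u = 0}"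
    using c by (auto simp: ops intro!: exI[of _ "cs @ ds"])
next
  fix t u assume "u \<in> {u\<in>M. \<exists>cs. set cs \<subseteq> A \<and> pol T cs u = 0}"
  then show "t *\<^sub>C u \<in> {u\<in>M. \<exists>cs. set cs \<subseteq> A \<and> pol T cs u = 0}"
    by (auto simp: ops lin_onD(2)[OF pol_lin])
qed

text \<open>If \<open>u\<close> is annihilated by a product of \<open>T - c\<close>, the factors with \<open>c \<noteq> a\<close> can be inverted on the
  part belonging to \<open>a\<close>.\<close>

lemma pol_filter:
  assumes "u \<in> M" "pol T cs u = 0"
  obtains k w where "w \<in> M" "w = (\<Prod>c\<leftarrow>filter (\<lambda>c. c \<noteq> a) cs. inverse (a - c)) *\<^sub>C pol T (filter (\<lambda>c. c \<noteq> a) cs) u"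
    "pol T (replicate k a) w = 0"
proof -
  have "\<exists>k. pol T (replicate k a) (pol T (filter (\<lambda>c. c \<noteq> a) cs) u) = 0" if "u \<in> M" "pol T cs u = 0" for u
    using that
  proof (induction cs arbitrary: u)
    case (Cons c cs)
    have 1: "pol T cs (pol T [c] u) = 0" using Cons.prems pol_comm[of u cs "[c]"] by simp
    have m: "pol T [c] u \<in> M" using Cons.prems by (intro pol_mem)
    obtain k where k: "pol T (replicate k a) (pol T (filter (\<lambda>c. c \<noteq> a) cs) (pol T [c] u)) = 0"
      using Cons.IH[OF m 1] by blast
    show ?case
    proof (cases "c = a")
      case True
      have "pol T (replicate k a @ [a]) (pol T (filter (\<lambda>c. c \<noteq> a) cs) u) = 0"
        unfolding pol_append using k True Cons.prems(1) pol_comm[of u "filter (\<lambda>c. c \<noteq> a) cs" "[a]"] by simp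
      then show ?thesis using True by (auto simp: replicate_append_same simp flip: replicate_Suc intro!: exI[of _ "Suc k"])
    next
      case False
      have "pol T (filter (\<lambda>c. c \<noteq> a) cs) (pol T [c] u) = pol T (filter (\<lambda>c. c \<noteq> a) (c # cs)) u"
        using False Cons.prems(1) pol_comm[of u "filter (\<lambda>c. c \<noteq> a) cs" "[c]"] by simp
      then show ?thesis using k by auto
    qed
  qed (auto intro: exI[of _ 0])
  then obtain k where k: "pol T (replicate k a) (pol T (filter (\<lambda>c. c \<noteq> a) cs) u) = 0" using assms by blast
  show ?thesis
    by (rule that[OF _ refl, of k]) (use k assms in \<open>auto simp: ops pol_mem lin_onD(2)[OF pol_lin]\<close>)
qed

end

section \<open>Weighted number operators and spectral flow\<close>

context smooth_weyl begin

definition pairop :: "int \<Rightarrow> 'm \<Rightarrow> 'm" where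
  "pairop n u = (if n \<ge> 0 then x True (- n - 1) (x False n u) else x False n (x True (- n - 1) u))"

text \<open>The weights 1 and n give the charge, the zero mode of :gamma beta:, and the conformal
  weight, the zero mode of :(d gamma) beta:, as \<open>charge_mode\<close> and
  \<open>conformal_mode\<close> confirm. A third choice of weights later counts creation
  modes.\<close>

definition qop :: "(int \<Rightarrow> complex) \<Rightarrow> 'm \<Rightarrow> 'm" where
  "qop w u = Sum_any (\<lambda>n. w n *\<^sub>C pairop n u)"

text \<open>The factor by which the commutator of \<open>qop w\<close> with a mode rescales it: plus
  the weight for gamma and minus the weight for beta, taken at the pair n in which the mode
  occurs.\<close>

definition charge :: "(int \<Rightarrow> complex) \<Rightarrow> bool \<Rightarrow> int \<Rightarrow> complex" where
  "charge w i m = (if i then w (- m - 1) else - w m)"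

lemma pairop_mem: "u \<in> M \<Longrightarrow> pairop n u \<in> M" by (simp add: pairop_def M_ops)

lemma fin_pairop: assumes u: "u \<in> M" shows "finite {n. c n *\<^sub>C pairop n u \<noteq> 0}"
proof -
  obtain K where K: "\<forall>n\<ge>K. x False n u = 0" using smoothD[OF smooth u] by blast
  obtain K' where K': "\<forall>n\<ge>K'. x True n u = 0" using smoothD[OF smooth u] by blast
  have "pairop n u = 0" if "n \<notin> {min 0 (- K' - 1)..max 0 K}" for n
    using that K K' by (auto simp: pairop_def)
  then have "{n. c n *\<^sub>C pairop n u \<noteq> 0} \<subseteq> {min 0 (- K' - 1)..max 0 K}"
    by (metis (mono_tags, lifting) cv.scale_zero_right mem_Collect_eq subsetI)
  then show ?thesis by (rule finite_subset) simp
qed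

lemma qop_mem: "u \<in> M \<Longrightarrow> qop w u \<in> M"
  unfolding qop_def by (intro M_ops pairop_mem)

lemma pairop_lin: "lin_on M (pairop n)"
  by (auto simp: lin_on_def pairop_def x_add x_scale M_ops)

lemma qop_lin: "lin_on M (qop w)"
  unfolding lin_on_def qop_def
  by (auto simp: lin_onD[OF pairop_lin] scaleC_add_right Sum_any.distrib[OF fin_pairop fin_pairop]
      scaleC_Sum_any scaleC_scaleC mult.commute)

lemma endo_qop: "endo M (qop w)"
  by unfold_locales (auto intro: subM qop_lin qop_mem)

lemma pairop_x:
  assumes u: "u \<in> M"
  shows "pairop n (x i m u) = x i m (pairop n u) +
    (if n = (if i then - m - 1 else m) then (if i then 1 else -1) *\<^sub>C x i m u else 0)"
proof -
  have om: "om False False = 0" "om True True = 0" "om False True = 1" "om True False = -1" by (auto simp: om_def)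
  have e: "(m + (- n - 1) = - 1) = (n = m)" "(- n - 1 + m = - 1) = (n = m)"
    "(n + m = - 1) = (n = - m - 1)" "(m + n = - 1) = (n = - m - 1)" by auto
  show ?thesis
  proof (cases i)
    case False
    have 1: "x False n (x False m u) = x False m (x False n u)" using x_swap[OF u, of False n False m] by (simp add: om)
    have 2: "x True (- n - 1) (x False m v) = x False m (x True (- n - 1) v) + (if n = m then - v else 0)" if "v \<in> M" for v
      using x_swap[OF that, of True "- n - 1" False m] by (simp add: om e scaleC_one del: minus_diff_eq)
    have 3: "x False n (x False m v) = x False m (x False n v)" if "v \<in> M" for v
      using x_swap[OF that, of False n False m] by (simp add: om)
    have neg: "x False k (- u) = - x False k u" for k
      using x_scale[OF u, of False k "-1"] by (simp add: scaleC_one)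
    have "- u \<in> M" using M_ops(2)[OF u, of "-1"] by (simp add: scaleC_one)
    then show ?thesis using False u
      by (auto simp: pairop_def 1 2 3 M_ops x_add neg scaleC_one)
  next
    case True
    have 1: "x False n (x True m v) = x True m (x False n v) + (if n = - m - 1 then v else 0)" if "v \<in> M" for v
      using x_swap[OF that, of False n True m] by (simp add: om e scaleC_one)
    have 2: "x True k (x True m v) = x True m (x True k v)" if "v \<in> M" for v k
      using x_swap[OF that, of True k True m] by (simp add: om)
    show ?thesis using True u
      by (auto simp: pairop_def 1 2 M_ops x_add scaleC_one)
  qed
qed

lemma qop_x:
  assumes u: "u \<in> M"
  shows "qop w (x i m u) = x i m (qop w u) + charge w i m *\<^sub>C x i m u"
proof -
  let ?k = "if i then - m - 1 else m"
  let ?d = "\<lambda>n. if n = ?k then charge w i m *\<^sub>C x i m u else 0"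
  have "qop w (x i m u) = Sum_any (\<lambda>n. x i m (w n *\<^sub>C pairop n u) + ?d n)"
    unfolding qop_def by (rule Sum_any.cong)
      (auto simp: pairop_x[OF u] scaleC_add_right scaleC_scaleC charge_def x_scale pairop_mem u)
  also have "\<dots> = Sum_any (\<lambda>n. x i m (w n *\<^sub>C pairop n u)) + Sum_any ?d"
  proof (rule Sum_any.distrib)
    show "finite {n. x i m (w n *\<^sub>C pairop n u) \<noteq> 0}"
      by (rule finite_subset[OF _ fin_pairop[OF u, of w]]) auto
    show "finite {n. ?d n \<noteq> 0}" by (rule finite_subset[of _ "{?k}"]) auto
  qed
  also have "Sum_any (\<lambda>n. x i m (w n *\<^sub>C pairop n u)) = x i m (qop w u)"
    unfolding qop_def by (rule x_Sum_any[symmetric, OF _ fin_pairop[OF u]]) (simp add: M_ops pairop_mem u)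
  also have "Sum_any ?d = charge w i m *\<^sub>C x i m u" by simp
  finally show ?thesis .
qed

lemma qop_eigen_x:
  assumes "u \<in> M" "qop w u = h *\<^sub>C u"
  shows "qop w (x i m u) = (h + charge w i m) *\<^sub>C x i m u"
  using assms by (simp add: qop_x x_scale scaleC_add_left)

end

definition spec :: "int \<Rightarrow> (bool \<Rightarrow> int \<Rightarrow> 'm \<Rightarrow> 'm) \<Rightarrow> bool \<Rightarrow> int \<Rightarrow> 'm \<Rightarrow> 'm" where
  "spec l x i n = x i (if i then n + l else n - l)"

lemma spec_simps [simp]: "spec l x False n = x False (n - l)" "spec l x True n = x True (n + l)"
  by (auto simp: spec_def)

lemma spec_spec [simp]: "spec l (spec k x) = spec (l + k) x"
  by (auto simp: spec_def fun_eq_iff algebra_simps)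

lemma spec_0 [simp]: "spec 0 x = x"
  by (auto simp: spec_def fun_eq_iff)

lemma weyl_spec: "weyl M x \<Longrightarrow> weyl M (spec l x)"
proof -
  assume x: "weyl M x"
  have sw: "spec l x i m (spec l x j n u) = spec l x j n (spec l x i m u) + (if m + n = -1 then om i j *\<^sub>C u else 0)"
    if "u \<in> M" for i j m n u
    unfolding spec_def weylD(4)[OF x that, of i "if i then m + l else m - l"] by (auto simp: om_def)
  have m: "spec l x i n u \<in> M" if "u \<in> M" for i n u using weylD(2)[OF x that] by (simp add: spec_def)
  have l: "lin_on M (spec l x i n)" for i n using weylD(3)[OF x] by (simp add: spec_def)
  show ?thesis
    unfolding weyl_def[of M "spec l x"] by (intro conjI allI ballI weylD(1)[OF x] m l sw)
qed

lemma smooth_spec: assumes "smooth M x" shows "smooth M (spec l x)"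
proof -
  have "\<exists>K. \<forall>n\<ge>K. spec l x i n u = 0" if u: "u \<in> M" for i u
  proof -
    obtain K where "\<forall>n\<ge>K. x i n u = 0" using smoothD[OF assms u] by blast
    then show ?thesis by (intro exI[of _ "K + \<bar>l\<bar>"]) (auto simp: spec_def)
  qed
  then show ?thesis by (simp add: smooth_def)
qed

text \<open>The normal ordering constant picked up by a weighted number operator under spectral flow.\<close>

definition spec_const :: "int \<Rightarrow> (int \<Rightarrow> complex) \<Rightarrow> complex" where
  "spec_const l w = (\<Sum>m\<in>{0..<- l}. w (m + l)) - (\<Sum>m\<in>{- l..<0}. w (m + l))"

lemma sum_int_interval: "(\<Sum>m\<in>{0..<int k}. of_int m) = (of_nat k * (of_nat k - 1) / 2 :: complex)"
proof (induction k)
  case (Suc k)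
  have "{0..<int (Suc k)} = insert (int k) {0..<int k}" by auto
  then show ?case using Suc by (simp add: field_simps)
qed simp

lemma spec_const_1: "spec_const l (\<lambda>_. 1) = - of_int l"
  by (cases "l \<ge> 0") (auto simp: spec_const_def)

lemma spec_const_L: "spec_const l (\<lambda>n. of_int (n - l)) = of_int (l * (l + 1)) / 2"
proof (cases "l \<ge> 0")
  case True
  then obtain k where k: "l = int k" using nonneg_int_cases by blast
  have "(\<Sum>m\<in>{- l..<0}. of_int m :: complex) = (\<Sum>m\<in>{0..<int k}. of_int (- 1 - m))"
    by (rule sum.reindex_bij_witness[of _ "\<lambda>m. - 1 - m" "\<lambda>m. - 1 - m"]) (auto simp: k)
  also have "\<dots> = - of_nat k - (\<Sum>m\<in>{0..<int k}. of_int m)" by (simp add: sum_subtractf)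
  also have "\<dots> = - (of_nat k * (of_nat k + 1) / 2)" unfolding sum_int_interval by (simp add: field_simps)
  finally show ?thesis using True by (simp add: spec_const_def k)
next
  case False
  then obtain k where k: "l = - int k" using int_cases4[of l] by (metis nat_int_comparison(2) nle_le of_nat_0_le_iff)
  have "(\<Sum>m\<in>{0..<- l}. of_int m :: complex) = of_nat k * (of_nat k - 1) / 2"
    using sum_int_interval[of k] by (simp add: k)
  then show ?thesis using False by (simp add: spec_const_def k field_simps)
qed

locale weyl_spec = smooth_weyl M x for M :: "'m::complex_vector set" and x +
  fixes l :: int
begin

sublocale F: smooth_weyl M "spec l x"
  by unfold_locales (auto intro: weyl_spec smooth_spec weyl smooth)

text \<open>Spectral flow moves the boundary between the two normal orderings from n = 0 to n = -l.
  The pairs in between are written in the opposite order, and each costs one commutator.\<close>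

lemma spec_pairop:
  assumes u: "u \<in> M"
  shows "F.pairop (n + l) u = pairop n u
    + (if 0 \<le> n \<and> n < - l then u else 0) - (if - l \<le> n \<and> n < 0 then u else 0)"
proof -
  have "x False n (x True (- n - 1) u) = x True (- n - 1) (x False n u) + u"
    using x_swap[OF u, of False n True "- n - 1"] by (simp add: om_def scaleC_one)
  moreover have "- (n + l) - 1 + l = - n - 1" "n + l - l = n" by simp_all
  ultimately show ?thesis unfolding F.pairop_def pairop_def spec_simps by auto
qed

lemma spec_qop:
  assumes u: "u \<in> M"
  shows "F.qop w u = qop (\<lambda>n. w (n + l)) u + spec_const l w *\<^sub>C u"
proof -
  have shift: "Sum_any f = Sum_any (\<lambda>n. f (n + l))" for f :: "int \<Rightarrow> 'm"
    using Sum_any.reindex_cong[OF _ refl, of "\<lambda>n. n + l" f] o_bij[of "\<lambda>n. n - l" "\<lambda>n. n + l"]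
    by (simp add: comp_def fun_eq_iff id_def)
  let ?a = "\<lambda>n. if n \<in> {0..<- l} then w (n + l) *\<^sub>C u else 0"
  let ?b = "\<lambda>n. if n \<in> {- l..<0} then w (n + l) *\<^sub>C u else 0"
  have fin: "finite {n. ?a n \<noteq> 0}" "finite {n. ?b n \<noteq> 0}"
    by (rule finite_subset[of _ "{0..<- l}"], auto)[1] (rule finite_subset[of _ "{- l..<0}"], auto)
  have "F.qop w u = Sum_any (\<lambda>n. w (n + l) *\<^sub>C F.pairop (n + l) u)"
    unfolding F.qop_def by (rule shift)
  also have "\<dots> = Sum_any (\<lambda>n. w (n + l) *\<^sub>C pairop n u + (?a n - ?b n))"
    by (rule Sum_any.cong) (auto simp: spec_pairop[OF u] scaleC_add_right cv.scale_right_diff_distrib algebra_simps)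
  also have "\<dots> = qop (\<lambda>n. w (n + l)) u + (Sum_any ?a - Sum_any ?b)"
  proof -
    have "finite {n. ?a n - ?b n \<noteq> 0}" by (rule finite_subset[OF _ finite_UnI[OF fin]]) auto
    then show ?thesis
      unfolding qop_def by (simp only: Sum_any.distrib[OF fin_pairop[OF u]] Sum_any_diff[OF fin])
  qed
  also have "Sum_any ?a = (\<Sum>n\<in>{0..<- l}. w (n + l)) *\<^sub>C u"
    by (subst Sum_any_eq_sum[of "{0..<- l}"]) (auto simp: cv.scale_sum_left)
  also have "Sum_any ?b = (\<Sum>n\<in>{- l..<0}. w (n + l)) *\<^sub>C u"
    by (subst Sum_any_eq_sum[of "{- l..<0}"]) (auto simp: cv.scale_sum_left)
  finally show ?thesis by (simp add: spec_const_def cv.scale_left_diff_distrib)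
qed

end

context smooth_weyl begin

abbreviation Jop where "Jop \<equiv> qop (\<lambda>_. 1)"
abbreviation Lop where "Lop \<equiv> qop of_int"

definition vac_vec :: "int \<Rightarrow> 'm \<Rightarrow> bool" where
  "vac_vec l v \<longleftrightarrow> v \<in> M \<and> v \<noteq> 0 \<and> (\<forall>i. \<forall>n\<ge>0. spec l x i n v = 0)"

text \<open>The number operators of the flowed modes vanish on v, so the original ones act by minus
  the normal ordering constants.\<close>

lemma vac_vec_eigen:
  assumes "vac_vec l v"
  shows "Jop v = of_int l *\<^sub>C v" "Lop v = of_int (- (l * (l + 1) div 2)) *\<^sub>C v"
proof -
  interpret weyl_spec M x l by unfold_locales
  have v: "v \<in> M" using assms by (simp add: vac_vec_def)
  have k: "spec l x i n v = 0" if "n \<ge> 0" for i n using assms that unfolding vac_vec_def by blast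
  have "F.pairop n v = 0" for n
    using k[of n False] k[of "- n - 1" True] F.x_0[of True "- n - 1"] F.x_0[of False n]
    by (cases "n \<ge> 0") (auto simp: F.pairop_def)
  then have q: "F.qop w v = 0" for w by (simp add: F.qop_def)
  show "Jop v = of_int l *\<^sub>C v"
    using spec_qop[OF v, of "\<lambda>_. 1"] by (simp add: q spec_const_1 add_eq_0_iff)
  have "qop of_int v = - (of_int (l * (l + 1)) / 2) *\<^sub>C v"
    using spec_qop[OF v, of "\<lambda>n. of_int (n - l)"] unfolding spec_const_L by (simp add: q add_eq_0_iff)
  also have "(of_int (l * (l + 1)) / 2 :: complex) = of_int (l * (l + 1) div 2)"
  proof -
    have "even (l * (l + 1))" by auto
    then have "l * (l + 1) = 2 * (l * (l + 1) div 2)" by simp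
    then have "(of_int (l * (l + 1)) :: complex) = 2 * of_int (l * (l + 1) div 2)" by (metis of_int_mult of_int_numeral)
    then show ?thesis by simp
  qed
  finally show "Lop v = of_int (- (l * (l + 1) div 2)) *\<^sub>C v" by simp
qed

end

section \<open>Irreducibility of the vacuum module\<close>

lemma lin_on_image_subspace:
  assumes f: "lin_on M f" and M: "cv.subspace M"
  shows "cv.subspace (f ` M)"
proof (rule cv.subspaceI)
  show "0 \<in> f ` M" using imageI[OF cv.subspace_0[OF M], of f] by (simp add: lin_on_0[OF f M])
  show "u + v \<in> f ` M" if "u \<in> f ` M" "v \<in> f ` M" for u v
    using that lin_onD(1)[OF f] cv.subspace_add[OF M] by (auto simp: image_iff) metis
  show "t *\<^sub>C u \<in> f ` M" if "u \<in> f ` M" for t u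
    using that lin_onD(2)[OF f] cv.subspace_scale[OF M] by (auto simp: image_iff) metis
qed

definition winv :: "'m::complex_vector set \<Rightarrow> (bool \<Rightarrow> int \<Rightarrow> 'm \<Rightarrow> 'm) \<Rightarrow> 'm set \<Rightarrow> bool" where
  "winv M x K \<longleftrightarrow> cv.subspace K \<and> K \<subseteq> M \<and> (\<forall>i n. \<forall>u\<in>K. x i n u \<in> K)"

lemma winv_spec: "winv M (spec l x) K \<longleftrightarrow> winv M x K"
proof -
  have "winv M (spec l x) K" if "winv M x K" for l and x :: "bool \<Rightarrow> int \<Rightarrow> 'a \<Rightarrow> 'a"
    using that by (auto simp: winv_def spec_def)
  from this[of x l] this[of "spec l x" "- l"] show ?thesis by auto
qed

context bg begin

sublocale SS: smooth_weyl UNIV S_act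
  by unfold_locales (rule smooth_of_module[OF vertex_algebraD(1)[OF vaS]])

primrec Dg :: "nat \<Rightarrow> 's set" where
  "Dg 0 = cv.span {vacuum S}"
| "Dg (Suc k) = cv.span (Dg k \<union> {S_act i (- int n) a | i n a. n \<ge> 1 \<and> a \<in> Dg k})"

lemma Dg_subspace: "cv.subspace (Dg k)" by (cases k) auto
lemma Dg_mono: "Dg k \<subseteq> Dg (Suc k)" by (auto intro: cv.span_base)
lemma Dg_le: "k \<le> l \<Longrightarrow> Dg k \<subseteq> Dg l" by (rule lift_Suc_mono_le[of Dg]) (rule Dg_mono)
lemma Dg_creation: "n \<ge> 1 \<Longrightarrow> a \<in> Dg k \<Longrightarrow> S_act i (- int n) a \<in> Dg (Suc k)"
  by (auto intro!: cv.span_base)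

lemma Dg_all: "\<exists>k. a \<in> Dg k"
proof -
  have "a \<in> (\<Union>k. Dg k)"
  proof (rule bg_induct)
    show "cv.subspace (\<Union>k. Dg k)"
    proof (rule cv.subspaceI)
      show "0 \<in> (\<Union>k. Dg k)" using cv.subspace_0[OF Dg_subspace[of 0]] by blast
      fix a b assume "a \<in> (\<Union>k. Dg k)" "b \<in> (\<Union>k. Dg k)"
      then obtain k l where "a \<in> Dg k" "b \<in> Dg l" by blast
      then have "a \<in> Dg (max k l)" "b \<in> Dg (max k l)" using Dg_le[of k "max k l"] Dg_le[of l "max k l"] by auto
      then show "a + b \<in> (\<Union>k. Dg k)" using cv.subspace_add[OF Dg_subspace] by blast
    qed (use cv.subspace_scale[OF Dg_subspace] in blast)
    show "vacuum S \<in> (\<Union>k. Dg k)" by (rule UN_I[of 0]) (auto intro: cv.span_base)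
  qed (use Dg_creation in blast)
  then show ?thesis by blast
qed

lemma Dg_annihilation:
  assumes "n \<ge> 0" shows "a \<in> Dg 0 \<Longrightarrow> S_act i n a = 0" "a \<in> Dg (Suc k) \<Longrightarrow> S_act i n a \<in> Dg k"
proof -
  have lin: "lin_on UNIV (S_act i n)" for i n by (rule S.x_lin)
  have 0: "S_act i n a = 0" if "a \<in> Dg 0" for a i
    using lin_on_span_image[OF lin cv.subspace_UNIV, of "{vacuum S}" i n "{0}" a] that
      vertex_algebraD(3)[OF vaS assms] by (simp add: cv.subspace_def)
  show "a \<in> Dg 0 \<Longrightarrow> S_act i n a = 0" by (rule 0)
  show "a \<in> Dg (Suc k) \<Longrightarrow> S_act i n a \<in> Dg k"
  proof (induction k arbitrary: a i)
    case 0
    show ?case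
    proof (rule lin_on_span_image[OF lin cv.subspace_UNIV _ _ Dg_subspace 0[unfolded Dg.simps(2)]])
      fix b assume "b \<in> Dg 0 \<union> {S_act i (- int m) a |i m a. 1 \<le> m \<and> a \<in> Dg 0}"
      then consider "b \<in> Dg 0" | j m c where "b = S_act j (- int m) c" "m \<ge> 1" "c \<in> Dg 0" by blast
      then show "S_act i n b \<in> Dg 0"
      proof cases
        case 2
        have "S_act i n b = (if n - int m = -1 then om i j *\<^sub>C c else 0)"
          using S.x_swap[OF UNIV_I, of i n j "- int m" c] \<open>\<And>a i. a \<in> Dg 0 \<Longrightarrow> S_act i n a = 0\<close>[OF 2(3)] 2(1) by simp
        then show ?thesis using 2(3) cv.subspace_scale[OF Dg_subspace[of 0]] cv.subspace_0[OF Dg_subspace[of 0]]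
          by (simp del: Dg.simps)
      qed (use \<open>\<And>a i. a \<in> Dg 0 \<Longrightarrow> S_act i n a = 0\<close> cv.subspace_0[OF Dg_subspace[of 0]] in \<open>simp del: Dg.simps\<close>)
    qed auto
  next
    case (Suc k)
    show ?case
    proof (rule lin_on_span_image[OF lin cv.subspace_UNIV _ _ Dg_subspace Suc.prems[unfolded Dg.simps(2)[of "Suc k"]]])
      fix b assume "b \<in> Dg (Suc k) \<union> {S_act i (- int m) a |i m a. 1 \<le> m \<and> a \<in> Dg (Suc k)}"
      then consider "b \<in> Dg (Suc k)" | j m c where "b = S_act j (- int m) c" "m \<ge> 1" "c \<in> Dg (Suc k)" by blast
      then show "S_act i n b \<in> Dg (Suc k)"
      proof cases
        case 1
        then show ?thesis using Suc.IH Dg_mono by blast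
      next
        case 2
        have "S_act i n b = S_act j (- int m) (S_act i n c) + (if n - int m = -1 then om i j *\<^sub>C c else 0)"
          using S.x_swap[OF UNIV_I, of i n j "- int m" c] 2(1) by simp
        moreover have "S_act j (- int m) (S_act i n c) \<in> Dg (Suc k)"
          by (rule Dg_creation[OF 2(2) Suc.IH[OF 2(3)]])
        ultimately show ?thesis using 2(3) cv.subspace_scale[OF Dg_subspace] cv.subspace_0[OF Dg_subspace]
          cv.subspace_add[OF Dg_subspace[of "Suc k"]] by (auto simp del: Dg.simps)
      qed
    qed auto
  qed
qed

text \<open>The sign makes the charge of every creation mode equal to 1, so \<open>qop degw\<close>
  counts creation modes and acts as k on the k-th step of the filtration \<open>Dg\<close> modulo
  the previous one.\<close>

abbreviation degw :: "int \<Rightarrow> complex" where "degw n \<equiv> (if n \<ge> 0 then 1 else -1)"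

lemma Dg_degree:
  "a \<in> Dg k \<Longrightarrow> (k = 0 \<longrightarrow> SS.qop degw a = 0) \<and> (\<forall>j. k = Suc j \<longrightarrow> SS.qop degw a - of_nat k *\<^sub>C a \<in> Dg j)"
proof (induction k arbitrary: a)
  case 0
  have "SS.pairop n a = 0" for n
    using Dg_annihilation(1)[of n a False] Dg_annihilation(1)[of "- n - 1" a True] 0
    by (cases "n \<ge> 0") (auto simp: SS.pairop_def simp del: Dg.simps)
  then show ?case by (simp add: SS.qop_def)
next
  case (Suc k)
  have lin: "lin_on UNIV (\<lambda>a. SS.qop degw a - of_nat (Suc k) *\<^sub>C a)"
    using lin_onD[OF SS.qop_lin] by (auto simp: lin_on_def scaleC_add_right cv.scale_right_diff_distrib scaleC_scaleC mult.commute)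
  have low: "SS.qop degw b - of_nat k *\<^sub>C b \<in> Dg k" if "b \<in> Dg k" for b
  proof (cases k)
    case 0
    then show ?thesis using Suc.IH[OF that] cv.subspace_0[OF Dg_subspace] by (simp del: Dg.simps)
  next
    case (Suc j)
    then show ?thesis using Suc.IH[OF that] Dg_mono[of j] by blast
  qed
  have "SS.qop degw a - of_nat (Suc k) *\<^sub>C a \<in> Dg k"
  proof (rule lin_on_span_image[OF lin cv.subspace_UNIV _ _ Dg_subspace Suc.prems[unfolded Dg.simps(2)]])
    fix b assume "b \<in> Dg k \<union> {S_act i (- int m) a |i m a. 1 \<le> m \<and> a \<in> Dg k}"
    then consider "b \<in> Dg k" | j m c where "b = S_act j (- int m) c" "m \<ge> 1" "c \<in> Dg k" by blast
    then show "SS.qop degw b - of_nat (Suc k) *\<^sub>C b \<in> Dg k"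
    proof cases
      case 1
      have eq: "SS.qop degw b - of_nat (Suc k) *\<^sub>C b = (SS.qop degw b - of_nat k *\<^sub>C b) - b"
        by (simp add: scaleC_add_left scaleC_one algebra_simps)
      show ?thesis unfolding eq by (rule cv.subspace_diff[OF Dg_subspace low[OF 1] 1])
    next
      case 2
      have "SS.charge degw j (- int m) = 1" using 2(2) by (auto simp: SS.charge_def)
      then have "SS.qop degw b - of_nat (Suc k) *\<^sub>C b = S_act j (- int m) (SS.qop degw c - of_nat k *\<^sub>C c)"
        unfolding 2(1) by (simp add: SS.qop_x S.x_diff S.x_scale scaleC_add_left scaleC_one)
      moreover have "S_act j (- int m) (SS.qop degw c - of_nat k *\<^sub>C c) \<in> Dg k"
      proof (cases k)
        case 0
        then have "SS.qop degw c - of_nat k *\<^sub>C c = 0" using Suc.IH[OF 2(3)] by simp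
        then show ?thesis using cv.subspace_0[OF Dg_subspace] by (simp del: Dg.simps)
      next
        case (Suc j')
        then show ?thesis using Suc.IH[OF 2(3)] Dg_creation[OF 2(2)] by blast
      qed
      ultimately show ?thesis by (simp del: Dg.simps)
    qed
  qed auto
  then show ?case by simp
qed

text \<open>Annihilation modes lower the degree. A vector that all of them kill is killed by the
  counting operator too; as that acts as the degree modulo lower terms, the vector already lies one
  step lower. By descent every nonzero invariant subspace contains the vacuum.\<close>

lemma S_irreducible:
  assumes K: "winv UNIV S_act K" and "K \<noteq> {0}"
  shows "K = UNIV"
proof -
  have sub: "cv.subspace K" and inv: "\<And>i n u. u \<in> K \<Longrightarrow> S_act i n u \<in> K" using K by (auto simp: winv_def)
  have vac: "vacuum S \<in> K" if "a \<in> Dg k" "a \<in> K" "a \<noteq> 0" for a k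
    using that
  proof (induction k arbitrary: a)
    case 0
    then obtain t where t: "a = t *\<^sub>C vacuum S" by (auto simp: cv.span_singleton)
    then have "inverse t *\<^sub>C a = vacuum S" using 0(3) by (auto simp: scaleC_scaleC scaleC_one)
    then show ?case using cv.subspace_scale[OF sub 0(2)] by metis
  next
    case (Suc k)
    show ?case
    proof (cases "\<exists>i n. n \<ge> 0 \<and> S_act i n a \<noteq> 0")
      case True
      then show ?thesis using Suc.IH[OF Dg_annihilation(2)[OF _ Suc.prems(1)]] inv Suc.prems(2) by blast
    next
      case False
      then have z: "S_act i n a = 0" if "n \<ge> 0" for i n using that by blast
      have "SS.pairop n a = 0" for n
        using z[of n False] z[of "- n - 1" True] by (cases "n \<ge> 0") (auto simp: SS.pairop_def)
      then have "SS.qop degw a = 0" by (simp add: SS.qop_def)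
      then have "- (of_nat (Suc k) *\<^sub>C a) \<in> Dg k" using Dg_degree[OF Suc.prems(1)] by simp
      then have "(- inverse (of_nat (Suc k))) *\<^sub>C (- (of_nat (Suc k) *\<^sub>C a)) \<in> Dg k"
        by (rule cv.subspace_scale[OF Dg_subspace])
      moreover have "(- inverse (of_nat (Suc k))) *\<^sub>C (- (of_nat (Suc k) *\<^sub>C a)) = a"
      proof -
        have "inverse (of_nat (Suc k)) * of_nat (Suc k) = (1::complex)" by (rule left_inverse) (rule of_nat_neq_0)
        then show ?thesis by (simp add: scaleC_scaleC scaleC_one del: of_nat_Suc)
      qed
      ultimately show ?thesis using Suc.IH Suc.prems by metis
    qed
  qed
  obtain a where "a \<in> K" "a \<noteq> 0" using assms(2) cv.subspace_0[OF sub] by blast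
  then have v: "vacuum S \<in> K" using Dg_all vac by blast
  have "a \<in> K" for a by (rule bg_induct[OF sub v]) (rule inv)
  then show ?thesis by blast
qed

end

section \<open>Modules generated by a vacuum vector\<close>

definition wgen :: "'m::complex_vector set \<Rightarrow> (bool \<Rightarrow> int \<Rightarrow> 'm \<Rightarrow> 'm) \<Rightarrow> 'm \<Rightarrow> bool" where
  "wgen M x v \<longleftrightarrow> (\<forall>K. winv M x K \<and> v \<in> K \<longrightarrow> K = M)"

lemma wgen_spec: "wgen M (spec l x) v \<longleftrightarrow> wgen M x v"
  by (simp add: wgen_def winv_spec)

text \<open>The bound on the conformal weight at charge \<open>c\<close>: the minimum over \<open>l\<close> of the weights occurring in
  the \<open>l\<close>-th spectral flow of the vacuum module.\<close>

definition weight_bound :: "int \<Rightarrow> int" where "weight_bound c = (if c = 1 then -1 else 0)"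

context smooth_weyl begin

text \<open>Stated through annihilating polynomials because L is not known to be semisimple. The
  charges are those reached from a vector of charge 0 by a single mode or by one mode of each
  kind.\<close>

definition bounded_weights :: bool where
  "bounded_weights \<longleftrightarrow> (\<forall>c\<in>{-1, 0, 1}. \<forall>u\<in>M. Jop u = of_int c *\<^sub>C u \<longrightarrow>
     (\<exists>cs. set cs \<subseteq> of_int ` {weight_bound c..} \<and> pol Lop cs u = 0))"

lemma qop_qop: assumes u: "u \<in> M" shows "qop w (qop w' u) = qop w' (qop w u)"
proof -
  have p: "qop w (pairop n v) = pairop n (qop w v)" if v: "v \<in> M" for v n
    using v by (auto simp: pairop_def qop_x M_ops qop_mem charge_def scaleC_add_right x_add x_diff x_scale)
  have "qop w (qop w' u) = Sum_any (\<lambda>n. qop w (w' n *\<^sub>C pairop n u))"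
    unfolding qop_def[of w' u] by (rule lin_on_Sum_any[OF qop_lin subM _ fin_pairop[OF u]]) (simp add: M_ops pairop_mem u)
  also have "\<dots> = qop w' (qop w u)"
    unfolding qop_def[of w' "qop w u"] by (simp add: lin_onD(2)[OF qop_lin] pairop_mem u p)
  finally show ?thesis .
qed

sublocale L: endo M Lop by (rule endo_qop)
sublocale J: endo M Jop by (rule endo_qop)

lemma qop_pol: "u \<in> M \<Longrightarrow> qop w u = c *\<^sub>C u \<Longrightarrow> qop w (pol Lop cs u) = c *\<^sub>C pol Lop cs u"
proof (induction cs)
  case (Cons d cs)
  have m: "pol Lop cs u \<in> M" by (rule L.pol_mem[OF Cons.prems(1)])
  show ?case using Cons m
    by (simp add: lin_on_diff[OF qop_lin subM] lin_onD(2)[OF qop_lin] qop_qop[of _ w] L.ops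
      cv.scale_right_diff_distrib scaleC_scaleC mult.commute)
qed simp

lemma pol_x:
  assumes "u \<in> M"
  shows "pol Lop (replicate k (d + charge of_int i m)) (x i m u) = x i m (pol Lop (replicate k d) u)"
proof (induction k)
  case (Suc k)
  have m: "pol Lop (replicate k d) u \<in> M" by (rule L.pol_mem[OF assms])
  show ?case using m Suc by (simp add: qop_x x_diff x_scale L.ops scaleC_add_left)
qed simp

end

locale bg_vac = bg_weyl S \<beta> \<gamma> M x
  for S :: "'s::complex_vector vertex_alg" and \<beta> \<gamma> and M :: "'m::complex_vector set" and x +
  fixes l :: int and v :: 'm
  assumes vac: "vac_vec l v" and gen: "wgen M x v"
begin

text \<open>The universal property gives a map from S. Its kernel is invariant and misses the
  vacuum, hence is zero by irreducibility, and its range contains the generator.\<close>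

lemma vac_iso:
  obtains \<Psi> where "clinear \<Psi>" "\<Psi> (vacuum S) = v" "range \<Psi> = M" "inj \<Psi>"
    "\<And>i n a. \<Psi> (S_act i n a) = spec l x i n (\<Psi> a)"
proof -
  have v: "v \<in> M" "v \<noteq> 0" "\<And>i n. n \<ge> 0 \<Longrightarrow> spec l x i n v = 0" using vac unfolding vac_vec_def by blast+
  obtain \<Psi> where \<Psi>: "clinear \<Psi>" "\<Psi> (vacuum S) = v" "\<And>a. \<Psi> a \<in> M" "\<And>i n a. \<Psi> (S_act i n a) = spec l x i n (\<Psi> a)"
    by (rule universal[OF weyl_spec[OF weyl, of l], OF v(1), OF v(3)]) (assumption, rule that)
  note lin = \<Psi>(1)[folded lin_on_UNIV]
  have r: "winv M (spec l x) (range \<Psi>)"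
  proof -
    have "cv.subspace (range \<Psi>)" by (rule lin_on_image_subspace[OF lin cv.subspace_UNIV])
    moreover have "spec l x i n (\<Psi> a) \<in> range \<Psi>" for i n a by (metis \<Psi>(4) rangeI)
    ultimately show ?thesis using \<Psi>(3) by (auto simp: winv_def)
  qed
  moreover have "v \<in> range \<Psi>" using \<Psi>(2) by blast
  ultimately have range: "range \<Psi> = M" using gen unfolding wgen_def winv_spec[of M l] by blast
  have "winv UNIV S_act {a. \<Psi> a = 0}"
  proof -
    interpret F: smooth_weyl M "spec l x" by unfold_locales (auto intro: weyl_spec smooth_spec weyl smooth)
    show ?thesis unfolding winv_def
      by (auto simp: \<Psi>(4) intro!: cv.subspaceI)
        (simp_all add: lin_onD[OF lin] lin_on_0[OF lin cv.subspace_UNIV])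
  qed
  moreover have "vacuum S \<notin> {a. \<Psi> a = 0}" using \<Psi>(2) v(2) by simp
  ultimately have ker: "{a. \<Psi> a = 0} = {0}" using S_irreducible by blast
  have "inj \<Psi>"
  proof (rule injI)
    fix a b assume "\<Psi> a = \<Psi> b"
    then have "\<Psi> (a - b) = 0" using lin_on_diff[OF lin cv.subspace_UNIV] by simp
    then have "a - b \<in> {0}" unfolding ker[symmetric] by simp
    then show "a = b" by simp
  qed
  then show ?thesis using that \<Psi> range by blast
qed

lemma vac_irreducible:
  assumes K: "winv M x K" "K \<noteq> {0}"
  shows "K = M"
proof -
  obtain \<Psi> where \<Psi>: "clinear \<Psi>" "\<Psi> (vacuum S) = v" "range \<Psi> = M" "inj \<Psi>"
    "\<And>i n a. \<Psi> (S_act i n a) = spec l x i n (\<Psi> a)" by (rule vac_iso) (rule that)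
  note lin = \<Psi>(1)[folded lin_on_UNIV]
  have K': "winv M (spec l x) K" using K(1) by (simp add: winv_spec)
  then have Ks: "cv.subspace K" "K \<subseteq> M" by (auto simp: winv_def)
  have "cv.subspace (\<Psi> -` K)"
    by (rule cv.subspaceI) (auto simp: lin_onD[OF lin] lin_on_0[OF lin cv.subspace_UNIV]
      intro: cv.subspace_0[OF Ks(1)] cv.subspace_add[OF Ks(1)] cv.subspace_scale[OF Ks(1)])
  then have "winv UNIV S_act (\<Psi> -` K)" using K' by (auto simp: winv_def \<Psi>(5))
  moreover have "\<Psi> -` K \<noteq> {0}"
  proof -
    obtain u where "u \<in> K" "u \<noteq> 0" using K(2) cv.subspace_0[OF Ks(1)] by blast
    then obtain a where "\<Psi> a = u" using \<Psi>(3) Ks(2) by blast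
    then have "a \<in> \<Psi> -` K" "a \<noteq> 0" using \<open>u \<in> K\<close> \<open>u \<noteq> 0\<close> lin_on_0[OF lin cv.subspace_UNIV] by auto
    then show ?thesis by blast
  qed
  ultimately have "\<Psi> -` K = UNIV" by (rule S_irreducible)
  then show ?thesis using \<Psi>(3) Ks(2) by auto
qed

lemma vac_span:
  assumes X: "X \<subseteq> M" "v \<in> X" "\<And>i n u. n \<ge> 1 \<Longrightarrow> u \<in> X \<Longrightarrow> spec l x i (- int n) u \<in> X"
  shows "M = cv.span X"
proof
  interpret F: smooth_weyl M "spec l x" by unfold_locales (auto intro: weyl_spec smooth_spec weyl smooth)
  obtain \<Psi> where \<Psi>: "clinear \<Psi>" "\<Psi> (vacuum S) = v" "range \<Psi> = M" "inj \<Psi>"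
    "\<And>i n a. \<Psi> (S_act i n a) = spec l x i n (\<Psi> a)" by (rule vac_iso) (rule that)
  note lin = \<Psi>(1)[folded lin_on_UNIV]
  have "\<Psi> a \<in> cv.span X" for a
  proof -
    have "a \<in> {a. \<Psi> a \<in> cv.span X}"
    proof (rule bg_induct)
      show "cv.subspace {a. \<Psi> a \<in> cv.span X}"
        by (rule cv.subspaceI) (auto simp: lin_onD[OF lin] lin_on_0[OF lin cv.subspace_UNIV] intro: cv.span_zero cv.span_add cv.span_scale)
      show "vacuum S \<in> {a. \<Psi> a \<in> cv.span X}" using X(2) by (simp add: \<Psi>(2) cv.span_base)
      fix i n a assume n: "n \<ge> (1::nat)" and a: "a \<in> {a. \<Psi> a \<in> cv.span X}"
      have "spec l x i (- int n) (\<Psi> a) \<in> cv.span X"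
        by (rule lin_on_span_image[OF F.x_lin subM X(1) _ cv.subspace_span]) (use a X(3)[OF n] in \<open>auto intro: cv.span_base\<close>)
      then show "S_act i (- int n) a \<in> {a. \<Psi> a \<in> cv.span X}" by (simp add: \<Psi>(5))
    qed
    then show ?thesis by simp
  qed
  then show "M \<subseteq> cv.span X" using \<Psi>(3) by blast
  show "cv.span X \<subseteq> M" by (rule cv.span_minimal[OF X(1) subM])
qed

text \<open>In the proof \<open>B\<close> and \<open>G\<close> count the creation modes of \<open>\<beta>\<close> and \<open>\<gamma>\<close>.\<close>

lemma vac_bounded_weights: "bounded_weights"
proof -
  \<comment> \<open>A creation mode of beta has index -n - l and raises the weight by n + l, at
    least l + 1; one of gamma has index -n + l and raises it by n - l - 1, at least -l. The
    remaining constant is the weight of v.\<close>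
  define X where "X = {u\<in>M. \<exists>B G h. Jop u = of_int (l - int B + int G) *\<^sub>C u \<and> Lop u = of_int h *\<^sub>C u \<and>
    h \<ge> int B * (l + 1) - int G * l - l * (l + 1) div 2}"
  have vM: "v \<in> M" using vac by (simp add: vac_vec_def)
  have span: "M = cv.span X"
  proof (rule vac_span)
    show "X \<subseteq> M" by (auto simp: X_def)
    show "v \<in> X" using vac_vec_eigen[OF vac] vM unfolding X_def
      by (auto intro!: exI[of _ "0::nat"] exI[of _ "- (l * (l + 1) div 2)"])
    fix i n u assume n: "n \<ge> (1::nat)" and "u \<in> X"
    then obtain B G h where u: "u \<in> M" "Jop u = of_int (l - int B + int G) *\<^sub>C u" "Lop u = of_int h *\<^sub>C u"
      "h \<ge> int B * (l + 1) - int G * l - l * (l + 1) div 2" by (auto simp: X_def)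
    show "spec l x i (- int n) u \<in> X"
    proof (cases i)
      case False
      let ?y = "x False (- int n - l) u"
      have "Jop ?y = of_int (l - int (Suc B) + int G) *\<^sub>C ?y" "Lop ?y = of_int (h + int n + l) *\<^sub>C ?y"
        using qop_eigen_x[OF u(1,2), of False "- int n - l"] qop_eigen_x[OF u(1,3), of False "- int n - l"]
        by (simp_all add: charge_def algebra_simps)
      moreover have "h + int n + l \<ge> int (Suc B) * (l + 1) - int G * l - l * (l + 1) div 2"
        using u(4) n by (simp add: algebra_simps)
      ultimately show ?thesis using False u(1) unfolding X_def
        by (intro CollectI conjI exI[of _ "Suc B"] exI[of _ G] exI[of _ "h + int n + l"]) (simp_all add: x_mem)
    next
      case True
      let ?y = "x True (- int n + l) u"
      have "Jop ?y = of_int (l - int B + int (Suc G)) *\<^sub>C ?y" "Lop ?y = of_int (h + int n - l - 1) *\<^sub>C ?y"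
        using qop_eigen_x[OF u(1,2), of True "- int n + l"] qop_eigen_x[OF u(1,3), of True "- int n + l"]
        by (simp_all add: charge_def algebra_simps)
      moreover have "h + int n - l - 1 \<ge> int B * (l + 1) - int (Suc G) * l - l * (l + 1) div 2"
        using u(4) n by (simp add: algebra_simps)
      ultimately show ?thesis using True u(1) unfolding X_def
        by (intro CollectI conjI exI[of _ B] exI[of _ "Suc G"] exI[of _ "h + int n - l - 1"]) (simp_all add: x_mem)
    qed
  qed
  show ?thesis
    unfolding bounded_weights_def
  proof (intro ballI impI)
    fix c u assume c: "c \<in> {-1, 0, 1::int}" and u: "u \<in> M" "Jop u = of_int c *\<^sub>C u"
    let ?Z = "{u\<in>M. \<exists>cs. set cs \<subseteq> of_int ` {weight_bound c..} \<and> pol Lop cs u = 0}"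
    have "u \<in> cv.span {y\<in>X. Jop y = of_int c *\<^sub>C y}"
    proof (rule eigen_span[OF J.T_lin subM _ _ _ u(2)])
      show "u \<in> cv.span X" using u(1) unfolding span[symmetric] .
    qed (auto simp: X_def)
    moreover have "{y\<in>X. Jop y = of_int c *\<^sub>C y} \<subseteq> ?Z"
    proof
      fix y assume "y \<in> {y\<in>X. Jop y = of_int c *\<^sub>C y}"
      then obtain B G h where y: "y \<in> M" "Jop y = of_int (l - int B + int G) *\<^sub>C y" "Lop y = of_int h *\<^sub>C y"
        "h \<ge> int B * (l + 1) - int G * l - l * (l + 1) div 2" "Jop y = of_int c *\<^sub>C y" unfolding X_def by blast
      show "y \<in> ?Z"
      proof (cases "y = 0")
        case False
        have "(of_int (l - int B + int G) :: complex) = of_int c"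
          using y(2,5) False by (metis cv.scale_right_imp_eq)
        then have q: "int G = c - l + int B" by (simp only: of_int_eq_iff)
        have e: "2 * (l * (l + 1) div 2) = l * (l + 1)" by simp
        \<comment> \<open>With G eliminated the bound reads h >= B + (l^2 - l)/2 - c l. The three
          inequalities settle c = 0, c = -1 and c = 1, the last with minimum -1.\<close>
        have pos: "l * l \<ge> l" "l * l \<ge> - l" "(l - 1) * (l - 2) \<ge> 0"
        proof -
          show "l * l \<ge> l" "l * l \<ge> - l" using zero_le_square[of l]
            by (smt (verit) mult_le_cancel_left1 mult_minus_left mult_le_cancel_right1 mult.commute)+
          show "(l - 1) * (l - 2) \<ge> 0" by (cases "l \<ge> 2") (auto simp: zero_le_mult_iff)
        qed
        have "2 * h \<ge> 2 * (int B * (l + 1)) - 2 * (int G * l) - l * (l + 1)" using y(4) e by linarith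
        then have "2 * h \<ge> 2 * int B + l * l - l - 2 * (c * l)" unfolding q by (simp add: algebra_simps)
        then have "h \<ge> weight_bound c" using c pos by (auto simp: weight_bound_def algebra_simps)
        then show ?thesis using y by (intro CollectI conjI exI[of _ "[of_int h]"]) auto
      qed (auto simp: L.ops intro!: exI[of _ "[]"])
    qed
    ultimately have "u \<in> ?Z" using cv_span_subspace_induct[OF L.subspace_pol] by blast
    then show "\<exists>cs. set cs \<subseteq> of_int ` {weight_bound c..} \<and> pol Lop cs u = 0" by blast
  qed
qed

end

section \<open>Modes of derivatives and of normally ordered products\<close>

lemma va_deriv_mode:
  assumes V: "vertex_algebra V" and Y: "va_module V M Y" and u: "u \<in> M"
  shows "Y (va_deriv V a) n u = (- of_int n) *\<^sub>C Y a (n - 1) u"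
proof -
  interpret modes "nprod V" Y M by (rule modesI[OF V Y])
  have neg: "sbin (-2) j = of_nat (j + 1)" for j
  proof -
    have "bin (-2) j = (-1) ^ j * bin (int (j + 1)) j"
      using gbinomial_minus[of "2 :: complex" j] by (simp add: add.commute)
    also have "bin (int (j + 1)) j = of_nat (j + 1)"
      using binomial_symmetric[of j "j + 1"] by (simp add: binomial_gbinomial[symmetric] del: of_nat_add of_nat_Suc)
    finally show ?thesis by (simp add: mult.assoc[symmetric] power_mult_distrib[symmetric])
  qed
  have "Y (va_deriv V a) n u = Sum_any (\<lambda>j. of_nat (j + 1) *\<^sub>C
    (Y a (- 2 - int j) (Y (vacuum V) (n + int j) u) - Y (vacuum V) (n - 2 - int j) (Y a (int j) u)))"
    unfolding va_deriv_def Jac_iter[OF modes_Jac[OF V Y u]] neg by (simp add: algebra_simps)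
  also have "\<dots> = (- of_int n) *\<^sub>C Y a (n - 1) u"
  proof (cases "n \<le> -1 \<or> n \<ge> 1")
    case True
    then show ?thesis
    proof
      assume n: "n \<le> -1"
      then show ?thesis
        by (subst Sum_any_eq_sum[of "{nat (- 1 - n)}"]) (auto simp: va_moduleD(6)[OF Y] u Y_mem of_nat_diff)
    next
      assume n: "n \<ge> 1"
      then show ?thesis
        by (subst Sum_any_eq_sum[of "{nat (n - 1)}"]) (auto simp: va_moduleD(6)[OF Y] u Y_mem cv.scale_minus_left)
    qed
  next
    case False
    then have "n = 0" by simp
    then show ?thesis by (simp add: va_moduleD(6)[OF Y] u Y_mem)
  qed
  finally show ?thesis .
qed

lemma sbin_minus_1 [simp]: "sbin (-1) k = 1"
  using gbinomial_minus[of "1::complex" k] by (simp add: power_mult_distrib[symmetric] binomial_gbinomial[symmetric])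

lemma normal_prod_mode:
  assumes V: "vertex_algebra V" and Y: "va_module V M Y" and u: "u \<in> M"
  shows "Y (normal_prod V a b) t u = Sum_any (\<lambda>j::nat. Y a (- 1 - int j) (Y b (t + int j) u)) +
    Sum_any (\<lambda>j::nat. Y b (t - 1 - int j) (Y a (int j) u))"
    (is "_ = Sum_any ?f + Sum_any ?g")
proof -
  interpret modes "nprod V" Y M by (rule modesI[OF V Y])
  have fin: "finite {j. ?f j \<noteq> 0}" "finite {j. ?g j \<noteq> 0}"
    by (rule finite_subset[OF _ fin_Y[OF u, of b t]], auto)[1] (rule finite_subset[OF _ fin_Y[OF u, of a 0]], auto)
  have "Y (normal_prod V a b) t u = Sum_any (\<lambda>j. ?f j + ?g j)"
    unfolding Jac_iter[OF modes_Jac[OF V Y u]] sbin_minus_1 by (simp add: scaleC_one cv.scale_minus_left algebra_simps)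
  then show ?thesis by (simp add: Sum_any.distrib[OF fin])
qed

lemma Sum_any_int_split:
  fixes f :: "int \<Rightarrow> 'a::comm_monoid_add"
  assumes fin: "finite {n. f n \<noteq> 0}"
  shows "Sum_any f = Sum_any (\<lambda>j::nat. f (int j)) + Sum_any (\<lambda>j::nat. f (- 1 - int j))"
proof -
  obtain K where K: "{n. f n \<noteq> 0} \<subseteq> {- int K..<int K}"
  proof -
    have "finite ((\<lambda>n. nat \<bar>n\<bar>) ` {n. f n \<noteq> 0})" using fin by simp
    then obtain K where "(\<lambda>n. nat \<bar>n\<bar>) ` {n. f n \<noteq> 0} \<subseteq> {..<K}" using finite_nat_iff_bounded by meson
    then have "{n. f n \<noteq> 0} \<subseteq> {- int K..<int K}" by (force simp: subset_iff)
    then show ?thesis by (rule that)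
  qed
  have z: "f n = 0" if "n \<notin> {- int K..<int K}" for n using K that by auto
  have "Sum_any f = sum f ({0..<int K} \<union> {- int K..<0})"
    by (rule Sum_any_eq_sum) (auto intro!: z)
  also have "\<dots> = sum f {0..<int K} + sum f {- int K..<0}"
    by (rule sum.union_disjoint) auto
  also have "sum f {0..<int K} = (\<Sum>j<K. f (int j))"
    by (rule sum.reindex_bij_witness[of _ int nat]) auto
  also have "\<dots> = Sum_any (\<lambda>j::nat. f (int j))"
    by (rule Sum_any_eq_sum[symmetric]) (auto intro!: z)
  also have "sum f {- int K..<0} = (\<Sum>j<K. f (- 1 - int j))"
    by (rule sum.reindex_bij_witness[of _ "\<lambda>j. - 1 - int j" "\<lambda>n. nat (- 1 - n)"]) auto
  also have "\<dots> = Sum_any (\<lambda>j::nat. f (- 1 - int j))"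
    by (rule Sum_any_eq_sum[symmetric]) (auto intro!: z)
  finally show ?thesis .
qed

lemma bgen_simps [simp]: "bgen b g False = b" "bgen b g True = g"
  by (simp_all add: bgen_def)

context bg begin

lemma module_smooth_weyl: "va_module S M Y \<Longrightarrow> smooth_weyl M (\<lambda>i. Y (gen i))"
  by (intro smooth_weyl.intro weyl_module.intro smooth_weyl_axioms.intro weyl_of_module smooth_of_module)

lemma smooth_weyl_spec: "smooth_weyl M x \<Longrightarrow> smooth_weyl M (spec l x)"
  by (simp add: smooth_weyl_def smooth_weyl_axioms_def weyl_module_def weyl_spec smooth_spec)

lemma charge_mode:
  assumes Y: "va_module S M Y" and u: "u \<in> M"
  shows "Y (normal_prod S \<gamma> \<beta>) 0 u = smooth_weyl.qop (\<lambda>i. Y (gen i)) (\<lambda>_. 1) u"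
proof -
  interpret x: smooth_weyl M "\<lambda>i. Y (gen i)" by (rule module_smooth_weyl[OF Y])
  have "x.qop (\<lambda>_. 1) u = Sum_any (\<lambda>n. x.pairop n u)" by (simp add: x.qop_def scaleC_one)
  also have "\<dots> = Sum_any (\<lambda>j::nat. x.pairop (int j) u) + Sum_any (\<lambda>j::nat. x.pairop (- 1 - int j) u)"
    by (rule Sum_any_int_split) (use x.fin_pairop[OF u, of "\<lambda>_. 1"] in \<open>simp add: scaleC_one\<close>)
  also have "\<dots> = Y (normal_prod S \<gamma> \<beta>) 0 u"
  proof -
    have e: "- int a - 1 = - 1 - int a" for a :: nat by simp
    show ?thesis unfolding normal_prod_mode[OF vaS Y u] by (simp add: x.pairop_def e add.commute)
  qed
  finally show ?thesis by simp
qed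

lemma conformal_mode:
  assumes Y: "va_module S M Y" and u: "u \<in> M"
  shows "Y (normal_prod S (va_deriv S \<gamma>) \<beta>) 1 u = smooth_weyl.qop (\<lambda>i. Y (gen i)) of_int u"
proof -
  interpret x: smooth_weyl M "\<lambda>i. Y (gen i)" by (rule module_smooth_weyl[OF Y])
  let ?f = "\<lambda>n::int. of_int n *\<^sub>C x.pairop n u"
  have fin: "finite {n. ?f n \<noteq> 0}" by (rule x.fin_pairop[OF u])
  have fin1: "finite {j::nat. ?f (int j) \<noteq> 0}" "finite {j::nat. ?f (- int j) \<noteq> 0}"
    using finite_vimageI[OF fin, of int] finite_vimageI[OF fin, of "\<lambda>j::nat. - int j"]
    by (auto simp: vimage_def inj_on_def)
  have "x.qop of_int u = Sum_any ?f" by (simp add: x.qop_def)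
  also have "\<dots> = Sum_any (\<lambda>j::nat. ?f (int j)) + Sum_any (\<lambda>j::nat. ?f (- 1 - int j))"
    by (rule Sum_any_int_split[OF fin])
  \<comment> \<open>The term n = 0 carries the weight 0. Dropping it on one side and adding it on
    the other matches the splitting at n = 1 that the derivative of gamma induces.\<close>
  also have "Sum_any (\<lambda>j::nat. ?f (int j)) = Sum_any (\<lambda>j::nat. ?f (int (1 + j)))"
    by (rule Sum_any_shift[OF _ fin1(1)]) simp
  also have "Sum_any (\<lambda>j::nat. ?f (- 1 - int j)) = Sum_any (\<lambda>j::nat. ?f (- int j))"
    by (subst Sum_any_shift[of 1 "\<lambda>j. ?f (- int j)", OF _ fin1(2)]) (auto simp: algebra_simps)
  also have "Sum_any (\<lambda>j::nat. ?f (int (1 + j))) + \<dots> = Y (normal_prod S (va_deriv S \<gamma>) \<beta>) 1 u"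
  proof -
    note d = va_deriv_mode[OF vaS Y]
    have "Y (va_deriv S \<gamma>) (- 1 - int j) (Y \<beta> (1 + int j) u) = ?f (int (1 + j))" for j
      by (simp add: d[OF va_moduleD(2)[OF Y u]] x.pairop_def algebra_simps)
    moreover have "Y \<beta> (1 - 1 - int j) (Y (va_deriv S \<gamma>) (int j) u) = ?f (- int j)" for j
    proof (cases "j = 0")
      case True
      then show ?thesis by (simp add: d[OF u] lin_on_0[OF va_moduleD(3)[OF Y] va_moduleD(1)[OF Y]])
    next
      case False
      then show ?thesis
        using lin_onD(2)[OF va_moduleD(3)[OF Y] va_moduleD(2)[OF Y u], of \<beta> "- int j" _ \<gamma> "int j - 1"]
        by (simp add: d[OF u] x.pairop_def cv.scale_minus_left[symmetric] del: cv.scale_minus_left)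
    qed
    ultimately show ?thesis unfolding normal_prod_mode[OF vaS Y u] by simp
  qed
  finally show ?thesis by simp
qed

end

section \<open>Weights in the category of weight modules\<close>

context smooth_weyl begin

text \<open>The zero mode beta_0 preserves the relaxed conditions and lowers the eigenvalue of
  gamma_-1 beta_0 by one. The descent ends at eigenvalue 0, where either beta_0 v = 0 and v is a
  vacuum vector, or gamma_-1 kills beta_0 v, which is then a vacuum vector for the flow -1.\<close>

lemma relaxed_vac_pos:
  "v \<in> M \<Longrightarrow> v \<noteq> 0 \<Longrightarrow> (\<And>n. n > 0 \<Longrightarrow> x False n v = 0) \<Longrightarrow> (\<And>n. n \<ge> 0 \<Longrightarrow> x True n v = 0) \<Longrightarrow>
   x True (-1) (x False 0 v) = of_nat k *\<^sub>C v \<Longrightarrow> \<exists>l w. vac_vec l w"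
proof (induction k arbitrary: v)
  case (0 v)
  show ?case
  proof (cases "x False 0 v = 0")
    case True
    have "vac_vec 0 v" unfolding vac_vec_def
    proof (intro conjI allI impI)
      fix i and n :: int assume "n \<ge> 0"
      then show "spec 0 x i n v = 0" using 0 True by (cases i; cases "n = 0") auto
    qed (use 0 in auto)
    then show ?thesis by blast
  next
    case False
    have "vac_vec (-1) (x False 0 v)" unfolding vac_vec_def
    proof (intro conjI allI impI)
      fix i and n :: int assume n: "n \<ge> 0"
      have "x False (n + 1) (x False 0 v) = 0" "n > 0 \<Longrightarrow> x True (n - 1) (x False 0 v) = 0"
        using x_swap[OF 0(1), of False "n + 1" False 0] x_swap[OF 0(1), of True "n - 1" False 0] 0 n
        by (auto simp: om_def)
      then show "spec (-1) x i n (x False 0 v) = 0" using 0(5) n by (cases i; cases "n = 0") auto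
    qed (use 0 False in \<open>auto simp: x_mem\<close>)
    then show ?thesis by blast
  qed
next
  case (Suc k v)
  note v = Suc.prems
  show ?case
  proof (cases "x False 0 v = 0")
    case True
    then have "of_nat (Suc k) *\<^sub>C v = 0" using v(5) by simp
    then have False using v(2) of_nat_neq_0[where ?'a = complex] by (metis cv.scale_eq_0_iff)
    then show ?thesis ..
  next
    case False
    show ?thesis
    proof (rule Suc.IH[OF _ False])
      show "x False 0 v \<in> M" using v(1) by (rule x_mem)
      show "x False n (x False 0 v) = 0" if "n > 0" for n
        using x_swap[OF v(1), of False n False 0] v(3)[OF that] by (simp add: om_def)
      show "x True n (x False 0 v) = 0" if "n \<ge> 0" for n
        using x_swap[OF v(1), of True n False 0] v(4)[OF that] that by simp
      have "x True (-1) (x False 0 (x False 0 v)) = x False 0 (x True (-1) (x False 0 v)) - x False 0 v"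
        using x_swap[OF x_mem[OF v(1)], of True "-1" False 0 False 0] by (simp add: om_def cv.scale_minus_left scaleC_one)
      then show "x True (-1) (x False 0 (x False 0 v)) = of_nat k *\<^sub>C x False 0 v"
        unfolding v(5) by (simp add: x_add x_scale M_ops v(1) scaleC_add_left scaleC_one)
    qed
  qed
qed

text \<open>The mirror image: gamma_-1 raises a negative eigenvalue until -1 is reached, where
  beta_0 kills gamma_-1 v. If gamma_-1 kills a vector on the way, that vector is itself a vacuum
  vector for the flow -1. With the previous case every relaxed vector of integral charge leads to a
  flow of the vacuum.\<close>

lemma relaxed_vac_neg:
  "v \<in> M \<Longrightarrow> v \<noteq> 0 \<Longrightarrow> (\<And>n. n > 0 \<Longrightarrow> x False n v = 0) \<Longrightarrow> (\<And>n. n \<ge> 0 \<Longrightarrow> x True n v = 0) \<Longrightarrow>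
   x True (-1) (x False 0 v) = (- of_nat (Suc k)) *\<^sub>C v \<Longrightarrow> \<exists>l w. vac_vec l w"
proof (induction k arbitrary: v)
  case (0 v)
  show ?case
  proof (cases "x True (-1) v = 0")
    case True
    have "vac_vec (-1) v" unfolding vac_vec_def
    proof (intro conjI allI impI)
      fix i and n :: int assume "n \<ge> 0"
      then show "spec (-1) x i n v = 0" using 0 True by (cases i; cases "n = 0") auto
    qed (use 0 in auto)
    then show ?thesis by blast
  next
    case False
    have "vac_vec 0 (x True (-1) v)" unfolding vac_vec_def
    proof (intro conjI allI impI)
      fix i and n :: int assume n: "n \<ge> 0"
      have "x False n (x True (-1) v) = 0" if "n > 0"
        using x_swap[OF 0(1), of False n True "-1"] 0(3)[OF that] that by simp
      moreover have "x False 0 (x True (-1) v) = 0"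
        using x_swap[OF 0(1), of False 0 True "-1"] 0(5) by (simp add: om_def scaleC_one cv.scale_minus_left)
      moreover have "x True n (x True (-1) v) = 0"
        using x_swap[OF 0(1), of True n True "-1"] 0(4)[OF n] by (simp add: om_def)
      ultimately show "spec 0 x i n (x True (-1) v) = 0" using n by (cases i; cases "n = 0") auto
    qed (use 0 False in \<open>auto simp: x_mem\<close>)
    then show ?thesis by blast
  qed
next
  case (Suc k v)
  note v = Suc.prems
  have fb: "x False 0 (x True (-1) v) = x True (-1) (x False 0 v) + v"
    using x_swap[OF v(1), of False 0 True "-1"] by (simp add: om_def scaleC_one)
  show ?case
  proof (cases "x True (-1) v = 0")
    case True
    then have "vac_vec (-1) v" unfolding vac_vec_def
    proof (intro conjI allI impI)
      fix i and n :: int assume "n \<ge> 0"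
      then show "spec (-1) x i n v = 0" using v True by (cases i; cases "n = 0") auto
    qed (use v in auto)
    then show ?thesis by blast
  next
    case False
    show ?thesis
    proof (rule Suc.IH[OF _ False])
      show "x True (-1) v \<in> M" using v(1) by (rule x_mem)
      show "x False n (x True (-1) v) = 0" if "n > 0" for n
        using x_swap[OF v(1), of False n True "-1"] v(3)[OF that] that by simp
      show "x True n (x True (-1) v) = 0" if "n \<ge> 0" for n
        using x_swap[OF v(1), of True n True "-1"] v(4)[OF that] by (simp add: om_def)
      have "x True (-1) v + (- of_nat (Suc (Suc k))) *\<^sub>C x True (-1) v = (- of_nat (Suc k)) *\<^sub>C x True (-1) v"
        using scaleC_add_left[of 1 "- of_nat (Suc (Suc k))" "x True (-1) v"] by (simp add: scaleC_one)
      then show "x True (-1) (x False 0 (x True (-1) v)) = (- of_nat (Suc k)) *\<^sub>C x True (-1) v"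
        unfolding fb v(5) using v(1) by (simp add: x_add x_diff x_scale M_ops add.commute del: of_nat_Suc)
    qed
  qed
qed

lemma qop_hom:
  assumes y: "smooth_weyl N y" and f: "lin_on K f" "cv.subspace K" and u: "u \<in> K" "K \<subseteq> M" and K: "\<And>i n u. u \<in> K \<Longrightarrow> x i n u \<in> K"
    and hom: "\<And>i n u. u \<in> K \<Longrightarrow> f (x i n u) = y i n (f u)"
  shows "f (qop w u) = smooth_weyl.qop y w (f u)" "qop w u \<in> K"
proof -
  have p: "pairop n u \<in> K" for n using u K by (simp add: pairop_def)
  have fp: "f (pairop n u) = (if n \<ge> 0 then y True (- n - 1) (y False n (f u)) else y False n (y True (- n - 1) (f u)))" for n
    using u K by (simp add: pairop_def hom)
  show "qop w u \<in> K" unfolding qop_def by (intro Sum_any_mem[OF f(2)] cv.subspace_scale[OF f(2)] p)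
  have "f (qop w u) = Sum_any (\<lambda>n. f (w n *\<^sub>C pairop n u))"
    unfolding qop_def using u by (intro lin_on_Sum_any[OF f(1,2)] fin_pairop cv.subspace_scale[OF f(2)] p) auto
  also have "\<dots> = Sum_any (\<lambda>n. w n *\<^sub>C (if n \<ge> 0 then y True (- n - 1) (y False n (f u)) else y False n (y True (- n - 1) (f u))))"
    by (simp add: lin_onD(2)[OF f(1) p] fp)
  finally show "f (qop w u) = smooth_weyl.qop y w (f u)"
    by (simp add: smooth_weyl.qop_def[OF y] smooth_weyl.pairop_def[OF y])
qed

end

lemma span_subset_0: "u \<in> cv.span A \<Longrightarrow> A \<subseteq> {0} \<Longrightarrow> u = 0"
  using cv_span_subspace_induct[of "{0}" A u] by (simp add: cv.subspace_def)

context bg begin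

lemma winv_submodule:
  assumes "va_module S M Y" "winv M (\<lambda>i. Y (gen i)) K"
  shows "va_submodule S M Y K"
  using assms by (intro va_submoduleI) (auto simp: winv_def)

lemma irreducible_wgen:
  assumes irr: "va_irreducible S M Y" and v: "v \<in> M" "v \<noteq> 0"
  shows "wgen M (\<lambda>i. Y (gen i)) v"
proof -
  have "va_module S M Y" using irr by (simp add: va_irreducible_def)
  then show ?thesis
    using irr v winv_submodule unfolding wgen_def va_irreducible_def by blast
qed

lemma weights_coset:
  assumes "smooth_weyl M x" and gen: "wgen M x v" and v: "v \<in> M" "smooth_weyl.qop x (\<lambda>_. 1) v = t *\<^sub>C v"
  shows "M = cv.span {u\<in>M. \<exists>z::int. smooth_weyl.qop x (\<lambda>_. 1) u = (t + of_int z) *\<^sub>C u}" (is "M = cv.span ?X")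
proof -
  interpret smooth_weyl M x by fact
  have X: "?X \<subseteq> M" by auto
  have "winv M x (cv.span ?X)"
    unfolding winv_def
  proof (intro conjI allI ballI)
    show "cv.span ?X \<subseteq> M" by (rule cv.span_minimal[OF X subM])
    fix i n u assume u: "u \<in> cv.span ?X"
    show "x i n u \<in> cv.span ?X"
    proof (rule lin_on_span_image[OF x_lin subM X _ cv.subspace_span u])
      fix y assume "y \<in> ?X"
      then obtain z where y: "y \<in> M" "Jop y = (t + of_int z) *\<^sub>C y" by blast
      have "Jop (x i n y) = (t + of_int (z + (if i then 1 else -1))) *\<^sub>C x i n y"
        using qop_eigen_x[OF y, of i n] by (simp add: charge_def add.assoc)
      then show "x i n y \<in> cv.span ?X" using y(1) by (intro cv.span_base CollectI conjI exI x_mem)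
    qed
  qed simp
  moreover have "v \<in> cv.span ?X" using v by (intro cv.span_base) (auto intro!: exI[of _ 0])
  ultimately show ?thesis using gen unfolding wgen_def by blast
qed

lemma spec_qop:
  assumes "smooth_weyl M x" "u \<in> M"
  shows "smooth_weyl.qop (spec l x) w u = smooth_weyl.qop x (\<lambda>n. w (n + l)) u + spec_const l w *\<^sub>C u"
proof -
  interpret weyl_spec M x l using assms(1) by (simp add: weyl_spec_def)
  show ?thesis by (rule spec_qop[OF assms(2)])
qed

text \<open>A simple object containing a vacuum vector for some flow is covered by
  \<open>vac_bounded_weights\<close>, as irreducibility makes that vector a generator; this includes
  relaxed modules of integral charge. If the charge of the relaxed vector is not integral, all
  charges lie in a nontrivial coset of the integers and only the zero vector has to be
  considered.\<close>

lemma simple_object_bounded: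
  assumes obj: "bg_simple_object S \<beta> \<gamma> Q Y"
  shows "smooth_weyl.bounded_weights Q (spec s (\<lambda>i. Y (gen i)))"
proof -
  have irr: "va_irreducible S Q Y" and Y: "va_module S Q Y"
    using obj by (auto simp: bg_simple_object_def va_irreducible_def)
  obtain t Y0 where flow: "bg_spectral_flow S \<beta> \<gamma> t Q Y0 Y" and
    alt: "(\<exists>f. module_hom S UNIV (nprod S) Q Y0 f \<and> bij_betw f UNIV Q) \<or> bg_relaxed_module S \<beta> \<gamma> Q Y0"
    using obj unfolding bg_simple_object_def by blast
  have Y0: "va_module S Q Y0" using flow by (simp add: bg_spectral_flow_def)
  define x where "x = spec s (\<lambda>i. Y (gen i))"
  define x0 where "x0 = (\<lambda>i. Y0 (gen i))"
  have swx: "smooth_weyl Q x" unfolding x_def by (rule smooth_weyl_spec[OF module_smooth_weyl[OF Y]])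
  have swx0: "smooth_weyl Q x0" unfolding x0_def by (rule module_smooth_weyl[OF Y0])
  have rel: "x i n u = spec (s - t) x0 i n u" if "u \<in> Q" for i n u
    using flow that by (cases i) (auto simp: bg_spectral_flow_def x_def x0_def spec_def algebra_simps)
  have rel': "x0 i n u = spec (t - s) x i n u" if "u \<in> Q" for i n u
    using rel[OF that] by (cases i) (simp_all add: spec_def)
  interpret x: smooth_weyl Q x by (rule swx)
  interpret x0: smooth_weyl Q x0 by (rule swx0)
  have wg: "wgen Q x v" if "v \<in> Q" "v \<noteq> 0" for v
    unfolding x_def wgen_spec by (rule irreducible_wgen[OF irr that])
  have vac0: "x.vac_vec (l + (t - s)) v" if v: "x0.vac_vec l v" for l v
  proof -
    have "spec (l + (t - s)) x i n v = spec l x0 i n v" for i n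
      using rel'[of v i] v unfolding x0.vac_vec_def by (cases i) (simp_all add: spec_def algebra_simps)
    then show ?thesis using v unfolding x.vac_vec_def x0.vac_vec_def by auto
  qed
  have fin: "x.bounded_weights" if v: "x0.vac_vec l v" for l v
  proof -
    interpret bg_vac S \<beta> \<gamma> Q x "l + (t - s)" v
      using vac0[OF v] wg v unfolding x0.vac_vec_def by unfold_locales auto
    show ?thesis by (rule vac_bounded_weights)
  qed
  from alt have "x.bounded_weights"
  proof
    assume "\<exists>f. module_hom S UNIV (nprod S) Q Y0 f \<and> bij_betw f UNIV Q"
    then obtain f where f: "module_hom S UNIV (nprod S) Q Y0 f" "bij_betw f UNIV Q" by blast
    have f0: "f 0 = 0" using f(1) lin_on_0[of UNIV f] by (auto simp: module_hom_def lin_on_def)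
    have "vacuum S \<noteq> 0"
    proof
      assume z: "vacuum S = 0"
      have "vacuum S \<in> {0}" using z by simp
      have "a = 0" for a :: 's
        using bg_induct[of "{0}" a] z by (auto simp: cv.subspace_def)
      then have U: "(UNIV :: 's set) = {0}" by auto
      have "f ` UNIV = Q" using f(2) by (simp add: bij_betw_def)
      then have "Q = {0}" unfolding U using f0 by simp
      then show False using irr by (simp add: va_irreducible_def)
    qed
    then have "f (vacuum S) \<noteq> 0" using f(2) f0 by (metis UNIV_I bij_betw_def inj_on_eq_iff)
    moreover have "f (vacuum S) \<in> Q" using f(2) by (auto simp: bij_betw_def)
    moreover have "x0 i n (f (vacuum S)) = 0" if "n \<ge> 0" for i n
    proof -
      have "x0 i n (f (vacuum S)) = f (S_act i n (vacuum S))" using f(1) by (simp add: module_hom_def x0_def)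
      then show ?thesis using vertex_algebraD(3)[OF vaS that] f0 by simp
    qed
    ultimately have "x0.vac_vec 0 (f (vacuum S))" by (simp add: x0.vac_vec_def)
    then show ?thesis by (rule fin)
  next
    assume "bg_relaxed_module S \<beta> \<gamma> Q Y0"
    then obtain v \<tau> where v: "v \<noteq> 0" "Y0 (normal_prod S \<gamma> \<beta>) 0 v = \<tau> *\<^sub>C v"
      "\<forall>n>0. Y0 \<beta> n v = 0 \<and> Y0 \<gamma> (n - 1) v = 0" "v \<in> Q"
      unfolding bg_relaxed_module_def generated_by_def by blast
    have b0: "x0 False n v = 0" if "n > 0" for n using v(3) that by (simp add: x0_def)
    have g0: "x0 True n v = 0" if "n \<ge> 0" for n using v(3)[rule_format, of "n + 1"] that by (simp add: x0_def)
    have Jv: "x0.Jop v = \<tau> *\<^sub>C v" using charge_mode[OF Y0 v(4)] v(2) by (simp add: x0_def)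
    have p: "x0.pairop n v = 0" if "n \<noteq> 0" for n
      using that b0[of n] g0[of "- n - 1"] by (auto simp: x0.pairop_def)
    have "x0.Jop v = x0.pairop 0 v"
      unfolding x0.qop_def by (subst Sum_any_eq_sum[of "{0}"]) (auto simp: p scaleC_one)
    then have gb: "x0 True (-1) (x0 False 0 v) = \<tau> *\<^sub>C v" using Jv by (simp add: x0.pairop_def)
    show ?thesis
    proof (cases "\<tau> \<in> \<int>")
      case True
      then obtain z :: int where z: "\<tau> = of_int z" by (auto simp: Ints_def)
      have "\<exists>l w. x0.vac_vec l w"
      proof (cases "z \<ge> 0")
        case True
        then show ?thesis using x0.relaxed_vac_pos[OF v(4,1) b0 g0, of "nat z"] gb z by simp
      next
        case False
        then have "\<tau> = - of_nat (Suc (nat (- z - 1)))" using z by (simp add: of_nat_nat)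
        then show ?thesis using x0.relaxed_vac_neg[OF v(4,1) b0 g0, of "nat (- z - 1)"] gb by simp
      qed
      then show ?thesis using fin by blast
    next
      case False
      have "x.Jop v = (\<tau> + of_int (t - s)) *\<^sub>C v"
      proof -
        have "x.Jop v = smooth_weyl.qop (spec (s - t) x0) (\<lambda>_. 1) v"
        proof -
          interpret y: smooth_weyl Q "spec (s - t) x0" by (rule smooth_weyl_spec[OF swx0])
          have "x.pairop n v = y.pairop n v" for n
            unfolding x.pairop_def y.pairop_def
            using rel[OF v(4)] rel[OF x.x_mem[OF v(4)]] by (metis rel)
          then show ?thesis by (simp add: x.qop_def y.qop_def)
        qed
        also have "\<dots> = x0.Jop v + spec_const (s - t) (\<lambda>_. 1) *\<^sub>C v" by (rule spec_qop[OF swx0 v(4)])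
        finally show ?thesis by (simp add: Jv spec_const_1 scaleC_add_left)
      qed
      from weights_coset[OF swx wg[OF v(4,1)] v(4) this]
      have span: "Q = cv.span {u\<in>Q. \<exists>z::int. x.Jop u = (\<tau> + of_int (t - s) + of_int z) *\<^sub>C u}" (is "Q = cv.span ?X") .
      show ?thesis
        unfolding x.bounded_weights_def
      proof (intro ballI impI)
        fix c u assume u: "u \<in> Q" "x.Jop u = of_int c *\<^sub>C u"
        have uX: "u \<in> cv.span ?X" using u(1) unfolding span[symmetric] .
        have "u \<in> cv.span {y\<in>?X. x.Jop y = of_int c *\<^sub>C y}"
          by (rule eigen_span[OF x.J.T_lin x.subM _ _ uX u(2)]) auto
        moreover have "{y\<in>?X. x.Jop y = of_int c *\<^sub>C y} \<subseteq> {0}"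
        proof
          fix y assume "y \<in> {y\<in>?X. x.Jop y = of_int c *\<^sub>C y}"
          then obtain z :: int where z: "(\<tau> + of_int (t - s) + of_int z) *\<^sub>C y = of_int c *\<^sub>C y" by auto
          show "y \<in> {0}"
          proof (rule ccontr)
            assume "y \<notin> {0}"
            then have "\<tau> + of_int (t - s) + of_int z = of_int c" using z cv.scale_right_imp_eq by blast
            then have "\<tau> = of_int (c - (t - s) - z)" by (simp add: algebra_simps)
            then show False using False Ints_of_int by metis
          qed
        qed
        ultimately have "u = 0" by (rule span_subset_0)
        then show "\<exists>cs. set cs \<subseteq> of_int ` {weight_bound c..} \<and> pol x.Lop cs u = 0"
          by (intro exI[of _ "[]"]) simp
      qed
    qed
  qed
  then show ?thesis by (simp add: x_def)
qed

text \<open>Induction along the composition series: a polynomial that annihilates the image in the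
  top factor moves the vector one step down without changing its charge, and the polynomials are
  multiplied.\<close>

lemma category_bounded:
  assumes cat: "bg_category S \<beta> \<gamma> M Y"
  shows "smooth_weyl.bounded_weights M (spec s (\<lambda>i. Y (gen i)))"
proof -
  have Y: "va_module S M Y" using cat by (simp add: bg_category_def)
  obtain l K where K: "K 0 = {0}" "K l = M"
    "\<forall>i<l. va_submodule S M Y (K (Suc i)) \<and> K i \<subseteq> K (Suc i) \<and>
       (\<exists>(Q :: (nat \<Rightarrow> complex) set) YQ f. bg_simple_object S \<beta> \<gamma> Q YQ \<and>
          module_hom S (K (Suc i)) Y Q YQ f \<and> f ` K (Suc i) = Q \<and> {u \<in> K (Suc i). f u = 0} = K i)"
    using cat unfolding bg_category_def by blast
  define x where "x = spec s (\<lambda>i. Y (gen i))"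
  have swx: "smooth_weyl M x" unfolding x_def by (rule smooth_weyl_spec[OF module_smooth_weyl[OF Y]])
  interpret x: smooth_weyl M x by (rule swx)
  have main: "i \<le> l \<Longrightarrow> c \<in> {-1, 0, 1} \<Longrightarrow> u \<in> K i \<Longrightarrow> x.Jop u = of_int c *\<^sub>C u \<Longrightarrow>
    \<exists>cs. set cs \<subseteq> of_int ` {weight_bound c..} \<and> pol x.Lop cs u = 0" for i c u
  proof (induction i arbitrary: u)
    case 0
    then show ?case using K(1) by (intro exI[of _ "[]"]) simp
  next
    case (Suc i)
    have sub: "va_submodule S M Y (K (Suc i))" using K(3) Suc.prems(1) by simp
    obtain Q :: "(nat \<Rightarrow> complex) set" and YQ f where Q: "bg_simple_object S \<beta> \<gamma> Q YQ"
      "module_hom S (K (Suc i)) Y Q YQ f" "f ` K (Suc i) = Q" "{u \<in> K (Suc i). f u = 0} = K i"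
      using K(3) Suc.prems(1) by (metis Suc_le_lessD)
    have YQ: "va_module S Q YQ" using Q(1) by (simp add: bg_simple_object_def va_irreducible_def)
    define y where "y = spec s (\<lambda>i. YQ (gen i))"
    have swy: "smooth_weyl Q y" unfolding y_def by (rule smooth_weyl_spec[OF module_smooth_weyl[OF YQ]])
    interpret y: smooth_weyl Q y by (rule swy)
    have Ks: "cv.subspace (K (Suc i))" "K (Suc i) \<subseteq> M" using sub by (auto simp: va_submodule_def)
    have inv: "x j n u \<in> K (Suc i)" if "u \<in> K (Suc i)" for j n u
      using sub that by (auto simp: va_submodule_def x_def spec_def)
    have f: "lin_on (K (Suc i)) f" "\<And>j n u. u \<in> K (Suc i) \<Longrightarrow> f (x j n u) = y j n (f u)"
      using Q(2) by (auto simp: module_hom_def lin_on_def x_def y_def spec_def)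
    note hom = x.qop_hom[OF swy f(1) Ks(1) _ Ks(2) inv f(2)]
    have pol: "pol x.Lop cs u \<in> K (Suc i) \<and> f (pol x.Lop cs u) = pol y.Lop cs (f u)" if "u \<in> K (Suc i)" for cs u
    proof (induction cs)
      case (Cons d cs)
      then show ?case using that hom[of "pol x.Lop cs u" of_int] lin_on_diff[OF f(1) Ks(1)] lin_onD(2)[OF f(1)]
        by (simp add: cv.subspace_diff[OF Ks(1)] cv.subspace_scale[OF Ks(1)])
    qed (use that in simp)
    have u: "u \<in> K (Suc i)" "u \<in> M" using Suc.prems Ks by auto
    have "y.Jop (f u) = of_int c *\<^sub>C f u"
      using hom(1)[OF u(1), of "\<lambda>_. 1"] Suc.prems(4) lin_onD(2)[OF f(1) u(1)] by simp
    moreover have "f u \<in> Q" using u(1) Q(3) by blast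
    ultimately obtain cs where cs: "set cs \<subseteq> of_int ` {weight_bound c..}" "pol y.Lop cs (f u) = 0"
      using simple_object_bounded[OF Q(1), of s, folded y_def] Suc.prems(2) unfolding y.bounded_weights_def by blast
    then have "pol x.Lop cs u \<in> K i" using pol[OF u(1), of cs] Q(4) by auto
    moreover have "x.Jop (pol x.Lop cs u) = of_int c *\<^sub>C pol x.Lop cs u"
      by (rule x.qop_pol[OF u(2) Suc.prems(4)])
    ultimately obtain ds where "set ds \<subseteq> of_int ` {weight_bound c..}" "pol x.Lop ds (pol x.Lop cs u) = 0"
      using Suc.IH Suc.prems by (metis Suc_leD)
    then show ?case using cs(1) by (intro exI[of _ "ds @ cs"]) (simp add: pol_append)
  qed
  have "x.bounded_weights"
    unfolding x.bounded_weights_def using main[of l] K(2) by blast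
  then show ?thesis by (simp add: x_def)
qed

end

section \<open>The generator of the projective cover\<close>

text \<open>Split u into its part with eigenvalue c and the rest. The image of the rest is an
  eigenvector for c in a span of eigenvectors for other values, hence zero, so the first part is the
  lift.\<close>

lemma eigen_lift:
  assumes T: "lin_on M T" "cv.subspace M" and T': "lin_on M' T'" "cv.subspace M'"
    and f: "lin_on M f" "\<And>u. u \<in> M \<Longrightarrow> f u \<in> M'" "\<And>u. u \<in> M \<Longrightarrow> f (T u) = T' (f u)"
    and X: "X \<subseteq> M" "\<And>y. y \<in> X \<Longrightarrow> \<exists>\<mu>. T y = \<mu> *\<^sub>C y"
    and u: "u \<in> cv.span X" "T' (f u) = c *\<^sub>C f u"
  obtains w where "w \<in> M" "T w = c *\<^sub>C w" "f w = f u"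
proof -
  let ?A = "{y\<in>X. T y = c *\<^sub>C y}" and ?B = "{y\<in>X. T y \<noteq> c *\<^sub>C y}"
  have "X = ?A \<union> ?B" by auto
  then obtain a b where ab: "u = a + b" "a \<in> cv.span ?A" "b \<in> cv.span ?B"
    using u(1) cv.span_Un[of ?A ?B] by auto
  have M: "a \<in> M" "b \<in> M" by (rule span_in_subspace[OF T(2)], use ab X(1) in auto)+
  have "?A \<subseteq> {u\<in>M. T u = c *\<^sub>C u}" using X(1) by auto
  moreover have "cv.subspace {u\<in>M. T u = c *\<^sub>C u}"
    by (rule cv.subspaceI) (auto simp: lin_on_0[OF T] lin_onD[OF T(1)] scaleC_add_right scaleC_scaleC mult.commute
      cv.subspace_0[OF T(2)] cv.subspace_add[OF T(2)] cv.subspace_scale[OF T(2)])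
  ultimately have a: "T a = c *\<^sub>C a" using cv_span_subspace_induct ab(2) by blast
  have fb: "f b \<in> cv.span (f ` ?B)"
    by (rule lin_on_span_image[OF f(1) T(2) _ _ cv.subspace_span ab(3)]) (use X(1) in \<open>auto intro: cv.span_base\<close>)
  have fu: "f u = f a + f b" using ab(1) lin_onD(1)[OF f(1) M] by simp
  have "T' (f a) = c *\<^sub>C f a" using f(3)[OF M(1)] a lin_onD(2)[OF f(1) M(1)] by simp
  then have Tb: "T' (f b) = c *\<^sub>C f b"
    using u(2) unfolding fu lin_onD(1)[OF T'(1) f(2)[OF M(1)] f(2)[OF M(2)]] by (simp add: scaleC_add_right)
  have "f b \<in> cv.span {y \<in> f ` ?B. T' y = c *\<^sub>C y}"
  proof (rule eigen_span[OF T' _ _ fb Tb])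
    show "f ` ?B \<subseteq> M'" using X(1) f(2) by auto
    fix y assume "y \<in> f ` ?B"
    then obtain x \<mu> where x: "x \<in> M" "y = f x" "T x = \<mu> *\<^sub>C x" using X by blast
    then have "T' y = \<mu> *\<^sub>C y" using f(3)[OF x(1)] lin_onD(2)[OF f(1) x(1)] by simp
    then show "\<exists>\<mu>. T' y = \<mu> *\<^sub>C y" by blast
  qed
  moreover have "{y \<in> f ` ?B. T' y = c *\<^sub>C y} \<subseteq> {0}"
  proof
    fix y assume y: "y \<in> {y \<in> f ` ?B. T' y = c *\<^sub>C y}"
    then obtain x \<mu> where x: "x \<in> M" "y = f x" "T x = \<mu> *\<^sub>C x" "T x \<noteq> c *\<^sub>C x" using X by blast
    have "\<mu> *\<^sub>C y = c *\<^sub>C y" using y f(3)[OF x(1)] lin_onD(2)[OF f(1) x(1)] x(2,3) by simp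
    then show "y \<in> {0}" using x(3,4) cv.scale_right_imp_eq by blast
  qed
  ultimately have "f b = 0" by (rule span_subset_0)
  then show ?thesis using that[of a] a M fu by simp
qed

context smooth_weyl begin

text \<open>The vectors beta_n w and gamma_n w for n >= 1 and gamma_0 beta_0 w have generalised
  weights -n, -n - 1 and -1, below the bounds for their charges -1, 1 and 0, so they vanish. What is
  left of the charge relates the pairs n = 0 and n = -1, and L w becomes gamma_-1 beta_0 w = -
  beta_-1 gamma_0 w. Applying L once more brings beta_0 in front of gamma_0 w, which gives
  zero.\<close>

lemma log_generator:
  assumes bd: "bounded_weights" and w: "w \<in> M" "Jop w = 0" "pol Lop (replicate k 0) w = 0"
  shows "Lop w = x True (-1) (x False 0 w)" "Lop (Lop w) = 0" "Jop w = 0"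
proof -
  have kill: "x i n w = 0 " if c: "n \<ge> 1" for i n
  proof (cases i)
    case False
    let ?y = "x False n w"
    have y: "?y \<in> M" using w(1) by (rule x_mem)
    have "Jop ?y = of_int (-1) *\<^sub>C ?y" using qop_x[OF w(1), of "\<lambda>_. 1" False n] w(2) by (simp add: charge_def)
    then obtain cs where cs: "set cs \<subseteq> of_int ` {weight_bound (-1)..}" "pol Lop cs ?y = 0"
      using bd y unfolding bounded_weights_def by blast
    have "pol Lop (replicate k (of_int (- n))) ?y = 0"
      using pol_x[OF w(1), of k 0 False n] w(3) by (simp add: charge_def)
    moreover have "of_int (- n) \<notin> set cs" using cs(1) c by (auto simp: weight_bound_def subset_iff image_iff simp del: of_int_minus)
    ultimately show ?thesis using L.pol_coprime[OF y _ cs(2)] False by simp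
  next
    case True
    let ?y = "x True n w"
    have y: "?y \<in> M" using w(1) by (rule x_mem)
    have "Jop ?y = of_int 1 *\<^sub>C ?y" using qop_x[OF w(1), of "\<lambda>_. 1" True n] w(2) by (simp add: charge_def)
    then obtain cs where cs: "set cs \<subseteq> of_int ` {weight_bound 1..}" "pol Lop cs ?y = 0"
      using bd y unfolding bounded_weights_def by blast
    have "pol Lop (replicate k (of_int (- n - 1))) ?y = 0"
      using pol_x[OF w(1), of k 0 True n] w(3) by (simp add: charge_def)
    moreover have "of_int (- n - 1) \<notin> set cs" using cs(1) c
      by (auto simp: weight_bound_def subset_iff image_iff simp del: of_int_minus of_int_diff)
    ultimately show ?thesis using L.pol_coprime[OF y _ cs(2)] True by simp
  qed
  have kill2: "x True 0 (x False 0 w) = 0"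
  proof -
    let ?y = "x True 0 (x False 0 w)"
    have z: "x False 0 w \<in> M" and y: "?y \<in> M" using w(1) by (auto intro: x_mem)
    have "Jop (x False 0 w) = (-1) *\<^sub>C x False 0 w" using qop_x[OF w(1), of "\<lambda>_. 1" False 0] w(2) by (simp add: charge_def)
    then have "Jop ?y = of_int 0 *\<^sub>C ?y" using qop_eigen_x[OF z, of "\<lambda>_. 1" "-1" True 0] by (simp add: charge_def)
    then obtain cs where cs: "set cs \<subseteq> of_int ` {weight_bound 0..}" "pol Lop cs ?y = 0"
      using bd y unfolding bounded_weights_def by blast
    have "pol Lop (replicate k (of_int (-1))) ?y = 0"
      using pol_x[OF z, of k 0 True 0] pol_x[OF w(1), of k 0 False 0] w(3) by (simp add: charge_def)
    moreover have "of_int (-1) \<notin> set cs" using cs(1)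
      by (auto simp: weight_bound_def subset_iff image_iff simp del: of_int_minus)
    ultimately show ?thesis using L.pol_coprime[OF y _ cs(2)] by simp
  qed
  have p: "pairop n w = 0" if "n \<noteq> 0" "n \<noteq> -1" for n
  proof -
    have "n \<ge> 1 \<or> n \<le> -2" using that by linarith
    then show ?thesis using kill[of n False] kill[of "- n - 1" True] by (auto simp: pairop_def)
  qed
  have "Jop w = pairop 0 w + pairop (-1) w"
    unfolding qop_def by (subst Sum_any_eq_sum[of "{0, -1}"]) (auto simp: p scaleC_one)
  then have J: "x False (-1) (x True 0 w) = - x True (-1) (x False 0 w)"
    using w(2) by (simp add: pairop_def eq_neg_iff_add_eq_0 add.commute)
  have "Lop w = - pairop (-1) w"
    unfolding qop_def by (subst Sum_any_eq_sum[of "{0, -1}"]) (auto simp: p scaleC_one cv.scale_minus_left)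
  then have "Lop w = - x False (-1) (x True 0 w)" by (simp add: pairop_def)
  then show Lw: "Lop w = x True (-1) (x False 0 w)" by (simp add: J)
  note m = w(1) x_mem
  have neg: "x i n (- u) = - x i n u" if "u \<in> M" for i n u
    using x_scale[OF that, of i n "-1"] by (simp add: scaleC_one cv.scale_minus_left)
  have s1: "x False 0 (x True 0 w) = 0"
    using x_swap[OF w(1), of False 0 True 0] kill2 by simp
  have s2: "x False 0 (x False (-1) (x True 0 w)) = x False (-1) (x False 0 (x True 0 w))"
    using x_swap[OF x_mem[OF w(1)], of False 0 False "-1" True 0] by (simp add: om_def)
  have "Lop (x True (-1) (x False 0 w)) = x True (-1) (x False 0 (Lop w))"
    using qop_x[OF x_mem[OF w(1)], of of_int True "-1" False 0] qop_x[OF w(1), of of_int False 0] by (simp add: charge_def)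
  also have "Lop w = - x False (-1) (x True 0 w)" by (simp add: Lw J)
  also have "x True (-1) (x False 0 (- x False (-1) (x True 0 w))) = 0"
    using m by (simp add: neg s2 s1)
  finally show "Lop (Lop w) = 0" by (simp add: Lw)
  show "Jop w = 0" by (rule w(2))
qed

end

context bg begin

text \<open>A preimage of the vacuum is first corrected to charge 0 and then projected to the
  generalised weight 0, both without changing its image. The submodule it generates maps onto the
  target, so the covering property makes it everything.\<close>

lemma cover_generator:
  assumes P: "bg_P S \<beta> \<gamma> s UNIV (YP :: 's \<Rightarrow> int \<Rightarrow> 'm::complex_vector \<Rightarrow> 'm)"
  defines "x \<equiv> spec s (\<lambda>i. YP (gen i))"
  obtains w Y\<sigma> \<pi> where "smooth_weyl.qop x (\<lambda>_. 1) w = 0" "smooth_weyl.qop x of_int (smooth_weyl.qop x of_int w) = 0"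
    "wgen UNIV x w" "bg_projective S \<beta> \<gamma> UNIV YP" "bg_spectral_flow S \<beta> \<gamma> s UNIV (nprod S) Y\<sigma>"
    "module_hom S UNIV YP UNIV Y\<sigma> \<pi>" "\<pi> w = vacuum S"
proof -
  obtain Y\<sigma> \<pi> where flow: "bg_spectral_flow S \<beta> \<gamma> s UNIV (nprod S) Y\<sigma>" and proj: "bg_projective S \<beta> \<gamma> UNIV YP"
    and \<pi>: "module_hom S UNIV YP UNIV Y\<sigma> \<pi>" "\<pi> ` UNIV = UNIV"
      "\<And>K. va_submodule S UNIV YP K \<Longrightarrow> \<pi> ` K = UNIV \<Longrightarrow> K = UNIV"
    using P unfolding bg_P_def bg_projective_cover_def by blast
  have cat: "bg_category S \<beta> \<gamma> UNIV YP" using proj by (simp add: bg_projective_def)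
  then have YP: "va_module S UNIV YP" by (simp add: bg_category_def)
  interpret x: smooth_weyl UNIV x unfolding x_def by (rule smooth_weyl_spec[OF module_smooth_weyl[OF YP]])
  have Y\<sigma>: "va_module S UNIV Y\<sigma>" using flow by (simp add: bg_spectral_flow_def)
  have \<sigma>: "spec s (\<lambda>i. Y\<sigma> (gen i)) = S_act"
  proof (intro ext)
    fix i n u show "spec s (\<lambda>i. Y\<sigma> (gen i)) i n u = S_act i n u"
      using flow by (cases i) (auto simp: bg_spectral_flow_def spec_def)
  qed
  have lin: "lin_on UNIV \<pi>" using \<pi>(1) by (auto simp: module_hom_def lin_on_def)
  have hom: "\<pi> (x i n u) = S_act i n (\<pi> u)" for i n u
  proof -
    have "\<pi> (x i n u) = spec s (\<lambda>i. Y\<sigma> (gen i)) i n (\<pi> u)" using \<pi>(1) by (auto simp: module_hom_def x_def spec_def)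
    then show ?thesis by (simp add: \<sigma>)
  qed
  have hq: "\<pi> (x.qop w u) = SS.qop w (\<pi> u)" for w u
    by (rule x.qop_hom(1)[OF SS.smooth_weyl_axioms lin cv.subspace_UNIV]) (auto simp: hom)
  have vacS: "SS.qop w (vacuum S) = 0" for w
  proof -
    have "nprod S a n 0 = 0" for a n
      by (rule lin_on_0[OF va_moduleD(3)[OF vertex_algebraD(1)[OF vaS]] cv.subspace_UNIV])
    then have "SS.pairop n (vacuum S) = 0" for n
      using vertex_algebraD(3)[OF vaS, of n] vertex_algebraD(3)[OF vaS, of "- n - 1"]
      by (cases "n \<ge> 0") (auto simp: SS.pairop_def)
    then show ?thesis by (simp add: SS.qop_def)
  qed
  define X where "X = {v. \<exists>t::real. YP (normal_prod S \<gamma> \<beta>) 0 v = complex_of_real t *\<^sub>C v}"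
  have span: "cv.span X = UNIV" using cat by (simp add: bg_category_def X_def)
  have Xe: "\<exists>\<mu>. x.Jop y = \<mu> *\<^sub>C y" if "y \<in> X" for y
  proof -
    obtain t where t: "YP (normal_prod S \<gamma> \<beta>) 0 y = t *\<^sub>C y" using \<open>y \<in> X\<close> by (auto simp: X_def)
    have "x.Jop y = smooth_weyl.qop (\<lambda>i. YP (gen i)) (\<lambda>_. 1) y + spec_const s (\<lambda>_. 1) *\<^sub>C y"
      unfolding x_def by (rule spec_qop[OF module_smooth_weyl[OF YP] UNIV_I])
    then have "x.Jop y = (t + spec_const s (\<lambda>_. 1)) *\<^sub>C y"
      using charge_mode[OF YP UNIV_I, of y] t by (simp add: scaleC_add_left)
    then show ?thesis by blast
  qed
  obtain w0 where w0: "\<pi> w0 = vacuum S" using \<pi>(2) by (metis UNIV_I imageE)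
  obtain w1 where w1: "x.Jop w1 = 0 *\<^sub>C w1" "\<pi> w1 = \<pi> w0"
    by (rule eigen_lift[OF x.J.T_lin cv.subspace_UNIV SS.J.T_lin cv.subspace_UNIV lin, of X w0 0])
      (use Xe span w0 vacS in \<open>auto simp: hq\<close>)
  have bd: "x.bounded_weights" unfolding x_def by (rule category_bounded[OF cat])
  have "x.Jop w1 = of_int 0 *\<^sub>C w1" using w1(1) by simp
  then obtain cs where cs: "pol x.Lop cs w1 = 0"
    using bd unfolding x.bounded_weights_def by blast
  define ds where "ds = filter (\<lambda>c. c \<noteq> 0) cs"
  \<comment> \<open>L is 0 on the vacuum, so the filtered polynomial acts there as the product of
    the numbers 0 - c; r normalises this to 1.\<close>
  define r where "r = (\<Prod>c\<leftarrow>ds. inverse (0 - c))"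
  obtain k where k: "pol x.Lop (replicate k 0) (r *\<^sub>C pol x.Lop ds w1) = 0"
    by (rule x.L.pol_filter[OF UNIV_I cs, of 0]) (auto simp: ds_def r_def)
  let ?w = "r *\<^sub>C pol x.Lop ds w1"
  have "\<pi> (pol x.Lop es u) = pol SS.Lop es (\<pi> u)" for es u
    by (induction es) (auto simp: lin_on_diff[OF lin cv.subspace_UNIV] lin_onD(2)[OF lin] hq)
  then have "\<pi> ?w = r *\<^sub>C pol SS.Lop ds (vacuum S)" by (simp add: lin_onD(2)[OF lin] w1 w0)
  also have "pol SS.Lop ds (vacuum S) = (\<Prod>c\<leftarrow>ds. 0 - c) *\<^sub>C vacuum S"
    by (rule SS.L.pol_eigen) (auto simp: vacS)
  also have "r *\<^sub>C (\<Prod>c\<leftarrow>ds. 0 - c) *\<^sub>C vacuum S = vacuum S"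
  proof -
    have "0 \<notin> set ds" by (auto simp: ds_def)
    then have "r * (\<Prod>c\<leftarrow>ds. 0 - c) = 1" unfolding r_def by (induction ds) (auto simp: field_simps)
    then show ?thesis by (simp add: scaleC_scaleC scaleC_one)
  qed
  finally have pw: "\<pi> ?w = vacuum S" .
  have Jw: "x.Jop ?w = 0"
    using x.qop_pol[OF UNIV_I w1(1), of ds] by (simp add: lin_onD(2)[OF x.qop_lin])
  have gen: "wgen UNIV x ?w"
    unfolding wgen_def
  proof (intro allI impI, elim conjE)
    fix K assume K: "winv UNIV x K" "?w \<in> K"
    have sub: "va_submodule S UNIV YP K"
      using K(1) winv_submodule[OF YP] by (simp add: x_def winv_spec)
    have i: "winv UNIV S_act (\<pi> ` K)"
      using K(1) lin_on_image_subspace[OF lin_on_subset[OF lin]] unfolding winv_def by (auto simp: hom[symmetric])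
    have v: "vacuum S \<in> \<pi> ` K" using K(2) pw by (metis imageI)
    have "a \<in> \<pi> ` K" for a by (rule bg_induct[OF _ v]) (use i in \<open>auto simp: winv_def\<close>)
    then show "K = UNIV" by (intro \<pi>(3)[OF sub]) blast
  qed
  show ?thesis
    by (rule that[OF Jw x.log_generator(2)[OF bd UNIV_I Jw k] gen proj flow \<pi>(1) pw])
qed

text \<open>A mode shifts the charge and the generalised weight by constants and preserves the
  exponent 2, so the span of such vectors is invariant; it contains the generator.\<close>

lemma rank_two_span:
  assumes sw: "smooth_weyl UNIV x" and gen: "wgen UNIV x w" and w: "smooth_weyl.qop x (\<lambda>_. 1) w = 0"
    "smooth_weyl.qop x of_int (smooth_weyl.qop x of_int w) = 0"
  shows "cv.span {u. \<exists>q h. smooth_weyl.qop x (\<lambda>_. 1) u = q *\<^sub>C u \<and> pol (smooth_weyl.qop x of_int) [h, h] u = 0} = UNIV"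
    (is "cv.span ?X = UNIV")
proof -
  interpret smooth_weyl UNIV x by (rule sw)
  have "winv UNIV x (cv.span ?X)"
    unfolding winv_def
  proof (intro conjI allI ballI)
    fix i n u assume u: "u \<in> cv.span ?X"
    show "x i n u \<in> cv.span ?X"
    proof (rule lin_on_span_image[OF x_lin cv.subspace_UNIV subset_UNIV _ cv.subspace_span u])
      fix y assume "y \<in> ?X"
      then obtain q h where y: "Jop y = q *\<^sub>C y" "pol Lop [h, h] y = 0" by blast
      have "Jop (x i n y) = (q + charge (\<lambda>_. 1) i n) *\<^sub>C x i n y" by (rule qop_eigen_x[OF UNIV_I y(1)])
      moreover have "pol Lop [h + charge of_int i n, h + charge of_int i n] (x i n y) = 0"
        using pol_x[OF UNIV_I, of 2 h i n y] y(2) by (simp add: numeral_2_eq_2 del: pol_simps)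
      ultimately show "x i n y \<in> cv.span ?X" by (intro cv.span_base) blast
    qed
  qed auto
  moreover have "w \<in> cv.span ?X"
  proof (intro cv.span_base CollectI exI conjI)
    show "Jop w = 0 *\<^sub>C w" "pol Lop [0, 0] w = 0" using w by simp_all
  qed
  ultimately show ?thesis using gen unfolding wgen_def by blast
qed

end

section \<open>Quotients of countable dimension\<close>

text \<open>Membership in the category is tested on carriers in
  \<open>nat \<Rightarrow> complex\<close>. A basis of K is extended by countably many vectors of C,
  and the quotient is recorded by the coordinates at the added vectors, numbered by e.\<close>

lemma quotient_map_exists:
  fixes M :: "'m::complex_vector set"
  assumes C: "countable C" "C \<subseteq> M" "M = cv.span C" and K: "cv.subspace K" "K \<subseteq> M"
  obtains f :: "'m \<Rightarrow> nat \<Rightarrow> complex" where "lin_on M f" "{u\<in>M. f u = 0} = K"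
proof -
  obtain B0 where B0: "B0 \<subseteq> K" "cv.independent B0" "K \<subseteq> cv.span B0"
    using cv.maximal_independent_subset[of K] by metis
  obtain B where B: "B0 \<subseteq> B" "B \<subseteq> B0 \<union> C" "cv.independent B" "B0 \<union> C \<subseteq> cv.span B"
    using cv.maximal_independent_subset_extend[of B0 "B0 \<union> C"] B0(2) by (metis Un_upper1)
  have subM: "cv.subspace M" using C(3) by simp
  have spanB: "cv.span B = M"
  proof
    show "cv.span B \<subseteq> M" using B(2) B0(1) K(2) C(2) by (intro cv.span_minimal[OF _ subM]) auto
    show "M \<subseteq> cv.span B" unfolding C(3) using B(4) by (intro cv.span_minimal) auto
  qed
  have cnt: "countable (B - B0)" by (rule countable_subset[OF _ C(1)]) (use B(2) in auto)
  define e where "e = to_nat_on (B - B0)"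
  have e: "inj_on e (B - B0)" unfolding e_def by (rule inj_on_to_nat_on[OF cnt])
  define r where "r = cv.representation B"
  define f where "f u n = (if n \<in> e ` (B - B0) then r u (inv_into (B - B0) e n) else 0)" for u n
  have rl: "r (u + v) b = r u b + r v b" "r (t *\<^sub>C u) b = t * r u b" if "u \<in> M" "v \<in> M" for u v t b
    using that cv.representation_add[OF B(3), of v u] cv.representation_scale[OF B(3), of u t]
    unfolding spanB r_def by (simp_all add: add.commute)
  have "lin_on M f"
    unfolding lin_on_def by (auto simp: fun_eq_iff f_def rl scaleC_fun_def scaleC_complex_def)
  moreover have "{u\<in>M. f u = 0} = K"
  proof safe
    fix u assume u: "u \<in> M" "f u = 0"
    have z: "r u b = 0" if "b \<in> B - B0" for b
    proof -
      have "f u (e b) = r u b" using that e by (simp add: f_def)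
      then show ?thesis using u(2) by simp
    qed
    have "u = (\<Sum>b\<in>{b. r u b \<noteq> 0}. r u b *\<^sub>C b)"
      unfolding r_def using cv.sum_nonzero_representation_eq[OF B(3)] u(1) spanB by simp
    moreover have "{b. r u b \<noteq> 0} \<subseteq> B0"
      using z cv.representation_ne_zero[of B u] by (auto simp: r_def)
    moreover have "(\<Sum>b\<in>{b. r u b \<noteq> 0}. r u b *\<^sub>C b) \<in> cv.span B0"
      using calculation(2) by (intro cv.span_sum cv.span_scale cv.span_base) auto
    ultimately have "u \<in> cv.span B0" by (simp only:)
    then show "u \<in> K" using cv.span_minimal[OF B0(1) K(1)] by blast
  next
    fix u assume u: "u \<in> K"
    then show "u \<in> M" using K(2) by blast
    have "u \<in> cv.span B0" using u B0(3) by blast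
    then have "r u b = 0" if "b \<in> B - B0" for b
    proof -
      have "r u = cv.representation B0 u"
        unfolding r_def by (rule cv.representation_extend[OF B(3) \<open>u \<in> cv.span B0\<close> B(1)])
      then show ?thesis using cv.representation_ne_zero[of B0 u b] that by auto
    qed
    then have "f u n = 0" for n
      unfolding f_def using inv_into_into[of n e "B - B0"] by (cases "n \<in> e ` (B - B0)") simp_all
    then show "f u = 0" by (intro ext) simp
  qed
  ultimately show ?thesis by (rule that)
qed

lemma weyl_subset:
  assumes x: "weyl M x" and K: "winv M x K"
  shows "weyl K x"
proof -
  have sub: "cv.subspace K" "K \<subseteq> M" and inv: "\<And>i n u. u \<in> K \<Longrightarrow> x i n u \<in> K" using K by (auto simp: winv_def)
  have l: "lin_on K (x i n)" for i n by (rule lin_on_subset[OF weylD(3)[OF x] sub(2)])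
  have s: "x i m (x j n u) = x j n (x i m u) + (if m + n = -1 then om i j *\<^sub>C u else 0)" if "u \<in> K" for i j m n u
    using that sub(2) by (intro weylD(4)[OF x]) auto
  show ?thesis unfolding weyl_def by (intro conjI allI ballI sub(1) inv l s)
qed

lemma smooth_subset: "smooth M x \<Longrightarrow> K \<subseteq> M \<Longrightarrow> smooth K x"
  unfolding smooth_def by blast

lemma quotient_modes_exist:
  fixes M :: "'m::complex_vector set"
  assumes C: "countable C" "C \<subseteq> M" "M = cv.span C" and x: "weyl M x" "smooth M x" and K: "winv M x K"
  obtains f :: "'m \<Rightarrow> nat \<Rightarrow> complex" and q where "lin_on M f" "{u\<in>M. f u = 0} = K"
    "weyl (f ` M) q" "smooth (f ` M) q" "\<And>i n u. u \<in> M \<Longrightarrow> f (x i n u) = q i n (f u)"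
proof -
  have Ks: "cv.subspace K" "K \<subseteq> M" "\<And>i n u. u \<in> K \<Longrightarrow> x i n u \<in> K" using K by (auto simp: winv_def)
  interpret weyl_module M x by unfold_locales (rule x(1))
  obtain f :: "'m \<Rightarrow> nat \<Rightarrow> complex" where f: "lin_on M f" "{u\<in>M. f u = 0} = K"
    by (rule quotient_map_exists[OF C Ks(1,2)])
  \<comment> \<open>The choice of preimage is immaterial, since two of them differ by a vector of
    the invariant subspace K.\<close>
  define q where "q i n v = f (x i n (inv_into M f v))" for i n v
  have q: "f (x i n u) = q i n (f u)" if u: "u \<in> M" for i n u
  proof -
    let ?u = "inv_into M f (f u)"
    have m: "?u \<in> M" "f ?u = f u" using u by (auto simp: inv_into_into f_inv_into_f)
    then have "f (?u - u) = 0" using lin_on_diff[OF f(1) subM] u by simp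
    then have "?u - u \<in> K" using f(2) m(1) u M_ops by blast
    then have "f (x i n (?u - u)) = 0" using Ks(3) f(2) by blast
    then show ?thesis using lin_on_diff[OF f(1) subM] m u by (simp add: q_def x_diff x_mem)
  qed
  have "weyl (f ` M) q"
    unfolding weyl_def
  proof (intro conjI allI ballI)
    show "cv.subspace (f ` M)" by (rule lin_on_image_subspace[OF f(1) subM])
    show "q i n v \<in> f ` M" if "v \<in> f ` M" for i n v using that by (auto simp: q[symmetric] x_mem)
    show "lin_on (f ` M) (q i n)" for i n
      unfolding lin_on_def
    proof safe
      fix u v assume "u \<in> M" "v \<in> M"
      then show "q i n (f u + f v) = q i n (f u) + q i n (f v)"
        using q[of "u + v" i n] by (simp add: lin_onD[OF f(1)] M_ops x_add q)
    next
      fix t u assume "u \<in> M"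
      then show "q i n (t *\<^sub>C f u) = t *\<^sub>C q i n (f u)"
        using q[of "t *\<^sub>C u" i n] by (simp add: lin_onD[OF f(1)] M_ops x_scale q)
    qed
    fix i j m n v assume "v \<in> f ` M"
    then obtain u where u: "u \<in> M" "v = f u" by blast
    have "q i m (q j n v) = f (x i m (x j n u))" using u by (simp add: q x_mem)
    also have "\<dots> = f (x j n (x i m u)) + (if m + n = - 1 then om i j *\<^sub>C f u else 0)"
      unfolding x_swap[OF u(1), of i m j n] using u(1) by (simp add: lin_onD[OF f(1)] M_ops lin_on_0[OF f(1) subM])
    finally show "q i m (q j n v) = q j n (q i m v) + (if m + n = - 1 then om i j *\<^sub>C v else 0)"
      using u by (simp add: q x_mem)
  qed
  moreover have "smooth (f ` M) q"
    unfolding smooth_def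
  proof (intro allI ballI)
    fix i v assume "v \<in> f ` M"
    then obtain u where u: "u \<in> M" "v = f u" by blast
    obtain k where "\<forall>n\<ge>k. x i n u = 0" using smoothD[OF x(2) u(1)] by blast
    then have "\<forall>n\<ge>k. q i n v = 0" using u by (auto simp: q[symmetric] lin_on_0[OF f(1) subM])
    then show "\<exists>K. \<forall>n\<ge>K. q i n v = 0" by blast
  qed
  ultimately show ?thesis using that[OF f] q by blast
qed

text \<open>The submodule generated by C, written as the span of explicit words so that its
  countable dimension can be read off.\<close>

definition wspan :: "(bool \<Rightarrow> int \<Rightarrow> 'm \<Rightarrow> 'm) \<Rightarrow> 'm set \<Rightarrow> 'm::complex_vector set" where
  "wspan x C = cv.span ((\<lambda>(ws, c). foldr (\<lambda>(i, n). x i n) ws c) ` (UNIV \<times> C))"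

lemma wspan_base: "c \<in> C \<Longrightarrow> c \<in> wspan x C"
  unfolding wspan_def by (rule cv.span_base) (force intro!: image_eqI[of _ _ "([], c)"])

lemma wspan_inv:
  assumes "weyl UNIV x" shows "winv UNIV x (wspan x C)"
  unfolding winv_def
proof (intro conjI allI ballI)
  let ?W = "(\<lambda>(ws, c). foldr (\<lambda>(i, n). x i n) ws c) ` (UNIV \<times> C)"
  show "cv.subspace (wspan x C)" by (simp add: wspan_def)
  fix i n u assume "u \<in> wspan x C"
  then have u: "u \<in> cv.span ?W" by (simp add: wspan_def)
  show "x i n u \<in> wspan x C"
  proof (rule lin_on_span_image[OF weylD(3)[OF assms] cv.subspace_UNIV _ _ _ u])
    fix w assume "w \<in> ?W"
    then obtain ws c where w: "w = foldr (\<lambda>(i, n). x i n) ws c" "c \<in> C" by auto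
    then have "x i n w \<in> ?W" by (force intro!: image_eqI[of _ _ "((i, n) # ws, c)"])
    then show "x i n w \<in> wspan x C" unfolding wspan_def by (rule cv.span_base)
  qed (simp_all add: wspan_def)
qed simp

lemma wspan_minimal:
  assumes "winv M x K" "C \<subseteq> K" shows "wspan x C \<subseteq> K"
proof -
  have "foldr (\<lambda>(i, n). x i n) ws c \<in> K" if "c \<in> C" for ws c
    using that assms by (induction ws) (auto simp: winv_def)
  then show ?thesis unfolding wspan_def using assms(1) by (intro cv.span_minimal) (auto simp: winv_def)
qed

lemma wspan_spec: "wspan (spec l x) C = wspan x C"
proof -
  have "wspan (spec l x) C \<subseteq> wspan x C" for l and x :: "bool \<Rightarrow> int \<Rightarrow> 'a \<Rightarrow> 'a"
    unfolding wspan_def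
  proof (rule cv.span_mono, safe)
    fix ws c assume "c \<in> C"
    have "foldr (\<lambda>(i, n). spec l x i n) ws c = foldr (\<lambda>(i, n). x i n) (map (\<lambda>(i, n). (i, if i then n + l else n - l)) ws) c"
      by (induction ws) (auto simp: spec_def)
    then show "foldr (\<lambda>(i, n). spec l x i n) ws c \<in> (\<lambda>(ws, c). foldr (\<lambda>(i, n). x i n) ws c) ` (UNIV \<times> C)"
      using \<open>c \<in> C\<close> by auto
  qed
  from this[of l x] this[of "- l" "spec l x"] show ?thesis by auto
qed

lemma wspan_countable:
  assumes "countable C"
  obtains B where "countable B" "B \<subseteq> wspan x C" "wspan x C = cv.span B"
  by (rule that[of "(\<lambda>(ws, c). foldr (\<lambda>(i, n). x i n) ws c) ` (UNIV \<times> C)"])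
    (use assms in \<open>auto simp: wspan_def intro!: cv.span_base\<close>)

lemma wspan_smooth:
  assumes x: "weyl UNIV x" and C: "\<And>c i. c \<in> C \<Longrightarrow> \<exists>K. \<forall>n\<ge>K. x i n c = 0"
  shows "smooth (wspan x C) x"
proof -
  interpret weyl_module UNIV x by unfold_locales (rule x)
  let ?K = "{u. \<forall>i. \<exists>K. \<forall>n\<ge>K. x i n u = 0}"
  have "winv UNIV x ?K"
    unfolding winv_def
  proof (intro conjI allI ballI)
    show "cv.subspace ?K"
    proof (rule cv.subspaceI)
      fix u v assume uv: "u \<in> ?K" "v \<in> ?K"
      have "\<exists>K. \<forall>n\<ge>K. x i n (u + v) = 0" for i
      proof -
        obtain k l where "\<forall>n\<ge>k. x i n u = 0" "\<forall>n\<ge>l. x i n v = 0" using uv by blast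
        then show ?thesis by (intro exI[of _ "max k l"]) (simp add: x_add)
      qed
      then show "u + v \<in> ?K" by blast
    next
      fix t u assume "u \<in> ?K"
      then show "t *\<^sub>C u \<in> ?K" by (simp add: x_scale) (metis cv.scale_zero_right)
    qed simp
    fix j m u assume u: "u \<in> ?K"
    have "\<exists>K. \<forall>n\<ge>K. x i n (x j m u) = 0" for i
    proof -
      obtain k where k: "\<forall>n\<ge>k. x i n u = 0" using u by blast
      have "x i n (x j m u) = 0" if "n \<ge> max k (- m)" for n
        using x_swap[OF UNIV_I, of i n j m u] k that by simp
      then show ?thesis by blast
    qed
    then show "x j m u \<in> ?K" by blast
  qed simp
  then have "wspan x C \<subseteq> ?K" using C by (intro wspan_minimal) auto
  then show ?thesis by (auto simp: smooth_def)
qed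

context bg begin

text \<open>Modulo K the vector v is a vacuum vector for the flow t and a generator, so the quotient
  is isomorphic to that flow of S and inherits its irreducibility.\<close>

lemma simple_quotient_exists:
  fixes M :: "'m::complex_vector set"
  assumes C: "countable C" "C \<subseteq> M" "M = cv.span C" and x: "weyl M x" "smooth M x" and K: "winv M x K"
    and v: "v \<in> M" "v \<notin> K" "\<And>i n. n \<ge> 0 \<Longrightarrow> spec t x i n v \<in> K"
    and gen: "\<And>H. winv M x H \<Longrightarrow> K \<subseteq> H \<Longrightarrow> v \<in> H \<Longrightarrow> H = M"
  obtains Q :: "(nat \<Rightarrow> complex) set" and YQ f where "bg_simple_object S \<beta> \<gamma> Q YQ" "lin_on M f" "f ` M = Q"
    "{u\<in>M. f u = 0} = K" "\<And>i n u. u \<in> M \<Longrightarrow> f (x i n u) = YQ (gen i) n (f u)"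
proof -
  interpret xM: weyl_module M x by unfold_locales (rule x(1))
  obtain f :: "'m \<Rightarrow> nat \<Rightarrow> complex" and q where f: "lin_on M f" "{u\<in>M. f u = 0} = K"
    "weyl (f ` M) q" "smooth (f ` M) q" "\<And>i n u. u \<in> M \<Longrightarrow> f (x i n u) = q i n (f u)"
    by (rule quotient_modes_exist[OF C x K]) (rule that)
  interpret q: smooth_weyl "f ` M" q by unfold_locales (use f in auto)
  obtain YQ where YQ: "va_module S (f ` M) YQ" "\<And>i n u. u \<in> f ` M \<Longrightarrow> YQ (gen i) n u = q i n u"
    by (rule module_exists[OF f(3,4)]) (rule that)
  \<comment> \<open>\<open>Y0\<close> undoes the flow, so that S itself maps to it isomorphically,
    as the definition of a simple object demands.\<close>
  obtain Y0 where Y0: "va_module S (f ` M) Y0" "\<And>i n u. u \<in> f ` M \<Longrightarrow> Y0 (gen i) n u = spec t q i n u"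
    by (rule module_exists[OF weyl_spec[OF f(3)] smooth_spec[OF f(4)]]) (rule that)
  have vv: "q.vac_vec t (f v)"
  proof -
    have "spec t q i n (f v) = f (spec t x i n v)" for i n by (simp add: spec_def f(5)[OF v(1)])
    then have "spec t q i n (f v) = 0" if "n \<ge> 0" for i n using v(3)[OF that, of i] f(2) by auto
    moreover have "f v \<noteq> 0" using v(1,2) f(2) by blast
    ultimately show ?thesis using v(1) by (simp add: q.vac_vec_def)
  qed
  have wg: "wgen (f ` M) q (f v)"
    unfolding wgen_def
  proof (intro allI impI, elim conjE)
    fix H assume H: "winv (f ` M) q H" "f v \<in> H"
    then have Hs: "cv.subspace H" "H \<subseteq> f ` M" by (auto simp: winv_def)
    let ?H = "{u\<in>M. f u \<in> H}"
    have "winv M x ?H"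
      unfolding winv_def
    proof (intro conjI allI ballI)
      show "cv.subspace ?H"
        by (rule cv.subspaceI) (auto simp: xM.M_ops lin_onD[OF f(1)] lin_on_0[OF f(1) xM.subM]
          cv.subspace_0[OF Hs(1)] cv.subspace_add[OF Hs(1)] cv.subspace_scale[OF Hs(1)])
      show "x i n u \<in> ?H" if "u \<in> ?H" for i n u using that H(1) by (auto simp: xM.x_mem f(5) winv_def)
    qed auto
    moreover have "K \<subseteq> ?H" using f(2) cv.subspace_0[OF Hs(1)] by auto
    moreover have "v \<in> ?H" using H(2) v(1) by simp
    ultimately have "?H = M" by (rule gen)
    then show "H = f ` M" using Hs(2) by blast
  qed
  interpret bg_vac S \<beta> \<gamma> "f ` M" q t "f v" by unfold_locales (use vv wg in auto)
  obtain \<Psi> where \<Psi>: "clinear \<Psi>" "\<Psi> (vacuum S) = f v" "range \<Psi> = f ` M" "inj \<Psi>"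
    "\<And>i n a. \<Psi> (S_act i n a) = spec t q i n (\<Psi> a)" by (rule vac_iso) (rule that)
  have rangeI': "\<Psi> a \<in> f ` M" for a using \<Psi>(3) by blast
  have "va_irreducible S (f ` M) YQ"
    unfolding va_irreducible_def
  proof (intro conjI allI impI)
    show "f ` M \<noteq> {0}" using vv unfolding q.vac_vec_def by blast
    fix H assume "va_submodule S (f ` M) YQ H"
    then have "winv (f ` M) q H"
      unfolding va_submodule_def winv_def using YQ(2) by (metis (no_types, lifting) subsetD)
    then show "H = {0} \<or> H = f ` M" using vac_irreducible by blast
  qed (rule YQ(1))
  moreover have "bg_spectral_flow S \<beta> \<gamma> t (f ` M) Y0 YQ"
    unfolding bg_spectral_flow_def
  proof (intro conjI allI ballI YQ(1) Y0(1))
    fix n u assume u: "u \<in> f ` M"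
    show "YQ \<beta> n u = Y0 \<beta> (n + t) u" using YQ(2)[OF u, of False n] Y0(2)[OF u, of False "n + t"] by simp
    show "YQ \<gamma> n u = Y0 \<gamma> (n - t) u" using YQ(2)[OF u, of True n] Y0(2)[OF u, of True "n - t"] by simp
  qed
  moreover have "module_hom S UNIV (nprod S) (f ` M) Y0 \<Psi>"
    by (rule module_homI[OF vertex_algebraD(1)[OF vaS] Y0(1)])
      (use \<Psi> Y0(2) rangeI' in \<open>auto simp: lin_on_UNIV\<close>)
  moreover have "bij_betw \<Psi> UNIV (f ` M)" using \<Psi>(3,4) by (simp add: bij_betw_def)
  ultimately have "bg_simple_object S \<beta> \<gamma> (f ` M) YQ" unfolding bg_simple_object_def by blast
  then show ?thesis by (rule that) (use f YQ(2) in auto)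
qed

end

section \<open>A logarithmic extension\<close>

text \<open>Functions of \<open>k\<close> and \<open>b\<close> stand for formal sums of monomials \<open>\<Prod>\<^sub>n X\<^sub>n\<^sup>k\<^sup>n\<close> with coefficients in the
  dual numbers \<open>\<complex>[\<epsilon>]\<close>, where \<open>b\<close> selects the coefficient of \<open>\<epsilon>\<close>. The exponents of \<open>X\<^sub>0\<close> and \<open>X\<^sub>-\<^sub>1\<close>
  are deformed by \<open>\<epsilon>\<close> and \<open>- \<epsilon>\<close>.\<close>

type_synonym logfun = "(int \<Rightarrow> int) \<Rightarrow> bool \<Rightarrow> complex"

definition log_eps :: "logfun \<Rightarrow> logfun" where
  "log_eps \<phi> k b = (if b then \<phi> k False else 0)"

text \<open>Since the functions are coefficients, reading at exponent k + t is multiplication by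
  X_n^(-t).\<close>

definition log_shift :: "int \<Rightarrow> int \<Rightarrow> logfun \<Rightarrow> logfun" where
  "log_shift n t \<phi> k b = \<phi> (k(n := k n + t)) b"

text \<open>In the charge both exponents have weight 1 and the deformations cancel; in L the weights
  are 0 and -1, and \<epsilon> survives with coefficient 1.\<close>

definition log_slope :: "int \<Rightarrow> complex" where
  "log_slope n = (if n = 0 then 1 else if n = -1 then -1 else 0)"

definition log_exp :: "int \<Rightarrow> logfun \<Rightarrow> logfun" where
  "log_exp n \<phi> k b = of_int (k n) * \<phi> k b + log_slope n * log_eps \<phi> k b"

text \<open>For n >= 0 this and \<open>log_X\<close> are the derivative and the multiplication by
  X_n. For n < 0 monomials are rescaled so that the scalar sits on the raising operator: the vacuum
  has exponent -1 there, raising it gives the factor 0, and lowering creates.\<close>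

definition log_D :: "int \<Rightarrow> logfun \<Rightarrow> logfun" where
  "log_D n \<phi> = (if n \<ge> 0 then log_shift n 1 (log_exp n \<phi>) else log_shift n 1 \<phi>)"

definition log_X :: "int \<Rightarrow> logfun \<Rightarrow> logfun" where
  "log_X n \<phi> = (if n \<ge> 0 then log_shift n (-1) \<phi> else log_exp n (log_shift n (-1) \<phi>))"

definition logx :: "bool \<Rightarrow> int \<Rightarrow> logfun \<Rightarrow> logfun" where
  "logx i n = (if i then log_X (- n - 1) else log_D n)"

lemma logx_simps [simp]: "logx False n = log_D n" "logx True n = log_X (- n - 1)"
  by (simp_all add: logx_def)

lemma scaleC_logfun: "((t *\<^sub>C \<phi>) :: logfun) k b = t * \<phi> k b"
  by (simp add: scaleC_fun_def scaleC_complex_def)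

lemma log_shift_shift: "log_shift n s (log_shift m t \<phi>) = log_shift m t (log_shift n s \<phi>)"
  by (cases "n = m") (auto simp: fun_eq_iff log_shift_def fun_upd_twist algebra_simps)

lemma log_shift_inverse: "log_shift n 1 (log_shift n (-1) \<phi>) = \<phi>" "log_shift n (-1) (log_shift n 1 \<phi>) = \<phi>"
  by (auto simp: fun_eq_iff log_shift_def)

lemma log_exp_exp: "log_exp n (log_exp m \<phi>) = log_exp m (log_exp n \<phi>)"
  by (auto simp: fun_eq_iff log_exp_def log_eps_def algebra_simps)

lemma log_exp_shift: "n \<noteq> m \<Longrightarrow> log_exp n (log_shift m t \<phi>) = log_shift m t (log_exp n \<phi>)"
  by (auto simp: fun_eq_iff log_exp_def log_shift_def log_eps_def)

lemma log_exp_shift_same: "log_exp n (log_shift n t \<phi>) = log_shift n t (log_exp n \<phi>) - of_int t *\<^sub>C log_shift n t \<phi>"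
  by (auto simp: fun_eq_iff log_exp_def log_shift_def log_eps_def scaleC_logfun algebra_simps)

lemma log_shift_lin: "log_shift n t (\<phi> + \<psi>) = log_shift n t \<phi> + log_shift n t \<psi>"
  "log_shift n t (\<phi> - \<psi>) = log_shift n t \<phi> - log_shift n t \<psi>" "log_shift n t (c *\<^sub>C \<phi>) = c *\<^sub>C log_shift n t \<phi>"
  by (auto simp: fun_eq_iff log_shift_def scaleC_logfun)

lemma log_exp_lin: "log_exp n (\<phi> + \<psi>) = log_exp n \<phi> + log_exp n \<psi>" "log_exp n (c *\<^sub>C \<phi>) = c *\<^sub>C log_exp n \<phi>"
  by (auto simp: fun_eq_iff log_exp_def log_eps_def scaleC_logfun algebra_simps)

lemma log_0 [simp]: "log_shift n t 0 = 0" "log_exp n 0 = 0"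
  by (auto simp: fun_eq_iff log_shift_def log_exp_def log_eps_def)

lemma log_X_D: "log_X n (log_D n \<phi>) = log_exp n \<phi>"
  by (auto simp: log_X_def log_D_def log_shift_inverse)

lemma log_D_X: "log_D n (log_X n \<phi>) = log_exp n \<phi> + \<phi>"
  by (auto simp: log_X_def log_D_def log_shift_inverse log_exp_shift_same log_shift_lin scaleC_one)

lemma log_D_D: "log_D n (log_D m \<phi>) = log_D m (log_D n \<phi>)"
  by (cases "n = m") (auto simp: log_D_def log_exp_shift log_shift_shift[of n] log_exp_exp[of n])

lemma log_X_X: "log_X n (log_X m \<phi>) = log_X m (log_X n \<phi>)"
proof (cases "n = m")
  case False
  then show ?thesis
    using log_shift_shift[of n "-1" m "-1" \<phi>] log_exp_exp[of n m]
      log_exp_shift[of n m "-1"] log_exp_shift[of m n "-1"]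
    by (cases "n \<ge> 0"; cases "m \<ge> 0") (simp_all add: log_X_def, metis+)
qed simp

lemma log_D_X_swap: "n \<noteq> m \<Longrightarrow> log_D n (log_X m \<phi>) = log_X m (log_D n \<phi>)"
  using log_shift_shift[of n 1 m "-1"] log_exp_exp[of n m]
    log_exp_shift[of n m "-1"] log_exp_shift[of m n 1]
  by (cases "n \<ge> 0"; cases "m \<ge> 0") (simp_all add: log_D_def log_X_def, metis+)

lemma weyl_logx: "weyl UNIV logx"
proof -
  have s: "logx i m (logx j n \<phi>) = logx j n (logx i m \<phi>) + (if m + n = -1 then om i j *\<^sub>C \<phi> else 0)" for i j m n \<phi>
  proof (cases i; cases j)
    assume ij: "\<not> i" "j"
    show ?thesis
    proof (cases "m + n = -1")
      case True
      then have n: "n = - m - 1" by simp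
      show ?thesis using ij unfolding n by (simp add: log_D_X log_X_D om_def scaleC_one)
    next
      case False
      then have "m \<noteq> - n - 1" by auto
      then show ?thesis using False ij by (simp add: log_D_X_swap)
    qed
  next
    assume ij: "i" "\<not> j"
    show ?thesis
    proof (cases "m + n = -1")
      case True
      then have n: "n = - m - 1" by simp
      show ?thesis using ij unfolding n by (simp add: log_D_X log_X_D om_def scaleC_one)
    next
      case False
      then have "n \<noteq> - m - 1" by auto
      then show ?thesis using False ij by (simp add: log_D_X_swap)
    qed
  qed (simp_all add: om_def log_D_D[of m n] log_X_X[of "- m - 1" "- n - 1"])
  have l: "lin_on UNIV (logx i n)" for i n
    by (cases i) (auto simp: lin_on_def log_D_def log_X_def log_exp_lin log_shift_lin)
  show ?thesis unfolding weyl_def by (intro conjI allI ballI cv.subspace_UNIV UNIV_I l s)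
qed

global_interpretation LX: weyl_module UNIV logx by unfold_locales (rule weyl_logx)

lemma log_eps_lin: "lin_on M log_eps"
  by (auto simp: lin_on_def fun_eq_iff log_eps_def scaleC_logfun)

lemma log_eps_logx: "log_eps (logx i n \<phi>) = logx i n (log_eps \<phi>)"
proof -
  have "log_eps (log_exp m \<phi>) = log_exp m (log_eps \<phi>)" for m \<phi>
    by (auto simp: fun_eq_iff log_exp_def log_eps_def)
  moreover have "log_eps (log_shift m t \<phi>) = log_shift m t (log_eps \<phi>)" for m t \<phi>
    by (auto simp: fun_eq_iff log_shift_def log_eps_def)
  ultimately show ?thesis by (cases i) (auto simp: log_D_def log_X_def)
qed

definition log_vac :: "int \<Rightarrow> int" where "log_vac n = (if n \<ge> 0 then 0 else -1)"
definition log_delta :: "(int \<Rightarrow> int) \<Rightarrow> bool \<Rightarrow> logfun" where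
  "log_delta k b k' b' = (if k' = k \<and> b' = b then 1 else 0)"

lemma log_shift_delta: "log_shift n t (log_delta k b) = log_delta (k(n := k n - t)) b"
proof -
  have "k'(n := k' n + t) = k \<longleftrightarrow> k' = k(n := k n - t)" for k' by (auto simp: fun_eq_iff)
  then show ?thesis by (simp add: fun_eq_iff log_shift_def log_delta_def)
qed

lemma log_eps_delta: "log_eps (log_delta k b) = (if b then 0 else log_delta k True)"
  by (auto simp: fun_eq_iff log_eps_def log_delta_def)

lemma log_exp_delta: "log_exp n (log_delta k b) = of_int (k n) *\<^sub>C log_delta k b + log_slope n *\<^sub>C (if b then 0 else log_delta k True)"
  by (auto simp: fun_eq_iff log_exp_def scaleC_logfun log_eps_delta log_delta_def)

text \<open>Generators of the four layers: w on top, e = \<epsilon> w at the bottom, and in between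
  y = beta_0 w and z = - gamma_0 w, which modulo e are vacuum vectors for the flows -1 and 1.
  Without the deformation beta_0 and gamma_0 would kill w.\<close>

abbreviation "log_w \<equiv> log_delta log_vac False"
abbreviation "log_e \<equiv> log_delta log_vac True"
abbreviation "log_y \<equiv> log_delta (log_vac(0 := -1)) True"
abbreviation "log_z \<equiv> log_delta (log_vac(-1 := 0)) True"

lemmas log_delta_simps = log_D_def log_X_def log_shift_delta log_exp_delta log_vac_def log_slope_def scaleC_one log_shift_lin

lemma log_action_w:
  "log_D 0 log_w = log_y" "log_X (-1) log_w = - log_z"
  "n > 0 \<Longrightarrow> log_D n log_w = 0" "n < -1 \<Longrightarrow> log_X n log_w = 0"
  by (auto simp: log_delta_simps)

lemma log_action_e: "n \<ge> 0 \<Longrightarrow> log_D n log_e = 0" "n < 0 \<Longrightarrow> log_X n log_e = 0"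
  by (auto simp: log_delta_simps)

lemma log_action_y: "n \<ge> 1 \<Longrightarrow> log_D n log_y = 0" "n < 0 \<Longrightarrow> log_X n log_y = 0" "log_X 0 log_y = log_e"
  by (auto simp: log_delta_simps fun_upd_idem)

lemma log_action_z: "n \<ge> 0 \<Longrightarrow> log_D n log_z = 0" "n < -1 \<Longrightarrow> log_X n log_z = 0" "log_D (-1) log_z = log_e"
  by (auto simp: log_delta_simps fun_upd_idem)

lemma scaleC_minus_one: "(- 1) *\<^sub>C (u::'a::complex_vector) = - u"
  using cv.scale_minus_left[of 1 u] by (simp add: scaleC_one)

text \<open>The quotient of K' by K is to be a flow of the vacuum module. This is expressed without
  forming the quotient, by a vector that is a vacuum vector modulo K and generates K' over
  K.\<close>

definition vac_step :: "(bool \<Rightarrow> int \<Rightarrow> 'm \<Rightarrow> 'm) \<Rightarrow> 'm::complex_vector set \<Rightarrow> 'm set \<Rightarrow> bool" where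
  "vac_step x K K' \<longleftrightarrow> winv UNIV x K \<and> winv UNIV x K' \<and> K \<subseteq> K' \<and>
     (\<exists>t v. v \<in> K' \<and> v \<notin> K \<and> (\<forall>i. \<forall>n\<ge>0. spec t x i n v \<in> K) \<and>
       (\<forall>H. winv UNIV x H \<longrightarrow> K \<subseteq> H \<longrightarrow> v \<in> H \<longrightarrow> K' \<subseteq> H))"

lemma vac_step_spec: "vac_step x K K' \<Longrightarrow> vac_step (spec l x) K K'"
  unfolding vac_step_def winv_spec
proof (elim conjE exE, intro conjI)
  fix t v assume "v \<in> K'" "v \<notin> K" "\<forall>i. \<forall>n\<ge>0. spec t x i n v \<in> K"
    "\<forall>H. winv UNIV x H \<longrightarrow> K \<subseteq> H \<longrightarrow> v \<in> H \<longrightarrow> K' \<subseteq> H"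
  then show "\<exists>t v. v \<in> K' \<and> v \<notin> K \<and> (\<forall>i. \<forall>n\<ge>0. spec t (spec l x) i n v \<in> K) \<and>
       (\<forall>H. winv UNIV x H \<longrightarrow> K \<subseteq> H \<longrightarrow> v \<in> H \<longrightarrow> K' \<subseteq> H)"
    by (intro exI[of _ "t - l"] exI[of _ v]) simp
qed

lemma winv_subset: "winv UNIV x M \<Longrightarrow> winv M x K \<longleftrightarrow> winv UNIV x K \<and> K \<subseteq> M"
  by (auto simp: winv_def)

lemma va_submodule_module:
  assumes V: "vertex_algebra V" and Y: "va_module V M Y" and K: "va_submodule V M Y K"
  shows "va_module V K Y"
proof -
  have sub: "u \<in> K \<Longrightarrow> u \<in> M" for u using K by (auto simp: va_submodule_def)
  have "modes (nprod V) Y K"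
  proof
    show "cv.subspace K" "u \<in> K \<Longrightarrow> Y a n u \<in> K" for a n u using K by (auto simp: va_submodule_def)
    show "lin_on K (Y a n)" for a n by (rule lin_on_subset[OF va_moduleD(3)[OF Y]]) (use sub in blast)
  qed (use va_moduleD[OF Y] va_moduleD[OF vertex_algebraD(1)[OF V]] sub in auto)
  from modes.va_module_iff[OF this refl] show ?thesis
    using modes_Jac[OF V Y] va_moduleD(6)[OF Y] sub by blast
qed

context bg begin

text \<open>Copies a chain of such steps into the carriers over which projectivity is quantified.
  The charges are real because they differ by integers from the integral charge of the generator
  w.\<close>

lemma embedded_category:
  fixes x :: "bool \<Rightarrow> int \<Rightarrow> 'm::complex_vector \<Rightarrow> 'm" and K :: "nat \<Rightarrow> 'm set"
  assumes x: "weyl UNIV x" and sm: "smooth (K l) x"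
    and cnt: "\<And>i. i < l \<Longrightarrow> \<exists>C. countable C \<and> C \<subseteq> K (Suc i) \<and> K (Suc i) = cv.span C"
    and K: "K 0 = {0}" "\<And>i. i < l \<Longrightarrow> vac_step x (K i) (K (Suc i))" "l > 0"
    and w: "w \<in> K l" "K l = wspan x {w}" "smooth_weyl.qop x (\<lambda>_. 1) w = of_int z *\<^sub>C w"
  obtains A :: "(nat \<Rightarrow> complex) set" and Y f where "lin_on (K l) f" "inj_on f (K l)" "f ` K l = A"
    "\<And>i n u. u \<in> K l \<Longrightarrow> f (x i n u) = Y (gen i) n (f u)" "bg_category S \<beta> \<gamma> A Y"
proof -
  have mono: "K i \<subseteq> K j" if "i \<le> j" "j \<le> l" for i j
    using that
  proof (induction rule: inc_induct)
    case (step i)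
    then show ?case using K(2)[of i] unfolding vac_step_def by (meson less_le_trans subset_trans)
  qed simp
  obtain l' where l': "l = Suc l'" using K(3) by (cases l) auto
  have inv: "winv UNIV x (K (Suc i))" "K i \<subseteq> K (Suc i)" "winv UNIV x (K i)" if "i < l" for i
    using K(2)[OF that] by (auto simp: vac_step_def)
  have M: "winv UNIV x (K l)" using inv(1)[of l'] l' by simp
  have xM: "weyl (K l) x" by (rule weyl_subset[OF x M])
  interpret x: smooth_weyl "K l" x by unfold_locales (rule xM sm)+
  have subK: "cv.subspace (K i)" if "i \<le> l" for i
    using that inv(3)[of i] M by (cases "i = l") (auto simp: winv_def)
  obtain C where C: "countable C" "C \<subseteq> K l" "K l = cv.span C" using cnt[of l'] l' by auto
  have "winv (K l) x {0}" using x.subM by (auto simp: winv_def cv.subspace_0)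
  then obtain f :: "'m \<Rightarrow> nat \<Rightarrow> complex" and q where f: "lin_on (K l) f" "{u \<in> K l. f u = 0} = {0}"
    "weyl (f ` K l) q" "smooth (f ` K l) q" "\<And>i n u. u \<in> K l \<Longrightarrow> f (x i n u) = q i n (f u)"
    by (rule quotient_modes_exist[OF C xM sm]) (rule that)
  have inj: "inj_on f (K l)"
  proof (rule inj_onI)
    fix u v assume uv: "u \<in> K l" "v \<in> K l" "f u = f v"
    then have "u - v \<in> {u \<in> K l. f u = 0}" using lin_on_diff[OF f(1) x.subM] x.M_ops by simp
    then show "u = v" unfolding f(2) by simp
  qed
  define g where "g = inv_into (K l) f"
  have g: "g (f u) = u" if "u \<in> K l" for u using that inj by (simp add: g_def)
  obtain Y where Y: "va_module S (f ` K l) Y" "\<And>i n u. u \<in> f ` K l \<Longrightarrow> Y (gen i) n u = q i n u"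
    by (rule module_exists[OF f(3,4)]) (rule that)
  have fY: "f (x i n u) = Y (gen i) n (f u)" if "u \<in> K l" for i n u using that by (simp add: f(5) Y(2))
  interpret q: smooth_weyl "f ` K l" q by unfold_locales (rule f)+
  interpret y: smooth_weyl "f ` K l" "\<lambda>i. Y (gen i)" by (rule module_smooth_weyl[OF Y(1)])
  have sub: "va_submodule S (f ` K l) Y (f ` K i)" if "i \<le> l" for i
  proof (rule va_submoduleI[OF Y(1)])
    show "f ` K i \<subseteq> f ` K l" using mono[of i l] that by auto
    show "cv.subspace (f ` K i)"
      by (rule lin_on_image_subspace[OF lin_on_subset[OF f(1)] subK[OF that]]) (use mono[of i l] that in auto)
    fix j n u assume "u \<in> f ` K i"
    then obtain v where v: "v \<in> K i" "u = f v" by blast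
    then have "x j n v \<in> K i" using inv(3)[of i] M that by (cases "i = l") (auto simp: winv_def)
    moreover have "v \<in> K l" using v mono[of i l] that by auto
    ultimately show "Y (gen j) n u \<in> f ` K i" using fY[of v j n] v by (metis imageI)
  qed
  have "bg_category S \<beta> \<gamma> (f ` K l) Y"
    unfolding bg_category_def
  proof (intro conjI exI[of _ l] exI[of _ "\<lambda>i. f ` K i"] allI impI)
    show "va_module S (f ` K l) Y" by (rule Y(1))
    have "wgen (f ` K l) (\<lambda>i. Y (gen i)) (f w)"
      unfolding wgen_def
    proof (intro allI impI, elim conjE)
      fix H assume H: "winv (f ` K l) (\<lambda>i. Y (gen i)) H" "f w \<in> H"
      then have Hs: "cv.subspace H" "H \<subseteq> f ` K l" by (auto simp: winv_def)
      have "winv (K l) x {u \<in> K l. f u \<in> H}"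
        unfolding winv_def
      proof (intro conjI allI ballI)
        show "cv.subspace {u \<in> K l. f u \<in> H}"
          by (rule cv.subspaceI) (auto simp: x.M_ops lin_onD[OF f(1)] lin_on_0[OF f(1) x.subM]
            cv.subspace_0[OF Hs(1)] cv.subspace_add[OF Hs(1)] cv.subspace_scale[OF Hs(1)])
        show "x i n u \<in> {u \<in> K l. f u \<in> H}" if "u \<in> {u \<in> K l. f u \<in> H}" for i n u
          using that H(1) by (auto simp: x.x_mem fY winv_def)
      qed auto
      then have "wspan x {w} \<subseteq> {u \<in> K l. f u \<in> H}" using w(1) H(2) by (intro wspan_minimal) auto
      then show "H = f ` K l" using Hs(2) unfolding w(2)[symmetric] by auto
    qed
    moreover have "y.qop (\<lambda>_. 1) (f w) = of_int z *\<^sub>C f w"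
      using x.qop_hom(1)[OF y.smooth_weyl_axioms f(1) x.subM w(1) order_refl x.x_mem fY, of "\<lambda>_. 1"]
      by (simp add: w(3) lin_onD(2)[OF f(1) w(1)])
    ultimately have "f ` K l = cv.span {u \<in> f ` K l. \<exists>m::int. y.qop (\<lambda>_. 1) u = (of_int z + of_int m) *\<^sub>C u}"
      using w(1) by (intro weights_coset[OF y.smooth_weyl_axioms]) auto
    also have "\<dots> \<subseteq> cv.span {v \<in> f ` K l. \<exists>t::real. Y (normal_prod S \<gamma> \<beta>) 0 v = complex_of_real t *\<^sub>C v}"
    proof (intro cv.span_mono subsetI, elim CollectE conjE exE, intro CollectI conjI)
      fix u and m :: int assume u: "u \<in> f ` K l" "y.qop (\<lambda>_. 1) u = (of_int z + of_int m) *\<^sub>C u"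
      then show "\<exists>t::real. Y (normal_prod S \<gamma> \<beta>) 0 u = complex_of_real t *\<^sub>C u"
        by (intro exI[of _ "real_of_int (z + m)"]) (simp add: charge_mode[OF Y(1) u(1)])
    qed
    finally show "f ` K l = cv.span {v \<in> f ` K l. \<exists>t::real. Y (normal_prod S \<gamma> \<beta>) 0 v = complex_of_real t *\<^sub>C v}"
      by (rule equalityI) (rule cv.span_minimal[OF _ y.subM], auto)
    show "f ` K 0 = {0}" using K(1) lin_on_0[OF f(1) x.subM] by simp
    fix i assume i: "i < l"
    show "va_submodule S (f ` K l) Y (f ` K (Suc i))" using sub[of "Suc i"] i by simp
    show "f ` K i \<subseteq> f ` K (Suc i)" using inv(2)[OF i] by auto
    have Kl: "K (Suc i) \<subseteq> K l" using mono[of "Suc i" l] i by simp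
    have fg: "g (f u) = u" "f (g v) = v" "g v \<in> K (Suc i)" if "u \<in> K (Suc i)" "v \<in> f ` K (Suc i)" for u v
      using that Kl g by auto
    obtain t v where v: "v \<in> K (Suc i)" "v \<notin> K i" "\<And>j n. n \<ge> 0 \<Longrightarrow> spec t x j n v \<in> K i"
      "\<And>H. winv UNIV x H \<Longrightarrow> K i \<subseteq> H \<Longrightarrow> v \<in> H \<Longrightarrow> K (Suc i) \<subseteq> H"
      using K(2)[OF i] unfolding vac_step_def by blast
    obtain C' where C': "countable C'" "C' \<subseteq> K (Suc i)" "K (Suc i) = cv.span C'" using cnt[OF i] by blast
    have Ki: "winv (K (Suc i)) x (K i)" using inv[OF i] by (simp add: winv_subset)
    have gen: "H = K (Suc i)" if "winv (K (Suc i)) x H" "K i \<subseteq> H" "v \<in> H" for H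
      using v(4)[of H] that inv(1)[OF i] by (simp add: winv_subset)
    obtain Q :: "(nat \<Rightarrow> complex) set" and YQ h where h: "bg_simple_object S \<beta> \<gamma> Q YQ" "lin_on (K (Suc i)) h"
      "h ` K (Suc i) = Q" "{u \<in> K (Suc i). h u = 0} = K i" "\<And>j n u. u \<in> K (Suc i) \<Longrightarrow> h (x j n u) = YQ (gen j) n (h u)"
      by (rule simple_quotient_exists[OF C' weyl_subset[OF x inv(1)[OF i]] smooth_subset[OF sm Kl] Ki v(1,2), OF v(3) gen]) (assumption+, rule that)
    have YQ: "va_module S Q YQ" using h(1) by (simp add: bg_simple_object_def va_irreducible_def)
    have "module_hom S (f ` K (Suc i)) Y Q YQ (h \<circ> g)"
    proof (rule module_homI[OF _ YQ])
      show "va_module S (f ` K (Suc i)) Y"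
        by (rule va_submodule_module[OF vaS Y(1) sub]) (use i in simp)
      have ad: "u + u' \<in> K (Suc i)" "t *\<^sub>C u \<in> K (Suc i)" if "u \<in> K (Suc i)" "u' \<in> K (Suc i)" for u u' t
        using that subK[of "Suc i"] i by (simp_all add: cv.subspace_add cv.subspace_scale)
      have gl: "g (f u + f u') = u + u'" "g (t *\<^sub>C f u) = t *\<^sub>C u" if "u \<in> K (Suc i)" "u' \<in> K (Suc i)" for u u' t
        using g[OF subsetD[OF Kl ad(1)[OF that]]] g[OF subsetD[OF Kl ad(2)[OF that]]] subsetD[OF Kl that(1)] subsetD[OF Kl that(2)]
        by (simp_all add: lin_onD[OF f(1)])
      show "lin_on (f ` K (Suc i)) (h \<circ> g)"
        unfolding lin_on_def using g Kl by (auto simp: gl lin_onD[OF h(2)] subset_iff)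
      show "(h \<circ> g) u \<in> Q" if "u \<in> f ` K (Suc i)" for u using that fg h(3) by auto
      fix j n u assume "u \<in> f ` K (Suc i)"
      then obtain a where a: "a \<in> K (Suc i)" "u = f a" by blast
      have "x j n a \<in> K (Suc i)" using a inv(1)[OF i] by (simp add: winv_def)
      then show "(h \<circ> g) (Y (gen j) n u) = YQ (gen j) n ((h \<circ> g) u)"
        using a(2) subsetD[OF Kl a(1)] subsetD[OF Kl, of "x j n a"] by (simp add: fY[symmetric] g h(5)[OF a(1)])
    qed
    moreover have "(h \<circ> g) ` f ` K (Suc i) = Q"
      using g Kl h(3) by (force simp: image_comp subset_iff)
    moreover have "{u \<in> f ` K (Suc i). (h \<circ> g) u = 0} = f ` K i"
      using g Kl h(4) inv(2)[OF i] by (auto simp: subset_iff)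
    ultimately show "\<exists>(Q :: (nat \<Rightarrow> complex) set) YQ h. bg_simple_object S \<beta> \<gamma> Q YQ \<and>
        module_hom S (f ` K (Suc i)) Y Q YQ h \<and> h ` f ` K (Suc i) = Q \<and> {u \<in> f ` K (Suc i). h u = 0} = f ` K i"
      using h(1) by blast
  qed simp
  with f(1) inj fY show ?thesis by (intro that[of f "f ` K l" Y]) auto
qed

end

section \<open>Composition series of the deformed module\<close>

lemma winv_log_eps_0: "winv UNIV logx {\<phi>. log_eps \<phi> = 0}"
  unfolding winv_def
  by (auto intro!: cv.subspaceI simp: log_eps_logx lin_onD[OF log_eps_lin[of UNIV]] lin_on_0[OF log_eps_lin cv.subspace_UNIV])

text \<open>On vectors killed by \<epsilon> the deformation is invisible, so beta_0 cannot lower the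
  exponent of X_0 from 0 to -1 and gamma_0 cannot raise that of X_-1 from -1 to 0. These two walls,
  in \<open>log_T1\<close> and \<open>log_T2\<close>, give invariant subspaces, which show that y
  and z are not produced by the lower layers.\<close>

definition log_T1 :: "logfun set" where
  "log_T1 = {\<phi>. log_eps \<phi> = 0 \<and> (\<forall>k b. k 0 < 0 \<longrightarrow> \<phi> k b = 0)}"

definition log_T2 :: "logfun set" where
  "log_T2 = {\<phi>. log_eps \<phi> = 0 \<and> (\<forall>k b. k (-1) \<ge> 0 \<longrightarrow> \<phi> k b = 0)}"

lemma log_action_explicit:
  assumes "log_eps \<phi> = 0"
  shows "log_D n \<phi> k b = (if n \<ge> 0 then of_int (k n + 1) else 1) * \<phi> (k(n := k n + 1)) b"
    "log_X n \<phi> k b = (if n \<ge> 0 then 1 else of_int (k n)) * \<phi> (k(n := k n - 1)) b"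
proof -
  have "log_eps (log_shift m t \<phi>) = log_shift m t (log_eps \<phi>)" for m t
    by (auto simp: fun_eq_iff log_eps_def log_shift_def)
  then show "log_D n \<phi> k b = (if n \<ge> 0 then of_int (k n + 1) else 1) * \<phi> (k(n := k n + 1)) b"
    "log_X n \<phi> k b = (if n \<ge> 0 then 1 else of_int (k n)) * \<phi> (k(n := k n - 1)) b"
    by (auto simp: log_D_def log_X_def log_exp_def assms) (auto simp: log_shift_def log_exp_def assms)
qed

lemma winv_log_T: "winv UNIV logx log_T1" "winv UNIV logx log_T2"
proof -
  have sub: "cv.subspace {\<phi>. log_eps \<phi> = 0 \<and> (\<forall>k b. P k \<longrightarrow> \<phi> k b = 0)}" for P
    by (rule cv.subspaceI)
      (auto simp: scaleC_logfun lin_onD[OF log_eps_lin[of UNIV]] lin_on_0[OF log_eps_lin cv.subspace_UNIV])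
  have D1: "(if n \<ge> 0 then of_int (k n + 1) else 1) * \<phi> (k(n := k n + 1)) b = (0 :: complex)"
    "(if n \<ge> 0 then 1 else of_int (k n)) * \<phi> (k(n := k n - 1)) b = 0"
    if "\<forall>k b. k 0 < 0 \<longrightarrow> \<phi> k b = 0" "k 0 < 0" for \<phi> :: logfun and k n b
    using that(1)[rule_format, of "k(n := k n + 1)" b] that(1)[rule_format, of "k(n := k n - 1)" b] that(2)
    by (cases "n = 0"; cases "k 0 = -1"; force)+
  have D2: "(if n \<ge> 0 then of_int (k n + 1) else 1) * \<phi> (k(n := k n + 1)) b = (0 :: complex)"
    "(if n \<ge> 0 then 1 else of_int (k n)) * \<phi> (k(n := k n - 1)) b = 0"
    if "\<forall>k b. k (-1) \<ge> 0 \<longrightarrow> \<phi> k b = 0" "k (-1) \<ge> 0" for \<phi> :: logfun and k n b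
    using that(1)[rule_format, of "k(n := k n + 1)" b] that(1)[rule_format, of "k(n := k n - 1)" b] that(2)
    by (cases "n = -1"; cases "k (-1) = 0"; force)+
  have D3: "k m = 0" if "\<forall>k. 0 \<le> k (-1) \<longrightarrow> (\<forall>b. \<phi> k b = 0)" "0 \<le> k (-1)" "\<phi> (k(m := k m - 1)) b \<noteq> 0"
    for \<phi> :: logfun and k m b
    using that(1)[rule_format, of "k(m := k m - 1)" b] that(2,3) by (cases "m = -1"; cases "k (-1) = 0") auto
  have e: "log_eps (log_D n \<phi>) = 0" "log_eps (log_X n \<phi>) = 0" if "log_eps \<phi> = 0" for n \<phi>
    using log_eps_logx[of False n \<phi>] log_eps_logx[of True "- n - 1" \<phi>] that LX.x_0[of False n] LX.x_0[of True "- n - 1"] by simp_all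
  show "winv UNIV logx log_T1"
    unfolding winv_def log_T1_def
    by (intro conjI allI ballI sub subset_UNIV CollectI; (elim CollectE conjE)?;
      auto simp: e logx_def log_action_explicit D1 simp del: of_int_add mult_eq_0_iff)
  show "winv UNIV logx log_T2"
    unfolding winv_def log_T2_def
    by (intro conjI allI ballI sub subset_UNIV CollectI; (elim CollectE conjE)?;
      auto simp: e logx_def log_action_explicit D2 simp del: of_int_add mult_eq_0_iff intro: D3)
qed

lemma vac_step_insert:
  assumes x: "weyl UNIV x" and v: "v \<notin> wspan x C" "\<And>i n. n \<ge> 0 \<Longrightarrow> spec t x i n v \<in> wspan x C"
  shows "vac_step x (wspan x C) (wspan x (insert v C))"
  unfolding vac_step_def
proof (intro conjI exI[of _ t] exI[of _ v] allI impI)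
  show "winv UNIV x (wspan x C)" "winv UNIV x (wspan x (insert v C))" by (rule wspan_inv[OF x])+
  show "wspan x C \<subseteq> wspan x (insert v C)"
    by (rule wspan_minimal[OF wspan_inv[OF x]]) (auto intro: wspan_base)
  show "v \<in> wspan x (insert v C)" by (auto intro: wspan_base)
  show "wspan x (insert v C) \<subseteq> H" if "winv UNIV x H" "wspan x C \<subseteq> H" "v \<in> H" for H
    by (rule wspan_minimal[OF that(1)]) (use that wspan_base[of _ C x] in auto)
qed (use v in auto)

lemma wspan_empty: "wspan x {} = {0}"
  by (simp add: wspan_def)

abbreviation "log_C \<equiv> \<lambda>i::nat. if i = 0 then {} else if i = 1 then {log_e} else if i = 2 then {log_y, log_e}
  else if i = 3 then {log_z, log_y, log_e} else {log_w}"

lemma log_delta_nonzero: "log_delta k b \<noteq> 0"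
  by (auto simp: fun_eq_iff log_delta_def)

lemma in_wspan: "weyl UNIV x \<Longrightarrow> u \<in> wspan x C \<Longrightarrow> x i n u \<in> wspan x C"
  using wspan_inv[of x C] by (auto simp: winv_def)

lemma log_members: "log_y \<in> wspan logx {log_w}" "log_z \<in> wspan logx {log_w}" "log_e \<in> wspan logx {log_w}"
proof -
  have w: "log_w \<in> wspan logx {log_w}" by (rule wspan_base) simp
  have "log_D 0 log_w \<in> wspan logx {log_w}" using in_wspan[OF weyl_logx w, of False 0] by simp
  then show y: "log_y \<in> wspan logx {log_w}" by (simp add: log_action_w)
  have "log_X (-1) log_w \<in> wspan logx {log_w}" using in_wspan[OF weyl_logx w, of True 0] by simp
  then have "- log_z \<in> wspan logx {log_w}" by (simp add: log_action_w)
  then show "log_z \<in> wspan logx {log_w}" using cv.subspace_neg[of "wspan logx {log_w}" "- log_z"] by (simp add: wspan_def)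
  have "log_X 0 log_y \<in> wspan logx {log_w}" using in_wspan[OF weyl_logx y, of True "-1"] by simp
  then show "log_e \<in> wspan logx {log_w}" by (simp add: log_action_y)
qed

lemma wspan_0: "0 \<in> wspan x C" by (simp add: wspan_def cv.span_zero)

text \<open>The factors are generated by e, y, z and w, with flows 0, -1, 1 and 0. In the last step
  the listed generators reduce to w alone, since w produces the others.\<close>

lemma log_chain: "i < 4 \<Longrightarrow> vac_step logx (wspan logx (log_C i)) (wspan logx (log_C (Suc i)))"
proof -
  have 0: "vac_step logx (wspan logx {}) (wspan logx {log_e})"
  proof (rule vac_step_insert[OF weyl_logx, of _ _ 0])
    show "log_e \<notin> wspan logx {}" by (simp add: wspan_empty log_delta_nonzero)
    fix i and n :: int assume "n \<ge> 0"
    then show "spec 0 logx i n log_e \<in> wspan logx {}" by (cases i) (simp_all add: wspan_empty log_action_e)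
  qed
  have 1: "vac_step logx (wspan logx {log_e}) (wspan logx {log_y, log_e})"
  proof (rule vac_step_insert[OF weyl_logx, of _ _ "-1"])
    have "wspan logx {log_e} \<subseteq> log_T1"
      by (rule wspan_minimal[OF winv_log_T(1)]) (auto simp: log_T1_def log_eps_delta log_delta_def log_vac_def)
    moreover have "log_y \<notin> log_T1"
      by (auto simp: log_T1_def log_delta_def intro!: exI[of _ "log_vac(0 := -1)"])
    ultimately show "log_y \<notin> wspan logx {log_e}" by blast
    fix i and n :: int assume n: "n \<ge> 0"
    show "spec (-1) logx i n log_y \<in> wspan logx {log_e}"
    proof (cases "i \<and> n = 0")
      case True
      then show ?thesis using log_action_y(3) wspan_base[of log_e "{log_e}" logx] by simp
    next
      case False
      then show ?thesis using n by (cases i) (simp_all add: log_action_y wspan_0)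
    qed
  qed
  have 2: "vac_step logx (wspan logx {log_y, log_e}) (wspan logx {log_z, log_y, log_e})"
  proof (rule vac_step_insert[OF weyl_logx, of _ _ "1"])
    have "wspan logx {log_y, log_e} \<subseteq> log_T2"
      by (rule wspan_minimal[OF winv_log_T(2)]) (auto simp: log_T2_def log_eps_delta log_delta_def log_vac_def)
    moreover have "log_z \<notin> log_T2"
      by (auto simp: log_T2_def log_delta_def intro!: exI[of _ "log_vac(-1 := 0)"])
    ultimately show "log_z \<notin> wspan logx {log_y, log_e}" by blast
    fix i and n :: int assume n: "n \<ge> 0"
    show "spec 1 logx i n log_z \<in> wspan logx {log_y, log_e}"
    proof (cases "\<not> i \<and> n = 0")
      case True
      then show ?thesis using log_action_z(3) wspan_base[of log_e "{log_y, log_e}" logx] by simp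
    next
      case False
      then show ?thesis using n by (cases i) (simp_all add: log_action_z wspan_0)
    qed
  qed
  have 3: "vac_step logx (wspan logx {log_z, log_y, log_e}) (wspan logx {log_w, log_z, log_y, log_e})"
  proof (rule vac_step_insert[OF weyl_logx, of _ _ "0"])
    let ?W = "wspan logx {log_z, log_y, log_e}"
    have "?W \<subseteq> {\<phi>. log_eps \<phi> = 0}"
      by (rule wspan_minimal[OF winv_log_eps_0]) (auto simp: log_eps_delta)
    moreover have "log_eps log_w \<noteq> 0" by (simp add: log_eps_delta log_delta_nonzero)
    ultimately show "log_w \<notin> ?W" by blast
    have y: "log_y \<in> ?W" and z: "log_z \<in> ?W" by (auto intro: wspan_base)
    then have z': "- log_z \<in> ?W" by (simp add: wspan_def cv.span_neg)
    fix i and n :: int assume n: "n \<ge> 0"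
    show "spec 0 logx i n log_w \<in> ?W"
    proof (cases "n = 0")
      case True
      then show ?thesis using y z' by (cases i) (simp_all add: log_action_w)
    next
      case False
      then have "spec 0 logx i n log_w = 0"
        using n by (cases i) (simp_all add: log_action_w)
      then show ?thesis by (simp add: wspan_0)
    qed
  qed
  have "wspan logx {log_w, log_z, log_y, log_e} = wspan logx {log_w}"
  proof
    show "wspan logx {log_w, log_z, log_y, log_e} \<subseteq> wspan logx {log_w}"
      by (rule wspan_minimal[OF wspan_inv[OF weyl_logx]]) (use log_members in \<open>auto intro: wspan_base\<close>)
    show "wspan logx {log_w} \<subseteq> wspan logx {log_w, log_z, log_y, log_e}"
      by (rule wspan_minimal[OF wspan_inv[OF weyl_logx]]) (auto intro: wspan_base)
  qed
  then show "i < 4 \<Longrightarrow> ?thesis" using 0 1 2 3 by (auto simp: less_Suc_eq numeral_eq_Suc)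
qed

lemma smooth_log: "smooth (wspan logx {log_w}) logx" "smooth (wspan logx {log_e}) logx"
proof -
  have "\<exists>K. \<forall>n\<ge>K. logx i n log_w = 0" for i
    by (cases i) (auto simp: log_action_w intro!: exI[of _ 1])
  then show "smooth (wspan logx {log_w}) logx" by (intro wspan_smooth[OF weyl_logx]) auto
  have "\<exists>K. \<forall>n\<ge>K. logx i n log_e = 0" for i
    using log_action_e by (cases i) (auto intro!: exI[of _ 0])
  then show "smooth (wspan logx {log_e}) logx" by (intro wspan_smooth[OF weyl_logx]) auto
qed

lemma smooth_weyl_log: "smooth_weyl (wspan logx {log_w}) logx" "smooth_weyl (wspan logx {log_e}) logx"
  using smooth_log weyl_subset[OF weyl_logx wspan_inv[OF weyl_logx]]
  by (auto intro!: smooth_weyl.intro weyl_module.intro smooth_weyl_axioms.intro)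

text \<open>Multiplication by \<epsilon> commutes with all modes and sends the top generator to the
  bottom one. It is the surjection onto the vacuum module through which the cover is lifted.\<close>

lemma log_eps_image: "log_eps ` wspan logx {log_w} = wspan logx {log_e}"
proof
  have "winv UNIV logx {u. log_eps u \<in> wspan logx {log_e}}"
    unfolding winv_def
  proof (intro conjI allI ballI subset_UNIV)
    have W: "cv.subspace (wspan logx {log_e})" by (simp add: wspan_def)
    show "cv.subspace {u. log_eps u \<in> wspan logx {log_e}}"
      by (rule cv.subspaceI) (simp_all add: lin_onD[OF log_eps_lin[of UNIV]] wspan_0
        lin_on_0[OF log_eps_lin cv.subspace_UNIV] cv.subspace_add[OF W] cv.subspace_scale[OF W])
    show "logx i n u \<in> {u. log_eps u \<in> wspan logx {log_e}}" if "u \<in> {u. log_eps u \<in> wspan logx {log_e}}" for i n u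
      using in_wspan[OF weyl_logx] that by (simp add: log_eps_logx)
  qed
  then have "wspan logx {log_w} \<subseteq> {u. log_eps u \<in> wspan logx {log_e}}"
    by (rule wspan_minimal) (auto simp: log_eps_delta intro: wspan_base)
  then show "log_eps ` wspan logx {log_w} \<subseteq> wspan logx {log_e}" by blast
  have "winv UNIV logx (log_eps ` wspan logx {log_w})"
    unfolding winv_def
  proof (intro conjI allI ballI subset_UNIV)
    show "cv.subspace (log_eps ` wspan logx {log_w})"
      by (rule lin_on_image_subspace[OF log_eps_lin]) (simp add: wspan_def)
    show "logx i n u \<in> log_eps ` wspan logx {log_w}" if "u \<in> log_eps ` wspan logx {log_w}" for i n u
      using that in_wspan[OF weyl_logx] by (auto simp: log_eps_logx[symmetric])
  qed
  moreover have "log_e \<in> log_eps ` wspan logx {log_w}"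
    by (rule image_eqI[of _ _ log_w]) (auto simp: log_eps_delta intro: wspan_base)
  ultimately show "wspan logx {log_e} \<subseteq> log_eps ` wspan logx {log_w}"
    by (intro wspan_minimal) auto
qed

context bg begin

text \<open>If L killed w, it would also kill the image a of w under the lift supplied by
  projectivity. But \<epsilon> a = e forces a to have coefficient 1 at the vacuum monomial, and the
  \<epsilon>-coefficient of L a at that monomial is this number.\<close>

lemma cover_not_semisimple:
  assumes YP: "bg_projective S \<beta> \<gamma> UNIV (YP :: 's \<Rightarrow> int \<Rightarrow> 'm::complex_vector \<Rightarrow> 'm)"
    and flow: "bg_spectral_flow S \<beta> \<gamma> s UNIV (nprod S) Y\<sigma>"
    and \<pi>: "module_hom S UNIV YP UNIV Y\<sigma> \<pi>" "\<pi> w = vacuum S"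
  shows "smooth_weyl.qop (spec s (\<lambda>i. YP (gen i))) of_int w \<noteq> 0"
proof
  \<comment> \<open>The cover lies over the s-th flow of the vacuum, so the deformed module is
    flowed accordingly; untwisting by s later recovers \<open>logx\<close>.\<close>
  let ?x = "spec (- s) logx"
  let ?A = "wspan logx {log_w}" and ?B = "wspan logx {log_e}"
  assume L0: "smooth_weyl.qop (spec s (\<lambda>i. YP (gen i))) of_int w = 0"
  have sx: "smooth ?A ?x" "smooth ?B ?x" by (intro smooth_spec smooth_log)+
  have wx: "weyl UNIV ?x" by (rule weyl_spec[OF weyl_logx])
  interpret A: smooth_weyl ?A logx by (rule smooth_weyl_log)
  interpret B: smooth_weyl ?B logx by (rule smooth_weyl_log)
  have wA: "log_w \<in> ?A" and eB: "log_e \<in> ?B" by (auto intro: wspan_base)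
  have cnt: "\<exists>C. countable C \<and> C \<subseteq> wspan logx G \<and> wspan logx G = cv.span C" if "finite G" for G
    by (rule wspan_countable[of G logx]) (use that countable_finite in auto)
  have pA: "A.pairop n \<phi> = log_exp n \<phi> + (if n < 0 then \<phi> else 0)" for n \<phi>
    by (simp add: A.pairop_def log_X_D log_D_X)
  have pB: "B.pairop n \<phi> = log_exp n \<phi> + (if n < 0 then \<phi> else 0)" for n \<phi>
    by (simp add: B.pairop_def log_X_D log_D_X)
  have qA: "A.qop u \<phi> k b = Sum_any (\<lambda>n. u n * (log_exp n \<phi> k b + (if n < 0 then \<phi> k b else 0)))"
    if "\<phi> \<in> ?A" for u \<phi> k b
  proof -
    have l: "lin_on ?A (\<lambda>\<phi>. \<phi> k b)" by (simp add: lin_on_def scaleC_logfun scaleC_complex_def)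
    show ?thesis
      unfolding A.qop_def lin_on_Sum_any[OF l A.subM A.M_ops(2)[OF A.pairop_mem[OF that]] A.fin_pairop[OF that]]
      by (rule Sum_any.cong) (auto simp: scaleC_logfun pA)
  qed
  have "A.qop (\<lambda>_. 1) log_w k b = (0 :: complex)" for k b
  proof -
    have "A.qop (\<lambda>_. 1) log_w k b = (\<Sum>n\<in>{-1, 0}. log_exp n log_w k b + (if n < 0 then log_w k b else 0))"
      unfolding qA[OF wA] by (subst Sum_any_eq_sum[of "{-1, 0}"])
        (auto simp: log_exp_delta scaleC_logfun log_vac_def log_slope_def log_delta_def)
    also have "\<dots> = 0" by (auto simp: log_exp_delta scaleC_logfun log_vac_def log_slope_def log_delta_def)
    finally show ?thesis .
  qed
  then have JA: "A.qop (\<lambda>_. 1) log_w = 0" by (simp add: fun_eq_iff)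
  have "log_exp n log_e + (if n < 0 then log_e else 0) = 0" for n
    by (auto simp: log_exp_delta log_vac_def scaleC_minus_one)
  then have JB: "B.qop (\<lambda>_. 1) log_e = 0" by (simp add: B.qop_def pB)
  have J: "smooth_weyl.qop ?x (\<lambda>_. 1) log_w = of_int s *\<^sub>C log_w" "smooth_weyl.qop ?x (\<lambda>_. 1) log_e = of_int s *\<^sub>C log_e"
    using spec_qop[OF smooth_weyl_log(1) wA, of "- s" "\<lambda>_. 1"] spec_qop[OF smooth_weyl_log(2) eB, of "- s" "\<lambda>_. 1"]
    by (simp_all add: JA JB spec_const_1)
  define F where "F i = wspan logx (log_C i)" for i
  have F: "F 0 = {0}" "F 1 = ?B" "F 4 = ?A" by (simp_all add: F_def wspan_empty)
  have Fc: "\<exists>C. countable C \<and> C \<subseteq> F (Suc i) \<and> F (Suc i) = cv.span C" for i unfolding F_def by (rule cnt) simp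
  have Fs: "vac_step ?x (F i) (F (Suc i))" if "i < 4" for i unfolding F_def by (rule vac_step_spec[OF log_chain[OF that]])
  have WA: "?A = wspan ?x {log_w}" "?B = wspan ?x {log_e}" by (simp_all add: wspan_spec)
  obtain A' :: "(nat \<Rightarrow> complex) set" and YA fA where fA: "lin_on ?A fA" "inj_on fA ?A" "fA ` ?A = A'"
    "\<And>i n u. u \<in> ?A \<Longrightarrow> fA (?x i n u) = YA (gen i) n (fA u)" "bg_category S \<beta> \<gamma> A' YA"
    by (rule embedded_category[of ?x F 4 log_w s, OF wx, unfolded F(3), OF sx(1) Fc F(1) Fs _ wA WA(1) J(1)])
      (assumption, simp, rule that)
  obtain B' :: "(nat \<Rightarrow> complex) set" and YB fB where fB: "lin_on ?B fB" "inj_on fB ?B" "fB ` ?B = B'"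
    "\<And>i n u. u \<in> ?B \<Longrightarrow> fB (?x i n u) = YB (gen i) n (fB u)" "bg_category S \<beta> \<gamma> B' YB"
    by (rule embedded_category[of ?x F 1 log_e s, OF wx, unfolded F(2), OF sx(2) Fc F(1) Fs _ eB WA(2) J(2)])
      (simp, simp, rule that)
  have YA: "va_module S A' YA" and YB: "va_module S B' YB" using fA(5) fB(5) by (simp_all add: bg_category_def)
  have YPm: "va_module S UNIV YP" using YP by (simp add: bg_projective_def bg_category_def)
  have Y\<sigma>: "va_module S UNIV Y\<sigma>" using flow by (simp add: bg_spectral_flow_def)
  define p where "p a = fB (log_eps (inv_into ?A fA a))" for a
  have p: "p (fA u) = fB (log_eps u)" if "u \<in> ?A" for u using that fA(2) by (simp add: p_def)
  have eps: "log_eps u \<in> ?B" if "u \<in> ?A" for u using log_eps_image that by blast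
  have A_ops: "u + v \<in> ?A" "t *\<^sub>C u \<in> ?A" "?x i n u \<in> ?A" if "u \<in> ?A" "v \<in> ?A" for u v t i n
    using that A.M_ops by (auto simp: spec_def)
  have hp: "module_hom S A' YA B' YB p"
  proof (rule module_homI[OF YA YB])
    have "p (fA u + fA v) = p (fA u) + p (fA v)" "p (t *\<^sub>C fA u) = t *\<^sub>C p (fA u)" if "u \<in> ?A" "v \<in> ?A" for u v t
      using p[OF A_ops(1)[OF that]] p[OF A_ops(2)[OF that]] that
      by (simp_all add: p lin_onD[OF fA(1)] lin_onD[OF fB(1)] lin_onD[OF log_eps_lin] eps)
    then show "lin_on A' p" unfolding lin_on_def fA(3)[symmetric] by auto
    show "p u \<in> B'" if "u \<in> A'" for u using that p eps fB(3) unfolding fA(3)[symmetric] by auto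
    fix i n u assume "u \<in> A'"
    then obtain v where v: "v \<in> ?A" "u = fA v" unfolding fA(3)[symmetric] by blast
    have "log_eps (?x i n v) = ?x i n (log_eps v)" by (simp add: spec_def log_eps_logx)
    then show "p (YA (gen i) n u) = YB (gen i) n (p u)"
      using v A_ops(3)[OF v(1) v(1)] eps by (simp add: fA(4)[symmetric] fB(4)[symmetric] p)
  qed
  have sp: "p ` A' = B'"
    unfolding fA(3)[symmetric] fB(3)[symmetric] log_eps_image[symmetric] image_image by (rule image_cong) (auto simp: p)
  interpret YB: smooth_weyl B' "\<lambda>i. YB (gen i)" by (rule module_smooth_weyl[OF YB])
  have wgB: "wgen B' (\<lambda>i. YB (gen i)) (fB log_e)"
    unfolding wgen_def
  proof (intro allI impI, elim conjE)
    fix H assume H: "winv B' (\<lambda>i. YB (gen i)) H" "fB log_e \<in> H"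
    then have Hs: "cv.subspace H" "H \<subseteq> B'" by (auto simp: winv_def)
    have "winv ?B ?x {u \<in> ?B. fB u \<in> H}"
      unfolding winv_def
    proof (intro conjI allI ballI)
      show "cv.subspace {u \<in> ?B. fB u \<in> H}"
        by (rule cv.subspaceI) (auto simp: B.M_ops lin_onD[OF fB(1)] lin_on_0[OF fB(1) B.subM]
          cv.subspace_0[OF Hs(1)] cv.subspace_add[OF Hs(1)] cv.subspace_scale[OF Hs(1)])
      show "?x i n u \<in> {u \<in> ?B. fB u \<in> H}" if "u \<in> {u \<in> ?B. fB u \<in> H}" for i n u
        using that H(1) B.x_mem by (auto simp: fB(4) winv_def) (auto simp: spec_def)
    qed auto
    then have "?B \<subseteq> {u \<in> ?B. fB u \<in> H}" using eB H(2) unfolding WA(2) by (intro wspan_minimal) auto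
    then show "H = B'" using Hs(2) unfolding fB(3)[symmetric] by auto
  qed
  have sB: "spec s (\<lambda>i. YB (gen i)) i n (fB u) = fB (logx i n u)" if "u \<in> ?B" for i n u
    using fB(4)[OF that, symmetric] by (simp add: spec_def)
  have vB: "YB.vac_vec s (fB log_e)"
    unfolding YB.vac_vec_def
  proof (intro conjI allI impI)
    show "fB log_e \<in> B'" using eB fB(3) by blast
    show "fB log_e \<noteq> 0"
      using inj_onD[OF fB(2), of log_e 0] eB lin_on_0[OF fB(1) B.subM] B.M_ops log_delta_nonzero by force
    fix i and n :: int assume "n \<ge> 0"
    then have "logx i n log_e = 0" by (cases i) (simp_all add: log_action_e)
    then show "spec s (\<lambda>i. YB (gen i)) i n (fB log_e) = 0"
      using sB[OF eB] lin_on_0[OF fB(1) B.subM] by simp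
  qed
  interpret bg_vac S \<beta> \<gamma> B' "\<lambda>i. YB (gen i)" s "fB log_e" by unfold_locales (rule vB wgB)+
  obtain \<Psi> where \<Psi>: "clinear \<Psi>" "\<Psi> (vacuum S) = fB log_e" "range \<Psi> = B'" "inj \<Psi>"
    "\<And>i n a. \<Psi> (S_act i n a) = spec s (\<lambda>i. YB (gen i)) i n (\<Psi> a)" by (rule vac_iso) (rule that)
  have hf: "module_hom S UNIV YP B' YB (\<Psi> \<circ> \<pi>)"
  proof (rule module_homI[OF YPm YB])
    have l: "lin_on UNIV \<pi>" "lin_on UNIV \<Psi>" using \<pi>(1) \<Psi>(1) by (auto simp: module_hom_def lin_on_def lin_on_UNIV[symmetric])
    then show "lin_on UNIV (\<Psi> \<circ> \<pi>)" by (simp add: lin_on_def)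
    show "(\<Psi> \<circ> \<pi>) u \<in> B'" for u using \<Psi>(3) by auto
    fix i n u
    have "\<pi> (YP (gen i) n u) = Y\<sigma> (gen i) n (\<pi> u)" using \<pi>(1) by (simp add: module_hom_def)
    also have "\<dots> = S_act i (if i then n - s else n + s) (\<pi> u)"
      using flow by (cases i) (auto simp: bg_spectral_flow_def)
    finally show "(\<Psi> \<circ> \<pi>) (YP (gen i) n u) = YB (gen i) n ((\<Psi> \<circ> \<pi>) u)"
      using \<Psi>(5)[of True "n - s" "\<pi> u"] \<Psi>(5)[of False "n + s" "\<pi> u"] by (cases i) simp_all
  qed
  obtain g where g: "module_hom S UNIV YP A' YA g" "\<And>u. p (g u) = (\<Psi> \<circ> \<pi>) u"
    using YP fA(5) fB(5) hp sp hf unfolding bg_projective_def by (metis UNIV_I)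
  obtain a where a: "a \<in> ?A" "g w = fA a" using g(1) fA(3) unfolding module_hom_def by blast
  have "fB (log_eps a) = fB log_e" using g(2)[of w] a \<pi>(2) \<Psi>(2) by (simp add: p)
  then have "log_eps a = log_e" using inj_onD[OF fB(2)] eps[OF a(1)] eB by blast
  then have "a log_vac False = 1" by (auto simp: fun_eq_iff log_eps_def log_delta_def split: if_splits dest!: spec[of _ log_vac])
  moreover have "A.qop of_int a log_vac True = a log_vac False"
  proof -
    \<comment> \<open>At the vacuum monomial the exponents cancel against the normal ordering terms
      and only the slopes remain. That at n = 0 has weight 0 in L, so n = -1 alone is left.\<close>
    have "A.qop of_int a log_vac True = (\<Sum>n\<in>{-1}. of_int n * (log_exp n a log_vac True + (if n < 0 then a log_vac True else 0)))"
      unfolding qA[OF a(1)] by (rule Sum_any_eq_sum) (auto simp: log_exp_def log_vac_def log_slope_def log_eps_def)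
    then show ?thesis by (simp add: log_exp_def log_vac_def log_slope_def log_eps_def)
  qed
  moreover have "A.qop of_int a = 0"
  proof -
    interpret xP: smooth_weyl UNIV "spec s (\<lambda>i. YP (gen i))" by (rule smooth_weyl_spec[OF module_smooth_weyl[OF YPm]])
    interpret xA: smooth_weyl A' "spec s (\<lambda>i. YA (gen i))" by (rule smooth_weyl_spec[OF module_smooth_weyl[OF YA]])
    have lg: "lin_on UNIV g" and hg: "g (YP b n u) = YA b n (g u)" for b n u
      using g(1) by (auto simp: module_hom_def lin_on_def)
    have "g (xP.qop of_int w) = xA.qop of_int (g w)"
      by (rule xP.qop_hom(1)[OF xA.smooth_weyl_axioms lg cv.subspace_UNIV]) (auto simp: spec_def hg)
    then have "xA.qop of_int (fA a) = 0" using L0 a(2) lin_on_0[OF lg cv.subspace_UNIV] by simp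
    moreover have "fA (A.qop of_int a) = xA.qop of_int (fA a)"
      by (rule A.qop_hom(1)[OF xA.smooth_weyl_axioms fA(1) A.subM a(1) order_refl A.x_mem])
        (simp_all add: spec_def fA(4)[symmetric])
    ultimately show ?thesis
      using inj_onD[OF fA(2), of "A.qop of_int a" 0] A.qop_mem[OF a(1)] A.M_ops lin_on_0[OF fA(1) A.subM] by simp
  qed
  ultimately show False by simp
qed

end

section \<open>Nilpotent rank two\<close>

lemma linear_eq_on_span:
  fixes f g :: "'a::complex_vector \<Rightarrow> 'b::complex_vector"
  assumes f: "clinear f" and g: "clinear g" and B: "cv.span B = UNIV" "\<And>b. b \<in> B \<Longrightarrow> f b = g b"
  shows "f = g"
proof (rule ext)
  fix v
  have l: "lin_on UNIV f" "lin_on UNIV g" using f g by (simp_all add: lin_on_UNIV)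
  have "cv.subspace {v. f v = g v}"
    by (rule cv.subspaceI) (simp_all add: lin_onD[OF l(1)] lin_onD[OF l(2)] lin_on_0[OF l(1)] lin_on_0[OF l(2)])
  then have "cv.span B \<subseteq> {v. f v = g v}" by (rule cv.span_minimal[rotated]) (simp add: B(2) subset_iff)
  moreover have "v \<in> cv.span B" by (simp add: B(1))
  ultimately show "f v = g v" by (metis (mono_tags) mem_Collect_eq subsetD)
qed

text \<open>\<open>Ts\<close> is fixed on a basis of generalised eigenvectors. It is scalar on every
  generalised eigenvector, not only on the basis, because the components at basis vectors of other
  eigenvalues sum to a vector killed by coprime polynomials.\<close>

lemma semisimple_part_exists:
  fixes T :: "'m::complex_vector \<Rightarrow> 'm"
  assumes T: "clinear T" and span: "cv.span {v. \<exists>\<mu>. pol T [\<mu>, \<mu>] v = 0} = UNIV"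
  obtains Ts B where "clinear Ts" "\<And>\<mu> v. pol T [\<mu>, \<mu>] v = 0 \<Longrightarrow> Ts v = \<mu> *\<^sub>C v"
    "cv.span B = UNIV" "\<And>b. b \<in> B \<Longrightarrow> \<exists>\<mu>. pol T [\<mu>, \<mu>] b = 0"
proof -
  have "endo UNIV T" by (rule endo.intro) (simp_all add: T lin_on_UNIV)
  then interpret endo UNIV T .
  interpret vp: vector_space_pair "scaleC :: complex \<Rightarrow> 'm \<Rightarrow> 'm" "scaleC :: complex \<Rightarrow> 'm \<Rightarrow> 'm" ..
  let ?G = "{v. \<exists>\<mu>. pol T [\<mu>, \<mu>] v = 0}"
  obtain B where B: "B \<subseteq> ?G" "cv.independent B" "?G \<subseteq> cv.span B"
    by (rule cv.maximal_independent_subset[of ?G]) (rule that)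
  have sB: "cv.span B = UNIV" using cv.span_minimal[OF B(3) cv.subspace_span] span by auto
  obtain m where m: "\<And>b. b \<in> B \<Longrightarrow> pol T [m b, m b] b = 0" using B(1) by (atomize_elim, subst choice_iff[symmetric]) blast
  obtain Ts where Ts: "clinear Ts" "\<And>b. b \<in> B \<Longrightarrow> Ts b = m b *\<^sub>C b"
    using vp.linear_independent_extend[OF B(2), of "\<lambda>b. m b *\<^sub>C b"] by blast
  have "Ts v = \<mu> *\<^sub>C v" if v: "pol T [\<mu>, \<mu>] v = 0" for \<mu> v
  proof -
    let ?r = "cv.representation B v"
    have fin: "finite {b. ?r b \<noteq> 0}" by (rule cv.finite_representation)
    have inB: "b \<in> B" if "?r b \<noteq> 0" for b using cv.representation_ne_zero that by blast
    have rep: "v = (\<Sum>b | ?r b \<noteq> 0. ?r b *\<^sub>C b)" using cv.sum_nonzero_representation_eq[OF B(2), of v] sB by simp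
    let ?I = "{b. ?r b \<noteq> 0 \<and> m b = \<mu>}" and ?J = "{b. ?r b \<noteq> 0 \<and> m b \<noteq> \<mu>}"
    define u where "u = (\<Sum>b\<in>?J. ?r b *\<^sub>C b)"
    have split: "v = (\<Sum>b\<in>?I. ?r b *\<^sub>C b) + u"
      unfolding u_def by (subst rep, subst sum.union_disjoint[symmetric]) (auto intro: fin finite_subset[OF _ fin] sum.cong)
    have eigI: "pol T [\<mu>, \<mu>] (\<Sum>b\<in>?I. ?r b *\<^sub>C b) = 0"
      unfolding lin_on_sum[OF pol_lin cv.subspace_UNIV UNIV_I] lin_onD(2)[OF pol_lin UNIV_I]
      using m inB by (intro sum.neutral) auto
    have uk: "pol T [\<mu>, \<mu>] u = 0"
      using v eigI lin_onD(1)[OF pol_lin UNIV_I UNIV_I, of "[\<mu>, \<mu>]" "\<Sum>b\<in>?I. ?r b *\<^sub>C b" u] split by simp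
    have "u \<in> {u \<in> UNIV. \<exists>cs. set cs \<subseteq> - {\<mu>} \<and> pol T cs u = 0}"
      unfolding u_def
    proof (intro cv.subspace_sum[OF subspace_pol] cv.subspace_scale[OF subspace_pol])
      fix b assume "b \<in> ?J"
      then show "b \<in> {u \<in> UNIV. \<exists>cs. set cs \<subseteq> - {\<mu>} \<and> pol T cs u = 0}"
        using m inB by (intro CollectI conjI UNIV_I exI[of _ "[m b, m b]"]) auto
    qed
    then obtain cs where cs: "set cs \<subseteq> - {\<mu>}" "pol T cs u = 0" by blast
    then have "\<mu> \<notin> set cs" by blast
    moreover have "pol T (replicate 2 \<mu>) u = 0" using uk by (simp add: numeral_2_eq_2)
    ultimately have "u = 0" using pol_coprime[OF UNIV_I _ cs(2)] by blast
    then have vI: "v = (\<Sum>b\<in>?I. ?r b *\<^sub>C b)" using split by simp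
    have lT: "lin_on UNIV Ts" using Ts(1) by (simp add: lin_on_UNIV)
    have "Ts v = (\<Sum>b\<in>?I. Ts (?r b *\<^sub>C b))"
      by (subst vI) (rule lin_on_sum[OF lT cv.subspace_UNIV UNIV_I])
    also have "\<dots> = (\<Sum>b\<in>?I. \<mu> *\<^sub>C ?r b *\<^sub>C b)"
      using inB by (intro sum.cong refl) (simp add: lin_onD(2)[OF lT] Ts(2) scaleC_scaleC mult.commute)
    also have "\<dots> = \<mu> *\<^sub>C (\<Sum>b\<in>?I. ?r b *\<^sub>C b)" by (rule cv.scale_sum_right[symmetric])
    also have "(\<Sum>b\<in>?I. ?r b *\<^sub>C b) = v" by (rule vI[symmetric])
    finally show ?thesis .
  qed
  then show ?thesis using that Ts(1) sB m by blast
qed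

text \<open>With \<open>Tn\<close> = T - \<open>Ts\<close> the rank is checked on generalised
  eigenvectors of exponent 2, where \<open>Tn\<close> is T - \<mu>. Were T diagonalizable,
  \<open>Tn\<close> would vanish on a spanning set of eigenvectors, against the vector w.\<close>

lemma nilpotent_rank_twoI:
  fixes T :: "'m::complex_vector \<Rightarrow> 'm"
  assumes T: "clinear T" and span: "cv.span {v. \<exists>\<mu>. pol T [\<mu>, \<mu>] v = 0} = UNIV"
    and w: "pol T [\<mu>, \<mu>] w = 0" "T w \<noteq> \<mu> *\<^sub>C w"
  shows "\<not> diagonalizable T" "nilpotent_rank T 2"
proof -
  obtain Ts B where Ts: "clinear Ts" "\<And>\<mu> v. pol T [\<mu>, \<mu>] v = 0 \<Longrightarrow> Ts v = \<mu> *\<^sub>C v"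
    and B: "cv.span B = UNIV" "\<And>b. b \<in> B \<Longrightarrow> \<exists>\<mu>. pol T [\<mu>, \<mu>] b = 0"
    by (rule semisimple_part_exists[OF T span]) (rule that)
  have "endo UNIV T" by (rule endo.intro) (simp_all add: T lin_on_UNIV)
  then interpret endo UNIV T .
  define Tn where "Tn v = T v - Ts v" for v
  have Tn: "clinear Tn" using T Ts(1) by (auto simp: clinear_iff Tn_def cv.scale_right_diff_distrib)
  have comp: "clinear (f \<circ> g)" if "clinear f" "clinear g" for f g :: "'m \<Rightarrow> 'm"
    using that by (simp add: clinear_iff)
  have mem: "pol T [\<mu>, \<mu>] (Tn v) = 0" "Tn v = T v - \<mu> *\<^sub>C v" "Tn (Tn v) = 0" if "pol T [\<mu>, \<mu>] v = 0" for \<mu> v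
  proof -
    show 1: "Tn v = T v - \<mu> *\<^sub>C v" by (simp add: Tn_def Ts(2)[OF that])
    have "pol T [\<mu>, \<mu>] (T v) = 0" by (simp only: pol_T[OF UNIV_I] that T_0)
    then show 2: "pol T [\<mu>, \<mu>] (Tn v) = 0"
      unfolding 1 lin_on_diff[OF pol_lin cv.subspace_UNIV UNIV_I UNIV_I] lin_onD(2)[OF pol_lin UNIV_I] that by simp
    have "Tn (Tn v) = T (Tn v) - \<mu> *\<^sub>C Tn v" unfolding Tn_def[of "Tn v"] Ts(2)[OF 2] ..
    also have "\<dots> = 0" using that unfolding 1 by simp
    finally show "Tn (Tn v) = 0" .
  qed
  have "Ts \<circ> Tn = Tn \<circ> Ts"
  proof (rule linear_eq_on_span[OF comp[OF Ts(1) Tn] comp[OF Tn Ts(1)] B(1)])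
    fix b assume "b \<in> B"
    then obtain \<mu> where b: "pol T [\<mu>, \<mu>] b = 0" using B(2) by blast
    show "(Ts \<circ> Tn) b = (Tn \<circ> Ts) b" using Tn by (simp add: Ts(2)[OF b] Ts(2)[OF mem(1)[OF b]] clinear_iff)
  qed
  moreover have sq: "Tn \<circ> Tn = (\<lambda>_. 0)"
  proof (rule linear_eq_on_span[OF comp[OF Tn Tn] _ B(1)])
    show "clinear (\<lambda>_::'m. 0::'m)" by (simp add: clinear_iff)
    show "b \<in> B \<Longrightarrow> (Tn \<circ> Tn) b = 0" for b using B(2) mem(3) by auto
  qed
  moreover have "diagonalizable Ts"
  proof -
    have "B \<subseteq> {v. \<exists>\<mu>. Ts v = \<mu> *\<^sub>C v}" using B(2) Ts(2) by blast
    then show ?thesis using B(1) cv.span_mono unfolding diagonalizable_def by blast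
  qed
  moreover have "(Tn ^^ 2) v = 0" for v using fun_cong[OF sq, of v] by (simp add: numeral_2_eq_2)
  moreover have wn: "Tn w \<noteq> 0" using w mem(2)[OF w(1)] by simp
  moreover have "T v = Ts v + Tn v" for v by (simp add: Tn_def)
  ultimately show "nilpotent_rank T 2"
    unfolding nilpotent_rank_def nilpotent_part_def using Tn Ts(1)
    by (intro conjI exI[of _ Tn] exI[of _ Ts] allI exI[of _ "2::nat"] exI[of _ w]) simp_all
  show "\<not> diagonalizable T"
  proof
    assume "diagonalizable T"
    then have "Tn = (\<lambda>_. 0)"
      unfolding diagonalizable_def
    proof (intro linear_eq_on_span[OF Tn])
      show "clinear (\<lambda>_::'m. 0::'m)" by (simp add: clinear_iff)
      fix b assume "b \<in> {v. \<exists>\<mu>. T v = \<mu> *\<^sub>C v}"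
      then obtain \<mu> where b: "T b = \<mu> *\<^sub>C b" by blast
      then have 0: "pol T [\<mu>, \<mu>] b = 0" by simp
      show "Tn b = 0" using b unfolding mem(2)[OF 0] by simp
    qed
    then show False using wn by simp
  qed
qed

section \<open>Calculus of modes\<close>

locale va_mod =
  fixes V :: "'v::complex_vector vertex_alg" and M :: "'m::complex_vector set" and Y :: "'v \<Rightarrow> int \<Rightarrow> 'm \<Rightarrow> 'm"
  assumes V: "vertex_algebra V" and Y: "va_module V M Y"
begin

sublocale modes "nprod V" Y M by (rule modesI[OF V Y])

lemma comm_sum:
  assumes "u \<in> M" "\<And>j. j \<ge> N \<Longrightarrow> bin m j = 0 \<or> nprod V a (int j) b = 0"
  shows "Y a m (Y b n u) = Y b n (Y a m u) + (\<Sum>j<N. bin m j *\<^sub>C Y (nprod V a (int j) b) (m + n - int j) u)"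
proof -
  have "Y a m (Y b n u) - Y b n (Y a m u) = Sum_any (\<lambda>j. bin m j *\<^sub>C Y (nprod V a (int j) b) (m + n - int j) u)"
    by (rule Jac_comm[OF modes_Jac[OF V Y assms(1)]])
  also have "\<dots> = (\<Sum>j<N. bin m j *\<^sub>C Y (nprod V a (int j) b) (m + n - int j) u)"
  proof (rule Sum_any_eq_sum)
    fix j assume "j \<notin> {..<N}"
    then show "bin m j *\<^sub>C Y (nprod V a (int j) b) (m + n - int j) u = 0"
      using assms(2)[of j] assms(1) by (cases "bin m j = 0") (auto simp: not_less)
  qed simp
  finally show ?thesis by (simp add: algebra_simps)
qed

lemma comm2:
  assumes "u \<in> M" "\<And>j. j \<ge> 2 \<Longrightarrow> nprod V a (int j) b = 0"
  shows "Y a m (Y b n u) = Y b n (Y a m u) + Y (nprod V a 0 b) (m + n) u + of_int m *\<^sub>C Y (nprod V a 1 b) (m + n - 1) u"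
  using comm_sum[OF assms(1), of 2 m a b n] assms(2) by (simp add: numeral_2_eq_2 scaleC_one add.assoc)

lemma comm_0:
  assumes "u \<in> M"
  shows "Y a 0 (Y b n u) = Y b n (Y a 0 u) + Y (nprod V a 0 b) n u"
  using comm_sum[OF assms, of 1 0 a b n] by (simp add: scaleC_one gbinomial_0_left)

lemma comm_1:
  assumes "u \<in> M"
  shows "Y a 1 (Y b n u) = Y b n (Y a 1 u) + Y (nprod V a 0 b) (1 + n) u + Y (nprod V a 1 b) n u"
proof -
  have "bin 1 j = 0" if "j \<ge> 2" for j
    using that by (simp add: binomial_gbinomial[symmetric, where n = 1, simplified])
  then show ?thesis
    using comm_sum[OF assms, of 2 1 a b n] by (simp add: numeral_2_eq_2 scaleC_one add.assoc)
qed

lemma normal_prod_mode_sum: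
  assumes "u \<in> M" "\<And>j. j \<ge> N \<Longrightarrow> Y b (t + int j) u = 0" "\<And>j. j \<ge> N' \<Longrightarrow> Y a (int j) u = 0"
  shows "Y (normal_prod V a b) t u = (\<Sum>j<N. Y a (- 1 - int j) (Y b (t + int j) u)) + (\<Sum>j<N'. Y b (t - 1 - int j) (Y a (int j) u))"
  unfolding normal_prod_mode[OF V Y assms(1)]
  by (intro arg_cong2[of _ _ _ _ "(+)"] Sum_any_eq_sum) (auto simp: assms not_less)

lemma deriv_mode: "u \<in> M \<Longrightarrow> Y (va_deriv V a) n u = (- of_int n) *\<^sub>C Y a (n - 1) u"
  by (rule va_deriv_mode[OF V Y])

end

locale va =
  fixes V :: "'v::complex_vector vertex_alg"
  assumes V: "vertex_algebra V"
begin

sublocale va_mod V UNIV "nprod V" by unfold_locales (rule V, rule vertex_algebraD(1)[OF V])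

lemmas vac_right = vertex_algebraD(2)[OF V] and vac_annih = vertex_algebraD(3)[OF V] and vac_left = vertex_algebraD(4)[OF V]

text \<open>Skew symmetry, read off from the commutator of a_-1 with b_n on the vacuum: a_-1 b_n
  kills the vacuum, while b_n a_-1 takes it to b_n a.\<close>

lemma skew:
  assumes "n \<ge> 0" "\<And>j. j \<ge> N \<Longrightarrow> nprod V a (int j) b = 0"
  shows "nprod V b n a = (\<Sum>j<N. (- 1) ^ (j + 1) *\<^sub>C nprod V (nprod V a (int j) b) (n - 1 - int j) (vacuum V))"
proof -
  have b: "(- 1 :: complex) gchoose j = (- 1) ^ j" for j
    using gbinomial_minus[of "1::complex" j] by (simp add: binomial_gbinomial[symmetric])
  have "nprod V a (-1) (nprod V b n (vacuum V)) = nprod V b n (nprod V a (-1) (vacuum V))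
      + (\<Sum>j<N. bin (-1) j *\<^sub>C nprod V (nprod V a (int j) b) (-1 + n - int j) (vacuum V))"
    using assms(2) by (intro comm_sum) auto
  then have "nprod V b n a = - (\<Sum>j<N. (- 1) ^ j *\<^sub>C nprod V (nprod V a (int j) b) (n - 1 - int j) (vacuum V))"
    using assms(1) by (simp add: vac_annih vac_right b eq_neg_iff_add_eq_0[symmetric] algebra_simps)
  then show ?thesis by (simp add: sum_negf)
qed

text \<open>Regularity of the operator product expansion, which by the commutator formula makes all
  modes commute.\<close>

definition commuting :: "'v \<Rightarrow> 'v \<Rightarrow> bool" where
  "commuting a b \<longleftrightarrow> (\<forall>n\<ge>0. nprod V a n b = 0)"

lemma commutingD: "commuting a b \<Longrightarrow> n \<ge> 0 \<Longrightarrow> nprod V a n b = 0"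
  by (simp add: commuting_def)

lemma commuting_sym: "commuting a b \<Longrightarrow> commuting b a"
  using skew[of _ 0 a b] by (auto simp: commuting_def)

lemma commuting_swap: "commuting a b \<Longrightarrow> nprod V a m (nprod V b n u) = nprod V b n (nprod V a m u)"
  using comm_sum[of u 0 m a b n] by (simp add: commuting_def)

lemma ope_imp_commuting: "ope V a b [] \<Longrightarrow> commuting a b"
  unfolding ope_def commuting_def by (metis int_nat_eq length_0_conv less_nat_zero_code list.size(3))

lemma commuting_normal:
  assumes "commuting a b" shows "normal_prod V a b = normal_prod V b a"
  using commuting_swap[OF assms, of "-1" "-1" "vacuum V"] by (simp add: vac_right)

lemma deriv_eq: "nprod V a (-2) (vacuum V) = va_deriv V a" by (simp add: va_deriv_def)

lemma deriv_nprod: "va_deriv V (nprod V a n b) = nprod V (va_deriv V a) n b + nprod V a n (va_deriv V b)"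
proof -
  have "nprod V (nprod V a n b) (-2) (vacuum V) = Sum_any (\<lambda>j. ((-1) ^ j * bin n j) *\<^sub>C
      (nprod V a (n - int j) (nprod V b (-2 + int j) (vacuum V)) - (-1) powi n *\<^sub>C nprod V b (-2 + n - int j) (nprod V a (int j) (vacuum V))))"
    by (rule Jac_iter[OF modes_Jac[OF V vertex_algebraD(1)[OF V] UNIV_I]])
  also have "\<dots> = (\<Sum>j<2. ((-1) ^ j * bin n j) *\<^sub>C
      (nprod V a (n - int j) (nprod V b (-2 + int j) (vacuum V)) - (-1) powi n *\<^sub>C nprod V b (-2 + n - int j) (nprod V a (int j) (vacuum V))))"
    by (rule Sum_any_eq_sum) (auto simp: vac_annih)
  also have "\<dots> = nprod V a n (va_deriv V b) - of_int n *\<^sub>C nprod V a (n - 1) b"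
    by (simp add: numeral_2_eq_2 vac_annih vac_right scaleC_one va_deriv_def)
  finally show ?thesis by (simp add: va_deriv_def[of V "nprod V a n b"] deriv_mode)
qed

end

context va_mod begin

lemma conformal_shift:
  assumes "nprod V w 0 a = va_deriv V a" "nprod V w 1 a = h *\<^sub>C a" "u \<in> M"
  shows "Y w 1 (Y a n u) = Y a n (Y w 1 u) + (h - 1 - of_int n) *\<^sub>C Y a n u"
  using comm_1[OF assms(3), of w a n] assms
  by (simp add: deriv_mode Y_scale_left scaleC_add_left[symmetric] add.assoc algebra_simps)

lemma stabilizer_nprod:
  assumes K: "cv.subspace K" "K \<subseteq> M" and a: "\<And>n u. u \<in> K \<Longrightarrow> Y a n u \<in> K" and b: "\<And>n u. u \<in> K \<Longrightarrow> Y b n u \<in> K"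
    and u: "u \<in> K"
  shows "Y (nprod V a r b) n u \<in> K"
  unfolding Jac_iter[OF modes_Jac[OF V Y subsetD[OF K(2) u]]]
  by (intro Sum_any_mem[OF K(1)] cv.subspace_scale[OF K(1)] cv.subspace_diff[OF K(1)] a b u)

lemma subspace_stabilizer:
  assumes K: "cv.subspace K" "K \<subseteq> M"
  shows "cv.subspace {a. \<forall>n. \<forall>u\<in>K. Y a n u \<in> K}"
  using K by (intro cv.subspaceI)
    (auto simp: Y_add_left Y_scale_left subset_iff cv.subspace_0 intro!: cv.subspace_add[OF K(1)] cv.subspace_scale[OF K(1)])

text \<open>On the generators of V the vector w acts like a conformal vector. Hence the span of
  eigenvectors is stable under these generators; the states stabilising it are closed under
  products, and it contains the generating vector of M.\<close>

lemma eigenvectors_span: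
  assumes M: "M = UNIV" and v: "generated_by V M Y v" "Y w 1 v = h *\<^sub>C v"
    and G: "\<And>a. a \<in> G \<Longrightarrow> nprod V w 0 a = va_deriv V a \<and> (\<exists>h. nprod V w 1 a = h *\<^sub>C a)"
    and gen: "\<And>K. cv.subspace K \<Longrightarrow> G \<subseteq> K \<Longrightarrow> (\<And>a b n. a \<in> K \<Longrightarrow> b \<in> K \<Longrightarrow> nprod V a n b \<in> K) \<Longrightarrow> K = UNIV"
  shows "diagonalizable (Y w 1)"
proof -
  let ?X = "{u. \<exists>\<mu>. Y w 1 u = \<mu> *\<^sub>C u}"
  let ?K = "cv.span ?X"
  have K: "cv.subspace ?K" "?K \<subseteq> M" by (simp_all add: M)
  have "{a. \<forall>n. \<forall>u\<in>?K. Y a n u \<in> ?K} = UNIV"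
  proof (rule gen)
    show "cv.subspace {a. \<forall>n. \<forall>u\<in>?K. Y a n u \<in> ?K}" by (rule subspace_stabilizer[OF K])
    show "G \<subseteq> {a. \<forall>n. \<forall>u\<in>?K. Y a n u \<in> ?K}"
    proof (intro subsetI CollectI allI ballI)
      fix a n u assume a: "a \<in> G" and u: "u \<in> ?K"
      show "Y a n u \<in> ?K"
      proof (rule lin_on_span_image[OF Y_lin subM _ _ cv.subspace_span u])
        fix y assume "y \<in> ?X"
        then obtain \<mu> where y: "Y w 1 y = \<mu> *\<^sub>C y" by blast
        obtain h where h: "nprod V w 1 a = h *\<^sub>C a" using G[OF a] by blast
        have "Y w 1 (Y a n y) = (\<mu> + (h - 1 - of_int n)) *\<^sub>C Y a n y"
          using conformal_shift[OF conjunct1[OF G[OF a]] h, of y n] M y by (simp add: Y_scale scaleC_add_left)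
        then show "Y a n y \<in> ?K" by (intro cv.span_base) blast
      qed (simp add: M)
    qed
    fix a b n assume "a \<in> {a. \<forall>n. \<forall>u\<in>?K. Y a n u \<in> ?K}" "b \<in> {a. \<forall>n. \<forall>u\<in>?K. Y a n u \<in> ?K}"
    then show "nprod V a n b \<in> {a. \<forall>n. \<forall>u\<in>?K. Y a n u \<in> ?K}"
      by (intro CollectI allI ballI stabilizer_nprod[OF K]) auto
  qed
  then have "va_submodule V M Y ?K" using K by (auto simp: va_submodule_def)
  moreover have "v \<in> ?K" using v(2) by (intro cv.span_base) blast
  ultimately have "?K = M" using v(1) by (simp add: generated_by_def)
  then show ?thesis by (simp add: diagonalizable_def M)
qed

end

section \<open>The half lattice vertex algebra\<close>

locale half_lattice_va =
  fixes V :: "'p::complex_vector vertex_alg" and c d :: 'p and E :: "int \<Rightarrow> 'p"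
  assumes hl: "half_lattice V c d E"
begin

sublocale va V by unfold_locales (use hl in \<open>simp add: half_lattice_def\<close>)

lemma cd: "nprod V c 0 d = 0" "nprod V c 1 d = 2 *\<^sub>C vacuum V" "n \<ge> 2 \<Longrightarrow> nprod V c n d = 0"
proof -
  have o: "nprod V c (int n) d = (if n < 2 then [0, 2 *\<^sub>C vacuum V] ! n else 0)" for n
    using hl by (simp add: half_lattice_def ope_def numeral_2_eq_2)
  show "nprod V c 0 d = 0" "nprod V c 1 d = 2 *\<^sub>C vacuum V" using o[of 0] o[of 1] by simp_all
  show "n \<ge> 2 \<Longrightarrow> nprod V c n d = 0" using o[of "nat n"] by simp
qed

lemma dE: "nprod V d 0 (E j) = of_int (2 * j) *\<^sub>C E j" "n > 0 \<Longrightarrow> nprod V d n (E j) = 0"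
proof -
  have o: "nprod V d (int n) (E j) = (if n < 1 then [of_int (2 * j) *\<^sub>C E j] ! n else 0)" for n
    using hl by (simp add: half_lattice_def ope_def)
  show "nprod V d 0 (E j) = of_int (2 * j) *\<^sub>C E j" using o[of 0] by simp
  show "n > 0 \<Longrightarrow> nprod V d n (E j) = 0" using o[of "nat n"] by simp
qed

lemma commutes: "commuting c c" "commuting d d" "commuting c (E j)" "commuting (E i) (E j)" "commuting (E j) c"
  using hl ope_imp_commuting commuting_sym by (auto simp: half_lattice_def)

lemma E_0: "E 0 = vacuum V" and E_add: "normal_prod V (E i) (E j) = E (i + j)"
  and deriv_E: "va_deriv V (E j) = of_int j *\<^sub>C normal_prod V c (E j)"
  using hl by (auto simp: half_lattice_def)

lemma dc: "n \<ge> 0 \<Longrightarrow> nprod V d n c = (if n = 1 then 2 *\<^sub>C vacuum V else 0)"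
  using skew[of n 2 c d] cd by (auto simp: numeral_2_eq_2 scaleC_one Y_scale vac_left Y_scale_left)

lemma generated:
  assumes K: "cv.subspace K" "c \<in> K" "d \<in> K" "\<And>j. E j \<in> K" "\<And>a b n. a \<in> K \<Longrightarrow> b \<in> K \<Longrightarrow> nprod V a n b \<in> K"
  shows "K = UNIV"
proof -
  have "pbw_monomial V [c, d] ps (E j) \<in> K" if "ps \<in> pbw_index [c, d]" for ps j
  proof -
    have "\<forall>(i, n)\<in>set ps. i < 2" using that by (auto simp: pbw_index_def)
    then show ?thesis
    proof (induction ps)
      case (Cons p ps)
      then have "[c, d] ! fst p \<in> K" using K(2,3) by (cases "fst p") (auto split: prod.splits)
      then show ?case using Cons K(5) by (auto simp: pbw_monomial_def split: prod.splits)
    qed (simp add: pbw_monomial_def K(4))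
  qed
  then have "(\<lambda>(j, ps). pbw_monomial V [c, d] ps (E j)) ` (UNIV \<times> pbw_index [c, d]) \<subseteq> K" by auto
  from cv.span_minimal[OF this K(1)] show ?thesis
    using hl by (auto simp: half_lattice_def basis_family_def)
qed

text \<open>With t = k/3 this is the contribution of the half lattice factor to the Sugawara
  vector.\<close>

definition conformal :: "complex \<Rightarrow> 'p" where
  "conformal t = (1/2) *\<^sub>C normal_prod V c d + t *\<^sub>C va_deriv V c - (1/2) *\<^sub>C va_deriv V d"

lemma conformal_mode:
  assumes "va_module V M Y" "u \<in> M"
  shows "Y (conformal t) n u = (1/2) *\<^sub>C Y (normal_prod V c d) n u - (t * of_int n) *\<^sub>C Y c (n - 1) u + (of_int n / 2) *\<^sub>C Y d (n - 1) u"
proof -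
  interpret m: va_mod V M Y by unfold_locales (rule V assms)+
  show ?thesis using assms(2) by (simp add: conformal_def m.Y_add_left m.Y_diff_left m.Y_scale_left m.deriv_mode scaleC_scaleC)
qed

lemma conformal_generators:
  assumes "a \<in> {c, d} \<union> range E"
  shows "nprod V (conformal t) 0 a = va_deriv V a \<and> (\<exists>h. nprod V (conformal t) 1 a = h *\<^sub>C a)"
proof -
  note m = conformal_mode[OF vertex_algebraD(1)[OF V] UNIV_I]
  have s2: "(\<Sum>j<2::nat. f j) = f 0 + f 1" for f :: "nat \<Rightarrow> 'p" by (simp add: numeral_2_eq_2)
  have np: "nprod V (normal_prod V c d) n a = nprod V c (-1) (nprod V d n a) + nprod V c (-2) (nprod V d (n + 1) a)
      + (nprod V d (n - 1) (nprod V c 0 a) + nprod V d (n - 2) (nprod V c 1 a))"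
    if "\<And>j. j \<ge> 2 \<Longrightarrow> nprod V d j a = 0" "\<And>j. j \<ge> 2 \<Longrightarrow> nprod V c j a = 0" "n \<ge> 0" for a n
    using normal_prod_mode_sum[of a 2 d n 2 c] that by (simp add: s2)
  consider "a = c" | "a = d" | j where "a = E j" using assms by auto
  then show ?thesis
  proof cases
    case 1
    have cc: "nprod V c n c = 0" if "n \<ge> 0" for n using commutingD[OF commutes(1)] that .
    have dc': "nprod V d 0 c = 0" "nprod V d 1 c = 2 *\<^sub>C vacuum V" "n \<ge> 2 \<Longrightarrow> nprod V d n c = 0" for n
      using dc[of n] dc[of 0] dc[of 1] by simp_all
    have "nprod V (normal_prod V c d) 0 c = 2 *\<^sub>C va_deriv V c" "nprod V (normal_prod V c d) 1 c = 2 *\<^sub>C c"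
      using np[of c 0] np[of c 1] dc'(3)[of 2]
      by (simp_all add: dc' cc Y_scale vac_right deriv_eq)
    then show ?thesis unfolding 1
      by (auto simp: m dc' cc scaleC_scaleC scaleC_one intro!: exI[of _ 1])
  next
    case 2
    have dd: "nprod V d n d = 0" if "n \<ge> 0" for n using commutingD[OF commutes(2)] that .
    show ?thesis using 2
      by (auto simp: m np cd dd Y_scale vac_right deriv_eq scaleC_scaleC scaleC_one intro!: exI[of _ 1])
  next
    case (3 j)
    have cE: "nprod V c n (E j) = 0" if "n \<ge> 0" for n using commutingD[OF commutes(3)] that .
    show ?thesis using 3
      by (auto simp: m np dE cE Y_scale deriv_E scaleC_scaleC scaleC_one)
  qed
qed

lemma conformal_diagonalizable:
  assumes "half_lattice_exp_module V c d r lam UNIV Y"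
  shows "diagonalizable (Y (conformal t) 1)"
proof -
  obtain v where Y: "va_module V UNIV Y" and v: "generated_by V UNIV Y v" "Y c 0 v = of_int r *\<^sub>C v"
    "Y d 0 v = (2 * lam) *\<^sub>C v" "\<And>n. n > 0 \<Longrightarrow> Y c n v = 0" "\<And>n. n > 0 \<Longrightarrow> Y d n v = 0"
    using assms by (auto simp: half_lattice_exp_module_def)
  interpret m: va_mod V UNIV Y by unfold_locales (rule V, rule Y)
  have "Y (normal_prod V c d) 1 v = (of_int r * 2 * lam) *\<^sub>C v"
    using m.normal_prod_mode_sum[of v 0 d 1 1 c] v by (simp add: m.Y_scale scaleC_scaleC)
  then have "Y (conformal t) 1 v = (of_int r * lam - t * of_int r + lam) *\<^sub>C v"
    using conformal_mode[OF Y UNIV_I, of t 1 v] v by (simp add: scaleC_scaleC scaleC_add_left cv.scale_left_diff_distrib)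
  then show ?thesis
  proof (rule m.eigenvectors_span[OF refl v(1) _ conformal_generators])
    fix K assume "cv.subspace K" "{c, d} \<union> range E \<subseteq> K" "\<And>a b n. a \<in> K \<Longrightarrow> b \<in> K \<Longrightarrow> nprod V a n b \<in> K"
    then show "K = UNIV" by (intro generated) auto
  qed
qed

end

section \<open>Bilinear rules, and products of opposite exponentials\<close>

context va begin

lemma Y_uminus: "nprod V a n (- u) = - nprod V a n u"
  using Y_diff[OF UNIV_I UNIV_I, of a n 0 u] by simp

lemma Y_uminus_left: "nprod V (- a) n u = - nprod V a n u"
  by (metis Y_scale_left[OF UNIV_I] scaleC_minus_one)

lemmas bilinear = Y_add[OF UNIV_I UNIV_I] Y_diff[OF UNIV_I UNIV_I] Y_scale[OF UNIV_I] Y_uminus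
  Y_add_left[OF UNIV_I] Y_diff_left[OF UNIV_I] Y_scale_left[OF UNIV_I] Y_uminus_left

lemma commuting_nprod:
  assumes "commuting a x" "commuting b x" shows "commuting (nprod V a n b) x"
proof -
  have "commuting x a" "commuting x b" using assms commuting_sym by blast+
  then have "commuting x (nprod V a n b)"
    unfolding commuting_def by (metis commuting_swap[OF \<open>commuting x a\<close>] commutingD[OF \<open>commuting x b\<close>] P_0)
  then show ?thesis by (rule commuting_sym)
qed

lemma sum_less_2: "(\<Sum>j<2::nat. f j) = f 0 + (f 1 :: 'v)" by (simp add: numeral_2_eq_2)

lemma sum_less_3: "(\<Sum>j<3::nat. f j) = f 0 + f 1 + (f 2 :: 'v)" by (simp add: numeral_eq_Suc)

text \<open>These are the first coefficients of exp(t(c_-1 z + c_-2 z^2/2 + ...)) applied to the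
  vacuum, into which x(z)y expands for exponentials with opposite exponents. They follow by
  comparing modes of the derivative of x.\<close>

lemma exponential_modes:
  assumes "commuting c x" "commuting c y" "commuting x y" and xy: "normal_prod V x y = vacuum V"
    and D: "va_deriv V x = t *\<^sub>C normal_prod V c x"
  shows "nprod V x (-2) y = t *\<^sub>C c" "nprod V x (-3) y = (t\<^sup>2 / 2) *\<^sub>C normal_prod V c c + (t / 2) *\<^sub>C va_deriv V c"
proof -
  have cy: "nprod V c n y = 0" and x: "nprod V x n y = 0" if "n \<ge> 0" for n using assms that by (auto intro: commutingD)
  have 1: "nprod V (normal_prod V c x) (-1) y = c"
    using normal_prod_mode_sum[of y 1 x "-1" 0 c] by (simp add: cy x xy vac_right)
  show 2: "nprod V x (-2) y = t *\<^sub>C c"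
    using deriv_mode[OF UNIV_I, of x "-1" y] unfolding D by (simp add: bilinear 1 scaleC_one)
  have 3: "nprod V (normal_prod V c x) (-2) y = t *\<^sub>C normal_prod V c c + va_deriv V c"
    using normal_prod_mode_sum[of y 2 x "-2" 0 c] by (simp add: sum_less_2 cy x xy 2 bilinear deriv_eq)
  have "(2 :: complex) *\<^sub>C nprod V x (-3) y = t *\<^sub>C (t *\<^sub>C normal_prod V c c + va_deriv V c)"
    using deriv_mode[OF UNIV_I, of x "-2" y] unfolding D by (simp add: bilinear 3)
  then have "(1/2 :: complex) *\<^sub>C (2 :: complex) *\<^sub>C nprod V x (-3) y = (1/2) *\<^sub>C t *\<^sub>C (t *\<^sub>C normal_prod V c c + va_deriv V c)"
    by simp
  then show "nprod V x (-3) y = (t\<^sup>2 / 2) *\<^sub>C normal_prod V c c + (t / 2) *\<^sub>C va_deriv V c"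
    by (simp add: scaleC_scaleC scaleC_one scaleC_add_right power2_eq_square)
qed

end

section \<open>The free field realisation\<close>

text \<open>The operator products for the Sugawara computation, collected in one vertex algebra. The
  tensor factors appear as mutually commuting sectors, which keeps tensor products out of the
  computation; \<open>e\<close> and \<open>em\<close> stand for the exponentials of c and
  -c.\<close>

locale free_field = va V for V :: "'v::complex_vector vertex_alg" +
  fixes k :: complex and J Gp Gm L \<beta> \<gamma> c d e em :: 'v
  assumes JJ: "ope V J J [0, ((2*k + 3) / 3) *\<^sub>C vacuum V]"
    and JG: "ope V J Gp [Gp]" "ope V J Gm [- Gm]"
    and GG: "ope V Gp Gm [3 *\<^sub>C normal_prod V J J + (3 * (k + 1) / 2) *\<^sub>C va_deriv V J - (k + 3) *\<^sub>C L,
        (3 * (k + 1)) *\<^sub>C J, ((k + 1) * (2*k + 3)) *\<^sub>C vacuum V]"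
    and bg: "ope V \<beta> \<gamma> [vacuum V]" "commuting \<beta> \<beta>" "commuting \<gamma> \<gamma>"
    and cd_ope: "ope V c d [0, 2 *\<^sub>C vacuum V]" "commuting c c" "commuting d d"
    and ce: "commuting c e" "commuting c em" "ope V d e [2 *\<^sub>C e]" "ope V d em [- (2 *\<^sub>C em)]"
      "va_deriv V e = normal_prod V c e" "va_deriv V em = - normal_prod V c em"
    and ee: "commuting e em" "normal_prod V e em = vacuum V"
    and sectors: "\<And>x y. x \<in> {J, Gp, Gm} \<Longrightarrow> y \<in> {\<beta>, \<gamma>, c, d, e, em} \<Longrightarrow> commuting x y"
      "\<And>x y. x \<in> {\<beta>, \<gamma>} \<Longrightarrow> y \<in> {c, d, e, em} \<Longrightarrow> commuting x y"
begin

abbreviation N where "N \<equiv> normal_prod V"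
abbreviation "D \<equiv> va_deriv V"
abbreviation P where "P \<equiv> nprod V"

lemma opeD: "ope V a b cs \<Longrightarrow> n \<ge> 0 \<Longrightarrow> P a n b = (if nat n < length cs then cs ! nat n else 0)"
  unfolding ope_def by (metis int_nat_eq)

lemma W_sector: "commuting J \<beta>" "commuting J \<gamma>" "commuting J c" "commuting J d" "commuting J e" "commuting J em"
  "commuting Gp \<beta>" "commuting Gp \<gamma>" "commuting Gp c" "commuting Gp d" "commuting Gp e" "commuting Gp em"
  "commuting Gm \<beta>" "commuting Gm \<gamma>" "commuting Gm c" "commuting Gm d" "commuting Gm e" "commuting Gm em"
  by (auto intro: sectors)

lemma S_sector: "commuting \<beta> c" "commuting \<beta> d" "commuting \<beta> e" "commuting \<beta> em"
  "commuting \<gamma> c" "commuting \<gamma> d" "commuting \<gamma> e" "commuting \<gamma> em"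
  by (auto intro: sectors)

lemmas sector = W_sector W_sector[THEN commuting_sym] S_sector S_sector[THEN commuting_sym]
  bg(2,3) cd_ope(2,3) ce(1,2) ce(1,2)[THEN commuting_sym] ee(1) ee(1)[THEN commuting_sym]
lemmas sector_zero = sector[THEN commutingD]


lemma J_modes: "P J 0 J = 0" "P J 1 J = ((2*k + 3) / 3) *\<^sub>C vacuum V" "n \<ge> 2 \<Longrightarrow> P J n J = 0"
  "P J 0 Gp = Gp" "n \<ge> 1 \<Longrightarrow> P J n Gp = 0" "P J 0 Gm = - Gm" "n \<ge> 1 \<Longrightarrow> P J n Gm = 0"
  using opeD[OF JJ] opeD[OF JG(1)] opeD[OF JG(2)] by (auto simp: nat_less_iff)

lemma Gm_J: "P Gm 0 J = Gm" "n \<ge> 1 \<Longrightarrow> P Gm n J = 0"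
proof -
  have "P Gm n J = (if n = 0 then Gm else 0)" if "n \<ge> 0" for n
    using skew[of n 1 J Gm] that J_modes by (auto simp: scaleC_minus_one bilinear vac_annih vac_right)
  then show "P Gm 0 J = Gm" "n \<ge> 1 \<Longrightarrow> P Gm n J = 0" by auto
qed

lemma Gm_Gp:
  "P Gm 0 Gp = (k + 3) *\<^sub>C L - 3 *\<^sub>C N J J + (3 * (k + 1) / 2) *\<^sub>C D J"
  "P Gm 1 Gp = (3 * (k + 1)) *\<^sub>C J" "P Gm 2 Gp = (- ((k + 1) * (2*k + 3))) *\<^sub>C vacuum V" "n \<ge> 3 \<Longrightarrow> P Gm n Gp = 0"
proof -
  define A0 A1 A2 where "A0 = 3 *\<^sub>C N J J + (3 * (k + 1) / 2) *\<^sub>C D J - (k + 3) *\<^sub>C L"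
    and "A1 = (3 * (k + 1)) *\<^sub>C J" and "A2 = ((k + 1) * (2*k + 3)) *\<^sub>C vacuum V"
  note A_def = A0_def A1_def A2_def
  have o: "P Gp 0 Gm = A0" "P Gp 1 Gm = A1" "P Gp 2 Gm = A2" "\<And>n. n \<ge> 3 \<Longrightarrow> P Gp n Gm = 0"
    using opeD[OF GG, of 0] opeD[OF GG, of 1] opeD[OF GG, of 2] opeD[OF GG] by (auto simp: nat_less_iff A_def)
  have "P Gm n Gp = - P A0 (n - 1) (vacuum V) + P A1 (n - 2) (vacuum V) - P A2 (n - 3) (vacuum V)" if "n \<ge> 0" for n
    using skew[of n 3 Gp Gm] that o by (simp add: sum_less_3 scaleC_minus_one scaleC_one)
  moreover have "P A1 n u = (3 * (k + 1)) *\<^sub>C P J n u" "P A2 n u = ((k + 1) * (2*k + 3)) *\<^sub>C P (vacuum V) n u" for n u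
    by (simp_all add: A_def bilinear)
  ultimately have s: "P Gm n Gp = - P A0 (n - 1) (vacuum V) + (3 * (k + 1)) *\<^sub>C P J (n - 2) (vacuum V)
     - ((k + 1) * (2*k + 3)) *\<^sub>C P (vacuum V) (n - 3) (vacuum V)" if "n \<ge> 0" for n
    using that by simp
  show "P Gm 0 Gp = (k + 3) *\<^sub>C L - 3 *\<^sub>C N J J + (3 * (k + 1) / 2) *\<^sub>C D J"
  proof -
    have "P Gm 0 Gp = - A0 + (3 * (k + 1)) *\<^sub>C D J" using s[of 0] by (simp add: vac_right vac_left deriv_eq)
    also have "(3 * (k + 1)) *\<^sub>C D J = (3 * (k + 1) / 2) *\<^sub>C D J + (3 * (k + 1) / 2) *\<^sub>C D J"
      unfolding scaleC_add_left[symmetric] by simp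
    finally show ?thesis by (simp add: A0_def algebra_simps)
  qed
  show "P Gm 1 Gp = (3 * (k + 1)) *\<^sub>C J" using s[of 1] by (simp add: vac_right vac_left vac_annih)
  show "P Gm 2 Gp = (- ((k + 1) * (2*k + 3))) *\<^sub>C vacuum V"
    using s[of 2] by (simp add: vac_left vac_annih)
  show "P Gm n Gp = 0" if "n \<ge> 3" using s[of n] that by (simp add: vac_left vac_annih)
qed

lemma bg_modes: "P \<beta> 0 \<gamma> = vacuum V" "n \<ge> 1 \<Longrightarrow> P \<beta> n \<gamma> = 0" "P \<gamma> 0 \<beta> = - vacuum V" "n \<ge> 1 \<Longrightarrow> P \<gamma> n \<beta> = 0"
proof -
  have b: "P \<beta> n \<gamma> = (if n = 0 then vacuum V else 0)" if "n \<ge> 0" for n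
    using opeD[OF bg(1) that] that by auto
  then show "P \<beta> 0 \<gamma> = vacuum V" "n \<ge> 1 \<Longrightarrow> P \<beta> n \<gamma> = 0" by auto
  have "P \<gamma> n \<beta> = (if n = 0 then - vacuum V else 0)" if "n \<ge> 0" for n
    using skew[of n 1 \<beta> \<gamma>] that b by (auto simp: scaleC_minus_one vac_left)
  then show "P \<gamma> 0 \<beta> = - vacuum V" "n \<ge> 1 \<Longrightarrow> P \<gamma> n \<beta> = 0" by auto
qed

lemma bg_comm: "P \<beta> m (P \<gamma> n u) = P \<gamma> n (P \<beta> m u) + (if m + n = -1 then u else 0)"
  "P \<gamma> m (P \<beta> n u) = P \<beta> n (P \<gamma> m u) - (if m + n = -1 then u else 0)"
  using comm2[of u \<beta> \<gamma> m n] comm2[of u \<gamma> \<beta> m n] bg_modes by (auto simp: vac_left bilinear)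

lemma cd_modes: "P c 0 d = 0" "P c 1 d = 2 *\<^sub>C vacuum V" "n \<ge> 2 \<Longrightarrow> P c n d = 0"
  "P d 0 c = 0" "P d 1 c = 2 *\<^sub>C vacuum V" "n \<ge> 2 \<Longrightarrow> P d n c = 0"
proof -
  show c: "P c 0 d = 0" "P c 1 d = 2 *\<^sub>C vacuum V" "\<And>n. n \<ge> 2 \<Longrightarrow> P c n d = 0"
    using opeD[OF cd_ope(1)] by (auto simp: nat_less_iff)
  have "P d n c = (if n = 1 then 2 *\<^sub>C vacuum V else 0)" if "n \<ge> 0" for n
    using skew[of n 2 c d] that c by (auto simp: sum_less_2 scaleC_one bilinear vac_left)
  then show "P d 0 c = 0" "P d 1 c = 2 *\<^sub>C vacuum V" "n \<ge> 2 \<Longrightarrow> P d n c = 0" by auto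
qed

lemma exp_modes: "P e 0 d = - (2 *\<^sub>C e)" "n \<ge> 1 \<Longrightarrow> P e n d = 0" "P em 0 d = 2 *\<^sub>C em" "n \<ge> 1 \<Longrightarrow> P em n d = 0"
proof -
  have "P d n e = (if n = 0 then 2 *\<^sub>C e else 0)" "P d n em = (if n = 0 then - (2 *\<^sub>C em) else 0)" if "n \<ge> 0" for n
    using opeD[OF ce(3) that] opeD[OF ce(4) that] that by auto
  then have "P e n d = (if n = 0 then - (2 *\<^sub>C e) else 0)" "P em n d = (if n = 0 then 2 *\<^sub>C em else 0)" if "n \<ge> 0" for n
    using skew[of n 1 d e] skew[of n 1 d em] that by (auto simp: scaleC_minus_one bilinear vac_annih vac_right)
  then show "P e 0 d = - (2 *\<^sub>C e)" "n \<ge> 1 \<Longrightarrow> P e n d = 0" "P em 0 d = 2 *\<^sub>C em" "n \<ge> 1 \<Longrightarrow> P em n d = 0" by auto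
qed

lemma exp_exp: "P e (-2) em = c" "P e (-3) em = (1/2) *\<^sub>C N c c + (1/2) *\<^sub>C D c"
  "P em (-2) e = - c" "P em (-3) e = (1/2) *\<^sub>C N c c - (1/2) *\<^sub>C D c" "N em e = vacuum V"
proof -
  show em: "N em e = vacuum V" using commuting_normal[OF ee(1)] ee(2) by simp
  show "P e (-2) em = c" "P e (-3) em = (1/2) *\<^sub>C N c c + (1/2) *\<^sub>C D c"
    using exponential_modes[OF ce(1,2) ee, of 1] ce(5) by (simp_all add: scaleC_one)
  show "P em (-2) e = - c" "P em (-3) e = (1/2) *\<^sub>C N c c - (1/2) *\<^sub>C D c"
    using exponential_modes[OF ce(2,1) commuting_sym[OF ee(1)] em, of "-1"] ce(6) by (simp_all add: scaleC_minus_one)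
qed

end

text \<open>Linear functionals separate vectors. Testing against an arbitrary one turns an identity
  with coefficients depending on k into an identity of complex numbers, to which field arithmetic
  applies.\<close>

lemma vector_eqI:
  fixes x y :: "'a::complex_vector"
  assumes "\<And>l :: 'a \<Rightarrow> complex. (\<And>a b. l (a + b) = l a + l b) \<Longrightarrow> (\<And>a b. l (a - b) = l a - l b) \<Longrightarrow> (\<And>a. l (- a) = - l a)
    \<Longrightarrow> (\<And>t a. l (t *\<^sub>C a) = t * l a) \<Longrightarrow> l x = l y"
  shows "x = y"
proof (rule ccontr)
  assume "x \<noteq> y"
  then obtain l :: "'a \<Rightarrow> complex" where l: "clinear l" "l (x - y) \<noteq> 0" using exists_functional[of "x - y"] by auto
  have lin: "lin_on UNIV l" using l(1) by (simp add: lin_on_UNIV)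
  have s: "l (t *\<^sub>C a) = t * l a" for t a using lin_onD(2)[OF lin UNIV_I] by (simp add: scaleC_complex_def)
  have d: "l (a - b) = l a - l b" for a b using lin_on_diff[OF lin cv.subspace_UNIV] by simp
  have "l x = l y"
    by (rule assms) (use s[of "-1"] s d lin_onD(1)[OF lin] in \<open>simp_all add: scaleC_minus_one\<close>)
  then show False using l(2) d by simp
qed

context free_field begin

text \<open>The images of f_1, f_2, h_1 and h_2 under the embedding, written in the single algebra;
  e_1 goes to \<open>- N \<gamma> e\<close>.\<close>

definition "f1 = Gp - (2 *\<^sub>C N J (N \<beta> em) + ((8*k + 9) / 6) *\<^sub>C N \<beta> (N c em) - (1/2) *\<^sub>C N \<beta> (N d em)) + (k + 1) *\<^sub>C N (D \<beta>) em"
definition "f2 = N Gm em + (N J \<gamma> + ((4*k + 9) / 6) *\<^sub>C N \<gamma> c + (1/2) *\<^sub>C N \<gamma> d) + k *\<^sub>C D \<gamma> - N \<gamma> (N \<gamma> \<beta>)"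
definition "h1 = - (2 *\<^sub>C J) + N \<gamma> \<beta> - ((2*k + 9) / 6) *\<^sub>C c + (1/2) *\<^sub>C d"
definition "h2 = J - 2 *\<^sub>C N \<gamma> \<beta> + ((4*k + 9) / 6) *\<^sub>C c + (1/2) *\<^sub>C d"

lemma N_dc: "N d c = N c d"
  using comm2[of "vacuum V" d c "-1" "-1"] cd_modes by (simp add: vac_right vac_left bilinear)

lemma deriv_N: "N (D a) u = P a (-2) u"
  by (simp add: deriv_mode scaleC_one)

lemma e_d: "P e n (P d m u) = P d m (P e n u) - 2 *\<^sub>C P e (n + m) u"
  using comm2[of u e d n m] exp_modes by (simp add: bilinear)

lemma e_f1_mode:
  "P e n f1 = P e n Gp - (2 *\<^sub>C N J (N \<beta> (P e n em)) + ((8*k + 9) / 6) *\<^sub>C N \<beta> (N c (P e n em))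
    - (1/2) *\<^sub>C N \<beta> (N d (P e n em) - 2 *\<^sub>C P e (n - 1) em)) + (k + 1) *\<^sub>C P \<beta> (-2) (P e n em)"
  unfolding f1_def deriv_N
  by (simp add: bilinear e_d commuting_swap[OF commuting_sym[OF W_sector(5)]]
    commuting_swap[OF commuting_sym[OF S_sector(3)]] commuting_swap[OF commuting_sym[OF ce(1)]])

lemma e_f1:
  "N e f1 = N Gp e - 2 *\<^sub>C N J \<beta> - ((8*k + 15) / 6) *\<^sub>C N \<beta> c + (1/2) *\<^sub>C N \<beta> d + (k + 1) *\<^sub>C D \<beta>"
  "P e 0 f1 = - \<beta>" "n \<ge> 1 \<Longrightarrow> P e n f1 = 0"
proof -
  have e: "P e n em = 0" if "n \<ge> 0" for n using commutingD[OF ee(1) that] .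
  have g: "P e n Gp = 0" if "n \<ge> 0" for n using commutingD[OF commuting_sym[OF W_sector(11)] that] .
  show "N e f1 = N Gp e - 2 *\<^sub>C N J \<beta> - ((8*k + 15) / 6) *\<^sub>C N \<beta> c + (1/2) *\<^sub>C N \<beta> d + (k + 1) *\<^sub>C D \<beta>"
    unfolding e_f1_mode
    by (rule vector_eqI)
      (simp add: ee(2) vac_right exp_exp bilinear deriv_eq commuting_normal[OF W_sector(11)], simp add: field_simps)
  show "P e 0 f1 = - \<beta>"
    unfolding e_f1_mode by (simp add: e g ee(2) vac_right bilinear scaleC_scaleC scaleC_one)
  show "n \<ge> 1 \<Longrightarrow> P e n f1 = 0"
    unfolding e_f1_mode by (simp add: e g)
qed

lemma \<gamma>_f1:
  "P \<gamma> 0 f1 = 2 *\<^sub>C N J em + ((8*k + 9) / 6) *\<^sub>C N c em - (1/2) *\<^sub>C N d em"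
  "P \<gamma> 1 f1 = (- (k + 1)) *\<^sub>C em" "n \<ge> 2 \<Longrightarrow> P \<gamma> n f1 = 0"
proof -
  have z: "P \<gamma> n Gp = 0" "P \<gamma> n em = 0" "P \<gamma> n (N c em) = 0" "P \<gamma> n (N d em) = 0" if "n \<ge> 0" for n
    using sector_zero that commuting_swap[OF S_sector(5), of n "-1" em] commuting_swap[OF S_sector(6), of n "-1" em]
    by simp_all
  have F: "P \<gamma> n f1 = - (2 *\<^sub>C N J (- (if n = 0 then em else 0)) + ((8*k + 9) / 6) *\<^sub>C - (if n = 0 then N c em else 0)
     - (1/2) *\<^sub>C - (if n = 0 then N d em else 0)) - (k + 1) *\<^sub>C (if n = 1 then em else 0)" if "n \<ge> 0" for n
    unfolding f1_def deriv_N
    using that by (simp add: bilinear bg_comm z commuting_swap[OF commuting_sym[OF W_sector(2)]] cong: if_cong)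
  show "P \<gamma> 0 f1 = 2 *\<^sub>C N J em + ((8*k + 9) / 6) *\<^sub>C N c em - (1/2) *\<^sub>C N d em"
    by (rule vector_eqI) (simp add: F bilinear)
  show "P \<gamma> 1 f1 = (- (k + 1)) *\<^sub>C em" by (rule vector_eqI) (simp add: F bilinear algebra_simps)
  show "n \<ge> 2 \<Longrightarrow> P \<gamma> n f1 = 0" by (simp add: F)
qed

text \<open>Normal ordering is not associative: besides \<open>N \<gamma> (N e f1)\<close> the poles
  with \<open>f1\<close> contribute, a simple one for \<open>e\<close> and a double one for
  \<gamma>. The negative modes of \<open>e\<close> then meet \<open>em\<close> inside them, which
  produces polynomials in c.\<close>

lemma e1_f1:
  "N (N \<gamma> e) f1 = N Gp (N \<gamma> e) - 2 *\<^sub>C N J (N \<gamma> \<beta>) - ((8*k + 15) / 6) *\<^sub>C N \<gamma> (N \<beta> c) + (1/2) *\<^sub>C N \<gamma> (N \<beta> d)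
    + (k + 1) *\<^sub>C N \<gamma> (D \<beta>) - P \<gamma> (-2) \<beta> + 2 *\<^sub>C N J c - (1/2) *\<^sub>C N c d + ((5*k + 9) / 6) *\<^sub>C N c c - (k/2) *\<^sub>C D c"
proof -
  have eq: "N (N \<gamma> e) f1 = N \<gamma> (N e f1) + P \<gamma> (-2) (P e 0 f1) + (P e (-2) (P \<gamma> 0 f1) + P e (-3) (P \<gamma> 1 f1))"
    using normal_prod_mode_sum[OF UNIV_I, of 2 e "-1" f1 2 \<gamma>] e_f1(3) \<gamma>_f1(3) by (simp add: sum_less_2)
  show ?thesis
    unfolding eq e_f1 \<gamma>_f1
    by (rule vector_eqI) (simp add: bilinear e_d exp_exp N_dc commuting_swap[OF commuting_sym[OF W_sector(5)]]
      commuting_swap[OF commuting_sym[OF ce(1)]] commuting_swap[OF commuting_sym[OF W_sector(8)]]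
      commuting_swap[OF commuting_sym[OF W_sector(2)]], simp add: field_simps)
qed

lemma N_commuting:
  assumes "commuting a u" "commuting b u" shows "N (N a b) u = N a (N b u)"
  using normal_prod_mode_sum[of u 1 b "-1" 0 a] commutingD[OF assms(1)] commutingD[OF assms(2)] by simp

lemma \<beta>\<gamma>: "N \<beta> \<gamma> = N \<gamma> \<beta>" "N \<beta> (D \<gamma>) = P \<gamma> (-2) \<beta>"
  using bg_comm(1)[of "-1" "-1" "vacuum V"] bg_comm(1)[of "-1" "-2" "vacuum V"] by (simp_all add: vac_right deriv_eq)

lemma e2_f2:
  "N \<beta> f2 = N Gm (N \<beta> em) + N J (N \<gamma> \<beta>) + ((4*k + 9) / 6) *\<^sub>C N \<gamma> (N \<beta> c) + (1/2) *\<^sub>C N \<gamma> (N \<beta> d)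
    + k *\<^sub>C P \<gamma> (-2) \<beta> - N \<gamma> (N \<gamma> (N \<beta> \<beta>))"
  unfolding f2_def
  by (simp add: bilinear bg_comm(1) \<beta>\<gamma> commuting_swap[OF commuting_sym[OF W_sector(1)]]
    commuting_swap[OF commuting_sym[OF W_sector(13)]])

lemma f2_commuting_parts:
  "commuting J x \<Longrightarrow> commuting \<gamma> x \<Longrightarrow> P (N J \<gamma>) 0 x = 0" "commuting \<gamma> x \<Longrightarrow> commuting c x \<Longrightarrow> P (N \<gamma> c) 0 x = 0"
  "commuting \<gamma> x \<Longrightarrow> commuting d x \<Longrightarrow> P (N \<gamma> d) 0 x = 0" "commuting Gm x \<Longrightarrow> commuting em x \<Longrightarrow> P (N Gm em) 0 x = 0"
  "commuting \<gamma> x \<Longrightarrow> commuting \<beta> x \<Longrightarrow> P (N \<gamma> (N \<gamma> \<beta>)) 0 x = 0" "P (D \<gamma>) 0 x = 0"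
  by (rule commutingD[OF commuting_nprod]; (assumption | simp))+
    ((rule commutingD[OF commuting_nprod[OF _ commuting_nprod]]; (assumption | simp)), simp add: deriv_mode)

text \<open>Zero modes are derivations of all products. The action of \<open>f2\<close> on
  \<open>N e f1\<close> is therefore assembled from its values on the fields that occur there,
  computed here and in the following lemmas.\<close>

lemma f2_J: "P f2 0 J = N Gm em + ((2*k + 3) / 3) *\<^sub>C D \<gamma>"
proof -
  have "P (N Gm em) 0 J = N Gm em"
    using normal_prod_mode_sum[of J 0 em 0 1 Gm] Gm_J sector_zero(24)
    by (simp add: commuting_normal[OF W_sector(18)] commutingD[OF commuting_sym[OF W_sector(6)]])
  moreover have "P (N J \<gamma>) 0 J = ((2*k + 3) / 3) *\<^sub>C D \<gamma>"
    using normal_prod_mode_sum[of J 0 \<gamma> 0 2 J] J_modes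
    by (simp add: sum_less_2 commutingD[OF commuting_sym[OF W_sector(2)]] bilinear deriv_eq)
  ultimately show ?thesis
    unfolding f2_def by (simp add: bilinear f2_commuting_parts sector)
qed

lemma f2_c: "P f2 0 c = D \<gamma>"
proof -
  have "P (N \<gamma> d) 0 c = 2 *\<^sub>C D \<gamma>"
    using normal_prod_mode_sum[of c 2 d 0 0 \<gamma>] cd_modes
    by (simp add: sum_less_2 commutingD[OF S_sector(5)] bilinear deriv_eq)
  then show ?thesis
    unfolding f2_def by (simp add: bilinear f2_commuting_parts sector scaleC_scaleC scaleC_one)
qed

lemma f2_d: "P f2 0 d = 2 *\<^sub>C N Gm em + (2 * ((4*k + 9) / 6)) *\<^sub>C D \<gamma>"
proof -
  have "P (N Gm em) 0 d = 2 *\<^sub>C N Gm em"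
    using normal_prod_mode_sum[of d 1 em 0 0 Gm] exp_modes
    by (simp add: commutingD[OF W_sector(16)] bilinear)
  moreover have "P (N \<gamma> c) 0 d = 2 *\<^sub>C D \<gamma>"
    using normal_prod_mode_sum[of d 2 c 0 0 \<gamma>] cd_modes
    by (simp add: sum_less_2 commutingD[OF S_sector(6)] bilinear deriv_eq)
  ultimately show ?thesis
    unfolding f2_def by (simp add: bilinear f2_commuting_parts sector scaleC_scaleC mult.commute)
qed

lemma f2_e: "P f2 0 e = N \<gamma> e"
proof -
  have "P d n e = (if n = 0 then 2 *\<^sub>C e else 0)" if "n \<ge> 0" for n using opeD[OF ce(3) that] that by auto
  then have "P (N \<gamma> d) 0 e = 2 *\<^sub>C N \<gamma> e"
    using normal_prod_mode_sum[of e 1 d 0 0 \<gamma>] by (simp add: commutingD[OF S_sector(7)] bilinear)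
  then show ?thesis
    unfolding f2_def by (simp add: bilinear f2_commuting_parts sector scaleC_scaleC scaleC_one)
qed

lemma f2_\<beta>: "P f2 0 \<beta> = - h2"
proof -
  have x: "P (N a \<gamma>) 0 \<beta> = - a" if "commuting a \<beta>" for a
    using normal_prod_mode_sum[of \<beta> 1 \<gamma> 0 0 a] bg_modes commutingD[OF that] by (simp add: bilinear vac_right)
  have y: "P (N \<gamma> a) 0 \<beta> = - a" if "commuting \<gamma> a" "commuting a \<beta>" for a
    using x[OF that(2)] commuting_normal[OF that(1)] by simp
  have z: "P (N \<gamma> \<beta>) n \<beta> = (if n = 0 then - \<beta> else 0)" if "n \<ge> 0" for n
    using normal_prod_mode_sum[of \<beta> 0 \<beta> n 1 \<gamma>] bg_modes commutingD[OF bg(2)] that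
    by (auto simp: bilinear vac_annih vac_right)
  have "P (N \<gamma> (N \<gamma> \<beta>)) 0 \<beta> = - (2 *\<^sub>C N \<gamma> \<beta>)"
    using normal_prod_mode_sum[of \<beta> 1 "N \<gamma> \<beta>" 0 1 \<gamma>] bg_modes z
    by (simp add: bilinear vac_right) (rule vector_eqI, simp)
  then show ?thesis
    unfolding f2_def h2_def
    by (simp add: bilinear f2_commuting_parts sector x y)
qed

lemma f2_Gp: "P f2 0 Gp = N em (P Gm 0 Gp) + P em (-2) (P Gm 1 Gp) + P em (-3) (P Gm 2 Gp) + N Gp \<gamma>"
proof -
  have "P (N Gm em) 0 Gp = N em (P Gm 0 Gp) + P em (-2) (P Gm 1 Gp) + P em (-3) (P Gm 2 Gp)"
    using normal_prod_mode_sum[of Gp 0 em 0 3 Gm] Gm_Gp(4) by (simp add: sum_less_3 commutingD[OF commuting_sym[OF W_sector(12)]])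
  moreover have "P (N J \<gamma>) 0 Gp = N Gp \<gamma>"
    using normal_prod_mode_sum[of Gp 0 \<gamma> 0 1 J] J_modes
    by (simp add: commutingD[OF commuting_sym[OF W_sector(8)]] commuting_normal[OF W_sector(8)])
  ultimately show ?thesis
    unfolding f2_def by (simp add: bilinear f2_commuting_parts sector)
qed

lemma f2_Gp_e:
  "P f2 0 (N Gp e) = P Gm 0 Gp - N (P Gm 1 Gp) c + N (P Gm 2 Gp) ((1/2) *\<^sub>C N c c - (1/2) *\<^sub>C D c) + 2 *\<^sub>C N Gp (N \<gamma> e)"
proof -
  \<comment> \<open>Both sides come from the second derivative of \<open>em\<close>, whose (-1)-mode
    is twice the (-3)-mode of \<open>em\<close>.\<close>
  have em3: "N (P em (-3) (vacuum V)) e = P em (-3) e"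
  proof -
    have DD: "D (D em) = 2 *\<^sub>C P em (-3) (vacuum V)" using deriv_mode[of "vacuum V" em "-2"] by (simp add: va_deriv_def[of V "D em"])
    have "N (D (D em)) e = 2 *\<^sub>C P em (-3) e" by (simp add: deriv_mode scaleC_one)
    then have "2 *\<^sub>C N (P em (-3) (vacuum V)) e = 2 *\<^sub>C P em (-3) e" unfolding DD by (simp add: bilinear)
    then show ?thesis by simp
  qed
  have vac: "commuting (vacuum V) x" for x by (simp add: commuting_def vac_left)
  have A: "N (P em n (P Gm m Gp)) e = N (P Gm m Gp) (N (P em n (vacuum V)) e)" for m n
  proof -
    have 1: "commuting (P Gm m Gp) em" "commuting (P Gm m Gp) e" by (intro commuting_nprod sector)+
    have "P em n (P Gm m Gp) = N (P Gm m Gp) (P em n (vacuum V))"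
      using commuting_swap[OF 1(1), of "-1" n "vacuum V"] by (simp add: vac_right)
    moreover have "commuting (P em n (vacuum V)) e" by (intro commuting_nprod sector vac)
    ultimately show ?thesis using N_commuting[OF 1(2)] by simp
  qed
  have "P f2 0 (N Gp e) = N Gp (N \<gamma> e) + N (P f2 0 Gp) e" using comm_0[of e f2 Gp "-1"] by (simp add: f2_e)
  also have "N (P f2 0 Gp) e = P Gm 0 Gp - N (P Gm 1 Gp) c + N (P Gm 2 Gp) ((1/2) *\<^sub>C N c c - (1/2) *\<^sub>C D c) + N Gp (N \<gamma> e)"
    using em3 by (simp add: f2_Gp bilinear(5) A vac_right exp_exp deriv_eq deriv_N Y_uminus N_commuting sector)
  finally show ?thesis by (rule trans) (rule vector_eqI, simp)
qed

end

section \<open>Assembling the Sugawara vector\<close>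

context free_field begin

lemma deriv_linear: "D (a + b) = D a + D b" "D (a - b) = D a - D b" "D (t *\<^sub>C a) = t *\<^sub>C D a" "D (- a) = - D a"
  by (simp_all add: va_deriv_def bilinear)

lemma products:
  "N (N \<gamma> \<beta>) c = N \<gamma> (N \<beta> c)" "N (N \<gamma> \<beta>) d = N \<gamma> (N \<beta> d)" "N (N \<gamma> \<beta>) J = N J (N \<gamma> \<beta>)"
  "N c (N \<gamma> \<beta>) = N \<gamma> (N \<beta> c)" "N d (N \<gamma> \<beta>) = N \<gamma> (N \<beta> d)" "N c J = N J c" "N d J = N J d"
  "N (N Gm em) \<beta> = N Gm (N \<beta> em)" "N (D \<gamma>) x = P \<gamma> (-2) x" "D (N \<gamma> \<beta>) = P \<gamma> (-2) \<beta> + N \<gamma> (D \<beta>)"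
proof -
  have s: "commuting (N \<gamma> \<beta>) c" "commuting (N \<gamma> \<beta>) d" "commuting (N \<gamma> \<beta>) J" by (intro commuting_nprod sector)+
  show "N (N \<gamma> \<beta>) c = N \<gamma> (N \<beta> c)" "N (N \<gamma> \<beta>) d = N \<gamma> (N \<beta> d)" by (simp_all add: N_commuting sector)
  then show "N c (N \<gamma> \<beta>) = N \<gamma> (N \<beta> c)" "N d (N \<gamma> \<beta>) = N \<gamma> (N \<beta> d)"
    using commuting_normal[OF s(1)] commuting_normal[OF s(2)] by simp_all
  show "N (N \<gamma> \<beta>) J = N J (N \<gamma> \<beta>)" by (rule commuting_normal[OF s(3)])
  show "N c J = N J c" "N d J = N J d" by (intro commuting_normal sector)+
  show "N (N Gm em) \<beta> = N Gm (N \<beta> em)"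
    using commuting_normal[OF S_sector(4)] by (simp add: N_commuting sector)
  show "N (D \<gamma>) x = P \<gamma> (-2) x" by (rule deriv_N)
  show "D (N \<gamma> \<beta>) = P \<gamma> (-2) \<beta> + N \<gamma> (D \<beta>)" by (simp add: deriv_nprod deriv_N)
qed

text \<open>The two correction terms are the single contractions, coming from the simple poles of
  \<beta> and of \<gamma> with \<open>N \<gamma> \<beta>\<close>.\<close>

lemma current_square: "N (N \<gamma> \<beta>) (N \<gamma> \<beta>) = N \<gamma> (N \<gamma> (N \<beta> \<beta>)) + P \<gamma> (-2) \<beta> - N \<gamma> (D \<beta>)"
proof -
  have \<gamma>\<gamma>: "P \<gamma> m (P \<gamma> n u) = P \<gamma> n (P \<gamma> m u)" for m n u by (rule commuting_swap[OF bg(3)])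
  have b: "P \<beta> n (N \<gamma> \<beta>) = (if n = 0 then \<beta> else 0)" if "n \<ge> 0" for n
    using that commutingD[OF bg(2)] by (auto simp: bg_comm(1))
  have g: "P \<gamma> n (N \<gamma> \<beta>) = (if n = 0 then - \<gamma> else 0)" if "n \<ge> 0" for n
    using that bg_modes \<gamma>\<gamma>[of n "-1" \<beta>] by (auto simp: bilinear vac_right)
  have "N (N \<gamma> \<beta>) (N \<gamma> \<beta>) = N \<gamma> (N \<beta> (N \<gamma> \<beta>)) + P \<gamma> (-2) (P \<beta> 0 (N \<gamma> \<beta>)) + P \<beta> (-2) (P \<gamma> 0 (N \<gamma> \<beta>))"
    using normal_prod_mode_sum[of "N \<gamma> \<beta>" 2 \<beta> "-1" 1 \<gamma>] b g by (simp add: sum_less_2)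
  also have "N \<beta> (N \<gamma> \<beta>) = N \<gamma> (N \<beta> \<beta>)" by (simp add: bg_comm(1))
  also have "P \<beta> (-2) (P \<gamma> 0 (N \<gamma> \<beta>)) = - N \<gamma> (D \<beta>)"
    using bg_comm(1)[of "-2" "-1" "vacuum V"] by (simp add: g Y_uminus vac_right deriv_eq)
  finally show ?thesis by (simp add: b)
qed

lemma f2_e_f1:
  "P f2 0 (N e f1) = P f2 0 (N Gp e) - 2 *\<^sub>C (N Gm (N \<beta> em) + ((2*k + 3) / 3) *\<^sub>C P \<gamma> (-2) \<beta> - N J h2)
    - ((8*k + 15) / 6) *\<^sub>C (P \<gamma> (-2) \<beta> - N h2 c)
    + (1/2) *\<^sub>C (2 *\<^sub>C N Gm (N \<beta> em) + (2 * ((4*k + 9) / 6)) *\<^sub>C P \<gamma> (-2) \<beta> - N h2 d) - (k + 1) *\<^sub>C D h2"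
proof -
  have "N \<beta> (N Gm em) = N Gm (N \<beta> em)" by (rule commuting_swap[OF commuting_sym[OF W_sector(13)]])
  moreover have "P f2 0 (D \<beta>) = - D h2"
    using comm_0[of "vacuum V" f2 \<beta> "-2"] by (simp add: deriv_eq vac_annih f2_\<beta> deriv_linear)
  ultimately show ?thesis
    unfolding e_f1(1)
    by (simp add: bilinear comm_0 f2_J f2_c f2_d f2_\<beta> products \<beta>\<gamma> scaleC_add_right cv.scale_right_diff_distrib)
qed

text \<open>The left side is the image of \<open>sugawara_reduced\<close>; its first sign comes from
  e_1 being sent to minus a product. All terms are brought to fixed normally ordered monomials and
  the coefficients compared. L enters through the first-order pole of \<open>Gm\<close> and
  \<open>Gp\<close>, where its coefficient is k + 3.\<close>

lemma sugawara_vector: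
  "- (4 *\<^sub>C N (N \<gamma> e) f1) + 2 *\<^sub>C N \<beta> f2 + 2 *\<^sub>C P f2 0 (N e f1) - 2 *\<^sub>C D (h1 + h2)
    + (2/3) *\<^sub>C (N h1 h1 + N h1 h2 + N h2 h2)
   = (2 * (k + 3)) *\<^sub>C (L + (1/2) *\<^sub>C D J + P \<gamma> (-2) \<beta> + (1/2) *\<^sub>C N c d + (k/3) *\<^sub>C D c - (1/2) *\<^sub>C D d)"
  unfolding e1_f1 e2_f2 f2_e_f1 f2_Gp_e Gm_Gp h1_def h2_def
  by (rule vector_eqI) (simp add: bilinear deriv_linear products current_square N_dc vac_left, simp add: field_simps)

end

section \<open>Homomorphisms\<close>

lemma va_homD:
  assumes "va_hom V W f"
  shows "f (a + b) = f a + f b" "f (a - b) = f a - f b" "f (t *\<^sub>C a) = t *\<^sub>C f a" "f (- a) = - f a" "f 0 = 0"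
    "f (vacuum V) = vacuum W" "f (nprod V a n b) = nprod W (f a) n (f b)" "f (va_deriv V a) = va_deriv W (f a)"
proof -
  have l: "lin_on UNIV f" using assms by (simp add: va_hom_def lin_on_UNIV)
  show "f (a + b) = f a + f b" "f (t *\<^sub>C a) = t *\<^sub>C f a" by (simp_all add: lin_onD[OF l])
  show d: "f (a - b) = f a - f b" for a b by (rule lin_on_diff[OF l cv.subspace_UNIV UNIV_I UNIV_I])
  show z: "f 0 = 0" by (rule lin_on_0[OF l cv.subspace_UNIV])
  show "f (- a) = - f a" using d[of 0 a] z by simp
  show "f (vacuum V) = vacuum W" "f (nprod V a n b) = nprod W (f a) n (f b)" using assms by (simp_all add: va_hom_def)
  then show "f (va_deriv V a) = va_deriv W (f a)" using assms by (simp add: va_hom_def va_deriv_def)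
qed

lemma va_hom_ope: "va_hom V W f \<Longrightarrow> ope V a b cs \<Longrightarrow> ope W (f a) (f b) (map f cs)"
  by (auto simp: ope_def va_homD(7)[symmetric] va_homD(5))

lemma va_hom_comp: "va_hom V W f \<Longrightarrow> va_hom W U g \<Longrightarrow> va_hom V U (g \<circ> f)"
  by (simp add: va_hom_def clinear_iff)

lemma va_module_pullback:
  assumes f: "va_hom V W f" and V: "vertex_algebra V" and W: "vertex_algebra W" and Y: "va_module W M Y"
  shows "va_module V M (\<lambda>a. Y (f a))"
proof -
  interpret W: va_mod W M Y by unfold_locales (rule W Y)+
  have m: "modes (nprod V) (\<lambda>a. Y (f a)) M"
  proof
    show "lin_on UNIV (\<lambda>a. Y (f a) n u)" if "u \<in> M" for n u
      using lin_onD[OF va_moduleD(4)[OF Y that]] by (simp add: lin_on_def va_homD(1,3)[OF f])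
  qed (use va_moduleD[OF Y] va_moduleD[OF vertex_algebraD(1)[OF V]] in auto)
  show ?thesis
    using modes.va_module_iff[OF m refl] modes_Jac[OF W Y] va_moduleD(6)[OF Y]
    unfolding modes.Jac_def[OF m] W.Jac_def va_homD(6,7)[OF f] by blast
qed

lemma simple_quotientD: "simple_quotient V Q f \<Longrightarrow> vertex_algebra Q" "simple_quotient V Q f \<Longrightarrow> va_hom V Q f"
  by (simp_all add: simple_quotient_def va_simple_def)

context
  fixes V :: "'a::complex_vector vertex_alg" and W :: "'b::complex_vector vertex_alg"
  assumes V: "vertex_algebra V" and W: "vertex_algebra W"
begin

lemma tensor_act_left:
  "va_module V UNIV YV \<Longrightarrow> va_module W UNIV YW \<Longrightarrow> tensor_act YV YW (a \<otimes> vacuum W) n (u \<otimes> v) = YV a n u \<otimes> v"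
  by (rule tensor_va_modes.T_left_factor[OF tensor_va_modesI[OF V _ W]])

lemma tensor_act_right:
  "va_module V UNIV YV \<Longrightarrow> va_module W UNIV YW \<Longrightarrow> tensor_act YV YW (vacuum V \<otimes> b) n (u \<otimes> v) = u \<otimes> YW b n v"
  by (rule tensor_va_modes.T_right_factor[OF tensor_va_modesI[OF V _ W]])

lemma tensor_nprod_left: "nprod (V \<otimes>\<^sub>V W) (a \<otimes> vacuum W) n (u \<otimes> v) = nprod V a n u \<otimes> v"
  using tensor_act_left[OF vertex_algebraD(1)[OF V] vertex_algebraD(1)[OF W]] by (simp add: tensor_va_def)

lemma tensor_nprod_right: "nprod (V \<otimes>\<^sub>V W) (vacuum V \<otimes> b) n (u \<otimes> v) = u \<otimes> nprod W b n v"
  using tensor_act_right[OF vertex_algebraD(1)[OF V] vertex_algebraD(1)[OF W]] by (simp add: tensor_va_def)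

lemma tensor_vacuum: "vacuum (V \<otimes>\<^sub>V W) = vacuum V \<otimes> vacuum W" by (simp add: tensor_va_def)

lemma tensor_hom_left: "va_hom V (V \<otimes>\<^sub>V W) (\<lambda>a. a \<otimes> vacuum W)"
  by (simp add: va_hom_def tensor_nprod_left tensor_vacuum clinear_iff pure_tensor_add_left scaleC_pure_tensor)

lemma tensor_hom_right: "va_hom W (V \<otimes>\<^sub>V W) (\<lambda>b. vacuum V \<otimes> b)"
  by (simp add: va_hom_def tensor_nprod_right tensor_vacuum clinear_iff pure_tensor_add_right pure_tensor_scale_right)

lemma tensor_commuting: "va.commuting (V \<otimes>\<^sub>V W) (a \<otimes> vacuum W) (vacuum V \<otimes> b)"
proof -
  interpret T: va "V \<otimes>\<^sub>V W" by unfold_locales (rule tensor_vertex_algebra[OF V W])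
  show ?thesis by (simp add: T.commuting_def tensor_nprod_left vertex_algebraD(3)[OF V])
qed

end

section \<open>The Sugawara vector of affine \<open>sl\<^sub>3\<close>\<close>

lemma mat_unit_mult: "mat_unit i j ** mat_unit k l = (if j = k then mat_unit i l else 0)"
  by (auto simp: mat_unit_def matrix_matrix_mult_def vec_eq_iff if_distrib cong: if_cong)
    (auto simp: mult_ac if_distrib sum.delta' intro!: sum.neutral cong: if_cong)

lemma trace_mat_unit: "trace (mat_unit i j) = (if i = j then 1 else 0)"
  by (auto simp: mat_unit_def trace_def intro!: sum.neutral)

lemma index3: "(1::3) \<noteq> 2" "(1::3) \<noteq> 3" "(2::3) \<noteq> 3" "(2::3) \<noteq> 1" "(3::3) \<noteq> 1" "(3::3) \<noteq> 2"
  by simp_all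

lemma sl3_mem: "sl3_e1 \<in> sl3" "sl3_e2 \<in> sl3" "sl3_e3 \<in> sl3" "sl3_h1 \<in> sl3" "sl3_h2 \<in> sl3"
  "sl3_f1 \<in> sl3" "sl3_f2 \<in> sl3" "sl3_f3 \<in> sl3"
  by (simp_all add: sl3_def trace_sub trace_mat_unit index3)

text \<open>The part of \<open>universal_affine_sl3\<close> that passes to the simple
  quotient.\<close>

locale affine_sl3 = va V for V :: "'v::complex_vector vertex_alg" +
  fixes k :: complex and g :: "complex^3^3 \<Rightarrow> 'v"
  assumes g_add: "X \<in> sl3 \<Longrightarrow> Z \<in> sl3 \<Longrightarrow> g (X + Z) = g X + g Z"
    and g_scale: "X \<in> sl3 \<Longrightarrow> g (t *\<^sub>C X) = t *\<^sub>C g X"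
    and g_ope: "X \<in> sl3 \<Longrightarrow> Z \<in> sl3 \<Longrightarrow> ope V (g X) (g Z) [g (X ** Z - Z ** X), (k * trace (X ** Z)) *\<^sub>C vacuum V]"
begin

lemma g_minus: "X \<in> sl3 \<Longrightarrow> g (- X) = - g X"
  using g_scale[of X "-1"] by (simp add: scaleC_minus_one)

lemma g_0: "g 0 = 0"
  using g_scale[of sl3_e1 0] sl3_mem by simp

lemma g_bracket: "X \<in> sl3 \<Longrightarrow> Z \<in> sl3 \<Longrightarrow> nprod V (g X) 0 (g Z) = g (X ** Z - Z ** X)"
  by (drule (1) g_ope) (drule ope_def[THEN iffD1, THEN spec, of _ _ _ _ 0], simp)

lemma g_swap:
  assumes X: "X \<in> sl3" and Z: "Z \<in> sl3"
  shows "normal_prod V (g X) (g Z) = normal_prod V (g Z) (g X) + va_deriv V (g (X ** Z - Z ** X))"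
proof -
  have o: "nprod V (g X) (int n) (g Z) = (if n < 2 then [g (X ** Z - Z ** X), (k * trace (X ** Z)) *\<^sub>C vacuum V] ! n else 0)" for n
    using g_ope[OF X Z] by (simp add: ope_def numeral_2_eq_2)
  have "nprod V (g X) 1 (g Z) = (k * trace (X ** Z)) *\<^sub>C vacuum V" using o[of 1] by simp
  then show ?thesis
    using comm2[of "vacuum V" "g X" "g Z" "-1" "-1"] o by (simp add: vac_right vac_left bilinear deriv_eq g_bracket[OF X Z])
qed

lemma matrix_diff_distrib: "(A - B) ** C = A ** C - B ** C" "A ** (B - C) = A ** B - A ** C"
  for A B C :: "complex^3^3"
  by (simp_all add: matrix_matrix_mult_def vec_eq_iff sum_subtractf left_diff_distrib right_diff_distrib)

lemma brackets:
  "sl3_f1 ** sl3_e1 - sl3_e1 ** sl3_f1 = - sl3_h1" "sl3_f2 ** sl3_e2 - sl3_e2 ** sl3_f2 = - sl3_h2"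
  "sl3_f3 ** sl3_e3 - sl3_e3 ** sl3_f3 = - (sl3_h1 + sl3_h2)" "sl3_f2 ** sl3_f1 - sl3_f1 ** sl3_f2 = sl3_f3"
  "sl3_f2 ** sl3_e3 - sl3_e3 ** sl3_f2 = - sl3_e1" "sl3_h2 ** sl3_h1 - sl3_h1 ** sl3_h2 = 0"
  by (simp_all add: mat_unit_mult index3 matrix_diff_distrib)

text \<open>Reordering f e to e f costs the derivative of h for each positive root, in total -2
  times that of h_1 + h_2. Since [f_2, f_1] = f_3 and [f_2, e_3] = - e_1, the zero mode of f_2 sends
  e_3 f_1 to e_3 f_3 - e_1 f_1; eliminating e_3 f_3 in this way raises the coefficient of e_1 f_1
  from 2 to 4.\<close>

lemma sugawara_reduced:
  assumes "k \<noteq> -3"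
  shows "(2 * (k + 3)) *\<^sub>C sugawara_sl3 k V g = 4 *\<^sub>C normal_prod V (g sl3_e1) (g sl3_f1) + 2 *\<^sub>C normal_prod V (g sl3_e2) (g sl3_f2)
    + 2 *\<^sub>C nprod V (g sl3_f2) 0 (normal_prod V (g sl3_e3) (g sl3_f1)) - 2 *\<^sub>C va_deriv V (g sl3_h1 + g sl3_h2)
    + (2/3) *\<^sub>C (normal_prod V (g sl3_h1) (g sl3_h1) + normal_prod V (g sl3_h1) (g sl3_h2) + normal_prod V (g sl3_h2) (g sl3_h2))"
proof -
  let ?N = "normal_prod V"
  have h: "sl3_h1 + sl3_h2 \<in> sl3" by (simp add: sl3_def trace_sub trace_mat_unit)
  have Dl: "va_deriv V (- a) = - va_deriv V a" "va_deriv V (a + b) = va_deriv V a + va_deriv V b" "va_deriv V (a - b) = va_deriv V a - va_deriv V b"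
    "va_deriv V 0 = 0" for a b
    by (simp_all add: va_deriv_def bilinear)
  have s: "?N (g sl3_f1) (g sl3_e1) = ?N (g sl3_e1) (g sl3_f1) - va_deriv V (g sl3_h1)"
    "?N (g sl3_f2) (g sl3_e2) = ?N (g sl3_e2) (g sl3_f2) - va_deriv V (g sl3_h2)"
    "?N (g sl3_f3) (g sl3_e3) = ?N (g sl3_e3) (g sl3_f3) - va_deriv V (g sl3_h1 + g sl3_h2)"
    "?N (g sl3_h2) (g sl3_h1) = ?N (g sl3_h1) (g sl3_h2)"
    using g_swap[of sl3_f1 sl3_e1] g_swap[of sl3_f2 sl3_e2] g_swap[of sl3_f3 sl3_e3] g_swap[of sl3_h2 sl3_h1] sl3_mem
      g_minus[OF sl3_mem(4)] g_minus[OF sl3_mem(5)] g_minus[OF h] g_add[OF sl3_mem(4,5)]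
    unfolding brackets by (simp_all add: Dl g_0)
  have "nprod V (g sl3_f2) 0 (?N (g sl3_e3) (g sl3_f1)) = ?N (g sl3_e3) (g sl3_f3) - ?N (g sl3_e1) (g sl3_f1)"
    using comm_0[of "g sl3_f1" "g sl3_f2" "g sl3_e3" "-1"] g_bracket[of sl3_f2 sl3_f1] g_bracket[of sl3_f2 sl3_e3] sl3_mem
      g_minus[OF sl3_mem(1)]
    unfolding brackets by (simp add: bilinear)
  then have e3: "?N (g sl3_e3) (g sl3_f3) = nprod V (g sl3_f2) 0 (?N (g sl3_e3) (g sl3_f1)) + ?N (g sl3_e1) (g sl3_f1)"
    by simp
  have "k + 3 \<noteq> 0" using assms by (metis add_eq_0_iff2)
  moreover have "q *\<^sub>C (1 / q) *\<^sub>C x = x" if "q \<noteq> 0" for q and x :: 'v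
    using that by (simp add: scaleC_scaleC scaleC_one)
  ultimately have c: "(2 * (k + 3)) *\<^sub>C (1 / (2 * (k + 3))) *\<^sub>C x = x" for x :: 'v
    by (metis mult_eq_0_iff zero_neq_numeral)
  show ?thesis
    unfolding sugawara_sl3_def Let_def c s e3
    by (rule vector_eqI) (simp add: Dl)
qed

end

lemma universal_affine_quotient:
  assumes "universal_affine_sl3 k Vk g" "simple_quotient Vk Lk f"
  shows "affine_sl3 Lk k (f \<circ> g)"
proof -
  note f = simple_quotientD[OF assms(2)]
  note h = va_homD[OF f(2)]
  show ?thesis
  proof
    show "vertex_algebra Lk" by (rule f)
    show "(f \<circ> g) (X + Z) = (f \<circ> g) X + (f \<circ> g) Z" if "X \<in> sl3" "Z \<in> sl3" for X Z
      using assms(1) that by (simp_all add: universal_affine_sl3_def h)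
    show "(f \<circ> g) (t *\<^sub>C X) = t *\<^sub>C (f \<circ> g) X" if "X \<in> sl3" for X t
      using assms(1) that by (simp add: universal_affine_sl3_def h)
    show "ope Lk ((f \<circ> g) X) ((f \<circ> g) Z) [(f \<circ> g) (X ** Z - Z ** X), (k * trace (X ** Z)) *\<^sub>C vacuum Lk]" if "X \<in> sl3" "Z \<in> sl3" for X Z
      using va_hom_ope[OF f(2), of "g X" "g Z" "[g (X ** Z - Z ** X), (k * trace (X ** Z)) *\<^sub>C vacuum Vk]"] assms(1) that
      by (simp add: universal_affine_sl3_def h)
  qed
qed

section \<open>The image of the Sugawara vector\<close>

locale triple_tensor =
  fixes W :: "'w::complex_vector vertex_alg" and S :: "'s::complex_vector vertex_alg" and Q :: "'p::complex_vector vertex_alg"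
  assumes W: "vertex_algebra W" and S: "vertex_algebra S" and Q: "vertex_algebra Q"
begin

definition "inW w = w \<otimes> (vacuum S \<otimes> vacuum Q)"
definition "inS s = vacuum W \<otimes> (s \<otimes> vacuum Q)"
definition "inQ p = vacuum W \<otimes> (vacuum S \<otimes> p)"

abbreviation "SQ \<equiv> S \<otimes>\<^sub>V Q"
abbreviation "T \<equiv> W \<otimes>\<^sub>V SQ"

lemma SQ: "vertex_algebra SQ" by (rule tensor_vertex_algebra[OF S Q])

sublocale va T by unfold_locales (rule tensor_vertex_algebra[OF W SQ])

lemma inW_hom: "va_hom W T inW"
  using tensor_hom_left[OF W SQ] by (simp add: inW_def[abs_def] tensor_va_def)

lemma inS_hom: "va_hom S T inS"
  using va_hom_comp[OF tensor_hom_left[OF S Q] tensor_hom_right[OF W SQ]] by (simp add: inS_def[abs_def] comp_def)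

lemma inQ_hom: "va_hom Q T inQ"
  using va_hom_comp[OF tensor_hom_right[OF S Q] tensor_hom_right[OF W SQ]] by (simp add: inQ_def[abs_def] comp_def)

lemma in_commuting: "commuting (inW a) (inS b)" "commuting (inW a) (inQ p)" "commuting (inS b) (inQ p)"
proof -
  show "commuting (inW a) (inS b)" "commuting (inW a) (inQ p)"
    using tensor_commuting[OF W SQ, of a] by (simp_all add: inW_def inS_def inQ_def tensor_vacuum[OF S Q])
  have "nprod SQ (b \<otimes> vacuum Q) n (vacuum S \<otimes> p) = 0" if "n \<ge> 0" for n
    using va.commutingD[OF va.intro[OF SQ] tensor_commuting[OF S Q] that] .
  then show "commuting (inS b) (inQ p)"
    by (simp add: commuting_def inS_def inQ_def tensor_nprod_right[OF W SQ])
qed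

text \<open>Turns the tensors in the formulas of the embedding into products of sector fields, the
  language of \<open>free_field\<close>.\<close>

lemma pure_product: "w \<otimes> (s \<otimes> p) = normal_prod T (inW w) (normal_prod T (inS s) (inQ p))"
proof -
  have "nprod T (inW a) n (u \<otimes> v) = nprod W a n u \<otimes> v" for a n u v
    using tensor_nprod_left[OF W SQ] by (simp add: inW_def tensor_vacuum[OF S Q])
  moreover have "vacuum W \<otimes> (s \<otimes> p) = normal_prod T (inS s) (inQ p)"
    by (simp add: inS_def inQ_def tensor_nprod_right[OF W SQ] tensor_nprod_left[OF S Q] vertex_algebraD(2)[OF S])
  ultimately show ?thesis by (metis vertex_algebraD(2)[OF W])
qed

lemma act:
  assumes "va_module W UNIV YW" "va_module S UNIV YS" "va_module Q UNIV YQ"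
  shows "tensor_act YW (tensor_act YS YQ) (inW a) n (u \<otimes> (v \<otimes> x)) = YW a n u \<otimes> (v \<otimes> x)"
    "tensor_act YW (tensor_act YS YQ) (inS b) n (u \<otimes> (v \<otimes> x)) = u \<otimes> (YS b n v \<otimes> x)"
    "tensor_act YW (tensor_act YS YQ) (inQ p) n (u \<otimes> (v \<otimes> x)) = u \<otimes> (v \<otimes> YQ p n x)"
proof -
  have Y: "va_module SQ UNIV (tensor_act YS YQ)" by (rule tensor_va_module[OF S assms(2) Q assms(3)])
  show "tensor_act YW (tensor_act YS YQ) (inW a) n (u \<otimes> (v \<otimes> x)) = YW a n u \<otimes> (v \<otimes> x)"
    using tensor_act_left[OF W SQ assms(1) Y] by (simp add: inW_def tensor_vacuum[OF S Q])
  show "tensor_act YW (tensor_act YS YQ) (inS b) n (u \<otimes> (v \<otimes> x)) = u \<otimes> (YS b n v \<otimes> x)"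
    "tensor_act YW (tensor_act YS YQ) (inQ p) n (u \<otimes> (v \<otimes> x)) = u \<otimes> (v \<otimes> YQ p n x)"
    by (simp_all add: inS_def inQ_def tensor_act_right[OF W SQ assms(1) Y] tensor_act_left[OF S Q assms(2,3)]
      tensor_act_right[OF S Q assms(2,3)])
qed

end

lemma tensor_free_field:
  assumes Wu: "universal_bp k Wu J Gp Gm L" "simple_quotient Wu W f" and bgS: "betagamma S \<beta> \<gamma>" and hlQ: "half_lattice Q c d E"
  shows "free_field (W \<otimes>\<^sub>V S \<otimes>\<^sub>V Q) k (triple_tensor.inW S Q (f J)) (triple_tensor.inW S Q (f Gp)) (triple_tensor.inW S Q (f Gm))
    (triple_tensor.inW S Q (f L)) (triple_tensor.inS W Q \<beta>) (triple_tensor.inS W Q \<gamma>)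
    (triple_tensor.inQ W S c) (triple_tensor.inQ W S d) (triple_tensor.inQ W S (E 1)) (triple_tensor.inQ W S (E (-1)))"
proof -
  interpret triple_tensor W S Q
    using simple_quotientD[OF Wu(2)] bgS hlQ by (simp add: triple_tensor_def betagamma_def half_lattice_def)
  interpret Q: half_lattice_va Q c d E by unfold_locales (rule hlQ)
  note hw = va_hom_comp[OF simple_quotientD(2)[OF Wu(2)] inW_hom]
  note ow = va_hom_ope[OF hw] and os = va_hom_ope[OF inS_hom] and oq = va_hom_ope[OF inQ_hom]
  have Wo: "ope Wu J J [0, ((2*k + 3) / 3) *\<^sub>C vacuum Wu]" "ope Wu J Gp [Gp]" "ope Wu J Gm [- Gm]"
    "ope Wu Gp Gm [3 *\<^sub>C normal_prod Wu J J + (3 * (k + 1) / 2) *\<^sub>C va_deriv Wu J - (k + 3) *\<^sub>C L,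
        (3 * (k + 1)) *\<^sub>C J, ((k + 1) * (2*k + 3)) *\<^sub>C vacuum Wu]"
    using Wu(1) by (simp_all only: universal_bp_def)
  have So: "ope S \<beta> \<gamma> [vacuum S]" "ope S \<beta> \<beta> []" "ope S \<gamma> \<gamma> []" using bgS by (simp_all add: betagamma_def)
  have Qo: "ope Q c d [0, 2 *\<^sub>C vacuum Q]" "ope Q c c []" "ope Q d d []" "ope Q c (E j) []"
    "ope Q d (E j) [of_int (2 * j) *\<^sub>C E j]" "ope Q (E i) (E j) []" for i j
    using hlQ by (auto simp: half_lattice_def)
  have DE: "va_deriv T (inQ (E j)) = of_int j *\<^sub>C normal_prod T (inQ c) (inQ (E j))" for j
    by (simp add: va_homD(8)[OF inQ_hom, symmetric] Q.deriv_E va_homD(3,7)[OF inQ_hom])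
  show ?thesis
  proof
    show "ope T (inW (f J)) (inW (f J)) [0, ((2*k + 3) / 3) *\<^sub>C vacuum T]"
      "ope T (inW (f J)) (inW (f Gp)) [inW (f Gp)]" "ope T (inW (f J)) (inW (f Gm)) [- inW (f Gm)]"
      "ope T (inW (f Gp)) (inW (f Gm)) [3 *\<^sub>C normal_prod T (inW (f J)) (inW (f J))
        + (3 * (k + 1) / 2) *\<^sub>C va_deriv T (inW (f J)) - (k + 3) *\<^sub>C inW (f L),
        (3 * (k + 1)) *\<^sub>C inW (f J), ((k + 1) * (2*k + 3)) *\<^sub>C vacuum T]"
      using ow[OF Wo(1)] ow[OF Wo(2)] ow[OF Wo(3)] ow[OF Wo(4)]
      by (simp_all only: list.map comp_apply va_homD[OF hw, unfolded comp_apply])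
    show "ope T (inS \<beta>) (inS \<gamma>) [vacuum T]" "commuting (inS \<beta>) (inS \<beta>)" "commuting (inS \<gamma>) (inS \<gamma>)"
      using os[OF So(1)] os[OF So(2)] os[OF So(3)] ope_imp_commuting by (simp_all add: va_homD[OF inS_hom])
    show "ope T (inQ c) (inQ d) [0, 2 *\<^sub>C vacuum T]"
      using oq[OF Qo(1)] by (simp add: va_homD[OF inQ_hom])
    show "commuting (inQ c) (inQ c)" "commuting (inQ d) (inQ d)" "commuting (inQ c) (inQ (E 1))" "commuting (inQ c) (inQ (E (-1)))"
      "commuting (inQ (E 1)) (inQ (E (-1)))"
      using oq[OF Qo(2)] oq[OF Qo(3)] oq[OF Qo(4)] oq[OF Qo(6)] ope_imp_commuting by auto
    show "ope T (inQ d) (inQ (E 1)) [2 *\<^sub>C inQ (E 1)]" "ope T (inQ d) (inQ (E (-1))) [- (2 *\<^sub>C inQ (E (-1)))]"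
      using oq[OF Qo(5), of 1] oq[OF Qo(5), of "-1"] by (simp_all add: va_homD[OF inQ_hom])
    show "va_deriv T (inQ (E 1)) = normal_prod T (inQ c) (inQ (E 1))"
      "va_deriv T (inQ (E (-1))) = - normal_prod T (inQ c) (inQ (E (-1)))"
      using DE[of 1] DE[of "-1"] by (simp_all add: scaleC_one)
    show "normal_prod T (inQ (E 1)) (inQ (E (-1))) = vacuum T"
      using Q.E_add[of 1 "-1"] Q.E_0 by (simp add: va_homD(6,7)[OF inQ_hom, symmetric])
    show "commuting x y" if "x \<in> {inW (f J), inW (f Gp), inW (f Gm)}"
      "y \<in> {inS \<beta>, inS \<gamma>, inQ c, inQ d, inQ (E 1), inQ (E (-1))}" for x y
      using that in_commuting by auto
    show "commuting x y" if "x \<in> {inS \<beta>, inS \<gamma>}" "y \<in> {inQ c, inQ d, inQ (E 1), inQ (E (-1))}" for x y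
      using that in_commuting by auto
  qed
qed

text \<open>The free field computation gives the identity multiplied by 2(k + 3), which can be
  cancelled as k is not -3.\<close>

lemma sugawara_image:
  assumes k: "k \<noteq> -3" and affine: "affine_sl3 Lk k g"
    and bp: "universal_bp k Wu J Gp Gm L" "simple_quotient Wu W f" and bgS: "betagamma S \<beta> \<gamma>" and hlQ: "half_lattice Q c d E"
    and emb: "sl3_embedding k Lk g W (f J) (f Gp) (f Gm) S \<beta> \<gamma> Q c d E \<Phi>"
  shows "\<Phi> (sugawara_sl3 k Lk g) = triple_tensor.inW S Q (bp_Ltilde W (f J) (f L))
    + triple_tensor.inS W Q (normal_prod S (va_deriv S \<gamma>) \<beta>) + triple_tensor.inQ W S (half_lattice_va.conformal Q c d (k / 3))"
proof -
  interpret triple_tensor W S Q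
    using simple_quotientD[OF bp(2)] bgS hlQ by (simp add: triple_tensor_def betagamma_def half_lattice_def)
  interpret A: affine_sl3 Lk k g by (rule affine)
  interpret Q: half_lattice_va Q c d E by unfold_locales (rule hlQ)
  interpret F: free_field T k "inW (f J)" "inW (f Gp)" "inW (f Gm)" "inW (f L)" "inS \<beta>" "inS \<gamma>"
    "inQ c" "inQ d" "inQ (E 1)" "inQ (E (-1))" by (rule tensor_free_field[OF bp bgS hlQ])
  have \<Phi>: "va_hom Lk T \<Phi>" using emb by (simp add: sl3_embedding_def)
  note h\<Phi> = va_homD[OF \<Phi>] and hW = va_homD[OF inW_hom] and hS = va_homD[OF inS_hom] and hQ = va_homD[OF inQ_hom]
  have im: "\<Phi> (g sl3_e1) = - F.N (inS \<gamma>) (inQ (E 1))" "\<Phi> (g sl3_e2) = inS \<beta>" "\<Phi> (g sl3_e3) = inQ (E 1)"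
    "\<Phi> (g sl3_h1) = F.h1" "\<Phi> (g sl3_h2) = F.h2" "\<Phi> (g sl3_f1) = F.f1" "\<Phi> (g sl3_f2) = F.f2"
    using emb unfolding sl3_embedding_def Let_def pure_product F.h1_def F.h2_def F.f1_def F.f2_def
    by (simp_all add: hW hS hQ vac_left vac_right)
  have "(2 * (k + 3)) *\<^sub>C \<Phi> (sugawara_sl3 k Lk g) = \<Phi> ((2 * (k + 3)) *\<^sub>C sugawara_sl3 k Lk g)"
    by (rule h\<Phi>(3)[symmetric])
  also have "\<dots> = - (4 *\<^sub>C F.N (F.N (inS \<gamma>) (inQ (E 1))) F.f1) + 2 *\<^sub>C F.N (inS \<beta>) F.f2 + 2 *\<^sub>C F.P F.f2 0 (F.N (inQ (E 1)) F.f1)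
      - 2 *\<^sub>C F.D (F.h1 + F.h2) + (2/3) *\<^sub>C (F.N F.h1 F.h1 + F.N F.h1 F.h2 + F.N F.h2 F.h2)"
    unfolding A.sugawara_reduced[OF k] by (simp add: h\<Phi> im Y_uminus_left)
  also have "\<dots> = (2 * (k + 3)) *\<^sub>C (inW (f L) + (1/2) *\<^sub>C F.D (inW (f J)) + F.P (inS \<gamma>) (-2) (inS \<beta>)
      + (1/2) *\<^sub>C F.N (inQ c) (inQ d) + (k/3) *\<^sub>C F.D (inQ c) - (1/2) *\<^sub>C F.D (inQ d))"
    by (rule F.sugawara_vector)
  also have "inW (f L) + (1/2) *\<^sub>C F.D (inW (f J)) + F.P (inS \<gamma>) (-2) (inS \<beta>)
      + (1/2) *\<^sub>C F.N (inQ c) (inQ d) + (k/3) *\<^sub>C F.D (inQ c) - (1/2) *\<^sub>C F.D (inQ d)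
    = inW (bp_Ltilde W (f J) (f L)) + inS (normal_prod S (va_deriv S \<gamma>) \<beta>) + inQ (Q.conformal (k / 3))"
    by (simp add: bp_Ltilde_def Q.conformal_def hW hS hQ F.deriv_N)
  finally have "(2 * (k + 3)) *\<^sub>C \<Phi> (sugawara_sl3 k Lk g) = (2 * (k + 3)) *\<^sub>C
    (inW (bp_Ltilde W (f J) (f L)) + inS (normal_prod S (va_deriv S \<gamma>) \<beta>) + inQ (Q.conformal (k / 3)))" .
  moreover have "2 * (k + 3) \<noteq> 0" using k by (metis add_eq_0_iff2 mult_eq_0_iff zero_neq_numeral)
  ultimately show ?thesis by (simp only: cv.scale_cancel_left) simp
qed

section \<open>The logarithmic modules\<close>

lemma span_pure_tensors:
  fixes A :: "'a::complex_vector set" and B :: "'b::complex_vector set"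
  assumes A: "cv.span A = UNIV" and B: "cv.span B = UNIV"
  shows "cv.span {a \<otimes> b | a b. a \<in> A \<and> b \<in> B} = UNIV" (is "cv.span ?X = _")
proof -
  have 1: "a \<otimes> b \<in> cv.span ?X" if b: "b \<in> B" for a b
  proof (rule lin_on_span_image[OF lin_pure_left cv.subspace_UNIV subset_UNIV _ cv.subspace_span])
    show "a \<in> cv.span A" by (simp add: A)
    show "a' \<otimes> b \<in> cv.span ?X" if "a' \<in> A" for a' using that b by (intro cv.span_base) blast
  qed
  have 2: "a \<otimes> b \<in> cv.span ?X" for a b
  proof (rule lin_on_span_image[OF lin_pure_right cv.subspace_UNIV subset_UNIV _ cv.subspace_span])
    show "b \<in> cv.span B" by (simp add: B)
    show "a \<otimes> b' \<in> cv.span ?X" if "b' \<in> B" for b' by (rule 1[OF that])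
  qed
  show ?thesis using tensor_subspace_UNIV[OF cv.subspace_span 2] by blast
qed

lemma (in smooth_weyl) qop_affine:
  assumes u: "u \<in> M"
  shows "qop (\<lambda>n. of_int (n + l)) u = Lop u + of_int l *\<^sub>C Jop u"
proof -
  have "qop (\<lambda>n. of_int (n + l)) u = Sum_any (\<lambda>n. of_int n *\<^sub>C pairop n u + of_int l *\<^sub>C pairop n u)"
    unfolding qop_def by (simp add: scaleC_add_left)
  also have "\<dots> = Lop u + Sum_any (\<lambda>n. of_int l *\<^sub>C pairop n u)"
    unfolding qop_def by (rule Sum_any.distrib[OF fin_pairop[OF u] fin_pairop[OF u]])
  also have "Sum_any (\<lambda>n. of_int l *\<^sub>C pairop n u) = of_int l *\<^sub>C Jop u"
    unfolding qop_def scaleC_Sum_any by (simp add: scaleC_one)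
  finally show ?thesis .
qed

context bg begin

text \<open>The operator of interest belongs to the twisted action, while nilpotency was found after
  untwisting. The two differ by s times the charge and a constant, which on vectors of fixed charge
  is a scalar, so kernels of squares and the failure of semisimplicity carry over.\<close>

lemma cover_conformal:
  assumes P: "bg_P S \<beta> \<gamma> s UNIV (YP :: 's \<Rightarrow> int \<Rightarrow> 'm::complex_vector \<Rightarrow> 'm)"
  defines "B \<equiv> YP (normal_prod S (va_deriv S \<gamma>) \<beta>) 1"
  shows "cv.span {v. \<exists>b. pol B [b, b] v = 0} = UNIV" "\<exists>v b. pol B [b, b] v = 0 \<and> B v \<noteq> b *\<^sub>C v"
proof -
  let ?y = "\<lambda>i. YP (gen i)"
  obtain w Y\<sigma> \<pi> where w: "smooth_weyl.qop (spec s ?y) (\<lambda>_. 1) w = 0" "smooth_weyl.qop (spec s ?y) of_int (smooth_weyl.qop (spec s ?y) of_int w) = 0"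
    "wgen UNIV (spec s ?y) w" and proj: "bg_projective S \<beta> \<gamma> UNIV YP" "bg_spectral_flow S \<beta> \<gamma> s UNIV (nprod S) Y\<sigma>"
    "module_hom S UNIV YP UNIV Y\<sigma> \<pi>" "\<pi> w = vacuum S"
    by (rule cover_generator[OF P]) (rule that)
  have YP: "va_module S UNIV YP" using proj(1) by (simp add: bg_projective_def bg_category_def)
  have y: "smooth_weyl UNIV ?y" by (rule module_smooth_weyl[OF YP])
  interpret y: smooth_weyl UNIV ?y by (rule y)
  interpret x: smooth_weyl UNIV "spec s ?y" by (rule smooth_weyl_spec[OF y])
  \<comment> \<open>The shift of the conformal weight caused by the flow on vectors of untwisted
    charge q.\<close>
  define \<kappa> where "\<kappa> q = of_int s * (q - spec_const s (\<lambda>_. 1)) + spec_const s of_int" for q :: complex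
  have B: "B u = x.Lop u - \<kappa> q *\<^sub>C u" if "x.Jop u = q *\<^sub>C u" for q u
  proof -
    have "x.Lop u = B u + of_int s *\<^sub>C y.Jop u + spec_const s of_int *\<^sub>C u"
      using spec_qop[OF y UNIV_I, of s of_int u] y.qop_affine[OF UNIV_I, of s u] conformal_mode[OF YP UNIV_I, of u]
      by (simp add: B_def)
    moreover have "y.Jop u = (q - spec_const s (\<lambda>_. 1)) *\<^sub>C u"
      using spec_qop[OF y UNIV_I, of s "\<lambda>_. 1" u] that by (simp add: cv.scale_left_diff_distrib)
    ultimately show ?thesis by (simp add: \<kappa>_def scaleC_add_left scaleC_scaleC)
  qed
  have pB: "pol B [h - \<kappa> q, h - \<kappa> q] u = pol x.Lop [h, h] u" if u: "x.Jop u = q *\<^sub>C u" for u q h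
  proof -
    have 1: "pol B [h - \<kappa> q] v = pol x.Lop [h] v" if "x.Jop v = q *\<^sub>C v" for v
      using B[OF that] by (simp add: cv.scale_left_diff_distrib)
    have "x.Jop (pol x.Lop [h] u) = q *\<^sub>C pol x.Lop [h] u" by (rule x.qop_pol[OF UNIV_I u])
    then have "pol B [h - \<kappa> q] (pol B [h - \<kappa> q] u) = pol x.Lop [h] (pol x.Lop [h] u)"
      using 1[OF u] 1[of "pol x.Lop [h] u"] by metis
    then show ?thesis unfolding pol_append[symmetric] by (simp only: append.simps)
  qed
  have "{u. \<exists>q h. x.Jop u = q *\<^sub>C u \<and> pol x.Lop [h, h] u = 0} \<subseteq> {v. \<exists>b. pol B [b, b] v = 0}"
  proof safe
    fix u q h assume "x.Jop u = q *\<^sub>C u" "pol x.Lop [h, h] u = 0"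
    then show "\<exists>b. pol B [b, b] u = 0" using pB[of u q h] by metis
  qed
  from cv.span_mono[OF this] show "cv.span {v. \<exists>b. pol B [b, b] v = 0} = UNIV"
    unfolding rank_two_span[OF x.smooth_weyl_axioms w(3,1,2)] by blast
  have J: "x.Jop w = 0 *\<^sub>C w" using w(1) by simp
  have "x.Lop w \<noteq> 0" by (rule cover_not_semisimple[OF proj])
  then have "B w \<noteq> (0 - \<kappa> 0) *\<^sub>C w" using B[OF J] by simp
  moreover have "pol B [0 - \<kappa> 0, 0 - \<kappa> 0] w = 0" unfolding pB[OF J] using w(2) by simp
  ultimately show "\<exists>v b. pol B [b, b] v = 0 \<and> B v \<noteq> b *\<^sub>C v" by blast
qed

end

text \<open>Between eigenvectors of A and C the operator T minus the sum of the eigenvalues is B - b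
  acting in the middle, so its square vanishes where that of B - b does. Nonzero eigenvectors on
  both sides keep the witness for B nonzero in the tensor product.\<close>

lemma sum_of_commuting_rank_two:
  fixes T :: "('a::complex_vector, ('b::complex_vector, 'c::complex_vector) tensor) tensor \<Rightarrow> ('a, ('b, 'c) tensor) tensor"
  assumes T: "clinear T" "\<And>u v x. T (u \<otimes> (v \<otimes> x)) = A u \<otimes> (v \<otimes> x) + u \<otimes> (B v \<otimes> x) + u \<otimes> (v \<otimes> C x)"
    and A: "diagonalizable A" "(UNIV :: 'a set) \<noteq> {0}" and C: "diagonalizable C" "(UNIV :: 'c set) \<noteq> {0}"
    and B: "cv.span {v. \<exists>b. pol B [b, b] v = 0} = UNIV" "\<exists>v b. pol B [b, b] v = 0 \<and> B v \<noteq> b *\<^sub>C v"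
  shows "\<not> diagonalizable T" "nilpotent_rank T 2"
proof -
  have step: "T (u \<otimes> (v \<otimes> x)) - (a + b + c) *\<^sub>C (u \<otimes> (v \<otimes> x)) = u \<otimes> ((B v - b *\<^sub>C v) \<otimes> x)"
    if "A u = a *\<^sub>C u" "C x = c *\<^sub>C x" for u v x a b c
    unfolding T(2) that
    by (simp add: scaleC_pure_tensor pure_tensor_scale_right scaleC_add_left pure_tensor_diff_left pure_tensor_diff_right)
  have pol: "pol T [a + b + c, a + b + c] (u \<otimes> (v \<otimes> x)) = 0"
    if "A u = a *\<^sub>C u" "C x = c *\<^sub>C x" "pol B [b, b] v = 0" for u v x a b c
    using step[OF that(1,2), of v b] step[OF that(1,2), of "B v - b *\<^sub>C v" b] that(3) by simp
  have spanX: "cv.span {u \<otimes> y | u y. u \<in> {u. \<exists>a. A u = a *\<^sub>C u} \<and>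
      y \<in> {v \<otimes> x | v x. v \<in> {v. \<exists>b. pol B [b, b] v = 0} \<and> x \<in> {x. \<exists>c. C x = c *\<^sub>C x}}} = UNIV"
    by (rule span_pure_tensors[OF A(1)[unfolded diagonalizable_def] span_pure_tensors[OF B(1) C(1)[unfolded diagonalizable_def]]])
  have "{u \<otimes> y | u y. u \<in> {u. \<exists>a. A u = a *\<^sub>C u} \<and>
      y \<in> {v \<otimes> x | v x. v \<in> {v. \<exists>b. pol B [b, b] v = 0} \<and> x \<in> {x. \<exists>c. C x = c *\<^sub>C x}}}
      \<subseteq> {z. \<exists>\<mu>. pol T [\<mu>, \<mu>] z = 0}"
  proof safe
    fix u v x a b c assume "A u = a *\<^sub>C u" "pol B [b, b] v = 0" "C x = c *\<^sub>C x"
    then show "\<exists>\<mu>. pol T [\<mu>, \<mu>] (u \<otimes> (v \<otimes> x)) = 0" using pol[of u a x c b v] by (intro exI)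
  qed
  from cv.span_mono[OF this] have span: "cv.span {z. \<exists>\<mu>. pol T [\<mu>, \<mu>] z = 0} = UNIV"
    unfolding spanX by (rule top.extremum_uniqueI)
  have eigen: "\<exists>u c. F u = c *\<^sub>C u \<and> u \<noteq> 0" if "diagonalizable F" "(UNIV :: 'd set) \<noteq> {0}" for F :: "'d::complex_vector \<Rightarrow> 'd"
  proof (rule ccontr)
    assume "\<not> ?thesis"
    then have "{v. \<exists>\<mu>. F v = \<mu> *\<^sub>C v} \<subseteq> {0}" by blast
    then have "cv.span {v. \<exists>\<mu>. F v = \<mu> *\<^sub>C v} \<subseteq> {0}" by (rule cv.span_minimal) (rule cv.subspace_single_0)
    then show False using that unfolding diagonalizable_def by blast
  qed
  obtain u a where u: "A u = a *\<^sub>C u" "u \<noteq> 0" using eigen[OF A] by blast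
  obtain x c where x: "C x = c *\<^sub>C x" "x \<noteq> 0" using eigen[OF C] by blast
  obtain v b where v: "pol B [b, b] v = 0" "B v \<noteq> b *\<^sub>C v" using B(2) by blast
  have "u \<otimes> ((B v - b *\<^sub>C v) \<otimes> x) \<noteq> 0" using u x v(2) by (intro pure_tensor_nonzero) auto
  then have "T (u \<otimes> (v \<otimes> x)) \<noteq> (a + b + c) *\<^sub>C (u \<otimes> (v \<otimes> x))" using step[OF u(1) x(1), of v b] by auto
  then show "\<not> diagonalizable T" "nilpotent_rank T 2"
    using nilpotent_rank_twoI[OF T(1) span pol[OF u(1) x(1) v(1)]] by blast+
qed

theorem proposition11p1:
  fixes k lam :: complex and r s :: int
    and Vk :: "'vk::complex_vector vertex_alg" and \<iota> :: "complex^3^3 \<Rightarrow> 'vk"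
    and Lk :: "'lk::complex_vector vertex_alg" and \<rho> :: "'vk \<Rightarrow> 'lk"
    and Wu :: "'wu::complex_vector vertex_alg" and J Gp Gm LBP :: 'wu
    and Wk :: "'wk::complex_vector vertex_alg" and \<pi> :: "'wu \<Rightarrow> 'wk"
    and S :: "'s::complex_vector vertex_alg" and \<beta> \<gamma> :: 's
    and Pi0 :: "'p::complex_vector vertex_alg" and c d :: 'p and E :: "int \<Rightarrow> 'p"
    and \<Phi> :: "'lk \<Rightarrow> ('wk, ('s, 'p) tensor) tensor"
    and YN :: "'wk \<Rightarrow> int \<Rightarrow> 'n::complex_vector \<Rightarrow> 'n"
    and YP :: "'s \<Rightarrow> int \<Rightarrow> 'm::complex_vector \<Rightarrow> 'm"
    and YF :: "'p \<Rightarrow> int \<Rightarrow> 'f::complex_vector \<Rightarrow> 'f"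
  assumes "k \<noteq> -3" and "k \<notin> \<nat>"
    and "universal_affine_sl3 k Vk \<iota>" and "simple_quotient Vk Lk \<rho>"
    and "universal_bp k Wu J Gp Gm LBP" and "simple_quotient Wu Wk \<pi>"
    and "betagamma S \<beta> \<gamma>"
    and "half_lattice Pi0 c d E"
    and "sl3_embedding k Lk (\<rho> \<circ> \<iota>) Wk (\<pi> J) (\<pi> Gp) (\<pi> Gm) S \<beta> \<gamma> Pi0 c d E \<Phi>"
    and "va_irreducible Wk UNIV YN"
    and "bp_highest_weight_module Wk (\<pi> J) (\<pi> Gp) (\<pi> Gm) (\<pi> LBP) UNIV YN \<or>
         bp_relaxed_module Wk (\<pi> J) (\<pi> Gp) (\<pi> Gm) (\<pi> LBP) UNIV YN"
    and "bg_P S \<beta> \<gamma> s UNIV YP"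
    and "half_lattice_exp_module Pi0 c d r lam UNIV YF"
  shows "let Y = (\<lambda>a. tensor_act YN (tensor_act YP YF) (\<Phi> a));
             L0 = Y (sugawara_sl3 k Lk (\<rho> \<circ> \<iota>)) 1
         in va_module Lk UNIV Y \<and> \<not> diagonalizable L0 \<and> nilpotent_rank L0 2"
proof -
  have bg: "bg S \<beta> \<gamma>" by (rule bg.intro) fact
  have Lk: "affine_sl3 Lk k (\<rho> \<circ> \<iota>)" by (rule universal_affine_quotient) fact+
  have vaL: "vertex_algebra Lk" and vaW: "vertex_algebra Wk"
    using assms(4,6) by (auto dest: simple_quotientD)
  have vaS: "vertex_algebra S" and vaQ: "vertex_algebra Pi0"
    using assms(7,8) by (simp_all add: betagamma_def half_lattice_def)
  interpret triple_tensor Wk S Pi0 by (rule triple_tensor.intro[OF vaW vaS vaQ])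
  interpret Q: half_lattice_va Pi0 c d E by unfold_locales fact
  have YN: "va_module Wk UNIV YN" and N0: "(UNIV :: 'n set) \<noteq> {0}" using assms(10) by (auto simp: va_irreducible_def)
  have YP: "va_module S UNIV YP"
    using assms(12) by (auto simp: bg_P_def bg_projective_cover_def bg_projective_def bg_category_def)
  have YF: "va_module Pi0 UNIV YF" and F0: "(UNIV :: 'f set) \<noteq> {0}"
    using assms(13) by (auto simp: half_lattice_exp_module_def)
  define Z where "Z = tensor_act YN (tensor_act YP YF)"
  have Z: "va_module T UNIV Z"
    unfolding Z_def by (rule tensor_va_module[OF vaW YN SQ tensor_va_module[OF vaS YP vaQ YF]])
  have \<Phi>: "va_hom Lk T \<Phi>" using assms(9) by (simp add: sl3_embedding_def)
  let ?A = "YN (bp_Ltilde Wk (\<pi> J) (\<pi> LBP)) 1" and ?B = "YP (normal_prod S (va_deriv S \<gamma>) \<beta>) 1"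
    and ?C = "YF (Q.conformal (k / 3)) 1" and ?L0 = "Z (\<Phi> (sugawara_sl3 k Lk (\<rho> \<circ> \<iota>))) 1"
  have L0: "?L0 (u \<otimes> (v \<otimes> x)) = ?A u \<otimes> (v \<otimes> x) + u \<otimes> (?B v \<otimes> x) + u \<otimes> (v \<otimes> ?C x)" for u v x
  proof -
    interpret Z: va_mod T UNIV Z by unfold_locales (rule tensor_vertex_algebra[OF vaW SQ], rule Z)
    show ?thesis
      unfolding sugawara_image[OF assms(1) Lk assms(5,6,7,8,9)]
      by (simp add: Z.Y_add_left) (simp add: Z_def act[OF YN YP YF])
  qed
  have lin: "clinear ?L0" using va_moduleD(3)[OF Z] by (simp add: lin_on_UNIV)
  \<comment> \<open>Either alternative contains that N is spanned by weight vectors, on which the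
    zero mode of \<open>bp_Ltilde\<close> is scalar.\<close>
  have A: "diagonalizable ?A"
  proof -
    have "bp_weight_module Wk (\<pi> J) (\<pi> LBP) UNIV YN"
      using assms(11) by (auto simp: bp_highest_weight_module_def bp_relaxed_module_def)
    then have span: "cv.span {v. bp_weight_vector Wk (\<pi> J) (\<pi> LBP) YN v} = UNIV" by (simp add: bp_weight_module_def)
    have "{v. bp_weight_vector Wk (\<pi> J) (\<pi> LBP) YN v} \<subseteq> {v. \<exists>\<mu>. ?A v = \<mu> *\<^sub>C v}"
      by (auto simp: bp_weight_vector_def)
    from cv.span_mono[OF this] show ?thesis unfolding span diagonalizable_def by (rule top.extremum_uniqueI)
  qed
  have C: "diagonalizable ?C" by (rule Q.conformal_diagonalizable) fact
  note B = bg.cover_conformal[OF bg assms(12)]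
  have "\<not> diagonalizable ?L0" "nilpotent_rank ?L0 2"
    by (rule sum_of_commuting_rank_two[OF lin L0 A N0 C F0 B])+
  moreover have "va_module Lk UNIV (\<lambda>a. Z (\<Phi> a))"
    by (rule va_module_pullback[OF \<Phi> vaL tensor_vertex_algebra[OF vaW SQ] Z])
  ultimately show ?thesis by (simp add: Let_def Z_def)
qed


end
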